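(* Let $(a,b)\subseteq\mathbb{R}$ be an interval, let $P(x)=x+\nu(x)$ be a real-valued function on $(a,b)$, locally of bounded variation, such that the measure $d\nu$ is singular with respect to Lebesgue measure, let $q\in L^1_{\mathrm{loc}}(a,b)$ be real-valued, and let $\mathrm{H}$ be the maximal operator in $L^2(a,b)$ associated with $\tau=-\frac{d}{dx}\frac{d}{dP(x)}+q(x)$. If $q\in L^\infty(a,b)+L^1_{\mathrm{c}}(a,b)$, then $\mathrm{H}=\mathrm{H}^*$ if and only if the following two conditions are satisfied: (i) for some $c\in(a,b)$ we have $\mathbf{1}\notin L^2(a,c)$ or $P\notin L^2(a,c)$; (ii) for some $c\in(a,b)$ we have $\mathbf{1}\notin L^2(c,b)$ or $P\notin L^2(c,b)$. Here $\mathbf{1}$ denotes the constant function equal to $1$.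
   Context: $L^1_{\mathrm{c}}(a,b)$ denotes the integrable functions with compact support in $(a,b)$. Since $P$ is locally of bounded variation, it defines a (locally finite, signed) real-valued Borel measure $dP=dx+d\nu$ on $(a,b)$. $AC_{\mathrm{loc}}((a,b);dP)$ is the set of functions $f$ on $(a,b)$ which are locally of bounded variation and whose Borel measure $df$ is absolutely continuous with respect to $dP$; then $df=f^{[1]}\,dP$ with $f^{[1]}\in L^1_{\mathrm{loc}}((a,b);dP)$ the quasi-derivative of $f$ (left-continuous representatives of $f$ are used, so $f(x)-f(y)=\int_y^x f^{[1]}dt+\int_{[y,x)}f^{[1]}d\nu$ for $y<x$). Put $\mathfrak{D}=\{f\in AC_{\mathrm{loc}}((a,b);dP): f^{[1]}\in AC_{\mathrm{loc}}(a,b)\}$, where $AC_{\mathrm{loc}}(a,b)$ refers to Lebesgue measure, and $\tau f=-(f^{[1]})'+qf$ for $f\in\mathfrak{D}$. The maximal operator is $\mathrm{H}f=\tau f$ with $\mathrm{dom}(\mathrm{H})=\{f\in L^2(a,b): f\in\mathfrak{D},\ \tau f\in L^2(a,b)\}$. *)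

theory Defs
  imports "HOL-Analysis.Analysis"
begin

text \<open>Throughout, \<open>I\<close> is the open interval \<open>(a,b)\<close>, i.e. \<^term>\<open>einterval a b\<close> with extended real
  end points. Functions on \<open>I\<close> are total functions whose values outside \<open>I\<close> are irrelevant.\<close>

definition bv_on :: "real set \<Rightarrow> (real \<Rightarrow> 'a::real_normed_vector) \<Rightarrow> bool" where
  "bv_on S f \<longleftrightarrow> (\<exists>B::real. \<forall>(n::nat) (t::nat \<Rightarrow> real).
     mono_on {..n} t \<and> t ` {..n} \<subseteq> S \<longrightarrow> (\<Sum>i<n. norm (f (t (Suc i)) - f (t i))) \<le> B)"

definition bv_loc :: "real set \<Rightarrow> (real \<Rightarrow> 'a::real_normed_vector) \<Rightarrow> bool" where
  "bv_loc I f \<longleftrightarrow> (\<forall>K. compact K \<and> K \<subseteq> I \<longrightarrow> bv_on K f)"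

text \<open>The locally finite signed Borel measure \<open>dF\<close> on \<open>I\<close> of a function \<open>F\<close> that is locally of
  bounded variation is determined by \<open>dF [y,x) = F(x-) - F(y-)\<close>. It may have infinite positive and
  infinite negative mass on \<open>I\<close>, so it is given by its Jordan decomposition: the unique pair
  \<open>(M, N)\<close> of mutually singular, locally finite positive measures with \<open>dF = M - N\<close>.\<close>

definition jordan_decomp ::
    "real set \<Rightarrow> (real \<Rightarrow> real) \<Rightarrow> real measure \<Rightarrow> real measure \<Rightarrow> bool" where
  "jordan_decomp I F M N \<longleftrightarrow>
     sets M = sets (restrict_space borel I) \<and> sets N = sets (restrict_space borel I) \<and>
     (\<forall>K. compact K \<and> K \<subseteq> I \<longrightarrow> emeasure M K < \<infinity> \<and> emeasure N K < \<infinity>) \<and>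
     (\<exists>A \<in> sets (restrict_space borel I). emeasure M A = 0 \<and> emeasure N (I - A) = 0) \<and>
     (\<forall>y\<in>I. \<forall>x\<in>I. y < x \<longrightarrow>
        measure M {y..<x} - measure N {y..<x} = Lim (at_left x) F - Lim (at_left y) F)"

definition pos_measure :: "real set \<Rightarrow> (real \<Rightarrow> real) \<Rightarrow> real measure" where
  "pos_measure I F = fst (THE (M, N). jordan_decomp I F M N)"

definition neg_measure :: "real set \<Rightarrow> (real \<Rightarrow> real) \<Rightarrow> real measure" where
  "neg_measure I F = snd (THE (M, N). jordan_decomp I F M N)"

definition tv_measure :: "real set \<Rightarrow> (real \<Rightarrow> real) \<Rightarrow> real measure" where
  "tv_measure I F = measure_of I (sets (restrict_space borel I))
     (\<lambda>A. emeasure (pos_measure I F) A + emeasure (neg_measure I F) A)"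

text \<open>The integral \<open>\<integral>\<^sub>A g dF\<close>.\<close>

definition signed_integral ::
    "real set \<Rightarrow> (real \<Rightarrow> real) \<Rightarrow> real set \<Rightarrow> (real \<Rightarrow> complex) \<Rightarrow> complex" where
  "signed_integral I F A g = (LINT x:A|pos_measure I F. g x) - (LINT x:A|neg_measure I F. g x)"

definition lebesgue_singular :: "real set \<Rightarrow> (real \<Rightarrow> real) \<Rightarrow> bool" where
  "lebesgue_singular I F \<longleftrightarrow> (\<exists>S \<in> sets (restrict_space borel I).
     emeasure lborel S = 0 \<and> emeasure (tv_measure I F) (I - S) = 0)"

text \<open>\<open>AC\<^sub>l\<^sub>o\<^sub>c((a,b); dP)\<close>. The complex measure \<open>df = d(Re f) + i d(Im f)\<close> is absolutely continuous with
  respect to \<open>dP\<close> iff both of its parts are.\<close>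

definition ac_loc :: "real set \<Rightarrow> (real \<Rightarrow> real) \<Rightarrow> (real \<Rightarrow> complex) set" where
  "ac_loc I P = {f. bv_loc I f \<and> (\<forall>x\<in>I. continuous (at_left x) f) \<and>
     absolutely_continuous (tv_measure I P) (tv_measure I (\<lambda>x. Re (f x))) \<and>
     absolutely_continuous (tv_measure I P) (tv_measure I (\<lambda>x. Im (f x)))}"

text \<open>\<open>df = g dP\<close> with \<open>g \<in> L\<^sup>1\<^sub>l\<^sub>o\<^sub>c((a,b); dP)\<close>. This determines \<open>g\<close> up to \<open>|dP|\<close>-null sets, so the
  quasi-derivative is a relation between representatives.\<close>

definition has_quasi_deriv ::
    "real set \<Rightarrow> (real \<Rightarrow> real) \<Rightarrow> (real \<Rightarrow> complex) \<Rightarrow> (real \<Rightarrow> complex) \<Rightarrow> bool" where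
  "has_quasi_deriv I P f g \<longleftrightarrow>
     (\<forall>K. compact K \<and> K \<subseteq> I \<longrightarrow> set_integrable (tv_measure I P) K g) \<and>
     (\<forall>y\<in>I. \<forall>x\<in>I. y < x \<longrightarrow> f x - f y = signed_integral I P {y..<x} g)"

text \<open>For \<open>P = id\<close> the measure \<open>dP\<close> is Lebesgue measure, so \<^term>\<open>ac_loc I (\<lambda>x. x)\<close> is the usual
  \<open>AC\<^sub>l\<^sub>o\<^sub>c(a,b)\<close> and \<^term>\<open>has_quasi_deriv I (\<lambda>x. x) g h\<close> says \<open>h = g'\<close> almost everywhere.
  In \<open>\<tau>\<close> below, \<open>g\<close> is the representative of \<open>f\<^sup>[\<^sup>1\<^sup>]\<close> in \<open>AC\<^sub>l\<^sub>o\<^sub>c(a,b)\<close>; it is unique on \<open>I\<close>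
  whenever Lebesgue null sets contain all \<open>|dP|\<close>-null sets, as for \<open>dP = dx + d\<nu>\<close> with \<open>d\<nu>\<close> singular.\<close>

definition sl_domain :: "real set \<Rightarrow> (real \<Rightarrow> real) \<Rightarrow> (real \<Rightarrow> complex) set" where
  "sl_domain I P = {f \<in> ac_loc I P. \<exists>g \<in> ac_loc I (\<lambda>x. x). has_quasi_deriv I P f g}"

definition is_tau :: "real set \<Rightarrow> (real \<Rightarrow> real) \<Rightarrow> (real \<Rightarrow> real) \<Rightarrow>
    (real \<Rightarrow> complex) \<Rightarrow> (real \<Rightarrow> complex) \<Rightarrow> bool" where
  "is_tau I P q f w \<longleftrightarrow> (\<exists>g \<in> ac_loc I (\<lambda>x. x). \<exists>h.
     has_quasi_deriv I P f g \<and> has_quasi_deriv I (\<lambda>x. x) g h \<and>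
     (AE x in lebesgue_on I. w x = - h x + complex_of_real (q x) * f x))"

text \<open>Elements of \<open>L\<^sup>2\<close> are represented by functions. An operator in \<open>L\<^sup>2(I)\<close> is represented by its
  graph, as a set of pairs of functions that is saturated under almost everywhere equality in both
  components; equality of saturated graphs is equality of operators.\<close>

definition L2 :: "real set \<Rightarrow> (real \<Rightarrow> complex) set" where
  "L2 I = {f \<in> borel_measurable (lebesgue_on I). integrable (lebesgue_on I) (\<lambda>x. (cmod (f x))\<^sup>2)}"

definition L2_inner :: "real set \<Rightarrow> (real \<Rightarrow> complex) \<Rightarrow> (real \<Rightarrow> complex) \<Rightarrow> complex" where
  "L2_inner I f g = (LINT x|lebesgue_on I. cnj (f x) * g x)"

definition maximal_operator :: "real set \<Rightarrow> (real \<Rightarrow> real) \<Rightarrow> (real \<Rightarrow> real) \<Rightarrow>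
    ((real \<Rightarrow> complex) \<times> (real \<Rightarrow> complex)) set" where
  "maximal_operator I P q = {(u, v). u \<in> L2 I \<and> v \<in> L2 I \<and>
     (\<exists>f \<in> sl_domain I P. (AE x in lebesgue_on I. u x = f x) \<and> is_tau I P q f v)}"

text \<open>The graph of the adjoint. For a graph \<open>T\<close> that is not densely defined this is only a linear
  relation; but if \<open>T\<close> is single-valued and equals its adjoint, then \<open>T\<close> is densely defined.\<close>

definition adjoint_graph :: "real set \<Rightarrow> ((real \<Rightarrow> complex) \<times> (real \<Rightarrow> complex)) set \<Rightarrow>
    ((real \<Rightarrow> complex) \<times> (real \<Rightarrow> complex)) set" where
  "adjoint_graph I T = {(u, v). u \<in> L2 I \<and> v \<in> L2 I \<and>
     (\<forall>(f, g) \<in> T. L2_inner I u g = L2_inner I v f)}"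

definition L1_loc :: "real set \<Rightarrow> (real \<Rightarrow> real) set" where
  "L1_loc I = {q. \<forall>K. compact K \<and> K \<subseteq> I \<longrightarrow> set_integrable lebesgue K q}"

definition L_infinity :: "real set \<Rightarrow> (real \<Rightarrow> real) set" where
  "L_infinity I = {q \<in> borel_measurable (lebesgue_on I). \<exists>C. AE x in lebesgue_on I. \<bar>q x\<bar> \<le> C}"

definition L1_compact :: "real set \<Rightarrow> (real \<Rightarrow> real) set" where
  "L1_compact I = {q. integrable (lebesgue_on I) q \<and>
     (\<exists>K. compact K \<and> K \<subseteq> I \<and> (AE x in lebesgue_on I. x \<notin> K \<longrightarrow> q x = 0))}"

end

theory Submission
  imports Defs
begin

text \<open>
  Adding the bounded part of \<open>q\<close> to \<open>\<tau>\<close> does not affect selfadjointness, so \<open>q\<close> may be taken to have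
  compact support.  The solutions \<open>y1, y2\<close> of \<open>\<tau> y = 0\<close> are then affine functions of \<open>P\<close> near both endpoints.

  Variation of constants turns every compactly supported source orthogonal to \<open>y1, y2\<close> into an element
  of the maximal operator with compact support; testing against these shows that the adjoint is a restriction
  of the maximal operator, so selfadjointness means that the Wronskians of any two elements vanish at both
  endpoints.  If \<open>1\<close> and \<open>P\<close> are square integrable near an endpoint, then both solutions belong to the
  maximal operator there and their Wronskian is not zero.

  Conversely, suppose that the Wronskian of \<open>f\<close> and \<open>h\<close> does not vanish at an endpoint.  At an infinite endpoint the quasi-derivatives
  grow at most like \<open>sqrt \<bar>x\<bar>\<close>, so \<open>|f|\<^sup>2 + |h|\<^sup>2\<close> is bounded below by a constant times \<open>1 / \<bar>x\<bar>\<close>, which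
  contradicts square integrability.  At a finite endpoint the quasi-derivatives have limits; if one limit is
  nonzero, then a Gronwall argument in \<open>L\<^sup>2\<close> shows \<open>P \<in> L\<^sup>2\<close>, and if all of them vanish, then they decay
  like the square root of the distance to the endpoint and the same divergence occurs.
\<close>

section \<open>Locally finite measures and Jordan decompositions\<close>

text \<open>The signed measure dP may have atoms and negative parts, so functions in the domain jump
  and P need not be monotone. Every object is therefore a pair of primitives: \<open>f\<close> has
  density \<open>s g\<close> with respect to |dP|, and \<open>g\<close> is a primitive for Lebesgue
  measure. As the latter has no atoms, products of two such functions obey the ordinary product rule
  without jump corrections; the Lagrange identity and variation of constants rest on this.
  Singularity of the remaining part of dP makes |dP| dominate Lebesgue measure, so P is constant on
  no interval. This keeps \<open>y1, y2\<close> independent in L2 even on short intervals. The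
  square roots come from Cauchy-Schwarz: off the support of \<open>q\<close> one has
  \<open>g' = - v\<close> with \<open>v\<close> in L2, so \<open>g\<close> is Hoelder continuous of
  exponent 1/2. A bound of |g|^2 by a distance is then the borderline case, since the reciprocal of
  a distance is just not integrable, near 0 and near infinity alike. At a finite endpoint the
  function 1 is always square integrable, so the condition there is about P; at an infinite endpoint
  1 never is.\<close>

definition sum_measure :: "'a measure \<Rightarrow> 'a measure \<Rightarrow> 'a measure" where
  "sum_measure M N = measure_of (space M) (sets M) (\<lambda>A. emeasure M A + emeasure N A)"

lemma sets_sum_measure [simp]: "sets (sum_measure M N) = sets M"
  by (simp add: sum_measure_def)

lemma space_sum_measure [simp]: "space (sum_measure M N) = space M"
  by (simp add: sum_measure_def)

lemma emeasure_sum_measure: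
  assumes "sets N = sets M"
  shows "emeasure (sum_measure M N) A = emeasure M A + emeasure N A"
proof (cases "A \<in> sets M")
  case True
  show ?thesis
    unfolding sum_measure_def
  proof (rule emeasure_measure_of_sigma)
    show "sigma_algebra (space M) (sets M)" ..
    show "positive (sets M) (\<lambda>A. emeasure M A + emeasure N A)"
      by (simp add: positive_def)
    show "countably_additive (sets M) (\<lambda>A. emeasure M A + emeasure N A)"
      unfolding countably_additive_def
    proof (intro allI impI)
      fix A :: "nat \<Rightarrow> 'a set"
      assume A: "range A \<subseteq> sets M" "disjoint_family A"
      have "(\<Sum>i. emeasure M (A i) + emeasure N (A i)) = (\<Sum>i. emeasure M (A i)) + (\<Sum>i. emeasure N (A i))"
        by (rule suminf_add[symmetric]) auto
      then show "(\<Sum>i. emeasure M (A i) + emeasure N (A i)) = emeasure M (\<Union> (range A)) + emeasure N (\<Union> (range A))"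
        using A assms by (simp add: suminf_emeasure)
    qed
  qed (use True in auto)
next
  case False
  then show ?thesis
    using assms by (simp add: emeasure_notin_sets)
qed

locale open_interval =
  fixes a b :: ereal and I :: "real set"
  assumes I_def: "I = einterval a b" and a_less_b: "a < b"
begin

lemma mem_I: "x \<in> I \<longleftrightarrow> a < ereal x \<and> ereal x < b"
  by (simp add: I_def einterval_iff)

lemma open_I [simp, intro]: "open I"
  by (simp add: I_def)

lemma borel_I [simp, measurable, intro]: "I \<in> sets borel"
  by (rule borel_open) simp

lemma subI:
  assumes "x \<in> I" "y \<in> I"
  shows "{x..y} \<subseteq> I" "{x..<y} \<subseteq> I" "{x<..<y} \<subseteq> I" "{x<..y} \<subseteq> I"
proof -
  show *: "{x..y} \<subseteq> I"
  proof
    fix z assume "z \<in> {x..y}"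
    then have "ereal x \<le> ereal z" "ereal z \<le> ereal y" by auto
    with assms show "z \<in> I" unfolding mem_I by (meson less_le_trans le_less_trans)
  qed
  show "{x..<y} \<subseteq> I" "{x<..<y} \<subseteq> I" "{x<..y} \<subseteq> I"
    using * by auto
qed

lemma betweenI: "x \<in> I \<Longrightarrow> y \<in> I \<Longrightarrow> x \<le> z \<Longrightarrow> z \<le> y \<Longrightarrow> z \<in> I"
  using subI(1)[of x y] by auto

lemma sets_I_iff: "B \<in> sets (restrict_space borel I) \<longleftrightarrow> B \<in> sets borel \<and> B \<subseteq> I"
  by (subst sets_restrict_space_iff) auto

text \<open>Half-open intervals fit the convention dF [y,x) = F(x-) - F(y-). The exhaustion by
  closed intervals also covers \<open>I\<close> by half-open ones because its right end points tend
  to \<open>b\<close>.\<close>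

lemma exhaust:
  obtains l u :: "nat \<Rightarrow> real" where "I = (\<Union>n. {l n..<u n})" "incseq u" "decseq l"
    "\<And>n. l n < u n" "\<And>n. l n \<in> I" "\<And>n. u n \<in> I"
proof (rule einterval_Icc_approximation[OF a_less_b])
  fix u l :: "nat \<Rightarrow> real"
  assume ul: "einterval a b = (\<Union>i. {l i .. u i})"
    "incseq u" "decseq l" "\<And>i. l i < u i" "\<And>i. a < l i" "\<And>i. u i < b"
    "(\<lambda>i. ereal (l i)) \<longlonglongrightarrow> a" "(\<lambda>i. ereal (u i)) \<longlonglongrightarrow> b"
  have in_I: "l n \<in> I" "u n \<in> I" for n
  proof -
    have "l n \<in> {l n..u n}" "u n \<in> {l n..u n}" using ul(4)[of n] by auto
    then show "l n \<in> I" "u n \<in> I" unfolding I_def ul(1) by blast+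
  qed
  have "I \<subseteq> (\<Union>n. {l n..<u n})"
  proof
    fix x assume x: "x \<in> I"
    then have "eventually (\<lambda>i. ereal x < ereal (u i)) sequentially"
      by (intro order_tendstoD(1)[OF ul(8)]) (auto simp: mem_I)
    moreover have "eventually (\<lambda>i. ereal (l i) < ereal x) sequentially"
      using x by (intro order_tendstoD(2)[OF ul(7)]) (auto simp: mem_I)
    ultimately have "eventually (\<lambda>i. x \<in> {l i..<u i}) sequentially"
      by eventually_elim auto
    then show "x \<in> (\<Union>n. {l n..<u n})"
      by (auto simp: eventually_sequentially)
  qed
  moreover have "(\<Union>n. {l n..<u n}) \<subseteq> I"
    using subI(2)[OF in_I] by blast
  ultimately have "I = (\<Union>n. {l n..<u n})" by auto
  then show thesis using ul in_I by (rule_tac that[of l u]) auto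
qed

lemma nonempty: obtains x where "x \<in> I"
proof -
  obtain x where "a < ereal x" "ereal x < b"
    using a_less_b ereal_dense2 by blast
  then show thesis by (intro that[of x]) (simp add: mem_I)
qed

lemma larger: assumes "x \<in> I" obtains y where "y \<in> I" "x < y"
proof -
  obtain z where "ereal x < ereal z" "ereal z < b"
    using assms ereal_dense2[of "ereal x" b] by (auto simp: mem_I)
  with assms show thesis by (intro that[of z]) (auto simp: mem_I intro: less_trans)
qed

lemma smaller: assumes "x \<in> I" obtains y where "y \<in> I" "y < x"
proof -
  obtain z where "a < ereal z" "ereal z < ereal x"
    using assms ereal_dense2[of a "ereal x"] by (auto simp: mem_I)
  with assms show thesis unfolding mem_I by (meson less_trans less_ereal.simps(1) that mem_I)
qed

lemma compact_sub: assumes "compact K" "K \<subseteq> I"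
  obtains c d where "c \<in> I" "d \<in> I" "c < d" "K \<subseteq> {c..<d}"
proof (cases "K = {}")
  case True
  obtain x where "x \<in> I" by (rule nonempty)
  moreover then obtain y where "y \<in> I" "x < y" by (rule larger)
  ultimately show ?thesis using True that by blast
next
  case False
  obtain s where s: "s \<in> K" "\<And>t. t \<in> K \<Longrightarrow> t \<le> s"
    using compact_attains_sup[OF assms(1) False] by blast
  obtain i where i: "i \<in> K" "\<And>t. t \<in> K \<Longrightarrow> i \<le> t"
    using compact_attains_inf[OF assms(1) False] by blast
  obtain y where y: "y \<in> I" "s < y" using larger s(1) assms(2) by blast
  show ?thesis
  proof (rule that[of i y])
    show "K \<subseteq> {i..<y}" using i s y by fastforce
    show "i < y" using i(2)[OF s(1)] y(2) by simp
  qed (use i y assms in auto)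
qed

text \<open>The measures are prescribed only on \<open>{y..<x}\<close> with both end points in
  \<open>I\<close>. A general half-open interval may meet \<open>I\<close> in a set that reaches an
  end point of \<open>I\<close>; cutting it along the exhaustion gives countably many intervals of
  the prescribed kind.\<close>

lemma sets_generator:
  "sets (restrict_space borel I) = sigma_sets I {{y..<x} | y x. y \<in> I \<and> x \<in> I}" (is "_ = sigma_sets I ?E")
proof -
  obtain l u :: "nat \<Rightarrow> real" where lu: "I = (\<Union>n. {l n..<u n})" "incseq u" "decseq l"
    "\<And>n. l n < u n" "\<And>n. l n \<in> I" "\<And>n. u n \<in> I"
    by (rule exhaust) (rule that; assumption)
  have "sets (restrict_space borel I) = (\<inter>) I ` sigma_sets UNIV (range (\<lambda>(a, b). {a..<b::real}))"
    unfolding sets_restrict_space by (subst borel_eq_atLeastLessThan) simp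
  also have "\<dots> = sigma_sets I ((\<inter>) I ` range (\<lambda>(a, b). {a..<b::real}))"
  proof (rule sigma_sets_Int)
    have "I \<in> sets (sigma UNIV (range (\<lambda>(a, b). {a..<b::real})))"
      using borel_I by (subst (asm) borel_eq_atLeastLessThan)
    then show "I \<in> sigma_sets UNIV (range (\<lambda>(a, b). {a..<b::real}))" by simp
  qed simp
  also have "\<dots> = sigma_sets I ?E"
  proof (intro sigma_sets_eqI)
    fix A assume "A \<in> (\<inter>) I ` range (\<lambda>(a, b). {a..<b::real})"
    then obtain i j where A: "A = I \<inter> {i..<j}" by auto
    have "z \<in> I \<longleftrightarrow> (\<exists>n. l n \<le> z \<and> z < u n)" for z
      by (subst lu(1)) simp
    then have "A = (\<Union>n. {max i (l n)..<min j (u n)})"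
      unfolding A set_eq_iff by (simp; blast)
    moreover have "{max i (l n)..<min j (u n)} \<in> sigma_sets I ?E" for n
    proof (cases "max i (l n) < min j (u n)")
      case True
      then have "max i (l n) \<in> I" "min j (u n) \<in> I"
        by (intro betweenI[OF lu(5)[of n] lu(6)[of n]]; linarith)+
      then show ?thesis by (intro sigma_sets.Basic) blast
    next
      case False
      then have "{max i (l n)..<min j (u n)} = {}" by auto
      then show ?thesis by (simp only: sigma_sets.Empty)
    qed
    ultimately show "A \<in> sigma_sets I ?E"
      by (simp add: sigma_sets.Union)
  next
    fix A assume "A \<in> ?E"
    then obtain y x where A: "A = {y..<x}" "y \<in> I" "x \<in> I" by auto
    then have "A = I \<inter> (case (y, x) of (a, b) \<Rightarrow> {a..<b})" using subI(2) by auto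
    then show "A \<in> sigma_sets I ((\<inter>) I ` range (\<lambda>(a, b). {a..<b::real}))"
      by (metis image_eqI rangeI sigma_sets.Basic)
  qed
  finally show ?thesis .
qed

definition locfin :: "real measure \<Rightarrow> bool" where
  "locfin T \<longleftrightarrow> sets T = sets (restrict_space borel I) \<and> (\<forall>K. compact K \<and> K \<subseteq> I \<longrightarrow> emeasure T K < \<infinity>)"

lemma locfin_sets: "locfin T \<Longrightarrow> B \<in> sets T \<longleftrightarrow> B \<in> sets borel \<and> B \<subseteq> I"
  by (simp add: locfin_def sets_I_iff)

lemma locfin_space: "locfin T \<Longrightarrow> space T = I"
  using sets_eq_imp_space_eq[of T "restrict_space borel I"] by (simp add: locfin_def space_restrict_space)

lemma locfin_Ico: "locfin T \<Longrightarrow> y \<in> I \<Longrightarrow> x \<in> I \<Longrightarrow> {y..<x} \<in> sets T"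
  using subI(2) by (simp add: locfin_sets)

lemma locfin_Ico_finite:
  assumes "locfin T" "y \<in> I" "x \<in> I"
  shows "emeasure T {y..<x} < \<infinity>"
proof -
  have "emeasure T {y..<x} \<le> emeasure T {y..x}"
    using assms subI by (intro emeasure_mono) (auto simp: locfin_sets)
  also have "\<dots> < \<infinity>" using assms subI(1) by (auto simp: locfin_def)
  finally show ?thesis .
qed

lemma locfinI:
  assumes "sets T = sets (restrict_space borel I)"
    and "\<And>y x. y \<in> I \<Longrightarrow> x \<in> I \<Longrightarrow> y < x \<Longrightarrow> emeasure T {y..<x} < \<infinity>"
  shows "locfin T"
  unfolding locfin_def
proof (intro conjI allI impI)
  fix K assume K: "compact K \<and> K \<subseteq> I"
  then obtain c d where cd: "c \<in> I" "d \<in> I" "c < d" "K \<subseteq> {c..<d}" by (metis compact_sub)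
  then have "emeasure T K \<le> emeasure T {c..<d}"
    using subI(2)[OF cd(1,2)] by (intro emeasure_mono) (auto simp: assms(1) sets_I_iff)
  also have "\<dots> < \<infinity>" by (rule assms(2)[OF cd(1-3)])
  finally show "emeasure T K < \<infinity>" .
qed (fact assms)

lemma locfin_sigma_finite:
  assumes T: "locfin T" shows "sigma_finite_measure T"
proof
  obtain l u :: "nat \<Rightarrow> real" where lu: "I = (\<Union>n. {l n..<u n})" "\<And>n. l n \<in> I" "\<And>n. u n \<in> I"
    by (rule exhaust) (rule that; assumption)
  show "\<exists>A. countable A \<and> A \<subseteq> sets T \<and> \<Union> A = space T \<and> (\<forall>a\<in>A. emeasure T a \<noteq> \<infinity>)"
  proof (intro exI[of _ "range (\<lambda>n. {l n..<u n})"] conjI)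
    show "\<Union> (range (\<lambda>n. {l n..<u n})) = space T"
      unfolding locfin_space[OF T] by (rule lu(1)[symmetric])
    show "range (\<lambda>n. {l n..<u n}) \<subseteq> sets T"
      using locfin_Ico[OF T lu(2) lu(3)] by blast
    show "\<forall>A\<in>range (\<lambda>n. {l n..<u n}). emeasure T A \<noteq> \<infinity>"
      using locfin_Ico_finite[OF T lu(2) lu(3)] by (auto simp: less_top)
  qed simp
qed

lemma locfin_eqI:
  assumes M: "locfin M" and N: "locfin N"
    and eq: "\<And>y x. y \<in> I \<Longrightarrow> x \<in> I \<Longrightarrow> y < x \<Longrightarrow> emeasure M {y..<x} = emeasure N {y..<x}"
  shows "M = N"
proof -
  obtain l u :: "nat \<Rightarrow> real" where lu: "I = (\<Union>n. {l n..<u n})" "\<And>n. l n \<in> I" "\<And>n. u n \<in> I"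
    by (rule exhaust) (rule that; assumption)
  let ?E = "{{y..<x} | y x. y \<in> I \<and> x \<in> I}"
  show ?thesis
  proof (rule measure_eqI_generator_eq[of ?E I M N "\<lambda>n. {l n..<u n}"])
    show "Int_stable ?E"
    proof (rule Int_stableI)
      fix A B assume "A \<in> ?E" "B \<in> ?E"
      then obtain y x y' x' where *: "A = {y..<x}" "B = {y'..<x'}" "y \<in> I" "x \<in> I" "y' \<in> I" "x' \<in> I"
        by blast
      then have "A \<inter> B = {max y y'..<min x x'}" "max y y' \<in> I" "min x x' \<in> I"
        by (auto simp: max_def min_def)
      then show "A \<inter> B \<in> ?E" by blast
    qed
    show "range (\<lambda>n. {l n..<u n}) \<subseteq> ?E" using lu(2,3) by blast
    show "emeasure M {l i..<u i} \<noteq> \<infinity>" for i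
      using locfin_Ico_finite[OF M lu(2) lu(3)] by (simp add: less_top[symmetric])
    show "?E \<subseteq> Pow I" using subI(2) by blast
    show "sets M = sigma_sets I ?E" "sets N = sigma_sets I ?E"
      using M N sets_generator by (auto simp: locfin_def)
    show "(\<Union>n. {l n..<u n}) = I" by (rule lu(1)[symmetric])
    show "emeasure M X = emeasure N X" if "X \<in> ?E" for X
      using that eq by (cases "X = {}") auto
  qed
qed

lemma locfin_sum:
  assumes "locfin M" "locfin N"
  shows "locfin (sum_measure M N)"
  using assms by (auto simp: locfin_def emeasure_sum_measure)

section \<open>Uniqueness of the Jordan decomposition\<close>

lemma jordan_locfin:
  assumes "jordan_decomp I F M N" shows "locfin M" "locfin N"
  using assms unfolding jordan_decomp_def locfin_def by simp_all

lemma jordan_sep: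
  assumes "jordan_decomp I F M N"
  obtains A where "A \<in> sets (restrict_space borel I)" "emeasure M A = 0" "emeasure N (I - A) = 0"
  using assms unfolding jordan_decomp_def by blast

lemma jordan_diff:
  assumes "jordan_decomp I F M N" "y \<in> I" "x \<in> I" "y < x"
  shows "measure M {y..<x} - measure N {y..<x} = Lim (at_left x) F - Lim (at_left y) F"
  using assms unfolding jordan_decomp_def by blast

lemma measure_diff_eq_imp_emeasure:
  assumes "emeasure M A < \<infinity>" "emeasure N A < \<infinity>" "emeasure M' A < \<infinity>" "emeasure N' A < \<infinity>"
    and "measure M A - measure N A = measure M' A - measure N' A"
  shows "emeasure M A + emeasure N' A = emeasure M' A + emeasure N A"
proof -
  have "emeasure M A = ennreal (measure M A)" "emeasure N A = ennreal (measure N A)"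
     "emeasure M' A = ennreal (measure M' A)" "emeasure N' A = ennreal (measure N' A)"
    using assms by (auto intro!: emeasure_eq_ennreal_measure)
  then show ?thesis using assms(5) by (auto simp flip: ennreal_plus intro!: arg_cong[of _ _ ennreal])
qed

text \<open>Both parts may be infinite on large sets, so their difference is not defined for every
  Borel set. Moving the negative parts to the other side compares two positive measures
  instead.\<close>

lemma signed_eqD:
  assumes "locfin M" "locfin N" "locfin M'" "locfin N'"
    and "\<And>y x. y \<in> I \<Longrightarrow> x \<in> I \<Longrightarrow> y < x \<Longrightarrow>
      measure M {y..<x} - measure N {y..<x} = measure M' {y..<x} - measure N' {y..<x}"
  shows "emeasure M B + emeasure N' B = emeasure M' B + emeasure N B"
proof -
  have st: "sets N' = sets M" "sets N = sets M'" using assms(1-4) by (auto simp: locfin_def)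
  have "sum_measure M N' = sum_measure M' N"
  proof (rule locfin_eqI)
    fix y x assume yx: "y \<in> I" "x \<in> I" "y < x"
    show "emeasure (sum_measure M N') {y..<x} = emeasure (sum_measure M' N) {y..<x}"
      unfolding emeasure_sum_measure[OF st(1)] emeasure_sum_measure[OF st(2)]
      by (rule measure_diff_eq_imp_emeasure) (use assms yx locfin_Ico_finite in auto)
  qed (use assms locfin_sum in auto)
  then show ?thesis using emeasure_sum_measure[OF st(1), of B] emeasure_sum_measure[OF st(2), of B] by simp
qed

lemma emeasure_minus_null:
  assumes "B \<in> sets M" "A \<in> sets M" "emeasure M A = 0"
  shows "emeasure M (B - A) = emeasure M B"
  using assms by (intro emeasure_Diff_null_set) auto


text \<open>A decomposition into mutually singular parts is minimal. Off \<open>A\<close> the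
  measure \<open>N\<close> vanishes, so there \<open>M + N' = M'\<close>, and all of
  \<open>M\<close> lives off \<open>A\<close>; symmetrically \<open>N\<close> lives on
  \<open>A\<close>, where \<open>M\<close> vanishes.\<close>

lemma jordan_le:
  assumes J: "jordan_decomp I F M N" and J': "jordan_decomp I F M' N'"
  shows "emeasure M B \<le> emeasure M' B" "emeasure N B \<le> emeasure N' B"
proof -
  note lf = jordan_locfin[OF J] jordan_locfin[OF J']
  obtain A where A: "A \<in> sets (restrict_space borel I)" "emeasure M A = 0" "emeasure N (I - A) = 0"
    by (rule jordan_sep[OF J])
  have eq: "emeasure M B + emeasure N' B = emeasure M' B + emeasure N B" for B
  proof (rule signed_eqD[OF lf])
    fix y x assume "y \<in> I" "x \<in> I" "y < x"
    then show "measure M {y..<x} - measure N {y..<x} = measure M' {y..<x} - measure N' {y..<x}"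
      using jordan_diff[OF J] jordan_diff[OF J'] by simp
  qed
  have st: "sets M = sets (restrict_space borel I)" "sets N = sets (restrict_space borel I)"
     "sets M' = sets (restrict_space borel I)" "sets N' = sets (restrict_space borel I)"
    using lf by (auto simp: locfin_def)
  show "emeasure M B \<le> emeasure M' B"
  proof (cases "B \<in> sets (restrict_space borel I)")
    case True
    have "emeasure N (B - A) \<le> emeasure N (I - A)"
      using True A by (intro emeasure_mono) (auto simp: st sets_I_iff)
    then have N0: "emeasure N (B - A) = 0" using A by simp
    have "emeasure M B = emeasure M (B - A)"
      using True A by (intro emeasure_minus_null[symmetric]) (auto simp: st)
    also have "\<dots> \<le> emeasure M' (B - A)"
      using eq[of "B - A"] N0 by (metis add.right_neutral le_iff_add)
    also have "\<dots> \<le> emeasure M' B"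
      using True by (intro emeasure_mono) (auto simp: st)
    finally show ?thesis .
  next
    case False
    then show ?thesis by (simp add: emeasure_notin_sets st)
  qed
  show "emeasure N B \<le> emeasure N' B"
  proof (cases "B \<in> sets (restrict_space borel I)")
    case True
    have IA: "I - A \<in> sets (restrict_space borel I)" using A by (auto simp: sets_I_iff)
    have "emeasure M (B - (I - A)) \<le> emeasure M A"
      using True A by (intro emeasure_mono) (auto simp: st sets_I_iff)
    then have N0: "emeasure M (B - (I - A)) = 0" using A by simp
    have "emeasure N B = emeasure N (B - (I - A))"
      using True A IA by (intro emeasure_minus_null[symmetric]) (auto simp: st)
    also have "\<dots> \<le> emeasure N' (B - (I - A))"
      using eq[of "B - (I - A)"] N0 by (metis add.left_neutral le_iff_add add.commute)
    also have "\<dots> \<le> emeasure N' B"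
      using True by (intro emeasure_mono) (auto simp: st)
    finally show ?thesis .
  next
    case False
    then show ?thesis by (simp add: emeasure_notin_sets st)
  qed
qed

lemma jordan_unique:
  assumes J: "jordan_decomp I F M N" and J': "jordan_decomp I F M' N'"
  shows "M = M'" "N = N'"
proof -
  have *: "sets M = sets M'" "sets N = sets N'"
    using jordan_locfin[OF J] jordan_locfin[OF J'] by (simp_all add: locfin_def)
  show "M = M'"
    by (rule measure_eqI[OF *(1)]) (rule antisym[OF jordan_le(1)[OF J J'] jordan_le(1)[OF J' J]])
  show "N = N'"
    by (rule measure_eqI[OF *(2)]) (rule antisym[OF jordan_le(2)[OF J J'] jordan_le(2)[OF J' J]])
qed

lemma jordan_pos_neg:
  assumes "jordan_decomp I F M N"
  shows "pos_measure I F = M" "neg_measure I F = N"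
proof -
  have "(THE (M, N). jordan_decomp I F M N) = (M, N)"
  proof (rule the_equality)
    show "case (M, N) of (M, N) \<Rightarrow> jordan_decomp I F M N"
      using assms by simp
    show "p = (M, N)" if "case p of (M, N) \<Rightarrow> jordan_decomp I F M N" for p
      using that jordan_unique[OF _ assms, of "fst p" "snd p"] by (cases p) simp
  qed
  then show "pos_measure I F = M" "neg_measure I F = N"
    by (simp_all add: pos_measure_def neg_measure_def)
qed

lemma tv_measure_eq:
  assumes "jordan_decomp I F M N"
  shows "tv_measure I F = sum_measure M N"
proof -
  have "space M = I" "sets M = sets (restrict_space borel I)"
    using jordan_locfin(1)[OF assms] by (simp_all add: locfin_space) (simp add: locfin_def)
  then show ?thesis
    unfolding tv_measure_def jordan_pos_neg[OF assms] sum_measure_def by (simp only:)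
qed


section \<open>Stieltjes measures and functions of bounded variation\<close>

text \<open>For a nondecreasing function the left limit is a supremum; in this form bounds on it
  need no limit argument.\<close>

definition left_lim :: "(real \<Rightarrow> real) \<Rightarrow> real \<Rightarrow> real" where
  "left_lim U x = Sup (U ` {y \<in> I. y < x})"

lemma left_lim_upper:
  assumes "mono_on I U" "x \<in> I" "y \<in> I" "y < x"
  shows "U y \<le> left_lim U x"
  unfolding left_lim_def
proof (rule cSup_upper)
  show "bdd_above (U ` {y \<in> I. y < x})"
    using assms by (intro bdd_aboveI2[of _ _ "U x"]) (auto intro: mono_onD)
qed (use assms in auto)

lemma left_lim_least:
  assumes "x \<in> I" "\<And>y. y \<in> I \<Longrightarrow> y < x \<Longrightarrow> U y \<le> s"
  shows "left_lim U x \<le> s"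
  unfolding left_lim_def
proof (rule cSup_least)
  show "U ` {y \<in> I. y < x} \<noteq> {}" using smaller[OF assms(1)] by blast
qed (use assms in auto)

lemma left_lim_mono:
  assumes "mono_on I U" shows "mono_on I (left_lim U)"
proof (rule mono_onI)
  fix r s assume "r \<in> I" "s \<in> I" "r \<le> s"
  then show "left_lim U r \<le> left_lim U s"
    using assms by (intro left_lim_least[of r]) (auto intro!: left_lim_upper)
qed

text \<open>Left-continuity of \<open>left_lim U\<close> in terms of order alone. It makes the
  supremum that defines a quantile belong to the sublevel set.\<close>

lemma left_lim_closed:
  assumes "mono_on I U" "x \<in> I" "\<And>z. z \<in> I \<Longrightarrow> z < x \<Longrightarrow> left_lim U z \<le> s"
  shows "left_lim U x \<le> s"
proof (rule left_lim_least[OF assms(2)])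
  fix y assume y: "y \<in> I" "y < x"
  obtain z where z: "y < z" "z < x" using dense[OF y(2)] by blast
  then have "z \<in> I" using y assms(2) by (intro betweenI[of y x z]) auto
  then show "U y \<le> s"
    using left_lim_upper[OF assms(1) _ y(1) z(1)] assms(3)[OF _ z(2)] by (meson order_trans)
qed

lemma left_lim_tendsto:
  assumes "mono_on I U" "x \<in> I"
  shows "(U \<longlongrightarrow> left_lim U x) (at_left x)"
proof (rule increasing_tendsto)
  obtain y where y: "y \<in> I" "y < x" using smaller[OF assms(2)] by blast
  have inI: "z \<in> I" if "y < z" "z < x" for z
    using that y assms(2) by (intro betweenI[of y x z]) auto
  show "eventually (\<lambda>z. U z \<le> left_lim U x) (at_left x)"
    unfolding eventually_at_left_field
    using y inI left_lim_upper[OF assms] by blast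
  fix s assume "s < left_lim U x"
  then obtain w where w: "w \<in> I" "w < x" "s < U w"
    using left_lim_least[of x U s] assms(2) by fastforce
  show "eventually (\<lambda>z. s < U z) (at_left x)"
    unfolding eventually_at_left_field
  proof (intro exI[of _ "w"] conjI allI impI)
    fix z assume z: "w < z" "z < x"
    then have "z \<in> I" using w assms(2) by (intro betweenI[of w x z]) auto
    then have "U w \<le> U z" using w z by (intro mono_onD[OF assms(1)]) auto
    with w show "s < U z" by simp
  qed (fact w(2))
qed

text \<open>The quantile transform: the Stieltjes measure of \<open>U\<close> is the image of Lebesgue measure under the
  generalized inverse \<open>X\<close> of the left-continuous version of \<open>U\<close>.\<close>

lemma stieltjes_exists:
  assumes U: "mono_on I U"
  obtains m where "locfin m"
    "\<And>y x. y \<in> I \<Longrightarrow> x \<in> I \<Longrightarrow> y < x \<Longrightarrow> measure m {y..<x} = left_lim U x - left_lim U y"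
proof -
  define V where "V = left_lim U"
  have V: "mono_on I V" unfolding V_def by (rule left_lim_mono[OF U])
  \<comment> \<open>Only levels between two values of \<open>V\<close> have a quantile inside
    \<open>I\<close>. On them \<open>X\<close> is adjoint to \<open>V\<close>:
    \<open>z \<le> X s\<close> iff \<open>V z \<le> s\<close>, so the preimage of
    \<open>{y..<x}\<close> is \<open>{V y..<V x}\<close>.\<close>
  define S where "S = {s. \<exists>y\<in>I. \<exists>x\<in>I. V y \<le> s \<and> s < V x}"
  define X where "X s = Sup {z \<in> I. V z \<le> s}" for s
  have key: "z \<le> X s \<longleftrightarrow> V z \<le> s" and XI: "X s \<in> I" if s: "s \<in> S" and z: "z \<in> I" for s z
  proof -
    obtain y x where yx: "y \<in> I" "x \<in> I" "V y \<le> s" "s < V x" using s by (auto simp: S_def)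
    have ub: "w \<le> x" if "w \<in> {z \<in> I. V z \<le> s}" for w
    proof (rule ccontr)
      assume "\<not> w \<le> x"
      then have "V x \<le> V w" using that yx by (intro mono_onD[OF V]) auto
      with that yx show False by auto
    qed
    then have bdd: "bdd_above {z \<in> I. V z \<le> s}" by (rule bdd_aboveI)
    have ne: "{z \<in> I. V z \<le> s} \<noteq> {}" using yx by auto
    have "X s \<le> x" unfolding X_def by (rule cSup_least[OF ne ub])
    moreover have "y \<le> X s" unfolding X_def using yx by (intro cSup_upper bdd) auto
    ultimately show "X s \<in> I" by (intro betweenI[OF yx(1,2)])
    show "z \<le> X s \<longleftrightarrow> V z \<le> s"
    proof
      assume "V z \<le> s"
      then show "z \<le> X s" unfolding X_def using z by (intro cSup_upper bdd) auto
    next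
      assume zX: "z \<le> X s"
      show "V z \<le> s" unfolding V_def
      proof (rule left_lim_closed[OF U z])
        fix y' assume y': "y' \<in> I" "y' < z"
        then have "y' < X s" using zX by simp
        then obtain w where w: "w \<in> I" "V w \<le> s" "y' < w"
          unfolding X_def using less_cSup_iff[OF ne bdd] by auto
        have "V y' \<le> V w" using w y' by (intro mono_onD[OF V]) auto
        with w show "left_lim U y' \<le> s" by (simp add: V_def)
      qed
    qed
  qed
  have "is_interval S"
    unfolding is_interval_1 S_def by (fastforce intro: order_trans le_less_trans)
  then have S[measurable]: "S \<in> sets borel" by (rule real_interval_borel_measurable)
  have "mono_on S X"
  proof (rule mono_onI)
    fix r s assume rs: "r \<in> S" "s \<in> S" "r \<le> s"
    obtain z where "z \<in> I" by (rule nonempty)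
    note XI = XI[OF rs(1) this]
    have "V (X r) \<le> r" using key[OF rs(1) XI] by simp
    then show "X r \<le> X s" using key[OF rs(2) XI] rs(3) by simp
  qed
  then have "X \<in> borel_measurable (restrict_space borel S)"
    by (rule borel_measurable_mono_on_fnc)
  then have X1: "X \<in> borel_measurable (restrict_space lborel S)"
    by (simp cong: measurable_cong_sets add: sets_restrict_space)
  have X: "X \<in> measurable (restrict_space lborel S) (restrict_space borel I)"
  proof (rule measurable_restrict_space2[OF _ X1])
    obtain z where "z \<in> I" by (rule nonempty)
    then show "X \<in> space (restrict_space lborel S) \<rightarrow> I"
      using XI by (auto simp: space_restrict_space)
  qed
  define m where "m = distr (restrict_space lborel S) (restrict_space borel I) X"
  have em: "emeasure m {y..<x} = ennreal (V x - V y)" if yx: "y \<in> I" "x \<in> I" "y < x" for y x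
  proof -
    have "emeasure m {y..<x} = emeasure (restrict_space lborel S) (X -` {y..<x} \<inter> S)"
      unfolding m_def using yx subI(2) X by (subst emeasure_distr) (auto simp: sets_I_iff space_restrict_space)
    also have "X -` {y..<x} \<inter> S = {V y..<V x}"
    proof (intro set_eqI iffI)
      fix s assume "s \<in> X -` {y..<x} \<inter> S"
      then show "s \<in> {V y..<V x}" using key[of s y] key[of s x] yx by auto
    next
      fix s assume s: "s \<in> {V y..<V x}"
      then have "s \<in> S" using yx by (auto simp: S_def)
      then show "s \<in> X -` {y..<x} \<inter> S" using key[of s y] key[of s x] yx s by auto
    qed
    also have "emeasure (restrict_space lborel S) {V y..<V x} = emeasure lborel {V y..<V x}"
    proof (rule emeasure_restrict_space)
      show "{V y..<V x} \<subseteq> S" using yx by (auto simp: S_def)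
    qed simp
    also have "\<dots> = ennreal (V x - V y)"
      using yx by (intro emeasure_lborel_Ico mono_onD[OF V]) auto
    finally show ?thesis .
  qed
  show thesis
  proof (rule that)
    show "locfin m"
    proof (rule locfinI)
      show "sets m = sets (restrict_space borel I)" by (simp add: m_def)
    qed (simp add: em)
    show "measure m {y..<x} = left_lim U x - left_lim U y" if yx: "y \<in> I" "x \<in> I" "y < x" for y x
    proof -
      have "V y \<le> V x" using yx by (intro mono_onD[OF V]) auto
      then show ?thesis using em[OF yx] by (simp add: measure_def V_def)
    qed
  qed
qed

section \<open>Functions of bounded variation as differences of monotone functions\<close>

definition var_sums :: "(real \<Rightarrow> real) \<Rightarrow> real \<Rightarrow> real \<Rightarrow> real set" where
  "var_sums F y x = {(\<Sum>i<n. \<bar>F (t (Suc i)) - F (t i)\<bar>) | (n::nat) t. mono_on {..n} t \<and> t ` {..n} \<subseteq> {y..x}}"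

text \<open>The partition is prolonged by \<open>x\<close> and then \<open>z\<close>. The additional
  jump from its last point to \<open>x\<close> can only enlarge the sum, so it does not matter
  whether the partition reaches \<open>x\<close>.\<close>

lemma var_sums_right:
  assumes "v \<in> var_sums F y x" "x \<le> z" and that: "bdd_above (var_sums F y z)" "y \<le> x"
  shows "v + \<bar>F z - F x\<bar> \<le> Sup (var_sums F y z)"
proof -
  obtain n t where t: "mono_on {..n} t" "t ` {..n} \<subseteq> {y..x}" "v = (\<Sum>i<n. \<bar>F (t (Suc i)) - F (t i)\<bar>)"
    using assms(1) unfolding var_sums_def by blast
  define t' where "t' i = (if i \<le> n then t i else if i = Suc n then x else z)" for i
  have tb: "y \<le> t i \<and> t i \<le> x" if "i \<le> n" for i using t(2) that by fastforce
  have "mono_on {..Suc (Suc n)} t'"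
  proof (rule mono_onI)
    fix r s assume rs: "r \<in> {..Suc (Suc n)}" "s \<in> {..Suc (Suc n)}" "r \<le> s"
    show "t' r \<le> t' s"
      using rs tb[of r] mono_onD[OF t(1), of r s] assms(2) by (auto simp: t'_def)
  qed
  moreover have "t' ` {..Suc (Suc n)} \<subseteq> {y..z}"
    using tb assms(2) that(2) by (fastforce simp: t'_def)
  ultimately have "(\<Sum>i<Suc (Suc n). \<bar>F (t' (Suc i)) - F (t' i)\<bar>) \<in> var_sums F y z"
    unfolding var_sums_def by blast
  then have "(\<Sum>i<Suc (Suc n). \<bar>F (t' (Suc i)) - F (t' i)\<bar>) \<le> Sup (var_sums F y z)"
    by (rule cSup_upper[OF _ that(1)])
  moreover have "(\<Sum>i<n. \<bar>F (t' (Suc i)) - F (t' i)\<bar>) = v"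
    unfolding t(3) by (intro sum.cong) (auto simp: t'_def)
  ultimately show ?thesis by (simp add: t'_def)
qed

lemma var_sums_left:
  assumes "v \<in> var_sums F x z" "y \<le> x" and that: "bdd_above (var_sums F y z)" "x \<le> z"
  shows "\<bar>F x - F y\<bar> + v \<le> Sup (var_sums F y z)"
proof -
  obtain n t where t: "mono_on {..n} t" "t ` {..n} \<subseteq> {x..z}" "v = (\<Sum>i<n. \<bar>F (t (Suc i)) - F (t i)\<bar>)"
    using assms(1) unfolding var_sums_def by blast
  \<comment> \<open>Two points in front shift the partition by two; \<open>t (i - 2)\<close> is
    reached only from index two on.\<close>
  define t' where "t' i = (if i = 0 then y else if i = Suc 0 then x else t (i - 2))" for i
  have tb: "x \<le> t i \<and> t i \<le> z" if "i \<le> n" for i using t(2) that by fastforce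
  have "mono_on {..Suc (Suc n)} t'"
  proof (rule mono_onI)
    fix r s assume rs: "r \<in> {..Suc (Suc n)}" "s \<in> {..Suc (Suc n)}" "r \<le> s"
    show "t' r \<le> t' s"
      using rs tb[of "s - 2"] mono_onD[OF t(1), of "r - 2" "s - 2"] assms(2)
      by (auto simp: t'_def intro: order_trans)
  qed
  moreover have "t' ` {..Suc (Suc n)} \<subseteq> {y..z}"
  proof
    fix w assume "w \<in> t' ` {..Suc (Suc n)}"
    then obtain i where i: "i \<le> Suc (Suc n)" "w = t' i" by auto
    show "w \<in> {y..z}"
      using i tb[of "i - 2"] assms(2) that(2) by (auto simp: t'_def intro: order_trans)
  qed
  ultimately have "(\<Sum>i<Suc (Suc n). \<bar>F (t' (Suc i)) - F (t' i)\<bar>) \<in> var_sums F y z"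
    unfolding var_sums_def by blast
  then have "(\<Sum>i<Suc (Suc n). \<bar>F (t' (Suc i)) - F (t' i)\<bar>) \<le> Sup (var_sums F y z)"
    by (rule cSup_upper[OF _ that(1)])
  moreover have "(\<Sum>i<n. \<bar>F (t' (Suc (Suc (Suc i)))) - F (t' (Suc (Suc i)))\<bar>) = v"
    unfolding t(3) by (intro sum.cong) (auto simp: t'_def)
  ultimately show ?thesis
    unfolding sum.lessThan_Suc_shift by (simp add: t'_def)
qed

text \<open>\<open>R\<close> and \<open>L\<close> say that the variation is superadditive when an
  interval is extended to the right or to the left. Hence increments of the variation function
  dominate those of \<open>F\<close>, and both \<open>V\<close> and \<open>V - F\<close> are
  nondecreasing.\<close>

lemma bv_loc_split:
  fixes F :: "real \<Rightarrow> real"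
  assumes F: "bv_loc I F"
  obtains U W where "mono_on I U" "mono_on I W" "\<And>x. F x = U x - W x"
proof -
  obtain c where c: "c \<in> I" by (rule nonempty)
  define vr where "vr y x = Sup (var_sums F y x)" for y x
  have bdd: "bdd_above (var_sums F y x)" if "y \<in> I" "x \<in> I" for y x
  proof -
    have "bv_on {y..x} F" using F subI(1)[OF that] by (simp add: bv_loc_def)
    then obtain B where B: "\<forall>(n::nat) t. mono_on {..n} t \<and> t ` {..n} \<subseteq> {y..x} \<longrightarrow>
      (\<Sum>i<n. norm (F (t (Suc i)) - F (t i))) \<le> B" unfolding bv_on_def by blast
    show ?thesis
    proof (rule bdd_aboveI)
      fix v assume "v \<in> var_sums F y x"
      then show "v \<le> B" using B unfolding var_sums_def by (auto simp flip: real_norm_def)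
    qed
  qed
  have ne: "0 \<in> var_sums F y x" if "y \<le> x" for y x
    unfolding var_sums_def using that
    by (intro CollectI exI[of _ "0::nat"] exI[of _ "\<lambda>_. y"]) (auto simp: mono_on_def)
  have vr0: "0 \<le> vr y x" if "y \<in> I" "x \<in> I" "y \<le> x" for y x
    unfolding vr_def by (rule cSup_upper[OF ne[OF that(3)] bdd[OF that(1,2)]])
  have R: "vr y x + \<bar>F z - F x\<bar> \<le> vr y z" if "y \<in> I" "z \<in> I" "y \<le> x" "x \<le> z" for x y z
  proof -
    have "vr y x \<le> vr y z - \<bar>F z - F x\<bar>"
      unfolding vr_def using ne[OF that(3)] var_sums_right[OF _ that(4) bdd[OF that(1,2)] that(3)]
      by (intro cSup_least) (auto simp: algebra_simps)
    then show ?thesis by simp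
  qed
  have L: "\<bar>F x - F y\<bar> + vr x z \<le> vr y z" if "y \<in> I" "z \<in> I" "y \<le> x" "x \<le> z" for x y z
  proof -
    have "vr x z \<le> vr y z - \<bar>F x - F y\<bar>"
      unfolding vr_def using ne[OF that(4)] var_sums_left[OF _ that(3) bdd[OF that(1,2)] that(4)]
      by (intro cSup_least) (auto simp: algebra_simps)
    then show ?thesis by simp
  qed
  \<comment> \<open>The variation measured from \<open>c\<close> is counted negatively to the left
    of \<open>c\<close>, so that \<open>V\<close> increases through \<open>c\<close>.\<close>
  define V where "V x = (if c \<le> x then vr c x else - vr x c)" for x
  have V: "\<bar>F x2 - F x1\<bar> \<le> V x2 - V x1" if "x1 \<in> I" "x2 \<in> I" "x1 \<le> x2" for x1 x2
  proof -
    consider "c \<le> x1" | "x2 < c" | "x1 < c" "c \<le> x2" by linarith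
    then show ?thesis
    proof cases
      case 1
      then show ?thesis using R[OF c that(2) 1 that(3)] that by (simp add: V_def)
    next
      case 2
      then show ?thesis using L[OF that(1) c that(3)] that by (simp add: V_def)
    next
      case 3
      have "\<bar>F x2 - F c\<bar> \<le> vr c x2" using R[OF c that(2) _ 3(2)] vr0[OF c c] by simp
      moreover have "\<bar>F c - F x1\<bar> \<le> vr x1 c" using L[OF that(1) c _ order_refl] 3(1) vr0[OF c c] by simp
      ultimately show ?thesis using 3 by (simp add: V_def)
    qed
  qed
  show thesis
  proof (rule that)
    show "mono_on I V" using V by (intro mono_onI) fastforce
    show "mono_on I (\<lambda>x. V x - F x)" using V by (intro mono_onI) fastforce
  qed simp
qed

section \<open>Existence of the Jordan decomposition\<close>

lemma split_tendsto:
  assumes "mono_on I U" "mono_on I W" "\<And>x. F x = U x - W x" "x \<in> I"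
  shows "(F \<longlongrightarrow> left_lim U x - left_lim W x) (at_left x)"
  unfolding assms(3) by (intro tendsto_diff left_lim_tendsto assms)

text \<open>Both sides are the maximum of \<open>f\<close> and \<open>g\<close>. The guards make
  both differences vanish where \<open>f = g\<close>, including where both are infinite.\<close>

lemma ennreal_diff_add_swap: "(if g < f then f - g else 0) + g = (if f < g then g - f else 0) + (f::ennreal)"
  by (cases f g rule: linorder_cases) (auto simp: diff_add_cancel_ennreal)

text \<open>The common part of \<open>m1\<close> and \<open>m2\<close> is cancelled: relative to
  their sum they have densities \<open>f\<close> and \<open>g\<close>, and the positive parts of
  \<open>f - g\<close> and \<open>g - f\<close> are carried by disjoint sets. Identities are kept in
  additive form because the densities are extended reals.\<close>

lemma jordan_of_diff:
  assumes m: "locfin m1" "locfin m2"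
    and F: "\<And>y x. y \<in> I \<Longrightarrow> x \<in> I \<Longrightarrow> y < x \<Longrightarrow>
      measure m1 {y..<x} - measure m2 {y..<x} = Lim (at_left x) F - Lim (at_left y) F"
  obtains M N where "jordan_decomp I F M N"
proof -
  define T where "T = sum_measure m1 m2"
  have lT: "locfin T" unfolding T_def by (rule locfin_sum[OF m])
  interpret T: sigma_finite_measure T by (rule locfin_sigma_finite[OF lT])
  have st: "sets m1 = sets T" "sets m2 = sets T" "sets T = sets (restrict_space borel I)"
    using m lT by (simp_all add: locfin_def)
  have spT: "space T = I" by (rule locfin_space[OF lT])
  have eT: "emeasure T A = emeasure m1 A + emeasure m2 A" for A
    unfolding T_def by (rule emeasure_sum_measure) (simp add: st)
  have ac: "absolutely_continuous T m1" "absolutely_continuous T m2"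
    unfolding absolutely_continuous_def null_sets_def by (auto simp: eT st)
  obtain f where f[measurable]: "f \<in> borel_measurable T" and fm: "density T f = m1"
    using T.Radon_Nikodym[OF ac(1) st(1)] by blast
  obtain g where g[measurable]: "g \<in> borel_measurable T" and gm: "density T g = m2"
    using T.Radon_Nikodym[OF ac(2) st(2)] by blast
  define M where "M = density T (\<lambda>x. if g x < f x then f x - g x else 0)"
  define N where "N = density T (\<lambda>x. if f x < g x then g x - f x else 0)"
  have eM: "emeasure M B = (\<integral>\<^sup>+x. (if g x < f x then f x - g x else 0) * indicator B x \<partial>T)"
    and eN: "emeasure N B = (\<integral>\<^sup>+x. (if f x < g x then g x - f x else 0) * indicator B x \<partial>T)"
    and e1: "emeasure m1 B = (\<integral>\<^sup>+x. f x * indicator B x \<partial>T)"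
    and e2: "emeasure m2 B = (\<integral>\<^sup>+x. g x * indicator B x \<partial>T)" if "B \<in> sets T" for B
    using that fm gm unfolding M_def N_def by (auto simp: emeasure_density[symmetric])
  have MN1: "emeasure M B \<le> emeasure m1 B" "emeasure N B \<le> emeasure m2 B" if "B \<in> sets T" for B
    using that unfolding eM[OF that] eN[OF that] e1[OF that] e2[OF that]
    by (auto intro!: nn_integral_mono mult_right_mono)
  have sum: "emeasure M B + emeasure m2 B = emeasure N B + emeasure m1 B" if [measurable]: "B \<in> sets T" for B
  proof -
    have "emeasure M B + emeasure m2 B = (\<integral>\<^sup>+x. (if g x < f x then f x - g x else 0) * indicator B x + g x * indicator B x \<partial>T)"
      unfolding eM[OF that] e2[OF that] by (intro nn_integral_add[symmetric]) auto
    also have "\<dots> = (\<integral>\<^sup>+x. (if f x < g x then g x - f x else 0) * indicator B x + f x * indicator B x \<partial>T)"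
      by (intro nn_integral_cong) (metis distrib_right ennreal_diff_add_swap)
    also have "\<dots> = emeasure N B + emeasure m1 B"
      unfolding eN[OF that] e1[OF that] by (intro nn_integral_add) auto
    finally show ?thesis .
  qed
  have lMN: "locfin M" "locfin N"
  proof -
    show "locfin M"
    proof (rule locfinI)
      show "emeasure M {y..<x} < \<infinity>" if "y \<in> I" "x \<in> I" for y x
        by (rule le_less_trans[OF MN1(1)[OF locfin_Ico[OF lT that]] locfin_Ico_finite[OF m(1) that]])
    qed (simp add: M_def st)
    show "locfin N"
    proof (rule locfinI)
      show "emeasure N {y..<x} < \<infinity>" if "y \<in> I" "x \<in> I" for y x
        by (rule le_less_trans[OF MN1(2)[OF locfin_Ico[OF lT that]] locfin_Ico_finite[OF m(2) that]])
    qed (simp add: N_def st)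
  qed
  show thesis
  proof (rule that[of M N])
    show "jordan_decomp I F M N"
      unfolding jordan_decomp_def
    proof (intro conjI)
      show "sets M = sets (restrict_space borel I)" "sets N = sets (restrict_space borel I)"
        using lMN by (simp_all add: locfin_def)
      show "\<forall>K. compact K \<and> K \<subseteq> I \<longrightarrow> emeasure M K < \<infinity> \<and> emeasure N K < \<infinity>"
        using lMN by (simp add: locfin_def)
      define A where "A = {x \<in> space T. f x < g x}"
      have A[measurable]: "A \<in> sets T" unfolding A_def by measurable
      have "emeasure M A = (\<integral>\<^sup>+x. 0 \<partial>T)" unfolding eM[OF A]
        by (intro nn_integral_cong) (auto simp: A_def split: split_indicator)
      then have M0: "emeasure M A = 0" by simp
      have IA: "I - A \<in> sets T" using A unfolding spT[symmetric] by (rule sets.compl_sets)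
      have "emeasure N (I - A) = (\<integral>\<^sup>+x. 0 \<partial>T)" unfolding eN[OF IA]
        by (intro nn_integral_cong) (auto simp: A_def spT split: split_indicator)
      then have N0: "emeasure N (I - A) = 0" by simp
      from M0 N0 show "\<exists>A\<in>sets (restrict_space borel I). emeasure M A = 0 \<and> emeasure N (I - A) = 0"
        using A st by blast
      show "\<forall>y\<in>I. \<forall>x\<in>I. y < x \<longrightarrow>
        measure M {y..<x} - measure N {y..<x} = Lim (at_left x) F - Lim (at_left y) F"
      proof (intro ballI impI)
        fix y x assume yx: "y \<in> I" "x \<in> I" "y < x"
        let ?A = "{y..<x}"
        have mea: "emeasure M ?A = ennreal (measure M ?A)" "emeasure N ?A = ennreal (measure N ?A)"
          "emeasure m1 ?A = ennreal (measure m1 ?A)" "emeasure m2 ?A = ennreal (measure m2 ?A)"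
          using locfin_Ico_finite[OF lMN(1) yx(1,2)] locfin_Ico_finite[OF lMN(2) yx(1,2)]
            locfin_Ico_finite[OF m(1) yx(1,2)] locfin_Ico_finite[OF m(2) yx(1,2)]
          by (auto intro!: emeasure_eq_ennreal_measure)
        have "measure M ?A + measure m2 ?A = measure N ?A + measure m1 ?A"
          using sum[OF locfin_Ico[OF lT yx(1,2)]] unfolding mea
          by (simp flip: ennreal_plus)
        then show "measure M {y..<x} - measure N {y..<x} = Lim (at_left x) F - Lim (at_left y) F"
          using F[OF yx] by simp
      qed
    qed
  qed
qed

lemma jordan_exists:
  assumes "bv_loc I F"
  obtains M N where "jordan_decomp I F M N"
proof -
  obtain U W where UW: "mono_on I U" "mono_on I W" "\<And>x. F x = U x - W x"
    by (rule bv_loc_split[OF assms]) (rule that; assumption)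
  obtain m1 where m1: "locfin m1"
    "\<And>y x. y \<in> I \<Longrightarrow> x \<in> I \<Longrightarrow> y < x \<Longrightarrow> measure m1 {y..<x} = left_lim U x - left_lim U y"
    by (rule stieltjes_exists[OF UW(1)]) (rule that; assumption)
  obtain m2 where m2: "locfin m2"
    "\<And>y x. y \<in> I \<Longrightarrow> x \<in> I \<Longrightarrow> y < x \<Longrightarrow> measure m2 {y..<x} = left_lim W x - left_lim W y"
    by (rule stieltjes_exists[OF UW(2)]) (rule that; assumption)
  have "Lim (at_left x) F = left_lim U x - left_lim W x" if "x \<in> I" for x
    by (rule tendsto_Lim[OF trivial_limit_at_left_real split_tendsto[OF UW that]])
  then have "measure m1 {y..<x} - measure m2 {y..<x} = Lim (at_left x) F - Lim (at_left y) F"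
    if "y \<in> I" "x \<in> I" "y < x" for y x
    using that m1(2)[OF that] m2(2)[OF that] by simp
  then show thesis
    by (rule jordan_of_diff[OF m1(1) m2(1)]) (assumption | rule that)+
qed


section \<open>Primitives and integration by parts\<close>

abbreviation L :: "real measure" where "L \<equiv> restrict_space lborel I"

lemma emeasure_L: "B \<subseteq> I \<Longrightarrow> emeasure L B = emeasure lborel B"
  by (rule emeasure_restrict_space) simp_all

lemma sets_L: "sets L = sets (restrict_space borel I)"
  by (simp add: sets_restrict_space)

lemma locfin_L: "locfin L"
  by (rule locfinI) (simp_all add: sets_L emeasure_L[OF subI(2)])

lemma id_measurable: "locfin T \<Longrightarrow> (\<lambda>x. x) \<in> borel_measurable T"
  by (subst measurable_cong_sets[of T "restrict_space borel I" borel borel])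
    (auto simp: locfin_def intro: measurable_restrict_space1)

lemma measurable_locfin_cong: "locfin T \<Longrightarrow> locfin T' \<Longrightarrow> f \<in> borel_measurable T \<longleftrightarrow> f \<in> borel_measurable T'"
  by (metis locfin_def measurable_cong_sets)

section \<open>Local integrability and primitives\<close>

definition locint :: "real measure \<Rightarrow> (real \<Rightarrow> complex) \<Rightarrow> bool" where
  "locint T \<phi> \<longleftrightarrow> (\<forall>y\<in>I. \<forall>x\<in>I. set_integrable T {y..<x} \<phi>)"

lemma locintD: "locint T \<phi> \<Longrightarrow> y \<in> I \<Longrightarrow> x \<in> I \<Longrightarrow> set_integrable T {y..<x} \<phi>"
  by (simp add: locint_def)

lemma locint_compact:
  assumes T: "locfin T"
  shows "(\<forall>K. compact K \<and> K \<subseteq> I \<longrightarrow> set_integrable T K \<phi>) \<longleftrightarrow> locint T \<phi>"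
proof
  assume A: "\<forall>K. compact K \<and> K \<subseteq> I \<longrightarrow> set_integrable T K \<phi>"
  show "locint T \<phi>" unfolding locint_def
  proof (intro ballI)
    fix y x assume yx: "y \<in> I" "x \<in> I"
    then have "set_integrable T {y..x} \<phi>" using A subI(1) by simp
    then show "set_integrable T {y..<x} \<phi>"
      by (rule set_integrable_subset) (use locfin_Ico[OF T yx] in auto)
  qed
next
  assume A: "locint T \<phi>"
  show "\<forall>K. compact K \<and> K \<subseteq> I \<longrightarrow> set_integrable T K \<phi>"
  proof (intro allI impI)
    fix K assume K: "compact K \<and> K \<subseteq> I"
    then obtain c d where cd: "c \<in> I" "d \<in> I" "K \<subseteq> {c..<d}" by (metis compact_sub)
    have "K \<in> sets T" using K by (auto simp: locfin_sets[OF T] borel_compact)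
    then show "set_integrable T K \<phi>"
      using set_integrable_subset[OF locintD[OF A cd(1,2)]] cd(3) by blast
  qed
qed

lemma locint_measurable:
  assumes T: "locfin T" and \<phi>: "locint T \<phi>"
  shows "\<phi> \<in> borel_measurable T"
proof -
  obtain l u :: "nat \<Rightarrow> real" where lu: "I = (\<Union>n. {l n..<u n})" "incseq u" "decseq l"
     "\<And>n. l n \<in> I" "\<And>n. u n \<in> I"
    by (rule exhaust) (rule that; assumption)
  show ?thesis
  proof (rule borel_measurable_LIMSEQ_metric)
    show "(\<lambda>x. indicator {l n..<u n} x *\<^sub>R \<phi> x) \<in> borel_measurable T" for n
      using locintD[OF \<phi> lu(4) lu(5)] unfolding set_integrable_def by (rule borel_measurable_integrable)
    fix x assume "x \<in> space T"
    then have "x \<in> (\<Union>n. {l n..<u n})" unfolding locfin_space[OF T] by (subst lu(1)[symmetric])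
    then obtain n where n: "l n \<le> x" "x < u n" by auto
    have "indicator {l m..<u m} x *\<^sub>R \<phi> x = \<phi> x" if "m \<ge> n" for m
      using n incseqD[OF lu(2) that] decseqD[OF lu(3) that] by auto
    then show "(\<lambda>m. indicator {l m..<u m} x *\<^sub>R \<phi> x) \<longlonglongrightarrow> \<phi> x"
      by (intro tendsto_eventually eventually_sequentiallyI[of n])
  qed
qed

lemma locint_one:
  assumes T: "locfin T" shows "locint T (\<lambda>x. 1)"
  unfolding locint_def set_integrable_def
proof (intro ballI)
  fix y x assume yx: "y \<in> I" "x \<in> I"
  have "integrable T (indicat_real {y..<x})"
    by (rule integrable_real_indicator[OF locfin_Ico[OF T yx] locfin_Ico_finite[OF T yx]])
  then have "integrable T (\<lambda>t. complex_of_real (indicat_real {y..<x} t))" by (rule integrable_of_real)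
  then show "complex_integrable T (\<lambda>t. indicat_real {y..<x} t *\<^sub>R 1)" by (simp add: scaleR_conv_of_real)
qed

lemma set_integrable_bounded_mult:
  fixes \<phi> h :: "real \<Rightarrow> complex"
  assumes "set_integrable T B \<phi>" "h \<in> borel_measurable T" "\<And>t. t \<in> B \<Longrightarrow> norm (h t) \<le> C"
  shows "set_integrable T B (\<lambda>t. h t * \<phi> t)"
  unfolding set_integrable_def
proof (rule Bochner_Integration.integrable_bound)
  show "integrable T (\<lambda>t. of_real C * (indicator B t *\<^sub>R \<phi> t))"
    using assms(1) unfolding set_integrable_def by (rule integrable_mult_right)
  have *: "(\<lambda>t. indicator B t *\<^sub>R (h t * \<phi> t)) = (\<lambda>t. h t * (indicator B t *\<^sub>R \<phi> t))"
    by (simp add: fun_eq_iff)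
  show "(\<lambda>t. indicator B t *\<^sub>R (h t * \<phi> t)) \<in> borel_measurable T"
    unfolding * using assms(1,2) by (intro borel_measurable_times) (simp_all add: set_integrable_def)
  show "AE t in T. norm (indicator B t *\<^sub>R (h t * \<phi> t)) \<le> norm (of_real C * (indicator B t *\<^sub>R \<phi> t))"
  proof (rule AE_I2)
    fix t show "norm (indicator B t *\<^sub>R (h t * \<phi> t)) \<le> norm (of_real C * (indicator B t *\<^sub>R \<phi> t))"
    proof (cases "t \<in> B")
      case True
      then have "norm (h t) \<le> \<bar>C\<bar>" using assms(3)[OF True] by linarith
      then show ?thesis using True by (simp add: norm_mult mult_right_mono)
    qed simp
  qed
qed

lemma locint_bounded_mult:
  assumes "locint T \<phi>" "h \<in> borel_measurable T"
    "\<And>y x. y \<in> I \<Longrightarrow> x \<in> I \<Longrightarrow> y < x \<Longrightarrow> \<exists>C. \<forall>t\<in>{y..<x}. norm (h t) \<le> C"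
  shows "locint T (\<lambda>t. h t * \<phi> t)"
  unfolding locint_def
proof (intro ballI)
  fix y x assume yx: "y \<in> I" "x \<in> I"
  show "set_integrable T {y..<x} (\<lambda>t. h t * \<phi> t)"
  proof (cases "y < x")
    case True
    then obtain C where "\<forall>t\<in>{y..<x}. norm (h t) \<le> C" using assms(3) yx by blast
    then show ?thesis by (intro set_integrable_bounded_mult[of _ _ _ _ C] locintD assms yx) auto
  next
    case False
    then show ?thesis by (simp add: set_integrable_def)
  qed
qed

lemma set_integrable_Ico_split:
  assumes T: "locfin T" and \<phi>: "locint T \<phi>" and "y \<in> I" "z \<in> I" "y \<le> x" "x \<le> z"
  shows "(LINT t:{y..<z}|T. \<phi> t) = (LINT t:{y..<x}|T. \<phi> t) + (LINT t:{x..<z}|T. \<phi> t)"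
proof -
  have x: "x \<in> I" using betweenI[OF assms(3-6)] .
  have "{y..<z} = {y..<x} \<union> {x..<z}" using assms by auto
  then show ?thesis using locintD[OF \<phi>] assms x by (simp add: set_integral_Un)
qed

text \<open>The half-open interval leaves the mass at \<open>x\<close> out of \<open>f x\<close>.
  Primitives are therefore left-continuous, the representative that \<open>ac_loc\<close> asks
  for.\<close>

definition prim :: "real measure \<Rightarrow> (real \<Rightarrow> complex) \<Rightarrow> (real \<Rightarrow> complex) \<Rightarrow> bool" where
  "prim T f \<phi> \<longleftrightarrow> locint T \<phi> \<and> (\<forall>y\<in>I. \<forall>x\<in>I. y \<le> x \<longrightarrow> f x = f y + (LINT t:{y..<x}|T. \<phi> t))"

lemma primD: "prim T f \<phi> \<Longrightarrow> y \<in> I \<Longrightarrow> x \<in> I \<Longrightarrow> y \<le> x \<Longrightarrow> f x = f y + (LINT t:{y..<x}|T. \<phi> t)"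
  and prim_locint: "prim T f \<phi> \<Longrightarrow> locint T \<phi>"
  unfolding prim_def by blast+

lemma primI:
  assumes "locint T \<phi>"
    "\<And>y x. y \<in> I \<Longrightarrow> x \<in> I \<Longrightarrow> y \<le> x \<Longrightarrow> f x = f y + (LINT t:{y..<x}|T. \<phi> t)"
  shows "prim T f \<phi>"
  using assms unfolding prim_def by blast

text \<open>At least one of the two intervals is always empty, so this is the oriented integral from
  \<open>c\<close> in a form without case distinction.\<close>

definition osint :: "real measure \<Rightarrow> real \<Rightarrow> (real \<Rightarrow> complex) \<Rightarrow> real \<Rightarrow> complex" where
  "osint T c \<phi> x = (LINT t:{c..<x}|T. \<phi> t) - (LINT t:{x..<c}|T. \<phi> t)"

lemma osint_refl [simp]: "osint T c \<phi> c = 0"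
  by (simp add: osint_def)

lemma prim_osint:
  assumes T: "locfin T" and \<phi>: "locint T \<phi>" and c: "c \<in> I"
  shows "prim T (osint T c \<phi>) \<phi>"
  unfolding prim_def
proof (intro conjI ballI impI \<phi>)
  fix y x assume yx: "y \<in> I" "x \<in> I" "y \<le> x"
  consider "c \<le> y" | "x \<le> c" | "y \<le> c" "c \<le> x" by linarith
  then show "osint T c \<phi> x = osint T c \<phi> y + (LINT t:{y..<x}|T. \<phi> t)"
  proof cases
    case 1
    show ?thesis using set_integrable_Ico_split[OF T \<phi> c yx(2) 1 yx(3)] 1 yx(3) by (simp add: osint_def)
  next
    case 2
    show ?thesis using set_integrable_Ico_split[OF T \<phi> yx(1) c yx(3) 2] 2 yx(3) by (simp add: osint_def)
  next
    case 3
    show ?thesis using set_integrable_Ico_split[OF T \<phi> yx(1,2) 3] 3 by (simp add: osint_def set_lebesgue_integral_def)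
  qed
qed

lemma prim_const_eq:
  assumes "prim T f \<phi>" "prim T g \<phi>" "c \<in> I" "x \<in> I"
  shows "f x - f c = g x - g c"
proof (cases "c \<le> x")
  case True
  show ?thesis using primD[OF assms(1,3,4) True] primD[OF assms(2,3,4) True] by simp
next
  case False
  then have "x \<le> c" by simp
  from primD[OF assms(1,4,3) this] primD[OF assms(2,4,3) this] show ?thesis by simp
qed

lemma prim_eq_osint:
  assumes T: "locfin T" and f: "prim T f \<phi>" and c: "c \<in> I" "x \<in> I"
  shows "f x = f c + osint T c \<phi> x"
  using prim_const_eq[OF f prim_osint[OF T prim_locint[OF f] c(1)] c] by (simp add: algebra_simps)

lemma prim_cong:
  assumes "prim T f \<phi>" "\<And>x. x \<in> I \<Longrightarrow> f x = g x" "\<And>x. x \<in> I \<Longrightarrow> \<phi> x = \<psi> x"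
  shows "prim T g \<psi>"
proof (rule primI)
  have A: "(\<lambda>t. indicator {y..<x} t *\<^sub>R \<phi> t) = (\<lambda>t. indicator {y..<x} t *\<^sub>R \<psi> t)" if "y \<in> I" "x \<in> I" for y x
    using subI(2)[OF that] assms(3) by (auto simp: fun_eq_iff indicator_def)
  show "locint T \<psi>"
    using prim_locint[OF assms(1)] A unfolding locint_def set_integrable_def by simp
  fix y x assume yx: "y \<in> I" "x \<in> I" "y \<le> x"
  show "g x = g y + (LINT t:{y..<x}|T. \<psi> t)"
    using primD[OF assms(1) yx] A[OF yx(1,2)] assms(2)[OF yx(1)] assms(2)[OF yx(2)]
    unfolding set_lebesgue_integral_def by simp
qed

lemma prim_add:
  assumes "prim T f \<phi>" "prim T g \<psi>" shows "prim T (\<lambda>x. f x + g x) (\<lambda>x. \<phi> x + \<psi> x)"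
proof -
  note * = prim_locint[OF assms(1)] prim_locint[OF assms(2)]
  then have "locint T (\<lambda>x. \<phi> x + \<psi> x)" by (simp add: locint_def)
  then show ?thesis
  proof (rule primI)
    fix y x assume yx: "y \<in> I" "x \<in> I" "y \<le> x"
    then show "f x + g x = f y + g y + (LINT t:{y..<x}|T. \<phi> t + \<psi> t)"
      using primD[OF assms(1) yx] primD[OF assms(2) yx] locintD[OF *(1)] locintD[OF *(2)] by simp
  qed
qed

lemma prim_const: "prim T (\<lambda>x. c) (\<lambda>x. 0)"
  unfolding prim_def locint_def by (simp add: set_integrable_def)

lemma prim_cmult:
  assumes "prim T f \<phi>" shows "prim T (\<lambda>x. c * f x) (\<lambda>x. c * \<phi> x)"
proof -
  have "set_integrable T B (\<lambda>x. c * \<phi> x)" if "set_integrable T B \<phi>" for B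
    by (rule set_integrable_mult_right) (rule that)
  then have "locint T (\<lambda>x. c * \<phi> x)"
    using prim_locint[OF assms] by (simp add: locint_def)
  then show ?thesis
  proof (rule primI)
    fix y x assume yx: "y \<in> I" "x \<in> I" "y \<le> x"
    then show "c * f x = c * f y + (LINT t:{y..<x}|T. c * \<phi> t)"
      using primD[OF assms yx] by (simp add: distrib_left)
  qed
qed

lemma prim_minus:
  assumes "prim T f \<phi>" shows "prim T (\<lambda>x. - f x) (\<lambda>x. - \<phi> x)"
  using prim_cmult[OF assms, of "-1"] by simp

lemma prim_diff:
  assumes "prim T f \<phi>" "prim T g \<psi>" shows "prim T (\<lambda>x. f x - g x) (\<lambda>x. \<phi> x - \<psi> x)"
  using prim_add[OF assms(1) prim_minus[OF assms(2)]] by simp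

lemma prim_cnj:
  assumes "prim T f \<phi>" shows "prim T (\<lambda>x. cnj (f x)) (\<lambda>x. cnj (\<phi> x))"
proof -
  have "set_integrable T B (\<lambda>x. cnj (\<phi> x))" if "set_integrable T B \<phi>" for B
    using integrable_bounded_linear[OF bounded_linear_cnj that[unfolded set_integrable_def]]
    by (simp add: set_integrable_def)
  moreover have "(LINT t:B|T. cnj (\<phi> t)) = cnj (LINT t:B|T. \<phi> t)" for B
    using Bochner_Integration.integral_cnj[of T "\<lambda>x. indicator B x *\<^sub>R \<phi> x"] by (simp add: set_lebesgue_integral_def)
  moreover have "locint T (\<lambda>x. cnj (\<phi> x))"
    using prim_locint[OF assms] calculation(1) by (simp add: locint_def)
  ultimately show ?thesis
    by (intro primI) (simp_all add: primD[OF assms, of y x for y x, symmetric] flip: complex_cnj_add)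
qed

lemma norm_set_integral_le:
  fixes \<phi> :: "real \<Rightarrow> complex"
  assumes T: "locfin T" and \<phi>: "locint T \<phi>" and "y \<in> I" "x \<in> I" "y \<le> t" "t \<le> t'" "t' \<le> x"
  shows "norm (LINT t:{t..<t'}|T. \<phi> t) \<le> (LINT t:{y..<x}|T. norm (\<phi> t))"
proof -
  have int: "set_integrable T {y..<x} \<phi>" by (rule locintD) fact+
  have t: "t \<in> I" "t' \<in> I" using betweenI[OF assms(3,4)] assms(5-7) by auto
  have "norm (LINT t:{t..<t'}|T. \<phi> t) \<le> (LINT s|T. norm (indicator {t..<t'} s *\<^sub>R \<phi> s))"
    unfolding set_lebesgue_integral_def by (rule integral_norm_bound)
  also have "\<dots> \<le> (LINT t:{y..<x}|T. norm (\<phi> t))"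
    unfolding set_lebesgue_integral_def
  proof (rule integral_mono)
    show "integrable T (\<lambda>s. norm (indicator {t..<t'} s *\<^sub>R \<phi> s))"
      using locintD[OF \<phi> t] by (intro integrable_norm) (simp add: set_integrable_def)
    show "integrable T (\<lambda>s. indicator {y..<x} s *\<^sub>R norm (\<phi> s))"
      using integrable_norm[OF int[unfolded set_integrable_def]] by simp
    show "norm (indicator {t..<t'} s *\<^sub>R \<phi> s) \<le> indicator {y..<x} s *\<^sub>R norm (\<phi> s)" for s
      using assms by (auto simp: indicator_def)
  qed
  finally show ?thesis .
qed

lemma prim_bound:
  assumes T: "locfin T" and f: "prim T f \<phi>" and yx: "y \<in> I" "x \<in> I" and t: "y \<le> t" "t \<le> x"
  shows "norm (f t) \<le> norm (f y) + (LINT t:{y..<x}|T. norm (\<phi> t))"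
proof -
  have "f t = f y + (LINT t:{y..<t}|T. \<phi> t)"
    using betweenI[OF yx t] yx t by (intro primD[OF f]) auto
  then have "norm (f t) \<le> norm (f y) + norm (LINT t:{y..<t}|T. \<phi> t)" by (metis norm_triangle_ineq)
  also have "\<dots> \<le> norm (f y) + (LINT t:{y..<x}|T. norm (\<phi> t))"
    using norm_set_integral_le[OF T prim_locint[OF f] yx order_refl t] by simp
  finally show ?thesis .
qed

lemma prim_locally_bounded:
  assumes "locfin T" "prim T f \<phi>" "y \<in> I" "x \<in> I"
  shows "\<exists>C. \<forall>t\<in>{y..<x}. norm (f t) \<le> C"
  using prim_bound[OF assms]
  by (intro exI[of _ "norm (f y) + (LINT t:{y..<x}|T. norm (\<phi> t))"] ballI) auto

lemma less_pair_sets: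
  assumes "locfin T" "locfin T'"
  shows "{p \<in> space (T \<Otimes>\<^sub>M T'). fst p < snd p} \<in> sets (T \<Otimes>\<^sub>M T')"
proof -
  have [measurable]: "(\<lambda>p. fst p) \<in> borel_measurable (T \<Otimes>\<^sub>M T')"
     "(\<lambda>p. snd p) \<in> borel_measurable (T \<Otimes>\<^sub>M T')"
    by (rule measurable_compose[OF measurable_fst id_measurable[OF assms(1)]]
      measurable_compose[OF measurable_snd id_measurable[OF assms(2)]])+
  show ?thesis by measurable
qed

text \<open>Primitives may jump, so measurability is obtained from integrals depending on a
  parameter: the condition that \<open>t\<close> lies between \<open>c\<close> and \<open>x\<close>
  is jointly measurable in \<open>x\<close> and \<open>t\<close>.\<close>

lemma measurable_osint:
  assumes T: "locfin T" and \<phi>: "locint T \<phi>" and c: "c \<in> I"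
  shows "osint T c \<phi> \<in> borel_measurable T"
proof -
  interpret T: sigma_finite_measure T by (rule locfin_sigma_finite[OF T])
  have [measurable]: "\<phi> \<in> borel_measurable T" by (rule locint_measurable[OF T \<phi>])
  have [measurable]: "(\<lambda>p. fst p) \<in> borel_measurable (T \<Otimes>\<^sub>M T)"
     "(\<lambda>p. snd p) \<in> borel_measurable (T \<Otimes>\<^sub>M T)"
    by (rule measurable_compose[OF measurable_fst id_measurable[OF T]]
      measurable_compose[OF measurable_snd id_measurable[OF T]])+
  have 1: "(\<lambda>x. LINT t|T. (if c \<le> t \<and> t < x then \<phi> t else 0)) \<in> borel_measurable T"
  proof (rule T.borel_measurable_lebesgue_integral)
    have "(\<lambda>p. if c \<le> snd p \<and> snd p < fst p then \<phi> (snd p) else 0) \<in> borel_measurable (T \<Otimes>\<^sub>M T)"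
      by measurable
    then show "(\<lambda>(x, t). if c \<le> t \<and> t < x then \<phi> t else 0) \<in> borel_measurable (T \<Otimes>\<^sub>M T)"
      by (simp add: case_prod_beta)
  qed
  have 2: "(\<lambda>x. LINT t|T. (if x \<le> t \<and> t < c then \<phi> t else 0)) \<in> borel_measurable T"
  proof (rule T.borel_measurable_lebesgue_integral)
    have "(\<lambda>p. if fst p \<le> snd p \<and> snd p < c then \<phi> (snd p) else 0) \<in> borel_measurable (T \<Otimes>\<^sub>M T)"
      by measurable
    then show "(\<lambda>(x, t). if x \<le> t \<and> t < c then \<phi> t else 0) \<in> borel_measurable (T \<Otimes>\<^sub>M T)"
      by (simp add: case_prod_beta)
  qed
  have *: "(LINT t:{y..<x}|T. \<phi> t) = (LINT t|T. (if y \<le> t \<and> t < x then \<phi> t else 0))" for y x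
    unfolding set_lebesgue_integral_def by (intro Bochner_Integration.integral_cong) (auto simp: indicator_def)
  show ?thesis
    unfolding osint_def[abs_def] * using 1 2 by (rule borel_measurable_diff)
qed

lemma prim_measurable:
  assumes T: "locfin T" and T': "locfin T'" and f: "prim T f \<phi>"
  shows "f \<in> borel_measurable T'"
proof -
  obtain c where c: "c \<in> I" by (rule nonempty)
  have "(\<lambda>x. f c + osint T c \<phi> x) \<in> borel_measurable T"
    using measurable_osint[OF T prim_locint[OF f] c] by simp
  then have "f \<in> borel_measurable T"
    by (rule measurable_cong[THEN iffD1, rotated]) (simp add: prim_eq_osint[OF T f c] locfin_space[OF T])
  then show ?thesis by (rule measurable_locfin_cong[OF T T', THEN iffD1])
qed

lemma locint_prim_mult:
  assumes "locfin T" "locfin T'" "prim T f \<phi>" "locint T' \<psi>"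
  shows "locint T' (\<lambda>x. f x * \<psi> x)"
  using assms by (intro locint_bounded_mult prim_measurable[OF assms(1-3)] prim_locally_bounded[OF assms(1,3)])

lemma L_singleton: "x \<in> I \<Longrightarrow> AE t in L. t \<noteq> x"
  by (rule AE_I[of _ _ "{x}"]) (auto simp: emeasure_L sets_L sets_I_iff)

text \<open>Integration by parts, from Fubini: Lebesgue measure has no atoms, so the diagonal is negligible.\<close>

lemma prim_parts:
  assumes T: "locfin T" and f: "prim T f \<phi>" and h: "prim L h k" and yx: "y \<in> I" "x \<in> I" "y \<le> x"
  shows "h x * f x = h y * f y + (LINT t:{y..<x}|T. h t * \<phi> t) + (LINT t:{y..<x}|L. f t * k t)"
proof -
  interpret T: sigma_finite_measure T by (rule locfin_sigma_finite[OF T])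
  interpret L: sigma_finite_measure L by (rule locfin_sigma_finite[OF locfin_L])
  interpret pair_sigma_finite T L ..
  let ?J = "{y..<x}"
  let ?u = "\<lambda>s. indicator ?J s *\<^sub>R \<phi> s" and ?v = "\<lambda>t. indicator ?J t *\<^sub>R k t"
  have u: "integrable T ?u" and v: "integrable L ?v"
    using locintD[OF prim_locint[OF f] yx(1,2)] locintD[OF prim_locint[OF h] yx(1,2)]
    by (simp_all add: set_integrable_def)
  have um[measurable]: "?u \<in> borel_measurable T" and vm[measurable]: "?v \<in> borel_measurable L"
    using u v by auto
  have uv: "integrable (T \<Otimes>\<^sub>M L) (\<lambda>(s, t). ?v t * ?u s)"
  proof (rule Fubini_integrable)
    show "(\<lambda>(s, t). ?v t * ?u s) \<in> borel_measurable (T \<Otimes>\<^sub>M L)" by measurable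
    show "integrable T (\<lambda>s. LINT t|L. norm (case (s, t) of (s, t) \<Rightarrow> ?v t * ?u s))"
    proof -
      have "(\<lambda>s. LINT t|L. norm (case (s, t) of (s, t) \<Rightarrow> ?v t * ?u s)) = (\<lambda>s. (LINT t|L. norm (?v t)) * norm (?u s))"
        unfolding prod.case norm_mult by (simp only: integral_mult_left_zero)
      then show ?thesis using integrable_norm[OF u] by (simp only: integrable_mult_right)
    qed
    show "AE s in T. integrable L (\<lambda>t. case (s, t) of (s, t) \<Rightarrow> ?v t * ?u s)"
      using v by (intro AE_I2) (simp only: prod.case integrable_mult_left)
  qed
  \<comment> \<open>The integral over the square \<open>{y..<x} \<times> {y..<x}\<close> is
    restricted to the triangle \<open>s < t\<close>. Integrating over \<open>t\<close> first gives
    increments of \<open>h\<close>, over \<open>s\<close> first increments of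
    \<open>f\<close>.\<close>
  let ?F = "\<lambda>s t. if s < t then ?v t * ?u s else 0"
  have "integrable (T \<Otimes>\<^sub>M L) (\<lambda>p. indicator {p \<in> space (T \<Otimes>\<^sub>M L). fst p < snd p} p *\<^sub>R (case p of (s, t) \<Rightarrow> ?v t * ?u s))"
    by (rule integrable_mult_indicator[OF less_pair_sets[OF T locfin_L] uv])
  then have F: "integrable (T \<Otimes>\<^sub>M L) (case_prod ?F)"
    by (rule Bochner_Integration.integrable_cong[THEN iffD1, rotated 2]) (auto simp: indicator_def)
  have fub: "(LINT t|L. LINT s|T. ?F s t) = (LINT s|T. LINT t|L. ?F s t)"
    by (rule Fubini_integral[OF F])
  have i1: "integrable T (\<lambda>s. LINT t|L. ?F s t)" using integrable_fst'[OF F] by simp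
  have i2: "integrable L (\<lambda>t. LINT s|T. ?F s t)" using integrable_snd[OF F] by simp
  have inner1: "indicator ?J s *\<^sub>R (h s * \<phi> s) = h x * ?u s - (LINT t|L. ?F s t)" if s: "s \<in> I" for s
  proof (cases "s \<in> ?J")
    case True
    have "(LINT t:{s..<x}|L. k t) * \<phi> s = (LINT t|L. (indicator {s..<x} t *\<^sub>R k t) * \<phi> s)"
      unfolding set_lebesgue_integral_def by (simp only: integral_mult_left_zero)
    also have "\<dots> = (LINT t|L. ?F s t)"
    proof (rule Bochner_Integration.integral_cong_AE)
      show "(\<lambda>t. (indicator {s..<x} t *\<^sub>R k t) * \<phi> s) \<in> borel_measurable L"
        using locintD[OF prim_locint[OF h] s yx(2)] unfolding set_integrable_def
        by (intro borel_measurable_times borel_measurable_const borel_measurable_integrable)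
      have [measurable]: "(\<lambda>t. t) \<in> borel_measurable L" by (rule id_measurable[OF locfin_L])
      show "(\<lambda>t. ?F s t) \<in> borel_measurable L" by measurable
      \<comment> \<open>The interval contains \<open>t = s\<close> and \<open>?F\<close> excludes
        it; for fixed \<open>s\<close> this is a single point, which \<open>L\<close> does not
        charge.\<close>
      show "AE t in L. (indicator {s..<x} t *\<^sub>R k t) * \<phi> s = ?F s t"
        using L_singleton[OF s] by eventually_elim (use True in \<open>auto simp: indicator_def\<close>)
    qed
    finally have "(LINT t:{s..<x}|L. k t) * \<phi> s = (LINT t|L. ?F s t)" .
    moreover have "h x = h s + (LINT t:{s..<x}|L. k t)" using True s yx by (intro primD[OF h]) auto
    ultimately show ?thesis using True by (simp add: algebra_simps)
  next
    case False
    then have "?F s = (\<lambda>t. 0)" by (simp add: fun_eq_iff)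
    with False show ?thesis by simp
  qed
  have "(LINT t:?J|T. h t * \<phi> t) = (LINT s|T. h x * ?u s - (LINT t|L. ?F s t))"
    unfolding set_lebesgue_integral_def using inner1
    by (intro Bochner_Integration.integral_cong) (auto simp: locfin_space[OF T])
  also have "\<dots> = h x * (LINT s|T. ?u s) - (LINT s|T. LINT t|L. ?F s t)"
    by (simp only: Bochner_Integration.integral_diff[OF integrable_mult_right[OF u] i1] integral_mult_right_zero)
  also have "(LINT s|T. ?u s) = f x - f y"
    using primD[OF f yx] by (simp add: set_lebesgue_integral_def)
  finally have e1: "(LINT t:?J|T. h t * \<phi> t) = h x * (f x - f y) - (LINT s|T. LINT t|L. ?F s t)" .
  have inner2: "indicator ?J t *\<^sub>R (f t * k t) = f y * ?v t + (LINT s|T. ?F s t)" if t: "t \<in> I" for t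
  proof (cases "t \<in> ?J")
    case True
    have "(LINT s:{y..<t}|T. \<phi> s) * k t = (LINT s|T. (indicator {y..<t} s *\<^sub>R \<phi> s) * k t)"
      unfolding set_lebesgue_integral_def by (simp only: integral_mult_left_zero)
    also have "\<dots> = (LINT s|T. ?F s t)"
      using True by (intro Bochner_Integration.integral_cong) (auto simp: indicator_def)
    finally have "(LINT s:{y..<t}|T. \<phi> s) * k t = (LINT s|T. ?F s t)" .
    moreover have "f t = f y + (LINT s:{y..<t}|T. \<phi> s)" using True t yx by (intro primD[OF f]) auto
    ultimately show ?thesis using True by (simp add: algebra_simps)
  next
    case False
    then have "(\<lambda>s. ?F s t) = (\<lambda>s. 0)" by (simp add: fun_eq_iff)
    with False show ?thesis by simp
  qed
  have "(LINT t:?J|L. f t * k t) = (LINT t|L. f y * ?v t + (LINT s|T. ?F s t))"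
    unfolding set_lebesgue_integral_def using inner2
    by (intro Bochner_Integration.integral_cong) (auto simp: locfin_space[OF locfin_L])
  also have "\<dots> = f y * (LINT t|L. ?v t) + (LINT t|L. LINT s|T. ?F s t)"
    by (simp only: Bochner_Integration.integral_add[OF integrable_mult_right[OF v] i2] integral_mult_right_zero)
  also have "(LINT t|L. ?v t) = h x - h y"
    using primD[OF h yx] by (simp add: set_lebesgue_integral_def)
  finally have e2: "(LINT t:?J|L. f t * k t) = f y * (h x - h y) + (LINT s|T. LINT t|L. ?F s t)"
    unfolding fub .
  show ?thesis unfolding e1 e2 by (simp add: algebra_simps)
qed

lemma prim_mult_L:
  assumes f: "prim L f \<phi>" and h: "prim L h k"
  shows "prim L (\<lambda>x. h x * f x) (\<lambda>x. h x * \<phi> x + f x * k x)"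
proof -
  have l: "locint L (\<lambda>x. h x * \<phi> x)" "locint L (\<lambda>x. f x * k x)"
    using locint_prim_mult[OF locfin_L locfin_L h prim_locint[OF f]]
      locint_prim_mult[OF locfin_L locfin_L f prim_locint[OF h]] .
  show ?thesis unfolding prim_def
  proof (intro conjI ballI impI)
    show "locint L (\<lambda>x. h x * \<phi> x + f x * k x)"
      using l unfolding locint_def by simp
    fix y x assume yx: "y \<in> I" "x \<in> I" "y \<le> x"
    show "h x * f x = h y * f y + (LINT t:{y..<x}|L. h t * \<phi> t + f t * k t)"
      using prim_parts[OF locfin_L f h yx] locintD[OF l(1) yx(1,2)] locintD[OF l(2) yx(1,2)] by simp
  qed
qed

text \<open>The combination in which the two absolutely continuous terms of the product rule cancel.\<close>

lemma prim_wronskian_T: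
  assumes T: "locfin T" and f1: "prim T f1 \<phi>1" and h1: "prim L h1 k1"
    and f2: "prim T f2 \<phi>2" and h2: "prim L h2 k2"
    and eq: "\<And>x. x \<in> I \<Longrightarrow> f1 x * k1 x = f2 x * k2 x"
  shows "prim T (\<lambda>x. h1 x * f1 x - h2 x * f2 x) (\<lambda>x. h1 x * \<phi>1 x - h2 x * \<phi>2 x)"
proof -
  have l: "locint T (\<lambda>x. h1 x * \<phi>1 x)" "locint T (\<lambda>x. h2 x * \<phi>2 x)"
    using locint_prim_mult[OF locfin_L T h1 prim_locint[OF f1]]
      locint_prim_mult[OF locfin_L T h2 prim_locint[OF f2]] .
  show ?thesis unfolding prim_def
  proof (intro conjI ballI impI)
    show "locint T (\<lambda>x. h1 x * \<phi>1 x - h2 x * \<phi>2 x)"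
      using l unfolding locint_def by simp
    fix y x assume yx: "y \<in> I" "x \<in> I" "y \<le> x"
    have "(LINT t:{y..<x}|L. f1 t * k1 t) = (LINT t:{y..<x}|L. f2 t * k2 t)"
      using eq subI(2)[OF yx(1,2)] by (intro set_lebesgue_integral_cong locfin_Ico[OF locfin_L]) (auto intro: yx)
    then show "h1 x * f1 x - h2 x * f2 x = h1 y * f1 y - h2 y * f2 y + (LINT t:{y..<x}|T. h1 t * \<phi>1 t - h2 t * \<phi>2 t)"
      using prim_parts[OF T f1 h1 yx] prim_parts[OF T f2 h2 yx] locintD[OF l(1) yx(1,2)] locintD[OF l(2) yx(1,2)]
      by simp
  qed
qed

text \<open>Here the terms against \<open>T\<close> cancel, and with them all jumps: the combination
  is absolutely continuous although \<open>f1\<close> and \<open>f2\<close> may be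
  discontinuous.\<close>

lemma prim_wronskian_L:
  assumes T: "locfin T" and f1: "prim T f1 \<phi>1" and h1: "prim L h1 k1"
    and f2: "prim T f2 \<phi>2" and h2: "prim L h2 k2"
    and eq: "\<And>x. x \<in> I \<Longrightarrow> h1 x * \<phi>1 x = h2 x * \<phi>2 x"
  shows "prim L (\<lambda>x. h1 x * f1 x - h2 x * f2 x) (\<lambda>x. f1 x * k1 x - f2 x * k2 x)"
proof -
  have l: "locint L (\<lambda>x. f1 x * k1 x)" "locint L (\<lambda>x. f2 x * k2 x)"
    using locint_prim_mult[OF T locfin_L f1 prim_locint[OF h1]]
      locint_prim_mult[OF T locfin_L f2 prim_locint[OF h2]] .
  show ?thesis unfolding prim_def
  proof (intro conjI ballI impI)
    show "locint L (\<lambda>x. f1 x * k1 x - f2 x * k2 x)"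
      using l unfolding locint_def by simp
    fix y x assume yx: "y \<in> I" "x \<in> I" "y \<le> x"
    have "(LINT t:{y..<x}|T. h1 t * \<phi>1 t) = (LINT t:{y..<x}|T. h2 t * \<phi>2 t)"
      using eq subI(2)[OF yx(1,2)] by (intro set_lebesgue_integral_cong locfin_Ico[OF T]) (auto intro: yx)
    then show "h1 x * f1 x - h2 x * f2 x = h1 y * f1 y - h2 y * f2 y + (LINT t:{y..<x}|L. f1 t * k1 t - f2 t * k2 t)"
      using prim_parts[OF T f1 h1 yx] prim_parts[OF T f2 h2 yx] locintD[OF l(1) yx(1,2)] locintD[OF l(2) yx(1,2)]
      by simp
  qed
qed

end

section \<open>Quasi-derivatives as primitives\<close>

text \<open>The definitions use completed Lebesgue measure, while dP lives on Borel sets. Both give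
  the same integrals of Borel functions, so the proof can stay within Borel sets.\<close>

lemma lebesgue_on_L:
  fixes f :: "real \<Rightarrow> 'b::{banach, second_countable_topology}"
  assumes I: "I \<in> sets borel" and f: "f \<in> borel_measurable (restrict_space lborel I)"
  shows "f \<in> borel_measurable (lebesgue_on I)"
    "integrable (lebesgue_on I) f \<longleftrightarrow> integrable (restrict_space lborel I) f"
    "integral\<^sup>L (lebesgue_on I) f = integral\<^sup>L (restrict_space lborel I) f"
proof -
  have Ib: "I \<inter> space lborel \<in> sets lborel" "I \<inter> space lebesgue \<in> sets lebesgue" using I by auto
  have *: "(\<lambda>x. indicator I x *\<^sub>R f x) \<in> borel_measurable lborel"
    using f by (subst (asm) borel_measurable_restrict_space_iff[OF Ib(1)])
  then show "f \<in> borel_measurable (lebesgue_on I)"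
    by (subst borel_measurable_restrict_space_iff[OF Ib(2)]) (rule measurable_completion)
  show "integrable (lebesgue_on I) f \<longleftrightarrow> integrable (restrict_space lborel I) f"
    unfolding integrable_restrict_space[OF Ib(1)] integrable_restrict_space[OF Ib(2)]
    by (rule integrable_completion[OF *])
  show "integral\<^sup>L (lebesgue_on I) f = integral\<^sup>L (restrict_space lborel I) f"
    unfolding integral_restrict_space[OF Ib(1)] integral_restrict_space[OF Ib(2)]
    by (rule integral_completion[OF *])
qed

lemma AE_lebesgue_on_L:
  assumes I: "I \<in> sets borel"
  shows "(AE x in lebesgue_on I. R x) \<longleftrightarrow> (AE x in restrict_space lborel I. R x)"
proof -
  have Ib: "I \<inter> space lborel \<in> sets lborel" "I \<inter> space lebesgue \<in> sets lebesgue" using I by auto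
  show ?thesis
    unfolding AE_restrict_space_iff[OF Ib(1)] AE_restrict_space_iff[OF Ib(2)] by (rule AE_completion_iff)
qed

lemma lebesgue_on_borel_rep_real:
  fixes f :: "real \<Rightarrow> real"
  assumes I: "I \<in> sets borel" and f: "f \<in> borel_measurable (lebesgue_on I)"
  obtains g where "g \<in> borel_measurable (restrict_space lborel I)" "AE x in lebesgue_on I. f x = g x"
proof -
  have Ib: "I \<inter> space lborel \<in> sets lborel" "I \<inter> space lebesgue \<in> sets lebesgue" using I by auto
  have "(\<lambda>x. indicator I x *\<^sub>R f x) \<in> borel_measurable lebesgue"
    using f by (subst (asm) borel_measurable_restrict_space_iff[OF Ib(2)])
  then obtain g where g: "g \<in> borel_measurable lborel" "AE x in lborel. indicator I x *\<^sub>R f x = g x"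
    using completion_ex_borel_measurable_real by blast
  have "AE x in lebesgue_on I. f x = g x"
    unfolding AE_lebesgue_on_L[OF I] AE_restrict_space_iff[OF Ib(1)]
    using g(2) by eventually_elim auto
  with measurable_restrict_space1[OF g(1)] show thesis by (rule that)
qed

lemma lebesgue_on_borel_rep:
  fixes f :: "real \<Rightarrow> complex"
  assumes I: "I \<in> sets borel" and f: "f \<in> borel_measurable (lebesgue_on I)"
  obtains g where "g \<in> borel_measurable (restrict_space lborel I)" "AE x in lebesgue_on I. f x = g x"
proof -
  have "(\<lambda>x. Re (f x)) \<in> borel_measurable (lebesgue_on I)" "(\<lambda>x. Im (f x)) \<in> borel_measurable (lebesgue_on I)"
    using f by simp_all
  then obtain g1 g2 where g: "g1 \<in> borel_measurable (restrict_space lborel I)" "AE x in lebesgue_on I. Re (f x) = g1 x"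
    "g2 \<in> borel_measurable (restrict_space lborel I)" "AE x in lebesgue_on I. Im (f x) = g2 x"
    by (metis lebesgue_on_borel_rep_real[OF I])
  show thesis
  proof (rule that)
    show "(\<lambda>x. Complex (g1 x) (g2 x)) \<in> borel_measurable (restrict_space lborel I)"
      unfolding Complex_eq using g(1,3) by simp
    show "AE x in lebesgue_on I. f x = Complex (g1 x) (g2 x)"
      using g(2,4) by eventually_elim (simp add: complex_eq_iff)
  qed
qed

section \<open>The polar decomposition of dP and quasi-derivatives\<close>

context open_interval begin

text \<open>The polar decomposition dF = s |dF|: \<open>s\<close> is -1 on the set \<open>A\<close>,
  which \<open>M\<close> does not charge, and 1 on the rest. It replaces the two integrals of
  \<open>signed_integral\<close> by a single one against a positive measure.\<close>

lemma jordan_sign: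
  assumes J: "jordan_decomp I F M N"
  obtains s :: "real \<Rightarrow> real" where "s \<in> borel_measurable (tv_measure I F)" "\<And>x. s x = 1 \<or> s x = -1"
    "M = density (tv_measure I F) (\<lambda>x. ennreal (s x))" "N = density (tv_measure I F) (\<lambda>x. ennreal (- s x))"
    "\<And>B g. B \<in> sets (tv_measure I F) \<Longrightarrow> set_integrable (tv_measure I F) B g \<Longrightarrow>
      signed_integral I F B g = (LINT x:B|tv_measure I F. of_real (s x) * g x)"
proof -
  define T where "T = tv_measure I F"
  note lf = jordan_locfin[OF J]
  have st: "sets M = sets (restrict_space borel I)" "sets N = sets (restrict_space borel I)"
    using lf by (simp_all add: locfin_def)
  have T: "T = sum_measure M N" unfolding T_def by (rule tv_measure_eq[OF J])
  have sT: "sets T = sets (restrict_space borel I)" unfolding T by (simp add: st)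
  have spT: "space T = I" unfolding T by (simp add: locfin_space[OF lf(1)])
  have eT: "emeasure T B = emeasure M B + emeasure N B" for B
    unfolding T by (rule emeasure_sum_measure) (simp add: st)
  obtain A where A: "A \<in> sets (restrict_space borel I)" "emeasure M A = 0" "emeasure N (I - A) = 0"
    by (rule jordan_sep[OF J])
  have [measurable]: "A \<in> sets T" using A sT by simp
  have IA: "I - A \<in> sets (restrict_space borel I)" using A by (auto simp: sets_I_iff)
  define s where "s x = (if x \<in> A then -1 else 1 :: real)" for x
  have s[measurable]: "s \<in> borel_measurable T" unfolding s_def[abs_def] by measurable
  have M: "M = density T (\<lambda>x. ennreal (s x))"
  proof (rule measure_eqI)
    fix B assume B: "B \<in> sets M"
    then have BT[measurable]: "B \<in> sets T" using st sT by simp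
    have "emeasure (density T (\<lambda>x. ennreal (s x))) B = (\<integral>\<^sup>+x. ennreal (s x) * indicator B x \<partial>T)"
      by (simp add: emeasure_density)
    also have "\<dots> = (\<integral>\<^sup>+x. indicator (B - A) x \<partial>T)"
      by (intro nn_integral_cong) (auto simp: s_def indicator_def ennreal_neg)
    also have "\<dots> = emeasure M (B - A) + emeasure N (B - A)"
      by (simp add: eT)
    also have "emeasure M (B - A) = emeasure M B"
      using B A by (intro emeasure_minus_null) (auto simp: st)
    also have "emeasure N (B - A) \<le> emeasure N (I - A)"
      using B A IA by (intro emeasure_mono) (auto simp: st sets_I_iff)
    then have "emeasure N (B - A) = 0" using A by simp
    finally show "emeasure M B = emeasure (density T (\<lambda>x. ennreal (s x))) B" by simp
  qed (simp add: st sT)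
  have N: "N = density T (\<lambda>x. ennreal (- s x))"
  proof (rule measure_eqI)
    fix B assume B: "B \<in> sets N"
    then have BT[measurable]: "B \<in> sets T" using st sT by simp
    have BA: "B \<inter> A = B - (I - A)" using B by (auto simp: st sets_I_iff)
    have "emeasure (density T (\<lambda>x. ennreal (- s x))) B = (\<integral>\<^sup>+x. ennreal (- s x) * indicator B x \<partial>T)"
      by (simp add: emeasure_density)
    also have "\<dots> = (\<integral>\<^sup>+x. indicator (B \<inter> A) x \<partial>T)"
      by (intro nn_integral_cong) (auto simp: s_def indicator_def ennreal_neg)
    also have "\<dots> = emeasure M (B \<inter> A) + emeasure N (B \<inter> A)"
      by (simp add: eT)
    also have "emeasure N (B \<inter> A) = emeasure N B"
      unfolding BA using B A IA by (intro emeasure_minus_null) (auto simp: st)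
    also have "emeasure M (B \<inter> A) \<le> emeasure M A"
      using B A by (intro emeasure_mono) (auto simp: st)
    then have "emeasure M (B \<inter> A) = 0" using A by simp
    finally show "emeasure N B = emeasure (density T (\<lambda>x. ennreal (- s x))) B" by simp
  qed (simp add: st sT)
  \<comment> \<open>The Bochner integral against a density asks for a nonnegative real density,
    hence the maximum with 0.\<close>
  have M': "M = density T (\<lambda>x. ennreal (max 0 (s x)))"
    and N': "N = density T (\<lambda>x. ennreal (max 0 (- s x)))"
    unfolding M N by (simp_all add: max_def ennreal_neg cong: if_cong) (auto intro!: density_cong simp: ennreal_neg)
  have si: "signed_integral I F B g = (LINT x:B|T. of_real (s x) * g x)"
    if B: "B \<in> sets T" and g: "set_integrable T B g" for B g
  proof -
    let ?g = "\<lambda>x. indicator B x *\<^sub>R g x"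
    have gm[measurable]: "?g \<in> borel_measurable T" using g unfolding set_integrable_def by auto
    have gi: "integrable T ?g" using g unfolding set_integrable_def .
    have i: "integrable T (\<lambda>x. max 0 (s x) *\<^sub>R ?g x)" "integrable T (\<lambda>x. max 0 (- s x) *\<^sub>R ?g x)"
    proof -
      have m: "(\<lambda>x. max 0 (s x) *\<^sub>R ?g x) \<in> borel_measurable T" "(\<lambda>x. max 0 (- s x) *\<^sub>R ?g x) \<in> borel_measurable T"
        by (intro borel_measurable_scaleR borel_measurable_max borel_measurable_const borel_measurable_uminus s gm)+
      have n: "norm (max 0 (s x) *\<^sub>R z) \<le> norm z" "norm (max 0 (- s x) *\<^sub>R z) \<le> norm z" for x and z :: complex
        by (simp_all add: s_def)
      show "integrable T (\<lambda>x. max 0 (s x) *\<^sub>R ?g x)" "integrable T (\<lambda>x. max 0 (- s x) *\<^sub>R ?g x)"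
        by (rule Bochner_Integration.integrable_bound[OF gi m(1) AE_I2[OF n(1)]]
            Bochner_Integration.integrable_bound[OF gi m(2) AE_I2[OF n(2)]])+
    qed
    have 1: "(LINT x|M. ?g x) = (LINT x|T. max 0 (s x) *\<^sub>R ?g x)"
      unfolding M' by (rule integral_density) auto
    have 2: "(LINT x|N. ?g x) = (LINT x|T. max 0 (- s x) *\<^sub>R ?g x)"
      unfolding N' by (rule integral_density) auto
    have "signed_integral I F B g = (LINT x|M. ?g x) - (LINT x|N. ?g x)"
      unfolding signed_integral_def jordan_pos_neg[OF J] set_lebesgue_integral_def ..
    also have "\<dots> = (LINT x|T. max 0 (s x) *\<^sub>R ?g x - max 0 (- s x) *\<^sub>R ?g x)"
      unfolding 1 2 using i by simp
    also have "\<dots> = (LINT x:B|T. of_real (s x) * g x)"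
      unfolding set_lebesgue_integral_def
      by (intro Bochner_Integration.integral_cong) (auto simp: s_def indicator_def)
    finally show ?thesis .
  qed
  show thesis
    by (rule that[of s]) (use s M N si in \<open>auto simp: T_def[symmetric] s_def\<close>)
qed

lemma sign_mult_locint:
  assumes T: "locfin T" and s: "s \<in> borel_measurable T" "\<And>x. s x = 1 \<or> s x = (-1::real)"
  shows "locint T (\<lambda>x. of_real (s x) * g x) \<longleftrightarrow> locint T g"
proof -
  have sm: "(\<lambda>x. complex_of_real (s x)) \<in> borel_measurable T" using s(1) by simp
  have sn: "norm (complex_of_real (s x)) \<le> 1" for x using s(2)[of x] by auto
  have ss: "complex_of_real (s x) * (complex_of_real (s x) * z) = z" for x z using s(2)[of x] by auto
  have "locint T (\<lambda>x. of_real (s x) * h x)" if "locint T h" for h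
    using that sm sn by (intro locint_bounded_mult) auto
  from this[of g] this[of "\<lambda>x. of_real (s x) * g x"] show ?thesis by (auto simp: ss)
qed

lemma has_quasi_deriv_prim:
  assumes T: "locfin (tv_measure I F)"
    and s: "s \<in> borel_measurable (tv_measure I F)" "\<And>x. s x = 1 \<or> s x = (-1::real)"
    and si: "\<And>B g. B \<in> sets (tv_measure I F) \<Longrightarrow> set_integrable (tv_measure I F) B g \<Longrightarrow>
      signed_integral I F B g = (LINT x:B|tv_measure I F. of_real (s x) * g x)"
  shows "has_quasi_deriv I F f g \<longleftrightarrow> prim (tv_measure I F) f (\<lambda>x. of_real (s x) * g x)"
  unfolding has_quasi_deriv_def locint_compact[OF T]
proof
  let ?T = "tv_measure I F"
  assume A: "locint ?T g \<and> (\<forall>y\<in>I. \<forall>x\<in>I. y < x \<longrightarrow> f x - f y = signed_integral I F {y..<x} g)"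
  show "prim ?T f (\<lambda>x. of_real (s x) * g x)"
  proof (rule primI)
    show "locint ?T (\<lambda>x. of_real (s x) * g x)" using A sign_mult_locint[OF T s] by simp
    fix y x assume yx: "y \<in> I" "x \<in> I" "y \<le> x"
    show "f x = f y + (LINT t:{y..<x}|?T. of_real (s t) * g t)"
    proof (cases "y = x")
      case True
      then show ?thesis by (simp add: set_lebesgue_integral_def)
    next
      case False
      then have "f x - f y = signed_integral I F {y..<x} g" using A yx by simp
      also have "\<dots> = (LINT t:{y..<x}|?T. of_real (s t) * g t)"
        using A yx by (intro si locfin_Ico[OF T] locintD) auto
      finally show ?thesis by (simp add: algebra_simps)
    qed
  qed
next
  let ?T = "tv_measure I F"
  assume A: "prim ?T f (\<lambda>x. of_real (s x) * g x)"
  have g: "locint ?T g" using prim_locint[OF A] sign_mult_locint[OF T s] by simp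
  show "locint ?T g \<and> (\<forall>y\<in>I. \<forall>x\<in>I. y < x \<longrightarrow> f x - f y = signed_integral I F {y..<x} g)"
  proof (intro conjI g ballI impI)
    fix y x assume yx: "y \<in> I" "x \<in> I" "y < x"
    then have "f x = f y + (LINT t:{y..<x}|?T. of_real (s t) * g t)" by (intro primD[OF A]) auto
    then show "f x - f y = signed_integral I F {y..<x} g"
      using si[OF locfin_Ico[OF T yx(1,2)] locintD[OF g yx(1,2)]] by (simp add: algebra_simps)
  qed
qed

lemma jordan_id: "jordan_decomp I (\<lambda>x. x) L (null_measure L)"
  unfolding jordan_decomp_def
proof (intro conjI)
  show "\<exists>A\<in>sets (restrict_space borel I). emeasure L A = 0 \<and> emeasure (null_measure L) (I - A) = 0"
    by (intro bexI[of _ "{}"]) auto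
  show "\<forall>K. compact K \<and> K \<subseteq> I \<longrightarrow> emeasure L K < \<infinity> \<and> emeasure (null_measure L) K < \<infinity>"
    using locfin_L by (simp add: locfin_def)
  show "\<forall>y\<in>I. \<forall>x\<in>I. y < x \<longrightarrow>
       measure L {y..<x} - measure (null_measure L) {y..<x} = Lim (at_left x) (\<lambda>x. x) - Lim (at_left y) (\<lambda>x. x)"
  proof (intro ballI impI)
    fix y x assume yx: "y \<in> I" "x \<in> I" "y < x"
    have "Lim (at_left z) (\<lambda>x. x) = z" for z :: real
      by (rule tendsto_Lim) (auto intro: tendsto_ident_at)
    then show "measure L {y..<x} - measure (null_measure L) {y..<x} = Lim (at_left x) (\<lambda>x. x) - Lim (at_left y) (\<lambda>x. x)"
      using yx emeasure_L[OF subI(2)[OF yx(1,2)]] by (simp add: measure_def)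
  qed
qed (simp_all add: sets_L)

lemma tv_id: "tv_measure I (\<lambda>x. x) = L"
  unfolding tv_measure_eq[OF jordan_id]
  by (rule measure_eqI) (simp_all add: emeasure_sum_measure)

lemma has_quasi_deriv_id: "has_quasi_deriv I (\<lambda>x. x) g h \<longleftrightarrow> prim L g h"
proof -
  have "has_quasi_deriv I (\<lambda>x. x) g h \<longleftrightarrow> prim (tv_measure I (\<lambda>x. x)) g (\<lambda>x. of_real 1 * h x)"
  proof (rule has_quasi_deriv_prim)
    show "signed_integral I (\<lambda>x. x) B g = (LINT x:B|tv_measure I (\<lambda>x. x). of_real 1 * g x)" for B g
      unfolding signed_integral_def jordan_pos_neg[OF jordan_id] tv_id
      by (simp add: set_lebesgue_integral_def)
  qed (simp_all add: tv_id locfin_L)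
  then show ?thesis by (simp add: tv_id)
qed

text \<open>As \<open>z\<close> increases to \<open>x\<close>, the sets \<open>{y..<z}\<close>
  exhaust \<open>{y..<x}\<close>, so dominated convergence applies. From the right the mass at
  \<open>x\<close> would be added.\<close>

lemma prim_left_continuous:
  assumes T: "locfin T" and f: "prim T f \<phi>" and x: "x \<in> I"
  shows "(f \<longlongrightarrow> f x) (at_left x)"
proof -
  obtain y where y: "y \<in> I" "y < x" using smaller[OF x] by blast
  show ?thesis
  proof (rule tendsto_at_left_sequentially[OF y(2)])
    fix S :: "nat \<Rightarrow> real" assume S: "\<And>n. S n < x" "\<And>n. y < S n" "S \<longlonglongrightarrow> x"
    have "(\<lambda>n. LINT t:{y..<S n}|T. \<phi> t) \<longlonglongrightarrow> (LINT t:{y..<x}|T. \<phi> t)"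
      unfolding set_lebesgue_integral_def
    proof (rule integral_dominated_convergence)
      have int: "integrable T (\<lambda>t. indicator {y..<x} t *\<^sub>R \<phi> t)"
        using locintD[OF prim_locint[OF f] y(1) x] by (simp add: set_integrable_def)
      then show "integrable T (\<lambda>t. norm (indicator {y..<x} t *\<^sub>R \<phi> t))" by (rule integrable_norm)
      show "(\<lambda>t. indicator {y..<x} t *\<^sub>R \<phi> t) \<in> borel_measurable T" using int by auto
      show "(\<lambda>t. indicator {y..<S n} t *\<^sub>R \<phi> t) \<in> borel_measurable T" for n
      proof -
        have "S n \<in> I" using betweenI[OF y(1) x, of "S n"] S(1,2)[of n] by simp
        from borel_measurable_integrable[OF locintD[OF prim_locint[OF f] y(1) this, unfolded set_integrable_def]]
        show ?thesis .
      qed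
      show "AE t in T. norm (indicator {y..<S n} t *\<^sub>R \<phi> t) \<le> norm (indicator {y..<x} t *\<^sub>R \<phi> t)" for n
        using S(1)[of n] by (intro AE_I2) (auto simp: indicator_def)
      show "AE t in T. (\<lambda>n. indicator {y..<S n} t *\<^sub>R \<phi> t) \<longlonglongrightarrow> indicator {y..<x} t *\<^sub>R \<phi> t"
      proof (rule AE_I2)
        fix t
        have "eventually (\<lambda>n. (t < S n) = (t < x)) sequentially"
        proof (cases "t < x")
          case True
          then have "eventually (\<lambda>n. t < S n) sequentially" by (rule order_tendstoD(1)[OF S(3)])
          then show ?thesis by eventually_elim (simp add: True)
        next
          case False
          have "(t < S n) = (t < x)" for n using False S(1)[of n] by simp
          then show ?thesis by simp
        qed
        then have "eventually (\<lambda>n. indicator {y..<S n} t *\<^sub>R \<phi> t = indicator {y..<x} t *\<^sub>R \<phi> t) sequentially"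
          by eventually_elim (simp add: indicator_def)
        then show "(\<lambda>n. indicator {y..<S n} t *\<^sub>R \<phi> t) \<longlonglongrightarrow> indicator {y..<x} t *\<^sub>R \<phi> t"
          by (rule tendsto_eventually)
      qed
    qed
    then have "(\<lambda>n. f y + (LINT t:{y..<S n}|T. \<phi> t)) \<longlonglongrightarrow> f y + (LINT t:{y..<x}|T. \<phi> t)"
      by (intro tendsto_add tendsto_const)
    moreover have "f y + (LINT t:{y..<S n}|T. \<phi> t) = f (S n)" for n
      using betweenI[OF y(1) x, of "S n"] S(1,2)[of n] y
      by (intro primD[OF f, symmetric]) auto
    moreover have "f y + (LINT t:{y..<x}|T. \<phi> t) = f x"
      using y x by (intro primD[OF f, symmetric]) auto
    ultimately show "(\<lambda>n. f (S n)) \<longlonglongrightarrow> f x" by simp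
  qed
qed

section \<open>Primitives are locally absolutely continuous\<close>

lemma prim_bv_loc:
  assumes T: "locfin T" and f: "prim T f \<phi>"
  shows "bv_loc I f"
  unfolding bv_loc_def
proof (intro allI impI)
  fix K assume K: "compact K \<and> K \<subseteq> I"
  obtain c d where cd: "c \<in> I" "d \<in> I" "c < d" "K \<subseteq> {c..<d}"
    by (rule compact_sub[OF conjunct1[OF K] conjunct2[OF K]])
  define \<Gamma> where "\<Gamma> x = (LINT t:{c..<x}|T. norm (\<phi> t))" for x
  have nint: "set_integrable T {y..<x} (\<lambda>t. norm (\<phi> t))" if "y \<in> I" "x \<in> I" for y x
    using integrable_norm[OF locintD[OF prim_locint[OF f] that, unfolded set_integrable_def]]
    by (simp add: set_integrable_def)
  have diff: "norm (f x - f y) \<le> \<Gamma> x - \<Gamma> y" if "c \<le> y" "y \<le> x" "x \<le> d" for x y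
  proof -
    have I: "y \<in> I" "x \<in> I" using that betweenI[OF cd(1,2)] by auto
    have "{c..<x} = {c..<y} \<union> {y..<x}" using that by auto
    then have "\<Gamma> x = \<Gamma> y + (LINT t:{y..<x}|T. norm (\<phi> t))"
      unfolding \<Gamma>_def using nint[OF cd(1) I(1)] nint[OF I] by (simp add: set_integral_Un)
    moreover have "norm (f x - f y) \<le> (LINT t:{y..<x}|T. norm (\<phi> t))"
      using primD[OF f I that(2)] norm_set_integral_le[OF T prim_locint[OF f] I order_refl that(2) order_refl]
      by (simp add: algebra_simps)
    ultimately show ?thesis by simp
  qed
  have diff0: "0 \<le> \<Gamma> x - \<Gamma> y" if "c \<le> y" "y \<le> x" "x \<le> d" for x y
    using diff[OF that] norm_ge_zero order_trans by blast
  show "bv_on K f" unfolding bv_on_def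
  proof (intro exI[of _ "\<Gamma> d - \<Gamma> c"] allI impI)
    fix n and t :: "nat \<Rightarrow> real" assume t: "mono_on {..n} t \<and> t ` {..n} \<subseteq> K"
    have tb: "c \<le> t i \<and> t i < d" if "i \<le> n" for i using t cd(4) that by fastforce
    have "(\<Sum>i<n. norm (f (t (Suc i)) - f (t i))) \<le> (\<Sum>i<n. \<Gamma> (t (Suc i)) - \<Gamma> (t i))"
    proof (rule sum_mono)
      fix i assume "i \<in> {..<n}"
      then show "norm (f (t (Suc i)) - f (t i)) \<le> \<Gamma> (t (Suc i)) - \<Gamma> (t i)"
        using tb[of i] tb[of "Suc i"] mono_onD[OF conjunct1[OF t], of i "Suc i"] by (intro diff) auto
    qed
    also have "\<dots> = \<Gamma> (t n) - \<Gamma> (t 0)" by (rule sum_lessThan_telescope)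
    also have "\<dots> \<le> \<Gamma> d - \<Gamma> c"
      using tb[of n] tb[of 0] diff0[of "t n" d] diff0[of c "t 0"] by simp
    finally show "(\<Sum>i<n. norm (f (t (Suc i)) - f (t i))) \<le> \<Gamma> d - \<Gamma> c" .
  qed
qed

text \<open>\<open>ennreal\<close> truncates negative values to 0, so \<open>r\<close> and
  \<open>- r\<close> directly give the positive and the negative part of the signed density, which
  are carried by disjoint sets.\<close>

lemma jordan_density:
  fixes r u :: "real \<Rightarrow> real"
  assumes T: "locfin T" and r: "\<And>y x. y \<in> I \<Longrightarrow> x \<in> I \<Longrightarrow> set_integrable T {y..<x} r"
    and rm: "r \<in> borel_measurable T"
    and u: "\<And>y x. y \<in> I \<Longrightarrow> x \<in> I \<Longrightarrow> y < x \<Longrightarrow> u x - u y = (LINT t:{y..<x}|T. r t)"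
    and ul: "\<And>x. x \<in> I \<Longrightarrow> (u \<longlongrightarrow> u x) (at_left x)"
  shows "jordan_decomp I u (density T (\<lambda>x. ennreal (r x))) (density T (\<lambda>x. ennreal (- r x)))"
    (is "jordan_decomp I u ?M ?N")
proof -
  note [measurable] = rm
  have stT: "sets T = sets (restrict_space borel I)" using T by (simp add: locfin_def)
  have spT: "space T = I" by (rule locfin_space[OF T])
  have em: "emeasure (density T (\<lambda>x. ennreal (r' x))) {y..<x} = ennreal (LINT t|T. max 0 (indicator {y..<x} t * r' t))
      \<and> integrable T (\<lambda>t. max 0 (indicator {y..<x} t * r' t))"
    if yx: "y \<in> I" "x \<in> I" and r': "r' = r \<or> r' = (\<lambda>x. - r x)" for y x r'
  proof -
    have [measurable]: "{y..<x} \<in> sets T" by (rule locfin_Ico[OF T yx])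
    have [measurable]: "r' \<in> borel_measurable T" using r' rm by auto
    have "integrable T (\<lambda>t. indicator {y..<x} t * r' t)"
      using r[OF yx] r' by (auto simp: set_integrable_def)
    then have i: "integrable T (\<lambda>t. max 0 (indicator {y..<x} t * r' t))"
      by (rule Bochner_Integration.integrable_bound) auto
    have "emeasure (density T (\<lambda>x. ennreal (r' x))) {y..<x} = (\<integral>\<^sup>+t. ennreal (r' t) * indicator {y..<x} t \<partial>T)"
      by (simp add: emeasure_density)
    also have "\<dots> = (\<integral>\<^sup>+t. ennreal (max 0 (indicator {y..<x} t * r' t)) \<partial>T)"
      by (intro nn_integral_cong) (auto simp: indicator_def max_def ennreal_neg)
    also have "\<dots> = ennreal (LINT t|T. max 0 (indicator {y..<x} t * r' t))"
      by (rule nn_integral_eq_integral[OF i]) auto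
    finally show ?thesis using i by simp
  qed
  have lM: "locfin ?M" using em[of _ _ r] by (intro locfinI) (simp_all add: stT)
  have lN: "locfin ?N" using em[of _ _ "\<lambda>x. - r x"] by (intro locfinI) (simp_all add: stT)
  show ?thesis unfolding jordan_decomp_def
  proof (intro conjI)
    show "sets ?M = sets (restrict_space borel I)" "sets ?N = sets (restrict_space borel I)"
      by (simp_all add: stT)
    show "\<forall>K. compact K \<and> K \<subseteq> I \<longrightarrow> emeasure ?M K < \<infinity> \<and> emeasure ?N K < \<infinity>"
      using lM lN by (simp add: locfin_def)
    define A where "A = {x \<in> space T. r x \<le> 0}"
    have A[measurable]: "A \<in> sets T" unfolding A_def by measurable
    have IA: "I - A \<in> sets T" using A unfolding spT[symmetric] by (rule sets.compl_sets)
    have "emeasure ?M A = (\<integral>\<^sup>+x. ennreal (r x) * indicator A x \<partial>T)"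
      by (simp add: emeasure_density)
    also have "\<dots> = (\<integral>\<^sup>+x. 0 \<partial>T)"
      by (rule nn_integral_cong) (auto simp: A_def indicator_def ennreal_neg)
    finally have M0: "emeasure ?M A = (\<integral>\<^sup>+x. 0 \<partial>T)" .
    have "emeasure ?N (I - A) = (\<integral>\<^sup>+x. ennreal (- r x) * indicator (I - A) x \<partial>T)"
      using IA by (simp add: emeasure_density)
    also have "\<dots> = (\<integral>\<^sup>+x. 0 \<partial>T)"
      by (rule nn_integral_cong) (auto simp: A_def spT indicator_def ennreal_neg)
    finally have "emeasure ?N (I - A) = (\<integral>\<^sup>+x. 0 \<partial>T)" .
    with M0
    show "\<exists>A\<in>sets (restrict_space borel I). emeasure ?M A = 0 \<and> emeasure ?N (I - A) = 0"
      using A stT by (intro bexI[of _ A]) simp_all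
    show "\<forall>y\<in>I. \<forall>x\<in>I. y < x \<longrightarrow> measure ?M {y..<x} - measure ?N {y..<x} = Lim (at_left x) u - Lim (at_left y) u"
    proof (intro ballI impI)
      fix y x assume yx: "y \<in> I" "x \<in> I" "y < x"
      note e1 = em[OF yx(1,2), of r] and e2 = em[OF yx(1,2), of "\<lambda>x. - r x"]
      have "measure ?M {y..<x} = (LINT t|T. max 0 (indicator {y..<x} t * r t))"
        using e1 by (simp add: measure_def)
      moreover have "measure ?N {y..<x} = (LINT t|T. max 0 (indicator {y..<x} t * - r t))"
        using e2 by (simp add: measure_def)
      ultimately have "measure ?M {y..<x} - measure ?N {y..<x} =
          (LINT t|T. max 0 (indicator {y..<x} t * r t) - max 0 (indicator {y..<x} t * - r t))"
        using e1 e2 by (subst Bochner_Integration.integral_diff) auto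
      also have "\<dots> = (LINT t:{y..<x}|T. r t)"
        unfolding set_lebesgue_integral_def
        by (intro Bochner_Integration.integral_cong) (auto simp: indicator_def)
      also have "\<dots> = u x - u y" using u[OF yx] by simp
      also have "u x = Lim (at_left x) u"
        using tendsto_Lim[OF trivial_limit_at_left_real ul[OF yx(2)]] by simp
      also have "u y = Lim (at_left y) u"
        using tendsto_Lim[OF trivial_limit_at_left_real ul[OF yx(1)]] by simp
      finally show "measure ?M {y..<x} - measure ?N {y..<x} = Lim (at_left x) u - Lim (at_left y) u" .
    qed
  qed
qed

lemma ac_tv_density:
  fixes r u :: "real \<Rightarrow> real"
  assumes T: "locfin T" and r: "\<And>y x. y \<in> I \<Longrightarrow> x \<in> I \<Longrightarrow> set_integrable T {y..<x} r"
    and rm: "r \<in> borel_measurable T"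
    and u: "\<And>y x. y \<in> I \<Longrightarrow> x \<in> I \<Longrightarrow> y < x \<Longrightarrow> u x - u y = (LINT t:{y..<x}|T. r t)"
    and ul: "\<And>x. x \<in> I \<Longrightarrow> (u \<longlongrightarrow> u x) (at_left x)"
  shows "absolutely_continuous T (tv_measure I u)"
proof -
  have 1: "absolutely_continuous T (density T (\<lambda>x. ennreal (r x)))"
    using rm by (intro absolutely_continuousI_density) simp
  have 2: "absolutely_continuous T (density T (\<lambda>x. ennreal (- r x)))"
    using rm by (intro absolutely_continuousI_density) simp
  have "jordan_decomp I u (density T (\<lambda>x. ennreal (r x))) (density T (\<lambda>x. ennreal (- r x)))"
    by (rule jordan_density) fact+
  note tv = tv_measure_eq[OF this]
  show ?thesis
    unfolding tv absolutely_continuous_def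
  proof (rule subsetI)
    fix B assume B: "B \<in> null_sets T"
    then have "B \<in> null_sets (density T (\<lambda>x. ennreal (r x)))" "B \<in> null_sets (density T (\<lambda>x. ennreal (- r x)))"
      using 1 2 unfolding absolutely_continuous_def by blast+
    then show "B \<in> null_sets (sum_measure (density T (\<lambda>x. ennreal (r x))) (density T (\<lambda>x. ennreal (- r x))))"
      by (simp add: null_sets_def emeasure_sum_measure)
  qed
qed

text \<open>Bounded variation and absolute continuity come for free for primitives, so the domain of
  the maximal operator can be described by primitives alone.\<close>

lemma prim_ac_loc:
  assumes T: "locfin (tv_measure I F)" and f: "prim (tv_measure I F) f \<phi>"
  shows "f \<in> ac_loc I F"
proof -
  let ?T = "tv_measure I F"
  note int = locintD[OF prim_locint[OF f]]
  have \<phi>m: "\<phi> \<in> borel_measurable ?T" by (rule locint_measurable[OF T prim_locint[OF f]])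
  have Re_int: "set_integrable ?T {y..<x} (\<lambda>t. Re (\<phi> t))" and Im_int: "set_integrable ?T {y..<x} (\<lambda>t. Im (\<phi> t))"
    if "y \<in> I" "x \<in> I" for y x
    using integrable_Re[OF int[OF that, unfolded set_integrable_def]] integrable_Im[OF int[OF that, unfolded set_integrable_def]]
    by (simp_all add: set_integrable_def)
  have Re_eq: "Re (f x) - Re (f y) = (LINT t:{y..<x}|?T. Re (\<phi> t))"
    and Im_eq: "Im (f x) - Im (f y) = (LINT t:{y..<x}|?T. Im (\<phi> t))"
    if yx: "y \<in> I" "x \<in> I" "y < x" for y x
    using primD[OF f yx(1,2)] yx(3) integral_Re[OF int[OF yx(1,2), unfolded set_integrable_def]]
      integral_Im[OF int[OF yx(1,2), unfolded set_integrable_def]]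
    by (simp_all add: set_lebesgue_integral_def)
  note lc = prim_left_continuous[OF T f]
  have "absolutely_continuous ?T (tv_measure I (\<lambda>x. Re (f x)))"
    using \<phi>m by (intro ac_tv_density[OF T Re_int _ Re_eq] tendsto_Re lc) auto
  moreover have "absolutely_continuous ?T (tv_measure I (\<lambda>x. Im (f x)))"
    using \<phi>m by (intro ac_tv_density[OF T Im_int _ Im_eq] tendsto_Im lc) auto
  moreover have "\<forall>x\<in>I. continuous (at_left x) f"
    unfolding continuous_within using lc by blast
  ultimately show ?thesis
    using prim_bv_loc[OF T f] unfolding ac_loc_def by blast
qed

end

section \<open>Square integrable functions and adjoints\<close>

lemma L2_iff: "f \<in> L2 I \<longleftrightarrow> f \<in> borel_measurable (lebesgue_on I) \<and> integrable (lebesgue_on I) (\<lambda>x. (cmod (f x))\<^sup>2)"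
  by (simp add: L2_def)

lemma L2_cong_AE:
  assumes "f \<in> L2 I" "g \<in> borel_measurable (lebesgue_on I)" "AE x in lebesgue_on I. f x = g x"
  shows "g \<in> L2 I"
  unfolding L2_iff
proof (intro conjI assms(2))
  have f: "f \<in> borel_measurable (lebesgue_on I)" "integrable (lebesgue_on I) (\<lambda>x. (cmod (f x))\<^sup>2)"
    using assms(1) by (auto simp: L2_iff)
  show "integrable (lebesgue_on I) (\<lambda>x. (cmod (g x))\<^sup>2)"
  proof (rule integrable_cong_AE_imp[OF f(2)])
    show "(\<lambda>x. (cmod (g x))\<^sup>2) \<in> borel_measurable (lebesgue_on I)" using assms(2) by simp
    show "AE x in lebesgue_on I. (cmod (f x))\<^sup>2 = (cmod (g x))\<^sup>2"
      using assms(3) by eventually_elim simp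
  qed
qed

lemma L2_bound:
  assumes "f \<in> L2 I" "g \<in> borel_measurable (lebesgue_on I)" "AE x in lebesgue_on I. cmod (g x) \<le> C * cmod (f x)"
  shows "g \<in> L2 I"
  unfolding L2_iff
proof (intro conjI assms(2))
  have f: "integrable (lebesgue_on I) (\<lambda>x. C\<^sup>2 * (cmod (f x))\<^sup>2)"
    using assms(1) by (auto simp: L2_iff)
  show "integrable (lebesgue_on I) (\<lambda>x. (cmod (g x))\<^sup>2)"
  proof (rule Bochner_Integration.integrable_bound[OF f])
    show "(\<lambda>x. (cmod (g x))\<^sup>2) \<in> borel_measurable (lebesgue_on I)" using assms(2) by simp
    show "AE x in lebesgue_on I. norm ((cmod (g x))\<^sup>2) \<le> norm (C\<^sup>2 * (cmod (f x))\<^sup>2)"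
      using assms(3)
    proof eventually_elim
      case (elim x)
      then have "(cmod (g x))\<^sup>2 \<le> (C * cmod (f x))\<^sup>2" by (intro power_mono) auto
      then show ?case by (simp add: power_mult_distrib)
    qed
  qed
qed

lemma L2_bounded_mult:
  assumes q1: "q1 \<in> borel_measurable (lebesgue_on I)" "AE x in lebesgue_on I. \<bar>q1 x\<bar> \<le> C" and "f \<in> L2 I"
  shows "(\<lambda>x. of_real (q1 x) * f x) \<in> L2 I"
proof (rule L2_bound[OF assms(3)])
  have "(\<lambda>x. complex_of_real (q1 x)) \<in> borel_measurable (lebesgue_on I)"
    using q1(1) by (rule measurable_compose) simp
  moreover have "f \<in> borel_measurable (lebesgue_on I)" using assms(3) by (simp add: L2_iff)
  ultimately show "(\<lambda>x. of_real (q1 x) * f x) \<in> borel_measurable (lebesgue_on I)"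
    by (rule borel_measurable_times)
  show "AE x in lebesgue_on I. cmod (of_real (q1 x) * f x) \<le> C * cmod (f x)"
    using q1(2) by eventually_elim (simp add: norm_mult mult_right_mono)
qed

lemma L2_add:
  assumes "f \<in> L2 I" "g \<in> L2 I" shows "(\<lambda>x. f x + g x) \<in> L2 I"
  unfolding L2_iff
proof (intro conjI)
  have m: "f \<in> borel_measurable (lebesgue_on I)" "g \<in> borel_measurable (lebesgue_on I)"
    and i: "integrable (lebesgue_on I) (\<lambda>x. (cmod (f x))\<^sup>2)" "integrable (lebesgue_on I) (\<lambda>x. (cmod (g x))\<^sup>2)"
    using assms by (auto simp: L2_iff)
  show "(\<lambda>x. f x + g x) \<in> borel_measurable (lebesgue_on I)" using m by simp
  have "integrable (lebesgue_on I) (\<lambda>x. 2 * (cmod (f x))\<^sup>2 + 2 * (cmod (g x))\<^sup>2)" using i by simp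
  then show "integrable (lebesgue_on I) (\<lambda>x. (cmod (f x + g x))\<^sup>2)"
  proof (rule Bochner_Integration.integrable_bound)
    show "(\<lambda>x. (cmod (f x + g x))\<^sup>2) \<in> borel_measurable (lebesgue_on I)" using m by simp
    show "AE x in lebesgue_on I. norm ((cmod (f x + g x))\<^sup>2) \<le> norm (2 * (cmod (f x))\<^sup>2 + 2 * (cmod (g x))\<^sup>2)"
    proof (rule AE_I2)
      fix x
      have "(cmod (f x + g x))\<^sup>2 \<le> (cmod (f x) + cmod (g x))\<^sup>2" by (intro power_mono norm_triangle_ineq) simp
      also have "\<dots> \<le> 2 * (cmod (f x))\<^sup>2 + 2 * (cmod (g x))\<^sup>2"
        using zero_le_power2[of "cmod (f x) - cmod (g x)"] by (simp add: power2_eq_square algebra_simps)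
      finally show "norm ((cmod (f x + g x))\<^sup>2) \<le> norm (2 * (cmod (f x))\<^sup>2 + 2 * (cmod (g x))\<^sup>2)" by simp
    qed
  qed
qed

lemma L2_cmult:
  assumes "f \<in> L2 I" shows "(\<lambda>x. c * f x) \<in> L2 I"
  using assms by (intro L2_bound[OF assms, where C="cmod c"]) (auto simp: L2_iff norm_mult)

lemma L2_diff:
  assumes "f \<in> L2 I" "g \<in> L2 I" shows "(\<lambda>x. f x - g x) \<in> L2 I"
  using L2_add[OF assms(1) L2_cmult[OF assms(2), of "-1"]] by simp

lemma L2_product_integrable:
  assumes "f \<in> L2 I" "g \<in> L2 I" shows "integrable (lebesgue_on I) (\<lambda>x. f x * g x)"
proof -
  have m: "f \<in> borel_measurable (lebesgue_on I)" "g \<in> borel_measurable (lebesgue_on I)"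
    and i: "integrable (lebesgue_on I) (\<lambda>x. (cmod (f x))\<^sup>2)" "integrable (lebesgue_on I) (\<lambda>x. (cmod (g x))\<^sup>2)"
    using assms by (auto simp: L2_iff)
  have "integrable (lebesgue_on I) (\<lambda>x. (cmod (f x))\<^sup>2 + (cmod (g x))\<^sup>2)" using i by simp
  then show ?thesis
  proof (rule Bochner_Integration.integrable_bound)
    show "(\<lambda>x. f x * g x) \<in> borel_measurable (lebesgue_on I)" using m by simp
    show "AE x in lebesgue_on I. norm (f x * g x) \<le> norm ((cmod (f x))\<^sup>2 + (cmod (g x))\<^sup>2)"
    proof (rule AE_I2)
      fix x
      have "2 * (cmod (f x) * cmod (g x)) \<le> (cmod (f x))\<^sup>2 + (cmod (g x))\<^sup>2"
        using sum_squares_bound[of "cmod (f x)" "cmod (g x)"] by simp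
      moreover have "0 \<le> cmod (f x) * cmod (g x)" by simp
      ultimately have "cmod (f x) * cmod (g x) \<le> (cmod (f x))\<^sup>2 + (cmod (g x))\<^sup>2" by linarith
      then show "norm (f x * g x) \<le> norm ((cmod (f x))\<^sup>2 + (cmod (g x))\<^sup>2)"
        by (simp add: norm_mult)
    qed
  qed
qed

lemma L2_cnj: "f \<in> L2 I \<Longrightarrow> (\<lambda>x. cnj (f x)) \<in> L2 I"
  using borel_measurable_continuous_on[of cnj f "lebesgue_on I"]
  by (simp add: L2_iff continuous_intros)

lemma L2_inner_integrable:
  assumes "f \<in> L2 I" "g \<in> L2 I" shows "integrable (lebesgue_on I) (\<lambda>x. cnj (f x) * g x)"
  using L2_product_integrable[OF L2_cnj[OF assms(1)] assms(2)] .

lemma adjoint_iff: "(u, v) \<in> adjoint_graph I H \<longleftrightarrow> u \<in> L2 I \<and> v \<in> L2 I \<and>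
    (\<forall>f g. (f, g) \<in> H \<longrightarrow> L2_inner I u g = L2_inner I v f)"
  unfolding adjoint_graph_def by auto

text \<open>Multiplication by the bounded real function \<open>q1\<close> is symmetric. Passing from
  \<open>v\<close> to \<open>v - q1 u\<close> in the graph therefore changes both sides of the
  relation that defines the adjoint by the same inner product.\<close>

lemma shear_selfadjoint:
  fixes q1 :: "real \<Rightarrow> real"
  assumes q1: "q1 \<in> borel_measurable (lebesgue_on I)" "AE x in lebesgue_on I. \<bar>q1 x\<bar> \<le> C"
    and H: "\<And>u v. (u, v) \<in> H \<Longrightarrow> u \<in> L2 I \<and> v \<in> L2 I"
    and HH': "\<And>u v. (u, v) \<in> H \<longleftrightarrow> (u, \<lambda>x. v x - of_real (q1 x) * u x) \<in> H'"
    and H': "\<And>u v. (u, v) \<in> H' \<Longrightarrow> u \<in> L2 I \<and> v \<in> L2 I"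
  shows "H = adjoint_graph I H \<longleftrightarrow> H' = adjoint_graph I H'"
proof -
  let ?Q = "\<lambda>u x. of_real (q1 x) * u x"
  have Q: "?Q u \<in> L2 I" if "u \<in> L2 I" for u
    by (rule L2_bounded_mult[OF q1 that])
  have add: "(u, \<lambda>x. v x + ?Q u x) \<in> H \<longleftrightarrow> (u, v) \<in> H'" for u v
    unfolding HH' by simp
  have L: "(\<lambda>x. v x - ?Q u x) \<in> L2 I \<longleftrightarrow> v \<in> L2 I" if "u \<in> L2 I" for u v
    using L2_diff[OF _ Q[OF that], of v] L2_add[OF _ Q[OF that], of "\<lambda>x. v x - ?Q u x"] by auto
  have inner: "L2_inner I u (\<lambda>x. g x + ?Q f x) = L2_inner I v f \<longleftrightarrow>
      L2_inner I u g = L2_inner I (\<lambda>x. v x - ?Q u x) f"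
    if "u \<in> L2 I" "v \<in> L2 I" "f \<in> L2 I" "g \<in> L2 I" for u v f g
  proof -
    have "L2_inner I u (\<lambda>x. g x + ?Q f x) = L2_inner I u g + (LINT x|lebesgue_on I. cnj (u x) * ?Q f x)"
      unfolding L2_inner_def distrib_left
      by (rule Bochner_Integration.integral_add) (intro L2_inner_integrable that Q)+
    moreover have "L2_inner I (\<lambda>x. v x - ?Q u x) f = L2_inner I v f - (LINT x|lebesgue_on I. cnj (?Q u x) * f x)"
      unfolding L2_inner_def complex_cnj_diff left_diff_distrib
      by (rule Bochner_Integration.integral_diff) (intro L2_inner_integrable that Q)+
    moreover have "(\<lambda>x. cnj (u x) * ?Q f x) = (\<lambda>x. cnj (?Q u x) * f x)"
      by (simp add: fun_eq_iff)
    ultimately show ?thesis by (metis (no_types, lifting) add_diff_cancel_right' diff_add_cancel)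
  qed
  have adj: "(u, v) \<in> adjoint_graph I H \<longleftrightarrow> (u, \<lambda>x. v x - ?Q u x) \<in> adjoint_graph I H'" for u v
  proof -
    have "(\<forall>f g. (f, g) \<in> H \<longrightarrow> L2_inner I u g = L2_inner I v f) \<longleftrightarrow>
        (\<forall>f g. (f, g) \<in> H' \<longrightarrow> L2_inner I u (\<lambda>x. g x + ?Q f x) = L2_inner I v f)" (is "?A \<longleftrightarrow> ?B")
    proof
      assume ?A then show ?B using add by blast
    next
      assume B: ?B
      show ?A
      proof (intro allI impI)
        fix f g assume "(f, g) \<in> H"
        then have "(f, \<lambda>x. g x - ?Q f x) \<in> H'" by (simp add: HH')
        with B have "L2_inner I u (\<lambda>x. g x - ?Q f x + ?Q f x) = L2_inner I v f" by blast
        then show "L2_inner I u g = L2_inner I v f" by simp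
      qed
    qed
    also have "u \<in> L2 I \<Longrightarrow> v \<in> L2 I \<Longrightarrow> ?B \<longleftrightarrow>
        (\<forall>f g. (f, g) \<in> H' \<longrightarrow> L2_inner I u g = L2_inner I (\<lambda>x. v x - ?Q u x) f)"
      using inner H' by blast
    finally show ?thesis unfolding adjoint_iff using L by blast
  qed
  show ?thesis
  proof
    assume "H = adjoint_graph I H"
    then have *: "(u, v) \<in> H \<longleftrightarrow> (u, v) \<in> adjoint_graph I H" for u v by simp
    have "(u, v) \<in> H' \<longleftrightarrow> (u, v) \<in> adjoint_graph I H'" for u v
      using *[of u "\<lambda>x. v x + ?Q u x"] unfolding adj add by simp
    then show "H' = adjoint_graph I H'" by (auto simp: set_eq_iff)
  next
    assume "H' = adjoint_graph I H'"
    then have *: "(u, v) \<in> H' \<longleftrightarrow> (u, v) \<in> adjoint_graph I H'" for u v by simp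
    have "(u, v) \<in> H \<longleftrightarrow> (u, v) \<in> adjoint_graph I H" for u v
      unfolding adj HH' by (rule *)
    then show "H = adjoint_graph I H" by (auto simp: set_eq_iff)
  qed
qed

section \<open>The maximal operator\<close>

text \<open>The measure \<open>dP\<close> is represented by its total variation \<open>T\<close> and its sign \<open>s\<close>, and \<open>Pl\<close> is the
  left-continuous representative of \<open>P\<close>; \<open>adm f g h\<close> stands for \<open>f\<^sup>[\<^sup>1\<^sup>] = g\<close> and \<open>g' = h\<close>.\<close>

locale sturm_liouville = open_interval +
  fixes P :: "real \<Rightarrow> real" and T :: "real measure" and s Pl :: "real \<Rightarrow> real"
  assumes T: "locfin T" and tv_P: "tv_measure I P = T"
    and s_meas: "s \<in> borel_measurable T" and s_cases: "\<And>x. s x = 1 \<or> s x = -1"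
    and qd: "\<And>f g. has_quasi_deriv I P f g \<longleftrightarrow> prim T f (\<lambda>x. of_real (s x) * g x)"
    and prim_Pl: "prim T (\<lambda>x. of_real (Pl x)) (\<lambda>x. of_real (s x))"
    and Pl_nonconst: "\<And>\<alpha> \<beta> k. \<alpha> \<in> I \<Longrightarrow> \<beta> \<in> I \<Longrightarrow> \<alpha> < \<beta> \<Longrightarrow> \<exists>x\<in>{\<alpha><..<\<beta>}. Pl x \<noteq> k"
    and P_AE: "AE x in L. P x = Pl x"
begin

definition adm :: "(real \<Rightarrow> complex) \<Rightarrow> (real \<Rightarrow> complex) \<Rightarrow> (real \<Rightarrow> complex) \<Rightarrow> bool" where
  "adm f g h \<longleftrightarrow> prim T f (\<lambda>x. of_real (s x) * g x) \<and> prim L g h"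

lemma maximal_operator_iff:
  "(u, v) \<in> maximal_operator I P q \<longleftrightarrow> u \<in> L2 I \<and> v \<in> L2 I \<and>
    (\<exists>f g h. adm f g h \<and> (AE x in lebesgue_on I. u x = f x) \<and>
      (AE x in lebesgue_on I. v x = - h x + of_real (q x) * f x))"
proof -
  have dom: "f \<in> sl_domain I P" "g \<in> ac_loc I (\<lambda>x. x)" if "adm f g h" for f g h
  proof -
    have f: "prim (tv_measure I P) f (\<lambda>x. of_real (s x) * g x)" and g: "prim (tv_measure I (\<lambda>x. x)) g h"
      using that by (simp_all add: adm_def tv_P tv_id)
    show g': "g \<in> ac_loc I (\<lambda>x. x)"
      by (rule prim_ac_loc[OF _ g]) (simp add: tv_id locfin_L)
    have "f \<in> ac_loc I P"
      by (rule prim_ac_loc[OF _ f]) (simp add: tv_P T)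
    then show "f \<in> sl_domain I P"
      unfolding sl_domain_def using g' f by (auto simp: qd tv_P)
  qed
  show ?thesis
  proof
    assume "(u, v) \<in> maximal_operator I P q"
    then show "u \<in> L2 I \<and> v \<in> L2 I \<and>
      (\<exists>f g h. adm f g h \<and> (AE x in lebesgue_on I. u x = f x) \<and>
      (AE x in lebesgue_on I. v x = - h x + of_real (q x) * f x))"
      unfolding maximal_operator_def is_tau_def adm_def qd has_quasi_deriv_id by blast
  next
    assume "u \<in> L2 I \<and> v \<in> L2 I \<and>
      (\<exists>f g h. adm f g h \<and> (AE x in lebesgue_on I. u x = f x) \<and>
      (AE x in lebesgue_on I. v x = - h x + of_real (q x) * f x))"
    then obtain f g h where *: "u \<in> L2 I" "v \<in> L2 I" "adm f g h" "AE x in lebesgue_on I. u x = f x"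
      "AE x in lebesgue_on I. v x = - h x + of_real (q x) * f x" by blast
    have "is_tau I P q f v"
      unfolding is_tau_def qd has_quasi_deriv_id using *(3,5) dom(2)[OF *(3)] unfolding adm_def by blast
    then show "(u, v) \<in> maximal_operator I P q"
      unfolding maximal_operator_def using * dom(1)[OF *(3)] by blast
  qed
qed

lemma maximal_operator_L2: "(u, v) \<in> maximal_operator I P q \<Longrightarrow> u \<in> L2 I \<and> v \<in> L2 I"
  by (simp add: maximal_operator_iff)

lemma maximal_operator_shear:
  assumes q1: "q1 \<in> borel_measurable (lebesgue_on I)" "AE x in lebesgue_on I. \<bar>q1 x\<bar> \<le> C"
    and q: "AE x in lebesgue_on I. q x = q1 x + q2 x"
  shows "(u, v) \<in> maximal_operator I P q \<longleftrightarrow> (u, \<lambda>x. v x - of_real (q1 x) * u x) \<in> maximal_operator I P q2"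
proof -
  have Q: "(\<lambda>x. of_real (q1 x) * u x) \<in> L2 I" if "u \<in> L2 I" for u
    by (rule L2_bounded_mult[OF q1 that])
  have L: "(\<lambda>x. v x - of_real (q1 x) * u x) \<in> L2 I \<longleftrightarrow> v \<in> L2 I" if "u \<in> L2 I"
    using L2_diff[OF _ Q[OF that], of v] L2_add[OF _ Q[OF that], of "\<lambda>x. v x - of_real (q1 x) * u x"] by auto
  have e: "(AE x in lebesgue_on I. v x = - h x + of_real (q x) * f x) \<longleftrightarrow>
      (AE x in lebesgue_on I. v x - of_real (q1 x) * u x = - h x + of_real (q2 x) * f x)"
    if uf: "AE x in lebesgue_on I. u x = f x" for f h
  proof
    assume "AE x in lebesgue_on I. v x = - h x + of_real (q x) * f x"
    with uf q show "AE x in lebesgue_on I. v x - of_real (q1 x) * u x = - h x + of_real (q2 x) * f x"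
      by eventually_elim (simp add: algebra_simps)
  next
    assume "AE x in lebesgue_on I. v x - of_real (q1 x) * u x = - h x + of_real (q2 x) * f x"
    with uf q show "AE x in lebesgue_on I. v x = - h x + of_real (q x) * f x"
      by eventually_elim (simp add: algebra_simps)
  qed
  show ?thesis unfolding maximal_operator_iff using L e by blast
qed

lemma selfadjoint_shear:
  assumes "q1 \<in> borel_measurable (lebesgue_on I)" "AE x in lebesgue_on I. \<bar>q1 x\<bar> \<le> C"
    and "AE x in lebesgue_on I. q x = q1 x + q2 x"
  shows "maximal_operator I P q = adjoint_graph I (maximal_operator I P q) \<longleftrightarrow>
    maximal_operator I P q2 = adjoint_graph I (maximal_operator I P q2)"
  by (rule shear_selfadjoint[OF assms(1,2) maximal_operator_L2 maximal_operator_shear[OF assms] maximal_operator_L2])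

lemma adm_f: "adm f g h \<Longrightarrow> prim T f (\<lambda>x. of_real (s x) * g x)"
  and adm_g: "adm f g h \<Longrightarrow> prim L g h"
  by (simp_all add: adm_def)

lemma admI: "prim T f (\<lambda>x. of_real (s x) * g x) \<Longrightarrow> prim L g h \<Longrightarrow> adm f g h"
  by (simp add: adm_def)

lemma adm_add: "adm f g h \<Longrightarrow> adm f' g' h' \<Longrightarrow> adm (\<lambda>x. f x + f' x) (\<lambda>x. g x + g' x) (\<lambda>x. h x + h' x)"
  unfolding adm_def distrib_left by (intro conjI prim_add) simp_all

lemma adm_cmult: "adm f g h \<Longrightarrow> adm (\<lambda>x. c * f x) (\<lambda>x. c * g x) (\<lambda>x. c * h x)"
  unfolding adm_def mult.left_commute[of _ c] by (intro conjI prim_cmult) simp_all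

lemma adm_cnj: "adm f g h \<Longrightarrow> adm (\<lambda>x. cnj (f x)) (\<lambda>x. cnj (g x)) (\<lambda>x. cnj (h x))"
  unfolding adm_def using prim_cnj[of T f "\<lambda>x. of_real (s x) * g x"] prim_cnj[of L g h] by simp

lemma adm_cong:
  assumes "adm f g h" "\<And>x. x \<in> I \<Longrightarrow> f x = f' x" "\<And>x. x \<in> I \<Longrightarrow> g x = g' x" "\<And>x. x \<in> I \<Longrightarrow> h x = h' x"
  shows "adm f' g' h'"
  using assms unfolding adm_def by (intro conjI; elim conjE) (erule prim_cong; simp)+

lemma adm_measurable:
  assumes A: "adm f g h"
  shows "f \<in> borel_measurable L" "g \<in> borel_measurable L" "h \<in> borel_measurable L"
proof -
  show "f \<in> borel_measurable L" by (rule prim_measurable[OF T locfin_L adm_f[OF A]])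
  show "g \<in> borel_measurable L" by (rule prim_measurable[OF locfin_L locfin_L adm_g[OF A]])
  show "h \<in> borel_measurable L" by (rule locint_measurable[OF locfin_L prim_locint[OF adm_g[OF A]]])
qed

text \<open>The densities against |dP| are \<open>g' s g\<close> and \<open>g s g'\<close>. They
  coincide, so the jumps of \<open>f\<close> and \<open>f'\<close> cancel in the Wronskian.\<close>

lemma lagrange:
  assumes "adm f g h" "adm f' g' h'"
  shows "prim L (\<lambda>x. f x * g' x - f' x * g x) (\<lambda>x. f x * h' x - f' x * h x)"
proof -
  have "prim L (\<lambda>x. g' x * f x - g x * f' x) (\<lambda>x. f x * h' x - f' x * h x)"
    by (rule prim_wronskian_L[OF T adm_f[OF assms(1)] adm_g[OF assms(2)] adm_f[OF assms(2)] adm_g[OF assms(1)]])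
      (simp add: mult_ac)
  then show ?thesis by (simp add: mult.commute)
qed

end

section \<open>Solutions by Picard iteration\<close>

text \<open>The second bound does not depend on \<open>n\<close>; it supplies the majorant for
  dominated convergence in the Picard iteration.\<close>

lemma exp_series_limit:
  fixes X :: "nat \<Rightarrow> complex"
  assumes "\<And>n. norm (X (Suc n) - X n) \<le> C * (M ^ n / fact n)" "0 \<le> C" "0 \<le> M"
  shows "convergent X" "norm (X n) \<le> norm (X 0) + C * exp M"
proof -
  have sm: "summable (\<lambda>n. C * (M ^ n / fact n))"
    using summable_exp[of M] by (intro summable_mult) (simp add: field_simps)
  have se: "(\<Sum>n. C * (M ^ n / fact n)) = C * exp M"
    using summable_exp[of M] unfolding exp_def
    by (subst suminf_mult) (simp_all add: field_simps scaleR_conv_of_real)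
  have "summable (\<lambda>n. X (Suc n) - X n)"
    by (rule summable_comparison_test'[OF sm]) (rule assms(1))
  then have "convergent (\<lambda>n. \<Sum>i<n. X (Suc i) - X i)" by (simp add: summable_iff_convergent)
  then have "convergent (\<lambda>n. X n - X 0)" by (simp add: sum_lessThan_telescope)
  then show "convergent X" using convergent_add[OF _ convergent_const[of "X 0"]] by fastforce
  have "norm (X n) \<le> norm (X 0) + norm (X n - X 0)" by (metis add.commute diff_add_cancel norm_triangle_ineq)
  also have "X n - X 0 = (\<Sum>i<n. X (Suc i) - X i)" by (simp add: sum_lessThan_telescope)
  also have "norm \<dots> \<le> (\<Sum>i<n. C * (M ^ i / fact i))" by (intro sum_norm_le assms(1))
  also have "\<dots> \<le> (\<Sum>n. C * (M ^ n / fact n))"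
    using assms by (intro sum_le_suminf sm) auto
  finally show "norm (X n) \<le> norm (X 0) + C * exp M" unfolding se by simp
qed

context open_interval begin

text \<open>The majorant is a complex function read through its real part, so that the calculus of
  primitives, which is complex valued throughout, applies to it too.\<close>

lemma norm_integral_dom:
  fixes \<phi> \<psi> :: "real \<Rightarrow> complex"
  assumes "set_integrable M B \<phi>" "set_integrable M B \<psi>" "\<And>t. t \<in> B \<Longrightarrow> norm (\<phi> t) \<le> Re (\<psi> t)"
  shows "norm (LINT t:B|M. \<phi> t) \<le> Re (LINT t:B|M. \<psi> t)"
proof -
  have "norm (LINT t:B|M. \<phi> t) \<le> (LINT t|M. norm (indicator B t *\<^sub>R \<phi> t))"
    unfolding set_lebesgue_integral_def by (rule integral_norm_bound)
  also have "\<dots> \<le> (LINT t|M. Re (indicator B t *\<^sub>R \<psi> t))"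
  proof (rule integral_mono)
    show "integrable M (\<lambda>t. norm (indicator B t *\<^sub>R \<phi> t))"
      using assms(1) unfolding set_integrable_def by (rule integrable_norm)
    show "integrable M (\<lambda>t. Re (indicator B t *\<^sub>R \<psi> t))"
      using assms(2) unfolding set_integrable_def by (rule integrable_Re)
    show "norm (indicator B t *\<^sub>R \<phi> t) \<le> Re (indicator B t *\<^sub>R \<psi> t)" for t
      using assms(3)[of t] by (auto simp: indicator_def)
  qed
  also have "\<dots> = Re (LINT t:B|M. \<psi> t)"
    unfolding set_lebesgue_integral_def using assms(2) unfolding set_integrable_def by (rule integral_Re)
  finally show ?thesis .
qed

lemma integral_Ico_mono:
  fixes \<psi> :: "real \<Rightarrow> complex"
  assumes M: "locfin M" and \<psi>: "locint M \<psi>" and yx: "y \<in> I" "x \<in> I" "y \<le> t" "t \<le> t'" "t' \<le> x"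
    and nn: "\<And>r. r \<in> {y..<x} \<Longrightarrow> 0 \<le> Re (\<psi> r)"
  shows "Re (LINT r:{t..<t'}|M. \<psi> r) \<le> Re (LINT r:{y..<x}|M. \<psi> r)"
proof -
  have I: "t \<in> I" "t' \<in> I" using betweenI[OF yx(1,2)] yx by auto
  have z: "set_integrable M B (\<lambda>_. 0::complex)" for B by (simp add: set_integrable_def)
  have nn': "0 \<le> Re (LINT r:{u..<v}|M. \<psi> r)" if "u \<in> I" "v \<in> I" "y \<le> u" "v \<le> x" for u v
    using norm_integral_dom[OF z locintD[OF \<psi> that(1,2)]] nn that by (simp add: set_lebesgue_integral_def)
  have "(LINT r:{y..<x}|M. \<psi> r) = (LINT r:{y..<t}|M. \<psi> r) + ((LINT r:{t..<t'}|M. \<psi> r) + (LINT r:{t'..<x}|M. \<psi> r))"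
    using set_integrable_Ico_split[OF M \<psi> yx(1,2,3)] set_integrable_Ico_split[OF M \<psi> I(1) yx(2,4,5)] yx by simp
  then show ?thesis using nn'[OF yx(1) I(1)] nn'[OF I(2) yx(2)] yx by simp
qed

lemma osint_bound:
  assumes M: "locfin M" and \<phi>: "locint M \<phi>" and \<psi>: "locint M \<psi>" and yx: "y \<in> I" "x \<in> I"
    and c: "c \<in> {y..x}" and t: "t \<in> {y..x}"
    and b: "\<And>r. r \<in> {y..<x} \<Longrightarrow> norm (\<phi> r) \<le> Re (\<psi> r)"
  shows "norm (osint M c \<phi> t) \<le> Re (LINT r:{y..<x}|M. \<psi> r)"
proof -
  have nn: "0 \<le> Re (\<psi> r)" if "r \<in> {y..<x}" for r using b[OF that] norm_ge_zero order_trans by blast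
  have *: "norm (LINT r:{u..<v}|M. \<phi> r) \<le> Re (LINT r:{y..<x}|M. \<psi> r)" if "u \<in> {y..x}" "v \<in> {y..x}" "u \<le> v" for u v
  proof -
    have I: "u \<in> I" "v \<in> I" using betweenI[OF yx] that by auto
    have "norm (LINT r:{u..<v}|M. \<phi> r) \<le> Re (LINT r:{u..<v}|M. \<psi> r)"
      using that b by (intro norm_integral_dom locintD[OF \<phi>] locintD[OF \<psi>] I) auto
    also have "\<dots> \<le> Re (LINT r:{y..<x}|M. \<psi> r)"
      using that nn by (intro integral_Ico_mono[OF M \<psi> yx]) auto
    finally show ?thesis .
  qed
  show ?thesis
  proof (cases "c \<le> t")
    case True
    then have "osint M c \<phi> t = (LINT r:{c..<t}|M. \<phi> r)" by (simp add: osint_def set_lebesgue_integral_def)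
    then show ?thesis using *[OF c t True] by simp
  next
    case False
    then have "osint M c \<phi> t = - (LINT r:{t..<c}|M. \<phi> r)" by (simp add: osint_def set_lebesgue_integral_def)
    then show ?thesis using *[OF t c] False by simp
  qed
qed

lemma osint_diff:
  assumes M: "locfin M" and \<phi>: "locint M \<phi>" and \<psi>: "locint M \<psi>" and I: "c \<in> I" "x \<in> I"
  shows "osint M c (\<lambda>t. \<phi> t - \<psi> t) x = osint M c \<phi> x - osint M c \<psi> x"
  using locintD[OF \<phi> I] locintD[OF \<psi> I] locintD[OF \<phi> I(2,1)] locintD[OF \<psi> I(2,1)]
  unfolding osint_def by (simp add: set_integral_diff)

lemma set_integral_tendsto:
  fixes \<phi> :: "nat \<Rightarrow> real \<Rightarrow> complex"
  assumes M: "locfin M" and \<phi>: "\<And>n. locint M (\<phi> n)" and \<phi>': "\<phi>' \<in> borel_measurable M"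
    and w: "locint M w" and yx: "y \<in> I" "x \<in> I"
    and b: "\<And>n t. t \<in> {y..<x} \<Longrightarrow> norm (\<phi> n t) \<le> norm (w t)"
    and lim: "\<And>t. t \<in> {y..<x} \<Longrightarrow> (\<lambda>n. \<phi> n t) \<longlonglongrightarrow> \<phi>' t"
  shows "(\<lambda>n. LINT t:{y..<x}|M. \<phi> n t) \<longlonglongrightarrow> (LINT t:{y..<x}|M. \<phi>' t)"
  unfolding set_lebesgue_integral_def
proof (rule integral_dominated_convergence)
  have wi: "integrable M (\<lambda>t. indicator {y..<x} t *\<^sub>R w t)"
    using locintD[OF w yx] by (simp add: set_integrable_def)
  show "integrable M (\<lambda>t. norm (indicator {y..<x} t *\<^sub>R w t))" by (rule integrable_norm[OF wi])
  show "(\<lambda>t. indicator {y..<x} t *\<^sub>R \<phi>' t) \<in> borel_measurable M"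
    by (intro borel_measurable_scaleR borel_measurable_indicator locfin_Ico[OF M yx] \<phi>')
  show "(\<lambda>t. indicator {y..<x} t *\<^sub>R \<phi> n t) \<in> borel_measurable M" for n
    by (rule borel_measurable_integrable[OF locintD[OF \<phi> yx, unfolded set_integrable_def]])
  show "AE t in M. norm (indicator {y..<x} t *\<^sub>R \<phi> n t) \<le> norm (indicator {y..<x} t *\<^sub>R w t)" for n
    using b[of _ n] by (intro AE_I2) (simp add: indicator_def)
  show "AE t in M. (\<lambda>n. indicator {y..<x} t *\<^sub>R \<phi> n t) \<longlonglongrightarrow> indicator {y..<x} t *\<^sub>R \<phi>' t"
    by (intro AE_I2) (simp add: indicator_def lim)
qed

lemma osint_tendsto:
  fixes \<phi> :: "nat \<Rightarrow> real \<Rightarrow> complex"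
  assumes M: "locfin M" and \<phi>: "\<And>n. locint M (\<phi> n)" and \<phi>': "\<phi>' \<in> borel_measurable M"
    and w: "locint M w" and I: "c \<in> I" "x \<in> I"
    and b: "\<And>n t. t \<in> {c..<x} \<or> t \<in> {x..<c} \<Longrightarrow> norm (\<phi> n t) \<le> norm (w t)"
    and lim: "\<And>t. t \<in> I \<Longrightarrow> (\<lambda>n. \<phi> n t) \<longlonglongrightarrow> \<phi>' t"
  shows "(\<lambda>n. osint M c (\<phi> n) x) \<longlonglongrightarrow> osint M c \<phi>' x"
  unfolding osint_def
proof (rule tendsto_diff)
  show "(\<lambda>n. LINT t:{c..<x}|M. \<phi> n t) \<longlonglongrightarrow> (LINT t:{c..<x}|M. \<phi>' t)"
    by (rule set_integral_tendsto[OF M \<phi> \<phi>' w I]) (use b lim subI(2)[OF I] in blast)+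
  show "(\<lambda>n. LINT t:{x..<c}|M. \<phi> n t) \<longlonglongrightarrow> (LINT t:{x..<c}|M. \<phi>' t)"
    by (rule set_integral_tendsto[OF M \<phi> \<phi>' w I(2,1)]) (use b lim subI(2)[OF I(2,1)] in blast)+
qed

lemma locint_cmult: "locint M \<phi> \<Longrightarrow> locint M (\<lambda>x. z * \<phi> x)"
  unfolding locint_def by (intro ballI set_integrable_mult_right) simp

text \<open>This evaluates the integral of \<open>K x ^ n * k x\<close>; the division by
  \<open>Suc n\<close> builds up the factorial of the Picard estimate.\<close>

lemma prim_power:
  assumes K: "prim L K k"
  shows "prim L (\<lambda>x. K x ^ Suc n) (\<lambda>x. of_nat (Suc n) * (K x ^ n * k x))"
proof (induction n)
  case 0
  then show ?case using K by simp
next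
  case (Suc n)
  show ?case
    by (rule prim_cong[OF prim_mult_L[OF Suc K]]) (simp_all add: algebra_simps)
qed

end

text \<open>From here on \<open>q\<close> is the compactly supported part of the potential. The
  strict and the weak inequality fit half-open intervals: \<open>q\<close> vanishes on all of
  \<open>{x..<c}\<close> and of \<open>{d..<x}\<close>.\<close>

locale sl_compact = sturm_liouville +
  fixes q :: "real \<Rightarrow> real" and c d :: real
  assumes c: "c \<in> I" and d: "d \<in> I" and c_less_d: "c < d"
    and q_locint: "locint L (\<lambda>x. of_real (q x))"
    and q_left: "\<And>x. x < c \<Longrightarrow> q x = 0" and q_right: "\<And>x. d \<le> x \<Longrightarrow> q x = 0"
begin

lemma locint_s: "prim L g k \<Longrightarrow> locint T (\<lambda>x. of_real (s x) * g x)"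
  using locint_prim_mult[OF locfin_L T _ prim_locint[OF prim_Pl], of g k] by (simp add: mult.commute)

lemma locint_q: "prim T f \<phi> \<Longrightarrow> locint L (\<lambda>x. of_real (q x) * f x)"
  using locint_prim_mult[OF T locfin_L _ q_locint, of f \<phi>] by (simp add: mult.commute)

lemma osint_q_left: assumes "x \<le> c" shows "osint L c (\<lambda>t. of_real (q t) * f t) x = 0"
proof -
  have "(\<lambda>t. indicator {x..<c} t *\<^sub>R (complex_of_real (q t) * f t)) = (\<lambda>t. 0)"
    using q_left by (auto simp: indicator_def)
  then show ?thesis using assms by (simp add: osint_def set_lebesgue_integral_def)
qed

lemma abs_s [simp]: "\<bar>s x\<bar> = 1"
  using s_cases[of x] by auto

lemma norm_s: "norm (complex_of_real (s x)) = 1"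
  by simp

context
  fixes A B :: complex
begin

definition stepf :: "(real \<Rightarrow> complex) \<Rightarrow> real \<Rightarrow> complex" where
  "stepf g x = A + osint T c (\<lambda>t. of_real (s t) * g t) x"

definition stepg :: "(real \<Rightarrow> complex) \<Rightarrow> real \<Rightarrow> complex" where
  "stepg f x = B + osint L c (\<lambda>t. of_real (q t) * f t) x"

text \<open>The iteration follows \<open>g\<close>, not \<open>f\<close>. One step integrates
  against |dP|, which may have atoms, and then against \<open>q dx\<close>, which has none; the
  second integration provides the gain \<open>1 / n!\<close>.\<close>

primrec gs :: "nat \<Rightarrow> real \<Rightarrow> complex" where
  "gs 0 = (\<lambda>x. B)"
| "gs (Suc n) = stepg (stepf (gs n))"

lemma prim_stepf: assumes "locint T (\<lambda>t. of_real (s t) * g t)" shows "prim T (stepf g) (\<lambda>t. of_real (s t) * g t)"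
  using prim_add[OF prim_const[of T A] prim_osint[OF T assms c]] by (simp add: stepf_def[abs_def])

lemma prim_stepg: assumes "locint L (\<lambda>t. of_real (q t) * f t)" shows "prim L (stepg f) (\<lambda>t. of_real (q t) * f t)"
  using prim_add[OF prim_const[of L B] prim_osint[OF locfin_L assms c]] by (simp add: stepg_def[abs_def])

lemma prim_gs: "\<exists>k. prim L (gs n) k"
proof (induction n)
  case 0
  show ?case using prim_const[of L B] by auto
next
  case (Suc n)
  then obtain k where "prim L (gs n) k" by blast
  from prim_stepg[OF locint_q[OF prim_stepf[OF locint_s[OF this]]]] show ?case by auto
qed

lemma locint_gs: "locint T (\<lambda>t. of_real (s t) * gs n t)"
  using prim_gs[of n] locint_s by blast

lemma locint_fs: "locint L (\<lambda>t. of_real (q t) * stepf (gs n) t)"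
  by (rule locint_q[OF prim_stepf[OF locint_gs]])

lemma gs_left: "x \<le> c \<Longrightarrow> gs n x = B"
  by (cases n) (simp_all add: stepg_def osint_q_left)

lemma gs_diff_bound:
  assumes e: "e \<in> I" "c \<le> e"
  obtains C M where "0 \<le> C" "0 \<le> M"
    "\<And>n x. x \<in> {c..e} \<Longrightarrow> norm (gs (Suc n) x - gs n x) \<le> C * (M ^ n / fact n)"
proof -
  define V where "V = Re (LINT r:{c..<e}|T. 1)"
  have V0: "0 \<le> V"
    using integral_Ico_mono[OF T locint_one[OF T] c e(1), of c c] e unfolding V_def by (simp add: set_lebesgue_integral_def)
  \<comment> \<open>Passing from \<open>g\<close> to \<open>f\<close> costs at most the total mass
    \<open>V\<close> of |dP| on \<open>{c..<e}\<close>; the following integration against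
    \<open>q\<close> then has the majorant \<open>V * \<bar>q t\<bar>\<close>.\<close>
  define k where "k t = complex_of_real (V * \<bar>q t\<bar>)" for t
  have k: "locint L k"
  proof -
    have "set_integrable L B k" if "set_integrable L B (\<lambda>x. complex_of_real (q x))" for B
    proof -
      have "integrable L (\<lambda>x. complex_of_real (V * norm (indicator B x *\<^sub>R complex_of_real (q x))))"
        using integrable_norm[OF that[unfolded set_integrable_def]] by (intro integrable_of_real integrable_mult_right)
      then show ?thesis unfolding set_integrable_def
        by (rule Bochner_Integration.integrable_cong[THEN iffD1, rotated 2]) (auto simp: k_def indicator_def)
    qed
    then show ?thesis using q_locint unfolding locint_def by simp
  qed
  define K where "K = osint L c k"
  have K: "prim L K k" unfolding K_def by (rule prim_osint[OF locfin_L k c])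
  define Kr where "Kr x = Re (K x)" for x
  have Kx: "K x = (LINT t:{c..<x}|L. k t)" if "c \<le> x" for x
    using that by (simp add: K_def osint_def set_lebesgue_integral_def)
  have Kre: "K x = of_real (Kr x)" if "c \<le> x" for x
  proof -
    have "K x = of_real (LINT t:{c..<x}|L. V * \<bar>q t\<bar>)"
      unfolding Kx[OF that] k_def by (rule set_integral_complex_of_real)
    then show ?thesis by (simp add: Kr_def)
  qed
  have k0: "0 \<le> Re (k t)" for t using V0 by (simp add: k_def)
  have Kmono: "Kr x \<le> Kr x'" if "c \<le> x" "x \<le> x'" "x' \<in> I" for x x'
    unfolding Kr_def Kx[OF that(1)] Kx[OF order_trans[OF that(1,2)]]
    using that k0 by (intro integral_Ico_mono[OF locfin_L k c]) auto
  have Kc: "Kr c = 0" by (simp add: Kr_def K_def)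
  have K0: "0 \<le> Kr x" if "c \<le> x" "x \<in> I" for x using Kmono[of c x] Kc that by simp
  obtain k1 where k1: "prim L (gs 1) k1" using prim_gs by blast
  define C where "C = norm (gs 1 c) + (LINT t:{c..<e}|L. norm (k1 t)) + norm B"
  have C1: "norm (gs 1 x) \<le> C - norm B" if "x \<in> {c..e}" for x
    unfolding C_def using prim_bound[OF locfin_L k1 c e(1), of x] that by simp
  have C0: "0 \<le> C" using C1[of c] e(2) norm_ge_zero[of "gs 1 c"] norm_ge_zero[of B]
    by (smt (verit) atLeastAtMost_iff)
  have bnd: "norm (gs (Suc n) x - gs n x) \<le> C * (Kr x ^ n / fact n)" if "x \<in> {c..e}" for n x
    using that
  proof (induction n arbitrary: x)
    case 0
    have "norm (gs 1 x - B) \<le> norm (gs 1 x) + norm B" by (rule norm_triangle_ineq4)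
    then show ?case using C1[OF 0] by simp
  next
    case (Suc n)
    have xI: "x \<in> I" using betweenI[OF c e(1)] Suc.prems by simp
    \<comment> \<open>\<open>h\<close> is the derivative of
      \<open>C * K ^ Suc n / fact (Suc n)\<close>, the bound wanted for the next iterate.\<close>
    define h where "h t = of_real (C / fact n) * (K t ^ n * k t)" for t
    have hint: "locint L h"
    proof -
      have "locint L (\<lambda>x. of_real (C / fact n / of_nat (Suc n)) * (of_nat (Suc n) * (K x ^ n * k x)))"
        using prim_locint[OF prim_cmult[OF prim_power[OF K, of n]]] .
      moreover have "(\<lambda>x. of_real (C / fact n / of_nat (Suc n)) * (of_nat (Suc n) * (K x ^ n * k x))) = h"
        unfolding h_def[abs_def] by (simp add: fun_eq_iff del: of_nat_Suc)
      ultimately show ?thesis by simp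
    qed
    have hval: "(LINT t:{c..<x}|L. h t) = of_real (C * (Kr x ^ Suc n / fact (Suc n)))"
    proof -
      have "K x ^ Suc n = K c ^ Suc n + (LINT t:{c..<x}|L. of_nat (Suc n) * (K t ^ n * k t))"
        using Suc.prems by (intro primD[OF prim_power[OF K]] c xI) auto
      then have "(LINT t:{c..<x}|L. K t ^ n * k t) = K x ^ Suc n / of_nat (Suc n)"
        by (simp add: K_def del: of_nat_Suc)
      then have "(LINT t:{c..<x}|L. h t) = of_real (C / fact n) * (of_real (Kr x) ^ Suc n / of_nat (Suc n))"
        unfolding h_def using Kre[of x] Suc.prems by (simp del: of_nat_Suc)
      then show ?thesis by (simp add: field_simps del: of_nat_Suc)
    qed
    have fdiff: "norm (stepf (gs (Suc n)) t - stepf (gs n) t) \<le> V * (C * (Kr t ^ n / fact n))" if t: "t \<in> {c..<x}" for t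
    proof -
      have tI: "t \<in> I" using betweenI[OF c xI] t by simp
      have eq: "stepf (gs (Suc n)) t - stepf (gs n) t =
          osint T c (\<lambda>r. of_real (s r) * gs (Suc n) r - of_real (s r) * gs n r) t"
        unfolding stepf_def osint_diff[OF T locint_gs locint_gs c tI] by simp
      have Rr: "Re (complex_of_real r * z) = r * Re z" for r z by simp
      have "norm (osint T c (\<lambda>r. of_real (s r) * gs (Suc n) r - of_real (s r) * gs n r) t)
          \<le> Re (LINT r:{c..<t}|T. of_real (C * (Kr t ^ n / fact n)) * 1)"
      proof (rule osint_bound[OF T _ _ c tI])
        show "locint T (\<lambda>r. of_real (s r) * gs (Suc n) r - of_real (s r) * gs n r)"
          using prim_locint[OF prim_diff[OF prim_stepf[OF locint_gs] prim_stepf[OF locint_gs]]] .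
        show "locint T (\<lambda>r. of_real (C * (Kr t ^ n / fact n)) * 1)"
          by (rule locint_cmult[OF locint_one[OF T]])
        fix r assume r: "r \<in> {c..<t}"
        have "norm (of_real (s r) * gs (Suc n) r - of_real (s r) * gs n r) = norm (gs (Suc n) r - gs n r)"
          unfolding right_diff_distrib[symmetric] norm_mult norm_s by simp
        also have "\<dots> \<le> C * (Kr r ^ n / fact n)" using Suc.IH[of r] r t Suc.prems by simp
        \<comment> \<open>Monotonicity of \<open>Kr\<close> makes the bound constant in
          \<open>r\<close>, so that only the mass of |dP| remains to be integrated.\<close>
        also have "\<dots> \<le> C * (Kr t ^ n / fact n)"
          using Kmono[of r t] K0[of r] r tI C0 betweenI[OF c tI, of r]
          by (intro mult_left_mono divide_right_mono power_mono) auto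
        finally show "norm (of_real (s r) * gs (Suc n) r - of_real (s r) * gs n r) \<le> Re (of_real (C * (Kr t ^ n / fact n)) * 1)"
          unfolding mult_1_right Re_complex_of_real .
      qed (use t in auto)
      also have "\<dots> = C * (Kr t ^ n / fact n) * Re (LINT r:{c..<t}|T. 1)"
        by (simp only: set_integral_mult_right Rr)
      also have "\<dots> \<le> C * (Kr t ^ n / fact n) * V"
        unfolding V_def using t Suc.prems K0[of t] tI C0
        by (intro mult_left_mono integral_Ico_mono[OF T locint_one[OF T] c e(1)]) auto
      finally show ?thesis unfolding eq by (simp add: mult.commute)
    qed
    have ld: "locint L (\<lambda>t. of_real (q t) * stepf (gs (Suc n)) t - of_real (q t) * stepf (gs n) t)"
      using prim_locint[OF prim_diff[OF prim_stepg[OF locint_fs] prim_stepg[OF locint_fs]]] .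
    have gsuc: "gs (Suc m) y = B + osint L c (\<lambda>t. of_real (q t) * stepf (gs m) t) y" for m y
      by (simp add: stepg_def)
    have "gs (Suc (Suc n)) x - gs (Suc n) x =
        osint L c (\<lambda>t. of_real (q t) * stepf (gs (Suc n)) t - of_real (q t) * stepf (gs n) t) x"
      unfolding osint_diff[OF locfin_L locint_fs locint_fs c xI] gsuc[of "Suc n" x] gsuc[of n x]
      by (rule add_diff_cancel_left)
    also have "\<dots> = (LINT t:{c..<x}|L. of_real (q t) * stepf (gs (Suc n)) t - of_real (q t) * stepf (gs n) t)"
      using Suc.prems by (simp add: osint_def set_lebesgue_integral_def)
    finally have "norm (gs (Suc (Suc n)) x - gs (Suc n) x) =
       norm (LINT t:{c..<x}|L. of_real (q t) * stepf (gs (Suc n)) t - of_real (q t) * stepf (gs n) t)" by simp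
    also have "\<dots> \<le> Re (LINT t:{c..<x}|L. h t)"
    proof (rule norm_integral_dom[OF locintD[OF ld c xI] locintD[OF hint c xI]])
      fix t assume t: "t \<in> {c..<x}"
      have "norm (of_real (q t) * stepf (gs (Suc n)) t - of_real (q t) * stepf (gs n) t)
          = \<bar>q t\<bar> * norm (stepf (gs (Suc n)) t - stepf (gs n) t)"
        unfolding right_diff_distrib[symmetric] norm_mult by simp
      also have "\<dots> \<le> \<bar>q t\<bar> * (V * (C * (Kr t ^ n / fact n)))"
        by (intro mult_left_mono fdiff t) simp
      also have "\<dots> = Re (h t)"
        using t Kre[of t] by (simp add: h_def k_def mult_ac flip: of_real_power of_real_mult of_real_divide)
      finally show "norm (of_real (q t) * stepf (gs (Suc n)) t - of_real (q t) * stepf (gs n) t) \<le> Re (h t)" .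
    qed
    also have "\<dots> = C * (Kr x ^ Suc n / fact (Suc n))" unfolding hval by (rule Re_complex_of_real)
    finally show ?case .
  qed
  show thesis
  proof (rule that[of C "Kr e"])
    fix n x assume x: "x \<in> {c..e}"
    have xI: "x \<in> I" using betweenI[OF c e(1)] x by simp
    have "C * (Kr x ^ n / fact n) \<le> C * (Kr e ^ n / fact n)"
      using Kmono[of x e] K0[of x] x e C0 xI
      by (intro mult_left_mono divide_right_mono power_mono) auto
    with bnd[OF x, of n] show "norm (gs (Suc n) x - gs n x) \<le> C * (Kr e ^ n / fact n)" by simp
  qed (use C0 K0 e in auto)
qed

text \<open>To the left of \<open>c\<close> the potential vanishes and all iterates equal
  \<open>B\<close>, so an estimate is called for only to the right of \<open>c\<close>.\<close>

lemma gs_bound_conv: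
  assumes yx: "y \<in> I" "x \<in> I"
  obtains D where "0 \<le> D" "\<And>t n. t \<in> {y..x} \<Longrightarrow> norm (gs n t) \<le> D" "\<And>t. t \<in> {y..x} \<Longrightarrow> convergent (\<lambda>n. gs n t)"
proof -
  have "max c x \<in> I" using c yx by (simp add: max_def)
  then obtain C M where CM: "0 \<le> C" "0 \<le> M"
    "\<And>n t. t \<in> {c..max c x} \<Longrightarrow> norm (gs (Suc n) t - gs n t) \<le> C * (M ^ n / fact n)"
    by (rule gs_diff_bound[OF _ max.cobounded1]) (rule that; assumption)
  show thesis
  proof (rule that[of "norm B + C * exp M"])
    fix t assume t: "t \<in> {y..x}"
    show "norm (gs n t) \<le> norm B + C * exp M" for n
    proof (cases "t \<le> c")
      case True then show ?thesis using CM(1) by (simp add: gs_left)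
    next
      case False
      then show ?thesis using exp_series_limit(2)[of "\<lambda>n. gs n t" C M n] CM t by simp
    qed
    show "convergent (\<lambda>n. gs n t)"
    proof (cases "t \<le> c")
      case True then show ?thesis by (simp add: gs_left convergent_const)
    next
      case False
      then show ?thesis using exp_series_limit(1)[of "\<lambda>n. gs n t" C M] CM t by simp
    qed
  qed (use CM in simp)
qed

text \<open>The iterates converge pointwise and are bounded uniformly in \<open>n\<close> on compact
  intervals. This allows passing to the limit first in the integral against |dP| and then in the one
  against \<open>q\<close>.\<close>

lemma solution_exists:
  obtains f g where "adm f g (\<lambda>x. of_real (q x) * f x)" "f c = A" "g c = B"
proof -
  define g where "g x = lim (\<lambda>n. gs n x)" for x
  have glim: "(\<lambda>n. gs n x) \<longlonglongrightarrow> g x" if x: "x \<in> I" for x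
  proof -
    obtain D where "\<And>t. t \<in> {x..x} \<Longrightarrow> convergent (\<lambda>n. gs n t)"
      by (rule gs_bound_conv[OF x x]) (rule that; assumption)
    then show ?thesis unfolding g_def convergent_LIMSEQ_iff[symmetric] by simp
  qed
  have gm: "g \<in> borel_measurable T"
  proof (rule borel_measurable_LIMSEQ_metric[where f=gs])
    show "gs n \<in> borel_measurable T" for n
      using prim_gs[of n] prim_measurable[OF locfin_L T] by blast
  qed (simp add: glim locfin_space[OF T])
  have sm: "(\<lambda>x. complex_of_real (s x)) \<in> borel_measurable T"
    using s_meas by (rule measurable_compose) simp
  have gb: "\<exists>D. \<forall>t\<in>{y..<x}. norm (g t) \<le> D" if yx: "y \<in> I" "x \<in> I" for y x
  proof -
    obtain D where D: "\<And>t n. t \<in> {y..x} \<Longrightarrow> norm (gs n t) \<le> D"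
      by (rule gs_bound_conv[OF yx]) (rule that; assumption)
    show ?thesis
    proof (intro exI[of _ D] ballI)
      fix t assume t: "t \<in> {y..<x}"
      then have "t \<in> I" using subI(2)[OF yx] by blast
      from tendsto_norm[OF glim[OF this]] show "norm (g t) \<le> D"
        by (rule LIMSEQ_le_const2) (use D t in auto)
    qed
  qed
  have lg: "locint T (\<lambda>t. of_real (s t) * g t)"
    using locint_bounded_mult[OF prim_locint[OF prim_Pl] gm gb] by (simp add: mult.commute)
  define f where "f = stepf g"
  have f: "prim T f (\<lambda>t. of_real (s t) * g t)" unfolding f_def by (rule prim_stepf[OF lg])
  have bnd: "\<exists>D. 0 \<le> D \<and> (\<forall>n. \<forall>t\<in>{c..<x} \<union> {x..<c}. norm (gs n t) \<le> D \<and> norm (stepf (gs n) t) \<le> D)" if x: "x \<in> I" for x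
  proof -
    have mI: "min c x \<in> I" "max c x \<in> I" using x c by (auto simp: min_def max_def)
    obtain D where D: "0 \<le> D" "\<And>t n. t \<in> {min c x..max c x} \<Longrightarrow> norm (gs n t) \<le> D"
      by (rule gs_bound_conv[OF mI]) (rule that; assumption)
    define D' where "D' = norm A + Re (LINT r:{min c x..<max c x}|T. of_real D * 1)"
    have "norm (stepf (gs n) t) \<le> D'" if t: "t \<in> {min c x..max c x}" for n t
    proof -
      have "norm (osint T c (\<lambda>t. of_real (s t) * gs n t) t) \<le> Re (LINT r:{min c x..<max c x}|T. of_real D * 1)"
      proof (rule osint_bound[OF T locint_gs _ mI _ t])
        show "locint T (\<lambda>r. of_real D * 1)"
          by (rule locint_cmult[OF locint_one[OF T]])
      qed (use D in \<open>auto simp: norm_mult\<close>)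
      then show ?thesis unfolding stepf_def D'_def by (intro norm_triangle_le) simp
    qed
    with D show ?thesis by (intro exI[of _ "max D D'"]) (auto simp: le_max_iff_disj)
  qed
  have flim: "(\<lambda>n. stepf (gs n) x) \<longlonglongrightarrow> f x" if x: "x \<in> I" for x
  proof -
    obtain D where D: "0 \<le> D" "\<forall>n. \<forall>t\<in>{c..<x} \<union> {x..<c}. norm (gs n t) \<le> D \<and> norm (stepf (gs n) t) \<le> D"
      using bnd[OF x] by blast
    have "(\<lambda>n. osint T c (\<lambda>t. of_real (s t) * gs n t) x) \<longlonglongrightarrow> osint T c (\<lambda>t. of_real (s t) * g t) x"
    proof (rule osint_tendsto[OF T locint_gs _ _ c x])
      show "(\<lambda>t. of_real (s t) * g t) \<in> borel_measurable T" using sm gm by (rule borel_measurable_times)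
      show "locint T (\<lambda>r. of_real D * 1)"
        by (rule locint_cmult[OF locint_one[OF T]])
      show "(\<lambda>n. of_real (s t) * gs n t) \<longlonglongrightarrow> of_real (s t) * g t" if "t \<in> I" for t
        by (intro tendsto_mult_left glim that)
    qed (use D in \<open>auto simp: norm_mult\<close>)
    then show ?thesis unfolding f_def stepf_def by (intro tendsto_add tendsto_const)
  qed
  have geq: "g x = stepg f x" if x: "x \<in> I" for x
  proof -
    obtain D where D: "0 \<le> D" "\<forall>n. \<forall>t\<in>{c..<x} \<union> {x..<c}. norm (gs n t) \<le> D \<and> norm (stepf (gs n) t) \<le> D"
      using bnd[OF x] by blast
    have "(\<lambda>n. osint L c (\<lambda>t. of_real (q t) * stepf (gs n) t) x) \<longlonglongrightarrow> osint L c (\<lambda>t. of_real (q t) * f t) x"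
    proof (rule osint_tendsto[OF locfin_L locint_fs _ _ c x])
      show "(\<lambda>t. of_real (q t) * f t) \<in> borel_measurable L"
        by (rule locint_measurable[OF locfin_L locint_q[OF f]])
      show "locint L (\<lambda>r. of_real D * of_real (q r))"
        by (rule locint_cmult[OF q_locint])
      show "(\<lambda>n. of_real (q t) * stepf (gs n) t) \<longlonglongrightarrow> of_real (q t) * f t" if "t \<in> I" for t
        by (intro tendsto_mult_left flim that)
    qed (use D in \<open>auto simp: norm_mult mult.commute[of D] intro!: mult_left_mono\<close>)
    then have "(\<lambda>n. gs (Suc n) x) \<longlonglongrightarrow> stepg f x"
      unfolding gs.simps stepg_def by (intro tendsto_add tendsto_const)
    then show ?thesis using LIMSEQ_Suc[OF glim[OF x]] by (rule LIMSEQ_unique[rotated])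
  qed
  show thesis
  proof (rule that[of f g])
    have "prim L g (\<lambda>x. of_real (q x) * f x)"
      by (rule prim_cong[OF prim_stepg[OF locint_q[OF f]]]) (simp_all add: geq)
    with f show "adm f g (\<lambda>x. of_real (q x) * f x)" by (rule admI)
    show "f c = A" by (simp add: f_def stepf_def)
    show "g c = B" using geq[OF c] by (simp add: stepg_def)
  qed
qed

end

text \<open>The equation has real coefficients, so averaging a solution with its conjugate keeps the
  equation and the real initial values. With real solutions the orthogonality relations used later
  involve no conjugates.\<close>

lemma real_solution_exists:
  fixes A B :: real
  obtains f g where "adm f g (\<lambda>x. of_real (q x) * f x)" "f c = of_real A" "g c = of_real B"
    "\<And>x. cnj (f x) = f x" "\<And>x. cnj (g x) = g x"
proof -
  obtain f g where fg: "adm f g (\<lambda>x. of_real (q x) * f x)" "f c = of_real A" "g c = of_real B"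
    by (rule solution_exists)
  let ?f = "\<lambda>x. (1/2) * (f x + cnj (f x))" and ?g = "\<lambda>x. (1/2) * (g x + cnj (g x))"
  show thesis
  proof (rule that[of ?f ?g])
    show "adm ?f ?g (\<lambda>x. of_real (q x) * ?f x)"
      by (rule adm_cong[OF adm_cmult[OF adm_add[OF fg(1) adm_cnj[OF fg(1)]], of "1/2"]])
        (simp_all add: distrib_left)
  qed (simp_all add: fg add.commute)
qed

end

section \<open>Square integrable functions in terms of Borel measurable ones\<close>

context open_interval begin

lemma L2_L:
  assumes f: "f \<in> borel_measurable L"
  shows "f \<in> L2 I \<longleftrightarrow> integrable L (\<lambda>x. (cmod (f x))\<^sup>2)"
proof -
  have "(\<lambda>x. (cmod (f x))\<^sup>2) \<in> borel_measurable L" using f by simp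
  from lebesgue_on_L(2)[OF borel_I this] lebesgue_on_L(1)[OF borel_I f] show ?thesis
    unfolding L2_iff by blast
qed

lemma L2_inner_L:
  assumes "f \<in> borel_measurable L" "g \<in> borel_measurable L"
  shows "L2_inner I f g = (LINT x|L. cnj (f x) * g x)"
proof -
  have "(\<lambda>x. cnj (f x)) \<in> borel_measurable L"
    using assms(1) by (rule measurable_compose) (simp add: borel_measurable_continuous_onI continuous_intros)
  with assms(2) show ?thesis
    unfolding L2_inner_def by (intro lebesgue_on_L(3)[OF borel_I] borel_measurable_times)
qed

lemma L2_inner_cong:
  assumes "f \<in> L2 I" "g \<in> L2 I" "f' \<in> L2 I" "g' \<in> L2 I"
    "AE x in lebesgue_on I. f x = f' x" "AE x in lebesgue_on I. g x = g' x"
  shows "L2_inner I f g = L2_inner I f' g'"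
  unfolding L2_inner_def
proof (rule Bochner_Integration.integral_cong_AE)
  show "(\<lambda>x. cnj (f x) * g x) \<in> borel_measurable (lebesgue_on I)"
    using L2_inner_integrable[OF assms(1,2)] by (rule borel_measurable_integrable)
  show "(\<lambda>x. cnj (f' x) * g' x) \<in> borel_measurable (lebesgue_on I)"
    using L2_inner_integrable[OF assms(3,4)] by (rule borel_measurable_integrable)
  show "AE x in lebesgue_on I. cnj (f x) * g x = cnj (f' x) * g' x"
    using assms(5,6) by eventually_elim simp
qed

lemma L2_borel_rep:
  assumes "f \<in> L2 I"
  obtains f' where "f' \<in> borel_measurable L" "f' \<in> L2 I" "AE x in lebesgue_on I. f x = f' x"
proof -
  have "f \<in> borel_measurable (lebesgue_on I)" using assms by (simp add: L2_iff)
  then obtain f' where f': "f' \<in> borel_measurable L" "AE x in lebesgue_on I. f x = f' x"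
    by (rule lebesgue_on_borel_rep[OF borel_I])
  have "f' \<in> L2 I"
    by (rule L2_cong_AE[OF assms _ f'(2)]) (rule lebesgue_on_L(1)[OF borel_I f'(1)])
  then show thesis by (rule that[OF f'(1) _ f'(2)])
qed

lemma integral_one: "y \<in> I \<Longrightarrow> x \<in> I \<Longrightarrow> y \<le> x \<Longrightarrow> (LINT t:{y..<x}|L. 1) = complex_of_real (x - y)"
proof -
  assume yx: "y \<in> I" "x \<in> I" "y \<le> x"
  have "(LINT t:{y..<x}|L. 1) = complex_of_real (LINT t|L. indicator {y..<x} t)"
    unfolding set_lebesgue_integral_def by (simp add: scaleR_conv_of_real)
  also have "(LINT t|L. indicator {y..<x} t) = x - y"
    using locfin_Ico[OF locfin_L yx(1,2)] yx(3) emeasure_L[OF subI(2)[OF yx(1,2)]]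
      sets.sets_into_space[OF locfin_Ico[OF locfin_L yx(1,2)]] by (simp add: measure_def Int_absorb2)
  finally show ?thesis .
qed

lemma set_integrable_sub:
  fixes f :: "'a \<Rightarrow> 'b::{banach, second_countable_topology}"
  assumes "integrable M f" "B \<in> sets M"
  shows "set_integrable M B f"
  unfolding set_integrable_def using assms(2,1) by (rule integrable_mult_indicator)

lemma L2_locint:
  assumes f: "f \<in> borel_measurable L" "f \<in> L2 I"
  shows "locint L f"
  unfolding locint_def
proof (intro ballI)
  fix y x assume yx: "y \<in> I" "x \<in> I"
  have J: "{y..<x} \<in> sets L" by (rule locfin_Ico[OF locfin_L yx])
  have "integrable L (\<lambda>x. (cmod (f x))\<^sup>2)" using f L2_L by blast
  from integrable_mult_indicator[OF J this]
  have 1: "integrable L (\<lambda>t. indicator {y..<x} t * (cmod (f t))\<^sup>2)" by simp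
  have 2: "integrable L (\<lambda>t. norm (indicator {y..<x} t *\<^sub>R (1::complex)))"
    using locintD[OF locint_one[OF locfin_L] yx] unfolding set_integrable_def by (rule integrable_norm)
  have "integrable L (\<lambda>t. norm (indicator {y..<x} t *\<^sub>R (1::complex)) + indicator {y..<x} t * (cmod (f t))\<^sup>2)"
    using 2 1 by (rule Bochner_Integration.integrable_add)
  then show "set_integrable L {y..<x} f" unfolding set_integrable_def
  proof (rule Bochner_Integration.integrable_bound)
    show "(\<lambda>t. indicator {y..<x} t *\<^sub>R f t) \<in> borel_measurable L"
      by (intro borel_measurable_scaleR borel_measurable_indicator J f)
    show "AE t in L. norm (indicator {y..<x} t *\<^sub>R f t) \<le>
        norm (norm (indicator {y..<x} t *\<^sub>R (1::complex)) + indicator {y..<x} t * (cmod (f t))\<^sup>2)"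
    proof (rule AE_I2)
      fix t
      have "2 * cmod (f t) \<le> 1 + (cmod (f t))\<^sup>2" using sum_squares_bound[of 1 "cmod (f t)"] by simp
      then have "cmod (f t) \<le> 1 + (cmod (f t))\<^sup>2" using norm_ge_zero[of "f t"] by linarith
      then show "norm (indicator {y..<x} t *\<^sub>R f t) \<le>
        norm (norm (indicator {y..<x} t *\<^sub>R (1::complex)) + indicator {y..<x} t * (cmod (f t))\<^sup>2)"
        by (auto simp: indicator_def)
    qed
  qed
qed

lemma bounded_L2_Ico:
  fixes f :: "real \<Rightarrow> complex"
  assumes "f \<in> borel_measurable L" "y \<in> I" "x \<in> I" "\<And>t. t \<in> {y..<x} \<Longrightarrow> cmod (f t) \<le> D"
  shows "set_integrable L {y..<x} (\<lambda>t. (cmod (f t))\<^sup>2)"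
proof -
  have "set_integrable L {y..<x} (\<lambda>t. (complex_of_real ((cmod (f t))\<^sup>2)) * 1)"
  proof (rule set_integrable_bounded_mult[OF locintD[OF locint_one[OF locfin_L] assms(2,3)]])
    have "(\<lambda>t. (cmod (f t))\<^sup>2) \<in> borel_measurable L" using assms(1) by simp
    then show "(\<lambda>t. complex_of_real ((cmod (f t))\<^sup>2)) \<in> borel_measurable L"
      by (rule measurable_compose) simp
    show "norm (complex_of_real ((cmod (f t))\<^sup>2)) \<le> D\<^sup>2" if "t \<in> {y..<x}" for t
      using power_mono[OF assms(4)[OF that] norm_ge_zero, of 2] by (simp add: norm_power)
  qed
  then have "integrable L (\<lambda>t. Re (indicator {y..<x} t *\<^sub>R ((complex_of_real ((cmod (f t))\<^sup>2)) * 1)))"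
    unfolding set_integrable_def by (rule integrable_Re)
  then show ?thesis by (simp add: set_integrable_def)
qed

lemma L2_supported:
  fixes f :: "real \<Rightarrow> complex"
  assumes "f \<in> borel_measurable L" "y \<in> I" "x \<in> I" "\<And>t. t \<in> {y..<x} \<Longrightarrow> cmod (f t) \<le> D"
    "\<And>t. t \<in> I \<Longrightarrow> t \<notin> {y..<x} \<Longrightarrow> f t = 0"
  shows "f \<in> L2 I"
proof -
  have "integrable L (\<lambda>t. indicator {y..<x} t *\<^sub>R (cmod (f t))\<^sup>2)"
    using bounded_L2_Ico[OF assms(1-4)] unfolding set_integrable_def .
  then have "integrable L (\<lambda>t. (cmod (f t))\<^sup>2)"
  proof (rule Bochner_Integration.integrable_cong[THEN iffD1, rotated 2])
    fix t assume "t \<in> space L"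
    then show "indicator {y..<x} t *\<^sub>R (cmod (f t))\<^sup>2 = (cmod (f t))\<^sup>2"
      using assms(5)[of t] by (auto simp: locfin_space[OF locfin_L] indicator_def)
  qed simp
  then show ?thesis by (simp add: L2_L[OF assms(1)])
qed

lemma integral_supported:
  fixes f :: "real \<Rightarrow> complex"
  assumes "\<And>t. t \<in> I \<Longrightarrow> t \<notin> J \<Longrightarrow> f t = 0"
  shows "(LINT t|L. f t) = (LINT t:J|L. f t)"
  unfolding set_lebesgue_integral_def
  by (intro Bochner_Integration.integral_cong) (use assms in \<open>auto simp: locfin_space[OF locfin_L] indicator_def\<close>)

end

section \<open>Variation of constants\<close>

locale sl_solutions = sl_compact +
  fixes y1 z1 y2 z2 :: "real \<Rightarrow> complex"
  assumes adm1: "adm y1 z1 (\<lambda>x. of_real (q x) * y1 x)" and adm2: "adm y2 z2 (\<lambda>x. of_real (q x) * y2 x)"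
    and init: "y1 c = 1" "z1 c = 0" "y2 c = 0" "z2 c = 1"
    and real_y: "\<And>x. cnj (y1 x) = y1 x" "\<And>x. cnj (y2 x) = y2 x"
begin

lemma wronskian_one: assumes x: "x \<in> I" shows "y1 x * z2 x - y2 x * z1 x = 1"
proof -
  have "prim L (\<lambda>x. y1 x * z2 x - y2 x * z1 x) (\<lambda>x. 0)"
    by (rule prim_cong[OF lagrange[OF adm1 adm2]]) (simp_all add: mult_ac)
  from prim_const_eq[OF this prim_const[of L 0] c x] show ?thesis by (simp add: init)
qed

lemma locint_y: "locint L w \<Longrightarrow> locint L (\<lambda>t. y1 t * w t)" "locint L w \<Longrightarrow> locint L (\<lambda>t. y2 t * w t)"
  by (rule locint_prim_mult[OF T locfin_L adm_f[OF adm1]] locint_prim_mult[OF T locfin_L adm_f[OF adm2]]; assumption)+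

text \<open>The solution of \<tau> f = w whose value and quasi-derivative vanish at
  \<open>e\<close>, by variation of constants with Wronskian one; \<open>vd\<close> is its
  quasi-derivative.\<close>

definition vc :: "real \<Rightarrow> (real \<Rightarrow> complex) \<Rightarrow> real \<Rightarrow> complex" where
  "vc e w x = osint L e (\<lambda>t. y2 t * w t) x * y1 x - osint L e (\<lambda>t. y1 t * w t) x * y2 x"

definition vd :: "real \<Rightarrow> (real \<Rightarrow> complex) \<Rightarrow> real \<Rightarrow> complex" where
  "vd e w x = osint L e (\<lambda>t. y2 t * w t) x * z1 x - osint L e (\<lambda>t. y1 t * w t) x * z2 x"

text \<open>Differentiating the coefficients contributes \<open>y1 y2 w - y2 y1 w = 0\<close> to the
  derivative of \<open>vc\<close>, and minus the Wronskian times \<open>w\<close> to that of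
  \<open>vd\<close>.\<close>

lemma vc_adm:
  assumes w: "locint L w" and e: "e \<in> I"
  shows "adm (vc e w) (vd e w) (\<lambda>x. of_real (q x) * vc e w x - w x)"
proof (rule admI)
  note F2 = prim_osint[OF locfin_L locint_y(2)[OF w] e] and F1 = prim_osint[OF locfin_L locint_y(1)[OF w] e]
  show "prim T (vc e w) (\<lambda>x. of_real (s x) * vd e w x)"
  proof (rule prim_cong[OF prim_wronskian_T[OF T adm_f[OF adm1] F2 adm_f[OF adm2] F1]])
    show "y1 x * (y2 x * w x) = y2 x * (y1 x * w x)" for x by (rule mult.left_commute)
  qed (simp_all add: vc_def vd_def right_diff_distrib mult.left_commute)
  have "prim L (\<lambda>x. osint L e (\<lambda>t. y2 t * w t) x * z1 x - osint L e (\<lambda>t. y1 t * w t) x * z2 x)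
      (\<lambda>x. (osint L e (\<lambda>t. y2 t * w t) x * (of_real (q x) * y1 x) + z1 x * (y2 x * w x)) -
        (osint L e (\<lambda>t. y1 t * w t) x * (of_real (q x) * y2 x) + z2 x * (y1 x * w x)))"
    by (rule prim_diff[OF prim_mult_L[OF adm_g[OF adm1] F2] prim_mult_L[OF adm_g[OF adm2] F1]])
  then show "prim L (vd e w) (\<lambda>x. of_real (q x) * vc e w x - w x)"
  proof (rule prim_cong)
    fix x assume x: "x \<in> I"
    have "z2 x * (y1 x * w x) - z1 x * (y2 x * w x) = (y1 x * z2 x - y2 x * z1 x) * w x"
      by (simp add: algebra_simps)
    also have "\<dots> = w x" using wronskian_one[OF x] by simp
    finally show "(osint L e (\<lambda>t. y2 t * w t) x * (of_real (q x) * y1 x) + z1 x * (y2 x * w x)) -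
        (osint L e (\<lambda>t. y1 t * w t) x * (of_real (q x) * y2 x) + z2 x * (y1 x * w x)) = of_real (q x) * vc e w x - w x"
      unfolding vc_def by (simp add: algebra_simps)
  qed (simp add: vd_def)
qed

section \<open>Sources of compact support, and solutions off the support of the potential\<close>

lemma osint_left_zero:
  assumes "\<And>t. t < e \<Longrightarrow> w t = 0" "x \<le> e"
  shows "osint L e (\<lambda>t. y t * w t) x = 0"
proof -
  have "(\<lambda>t. indicator {x..<e} t *\<^sub>R (y t * w t)) = (\<lambda>t. 0)"
    using assms(1) by (auto simp: indicator_def)
  then show ?thesis using assms(2) by (simp add: osint_def set_lebesgue_integral_def)
qed

lemma osint_right_zero:
  assumes "\<And>t. e \<le> t \<Longrightarrow> w t = 0" "e \<le> x"
  shows "osint L e (\<lambda>t. y t * w t) x = 0"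
proof -
  have "(\<lambda>t. indicator {e..<x} t *\<^sub>R (y t * w t)) = (\<lambda>t. 0)"
    using assms(1) by (auto simp: indicator_def)
  then show ?thesis using assms(2) by (simp add: osint_def set_lebesgue_integral_def)
qed

lemma osint_supported:
  assumes "\<And>t. t \<notin> {e..<f} \<Longrightarrow> w t = 0" "e \<le> f" "f \<le> x"
  shows "osint L e (\<lambda>t. y t * w t) x = (LINT t:{e..<f}|L. y t * w t)"
proof -
  have "(\<lambda>t. indicator {e..<x} t *\<^sub>R (y t * w t)) = (\<lambda>t. indicator {e..<f} t *\<^sub>R (y t * w t))"
    using assms by (auto simp: indicator_def fun_eq_iff)
  then show ?thesis using assms(2,3) by (simp add: osint_def set_lebesgue_integral_def)
qed

lemma osint_supported_left:
  assumes "\<And>t. t \<notin> {f..<e} \<Longrightarrow> w t = 0" "f \<le> e" "x \<le> f"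
  shows "osint L e (\<lambda>t. y t * w t) x = - (LINT t:{f..<e}|L. y t * w t)"
proof -
  have "(\<lambda>t. indicator {x..<e} t *\<^sub>R (y t * w t)) = (\<lambda>t. indicator {f..<e} t *\<^sub>R (y t * w t))"
    using assms by (auto simp: indicator_def fun_eq_iff)
  then show ?thesis using assms(2,3) by (simp add: osint_def set_lebesgue_integral_def)
qed

lemma z_left: assumes "adm y z (\<lambda>x. of_real (q x) * y x)" "x \<in> I" "x \<le> c" shows "z x = z c"
proof -
  have "z c = z x + (LINT t:{x..<c}|L. of_real (q t) * y t)"
    by (rule primD[OF adm_g[OF assms(1)] assms(2) c assms(3)])
  moreover have "(\<lambda>t. indicator {x..<c} t *\<^sub>R (complex_of_real (q t) * y t)) = (\<lambda>t. 0)"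
    using q_left by (auto simp: indicator_def)
  ultimately show ?thesis by (simp add: set_lebesgue_integral_def)
qed

lemma z_right: assumes "adm y z (\<lambda>x. of_real (q x) * y x)" "x \<in> I" "d \<le> x" shows "z x = z d"
proof -
  have "z x = z d + (LINT t:{d..<x}|L. of_real (q t) * y t)"
    by (rule primD[OF adm_g[OF assms(1)] d assms(2,3)])
  moreover have "(\<lambda>t. indicator {d..<x} t *\<^sub>R (complex_of_real (q t) * y t)) = (\<lambda>t. 0)"
    using q_right by (auto simp: indicator_def)
  ultimately show ?thesis by (simp add: set_lebesgue_integral_def)
qed

lemma y_left: assumes y: "adm y z (\<lambda>x. of_real (q x) * y x)" and x: "x \<in> I" "x \<le> c"
  shows "y x = y c + z c * of_real (Pl x - Pl c)"
proof -
  have "y c = y x + (LINT t:{x..<c}|T. of_real (s t) * z t)" by (rule primD[OF adm_f[OF y] x(1) c x(2)])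
  also have "(LINT t:{x..<c}|T. of_real (s t) * z t) = (LINT t:{x..<c}|T. z c * of_real (s t))"
  proof (rule set_lebesgue_integral_cong[OF locfin_Ico[OF T x(1) c]], intro allI impI)
    fix t assume t: "t \<in> {x..<c}"
    then have "z t = z c" using betweenI[OF x(1) c, of t] by (intro z_left[OF y]) auto
    then show "of_real (s t) * z t = z c * of_real (s t)" by simp
  qed
  also have "\<dots> = z c * (of_real (Pl c) - of_real (Pl x))"
    using primD[OF prim_Pl x(1) c x(2)] by simp
  finally show ?thesis by (simp add: algebra_simps)
qed

lemma y_right: assumes y: "adm y z (\<lambda>x. of_real (q x) * y x)" and x: "x \<in> I" "d \<le> x"
  shows "y x = y d + z d * of_real (Pl x - Pl d)"
proof -
  have "y x = y d + (LINT t:{d..<x}|T. of_real (s t) * z t)" by (rule primD[OF adm_f[OF y] d x])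
  also have "(LINT t:{d..<x}|T. of_real (s t) * z t) = (LINT t:{d..<x}|T. z d * of_real (s t))"
  proof (rule set_lebesgue_integral_cong[OF locfin_Ico[OF T d x(1)]], intro allI impI)
    fix t assume t: "t \<in> {d..<x}"
    then have "z t = z d" using betweenI[OF d x(1), of t] by (intro z_right[OF y]) auto
    then show "of_real (s t) * z t = z d * of_real (s t)" by simp
  qed
  also have "\<dots> = z d * (of_real (Pl x) - of_real (Pl d))"
    using primD[OF prim_Pl d x] by simp
  finally show ?thesis by simp
qed

lemma y_left_vals: "x \<in> I \<Longrightarrow> x \<le> c \<Longrightarrow> y1 x = 1" "x \<in> I \<Longrightarrow> x \<le> c \<Longrightarrow> y2 x = of_real (Pl x - Pl c)"
  using y_left[OF adm1] y_left[OF adm2] by (simp_all add: init)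

text \<open>The pairing of \<open>y1, y2\<close> with indicators has rank two to the left of \<open>c\<close>: otherwise
  \<open>\<integral>\<^sub>\<alpha>\<^sup>\<gamma> y2\<close> is linear in \<open>\<gamma>\<close>, so that \<open>P\<close> is constant on \<open>(\<alpha>, c)\<close>.\<close>

lemma rank_two:
  assumes \<alpha>: "\<alpha> \<in> I" "\<alpha> < c"
  obtains \<gamma> where "\<alpha> < \<gamma>" "\<gamma> \<le> c"
    "(LINT t:{\<alpha>..<c}|L. y1 t) * (LINT t:{\<alpha>..<\<gamma>}|L. y2 t) \<noteq> (LINT t:{\<alpha>..<\<gamma>}|L. y1 t) * (LINT t:{\<alpha>..<c}|L. y2 t)"
proof (rule ccontr)
  assume nt: "\<not> thesis"
  note goal = that
  have eq: "(LINT t:{\<alpha>..<c}|L. y1 t) * (LINT t:{\<alpha>..<\<gamma>}|L. y2 t) = (LINT t:{\<alpha>..<\<gamma>}|L. y1 t) * (LINT t:{\<alpha>..<c}|L. y2 t)"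
    if "\<alpha> < \<gamma>" "\<gamma> \<le> c" for \<gamma>
    by (rule ccontr) (rule notE[OF nt goal[OF that]])
  have inI: "t \<in> I" if "\<alpha> \<le> t" "t \<le> c" for t by (rule betweenI[OF \<alpha>(1) c that])
  have i1: "(LINT t:{\<alpha>..<\<gamma>}|L. y1 t) = of_real (\<gamma> - \<alpha>)" if "\<alpha> \<le> \<gamma>" "\<gamma> \<le> c" for \<gamma>
  proof -
    have "(LINT t:{\<alpha>..<\<gamma>}|L. y1 t) = (LINT t:{\<alpha>..<\<gamma>}|L. 1)"
      using that by (intro set_lebesgue_integral_cong locfin_Ico[OF locfin_L] \<alpha> inI allI impI y_left_vals) auto
    then show ?thesis using integral_one[OF \<alpha>(1) inI[OF that] that(1)] by simp
  qed
  have ly: "locint L y2" using locint_y(2)[OF locint_one[OF locfin_L]] by simp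
  \<comment> \<open>\<open>k\<close> is the mean of \<open>y2\<close> on
    \<open>{\<alpha>..<c}\<close>. As \<open>y1 = 1\<close> there, failure of rank two says that the
    mean over every \<open>{\<alpha>..<\<gamma>}\<close> has this value.\<close>
  define k where "k = (LINT t:{\<alpha>..<c}|L. y2 t) / of_real (c - \<alpha>)"
  have Y: "(LINT t:{\<alpha>..<\<gamma>}|L. y2 t) = of_real (\<gamma> - \<alpha>) * k" if "\<alpha> \<le> \<gamma>" "\<gamma> \<le> c" for \<gamma>
  proof (cases "\<gamma> = \<alpha>")
    case True then show ?thesis by (simp add: set_lebesgue_integral_def)
  next
    case False
    have "of_real (c - \<alpha>) * (LINT t:{\<alpha>..<\<gamma>}|L. y2 t) = of_real (\<gamma> - \<alpha>) * (LINT t:{\<alpha>..<c}|L. y2 t)"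
      using eq[of \<gamma>] i1[of c] i1[of \<gamma>] False that \<alpha>(2) by simp
    moreover have "complex_of_real (c - \<alpha>) \<noteq> 0" using \<alpha>(2) by (simp flip: of_real_diff)
    ultimately show ?thesis unfolding k_def by (simp add: field_simps)
  qed
  \<comment> \<open>By subtraction the means over short intervals \<open>{e..<x}\<close> are
    \<open>k\<close> as well, and left-continuity of \<open>y2\<close> makes them tend to
    \<open>y2 x\<close>.\<close>
  have y2k: "y2 x = k" if x: "\<alpha> < x" "x < c" for x
  proof (rule ccontr)
    assume "y2 x \<noteq> k"
    define \<epsilon> where "\<epsilon> = norm (y2 x - k) / 2"
    have \<epsilon>: "0 < \<epsilon>" using \<open>y2 x \<noteq> k\<close> by (simp add: \<epsilon>_def)
    have xI: "x \<in> I" using inI x by simp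
    have "eventually (\<lambda>t. dist (y2 t) (y2 x) < \<epsilon>) (at_left x)"
      using prim_left_continuous[OF T adm_f[OF adm2] xI] \<epsilon> by (rule tendstoD)
    then obtain b' where b': "b' < x" "\<And>t. b' < t \<Longrightarrow> t < x \<Longrightarrow> dist (y2 t) (y2 x) < \<epsilon>"
      unfolding eventually_at_left_field by blast
    obtain e where e: "max b' \<alpha> < e" "e < x" using dense[of "max b' \<alpha>" x] b' x by auto
    have eI: "e \<in> I" using inI e x by simp
    have split: "(LINT t:{\<alpha>..<x}|L. y2 t) = (LINT t:{\<alpha>..<e}|L. y2 t) + (LINT t:{e..<x}|L. y2 t)"
      using e by (intro set_integrable_Ico_split[OF locfin_L ly \<alpha>(1) xI]) auto
    have i: "(LINT t:{e..<x}|L. y2 t) = of_real (x - e) * k"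
      using split Y[of x] Y[of e] e x by (simp add: algebra_simps)
    have lc: "locint L (\<lambda>t. z * 1)" for z by (rule locint_cmult[OF locint_one[OF locfin_L]])
    have "(LINT t:{e..<x}|L. y2 x * 1 - y2 t) = (LINT t:{e..<x}|L. y2 x * 1) - (LINT t:{e..<x}|L. y2 t)"
      by (rule set_integral_diff(2)[OF locintD[OF lc eI xI] locintD[OF ly eI xI]])
    also have "\<dots> = of_real (x - e) * (y2 x - k)"
      unfolding i set_integral_mult_right integral_one[OF eI xI less_imp_le[OF e(2)]] by (simp add: algebra_simps)
    finally have "norm (of_real (x - e) * (y2 x - k)) = norm (LINT t:{e..<x}|L. y2 x * 1 - y2 t)" by simp
    also have "\<dots> \<le> Re (LINT t:{e..<x}|L. complex_of_real \<epsilon> * 1)"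
    proof (rule norm_integral_dom)
      show "set_integrable L {e..<x} (\<lambda>t. y2 x * 1 - y2 t)"
        by (rule set_integral_diff(1)[OF locintD[OF lc eI xI] locintD[OF ly eI xI]])
      show "set_integrable L {e..<x} (\<lambda>t. complex_of_real \<epsilon> * 1)" by (rule locintD[OF lc eI xI])
      fix t assume "t \<in> {e..<x}"
      then have "dist (y2 t) (y2 x) < \<epsilon>" using e by (intro b'(2)) auto
      then show "norm (y2 x * 1 - y2 t) \<le> Re (complex_of_real \<epsilon> * 1)" by (simp add: dist_norm norm_minus_commute)
    qed
    also have "\<dots> = \<epsilon> * (x - e)"
      unfolding set_integral_mult_right integral_one[OF eI xI less_imp_le[OF e(2)]] by simp
    finally have "(x - e) * norm (y2 x - k) \<le> \<epsilon> * (x - e)" using e by (simp add: norm_mult flip: of_real_diff)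
    then have "norm (y2 x - k) \<le> \<epsilon>" using e by (simp add: mult.commute)
    then show False using \<epsilon> unfolding \<epsilon>_def by simp
  qed
  have "Pl x = Pl c + Re k" if x: "x \<in> {\<alpha><..<c}" for x
  proof -
    have "of_real (Pl x - Pl c) = k" using y2k[of x] y_left_vals(2)[of x] inI[of x] x by simp
    then have "Pl x - Pl c = Re k" by (metis Re_complex_of_real)
    then show ?thesis by simp
  qed
  then show False using Pl_nonconst[OF \<alpha>(1) c \<alpha>(2)] by blast
qed

text \<open>Integrating the relation over \<open>{\<alpha>..<c}\<close> and over
  \<open>{\<alpha>..<\<gamma>}\<close> gives two linear equations for \<open>d1, d2\<close> whose
  determinant is nonzero by \<open>rank_two\<close>.\<close>

lemma independent:
  assumes \<alpha>: "\<alpha> \<in> I" "\<alpha> < c" and ae: "AE t in L. t \<in> {\<alpha>..<c} \<longrightarrow> d1 * y1 t + d2 * y2 t = 0"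
  shows "d1 = 0" "d2 = 0"
proof -
  obtain \<gamma> where \<gamma>: "\<alpha> < \<gamma>" "\<gamma> \<le> c"
    "(LINT t:{\<alpha>..<c}|L. y1 t) * (LINT t:{\<alpha>..<\<gamma>}|L. y2 t) \<noteq> (LINT t:{\<alpha>..<\<gamma>}|L. y1 t) * (LINT t:{\<alpha>..<c}|L. y2 t)"
    by (rule rank_two[OF \<alpha>])
  have ly: "locint L y1" "locint L y2" using locint_y[OF locint_one[OF locfin_L]] by simp_all
  have *: "d1 * (LINT t:{\<alpha>..<x}|L. y1 t) + d2 * (LINT t:{\<alpha>..<x}|L. y2 t) = 0" if x: "\<alpha> < x" "x \<le> c" for x
  proof -
    have xI: "x \<in> I" using betweenI[OF \<alpha>(1) c] x by simp
    note i1 = locintD[OF locint_cmult[OF ly(1)] \<alpha>(1) xI] and i2 = locintD[OF locint_cmult[OF ly(2)] \<alpha>(1) xI]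
    have "d1 * (LINT t:{\<alpha>..<x}|L. y1 t) + d2 * (LINT t:{\<alpha>..<x}|L. y2 t) = (LINT t:{\<alpha>..<x}|L. d1 * y1 t + d2 * y2 t)"
      unfolding set_integral_add(2)[OF i1 i2] set_integral_mult_right ..
    also have "\<dots> = (LINT t|L. 0)"
      unfolding set_lebesgue_integral_def
    proof (rule Bochner_Integration.integral_cong_AE)
      show "(\<lambda>t. indicator {\<alpha>..<x} t *\<^sub>R (d1 * y1 t + d2 * y2 t)) \<in> borel_measurable L"
        using set_integral_add(1)[OF i1 i2] unfolding set_integrable_def by (rule borel_measurable_integrable)
      show "AE t in L. indicator {\<alpha>..<x} t *\<^sub>R (d1 * y1 t + d2 * y2 t) = 0"
        using ae by eventually_elim (use x in \<open>auto simp: indicator_def\<close>)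
    qed simp
    finally show ?thesis by simp
  qed
  let ?a = "LINT t:{\<alpha>..<c}|L. y1 t" and ?b = "LINT t:{\<alpha>..<c}|L. y2 t"
  let ?a' = "LINT t:{\<alpha>..<\<gamma>}|L. y1 t" and ?b' = "LINT t:{\<alpha>..<\<gamma>}|L. y2 t"
  have 1: "d1 * ?a + d2 * ?b = 0" and 2: "d1 * ?a' + d2 * ?b' = 0"
    using *[OF \<alpha>(2) order_refl] *[OF \<gamma>(1,2)] .
  have "d1 * (?a * ?b' - ?a' * ?b) = (d1 * ?a + d2 * ?b) * ?b' - (d1 * ?a' + d2 * ?b') * ?b"
    by (simp add: algebra_simps)
  then show "d1 = 0" using 1 2 \<gamma>(3) by simp
  have "d2 * (?a * ?b' - ?a' * ?b) = (d1 * ?a' + d2 * ?b') * ?a - (d1 * ?a + d2 * ?b) * ?a'"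
    by (simp add: algebra_simps)
  then show "d2 = 0" using 1 2 \<gamma>(3) by simp
qed

end

section \<open>Selfadjointness and symmetry\<close>

lemma L2_inner_diff_right: "f \<in> L2 I \<Longrightarrow> g \<in> L2 I \<Longrightarrow> h \<in> L2 I \<Longrightarrow>
    L2_inner I f (\<lambda>x. g x - h x) = L2_inner I f g - L2_inner I f h"
  unfolding L2_inner_def right_diff_distrib
  by (rule Bochner_Integration.integral_diff) (rule L2_inner_integrable; assumption)+

lemma L2_inner_diff_left: "f \<in> L2 I \<Longrightarrow> g \<in> L2 I \<Longrightarrow> h \<in> L2 I \<Longrightarrow>
    L2_inner I (\<lambda>x. g x - h x) f = L2_inner I g f - L2_inner I h f"
  unfolding L2_inner_def left_diff_distrib complex_cnj_diff
  by (rule Bochner_Integration.integral_diff) (rule L2_inner_integrable; assumption)+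

lemma L2_inner_cmult_right: "L2_inner I f (\<lambda>x. k * g x) = k * L2_inner I f g"
  unfolding L2_inner_def mult.left_commute[of _ k] by (rule integral_mult_right_zero)

lemma L2_inner_cmult_left: "L2_inner I (\<lambda>x. k * g x) f = cnj k * L2_inner I g f"
  unfolding L2_inner_def complex_cnj_mult mult.assoc by (rule integral_mult_right_zero)

lemma L2_inner_cnj: "cnj (L2_inner I f g) = L2_inner I g f"
  unfolding L2_inner_def Bochner_Integration.integral_cnj[symmetric]
  by (rule Bochner_Integration.integral_cong) simp_all

lemma L2_inner_self_zero:
  assumes w: "w \<in> L2 I" and "L2_inner I w w = 0"
  shows "AE x in lebesgue_on I. w x = 0"
proof -
  have i: "integrable (lebesgue_on I) (\<lambda>x. (cmod (w x))\<^sup>2)" using w by (simp add: L2_iff)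
  have "cnj z * z = complex_of_real ((cmod z)\<^sup>2)" for z
    by (metis complex_norm_square mult.commute of_real_power)
  then have "L2_inner I w w = of_real (LINT x|lebesgue_on I. (cmod (w x))\<^sup>2)"
    unfolding L2_inner_def integral_complex_of_real[symmetric] by simp
  then have "(LINT x|lebesgue_on I. (cmod (w x))\<^sup>2) = 0" using assms(2) by simp
  then have "AE x in lebesgue_on I. (cmod (w x))\<^sup>2 = 0"
    using integral_nonneg_eq_0_iff_AE[OF i] by simp
  then show ?thesis by eventually_elim simp
qed

text \<open>If \<open>y\<close> is null, every function is orthogonal to it; otherwise
  \<open>k\<close> is the Fourier coefficient.\<close>

lemma L2_projection:
  assumes y: "y \<in> L2 I" and r: "r \<in> L2 I"
  obtains k where "L2_inner I y (\<lambda>x. r x - k * y x) = 0"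
proof (cases "L2_inner I y y = 0")
  case True
  have "AE x in lebesgue_on I. y x = 0" by (rule L2_inner_self_zero[OF y True])
  then have "AE x in lebesgue_on I. cnj (y x) * r x = 0" by eventually_elim simp
  then have "L2_inner I y r = 0"
    unfolding L2_inner_def by (rule integral_eq_zero_AE)
  then show thesis by (intro that[of 0]) simp
next
  case False
  have "L2_inner I y (\<lambda>x. r x - k * y x) = L2_inner I y r - k * L2_inner I y y" for k
    unfolding L2_inner_diff_right[OF y r L2_cmult[OF y]] L2_inner_cmult_right ..
  with False show thesis
    by (intro that[of "L2_inner I y r / L2_inner I y y"]) (simp only: nonzero_divide_eq_eq, simp)
qed

text \<open>Gram-Schmidt: \<open>y2\<close> is replaced by \<open>y3\<close>, orthogonal to
  \<open>y1\<close>, and \<open>r\<close> is projected successively off \<open>y3\<close> and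
  \<open>y1\<close>. Removing a multiple of \<open>y1\<close> does not disturb orthogonality to
  \<open>y3\<close>, and \<open>y2\<close> is a combination of \<open>y1\<close> and
  \<open>y3\<close>.\<close>

lemma L2_projection2:
  assumes y1: "y1 \<in> L2 I" and y2: "y2 \<in> L2 I" and r: "r \<in> L2 I"
  obtains k1 k2 where "L2_inner I y1 (\<lambda>x. r x - k1 * y1 x - k2 * y2 x) = 0"
    "L2_inner I y2 (\<lambda>x. r x - k1 * y1 x - k2 * y2 x) = 0"
proof -
  obtain k where k: "L2_inner I y1 (\<lambda>x. y2 x - k * y1 x) = 0" by (rule L2_projection[OF y1 y2])
  define y3 where "y3 x = y2 x - k * y1 x" for x
  have y3: "y3 \<in> L2 I" unfolding y3_def[abs_def] by (intro L2_diff L2_cmult y1 y2)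
  have k: "L2_inner I y1 y3 = 0" using k by (simp add: y3_def[abs_def])
  obtain m where m: "L2_inner I y3 (\<lambda>x. r x - m * y3 x) = 0" by (rule L2_projection[OF y3 r])
  have r': "(\<lambda>x. r x - m * y3 x) \<in> L2 I" by (intro L2_diff L2_cmult r y3)
  obtain n where n: "L2_inner I y1 (\<lambda>x. r x - m * y3 x - n * y1 x) = 0" by (rule L2_projection[OF y1 r'])
  have r'': "(\<lambda>x. r x - m * y3 x - n * y1 x) \<in> L2 I" by (intro L2_diff L2_cmult r y3 y1)
  have "L2_inner I y3 (\<lambda>x. r x - m * y3 x - n * y1 x) = 0 - n * L2_inner I y3 y1"
    unfolding L2_inner_diff_right[OF y3 r' L2_cmult[OF y1]] m L2_inner_cmult_right ..
  also have "L2_inner I y3 y1 = 0" using k L2_inner_cnj[of I y1 y3] by simp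
  finally have 3: "L2_inner I y3 (\<lambda>x. r x - m * y3 x - n * y1 x) = 0" by simp
  have "L2_inner I (\<lambda>x. y2 x - k * y1 x) (\<lambda>x. r x - m * y3 x - n * y1 x) = 0"
    using 3 by (simp add: y3_def[abs_def])
  then have 2: "L2_inner I y2 (\<lambda>x. r x - m * y3 x - n * y1 x) = 0"
    unfolding L2_inner_diff_left[OF r'' y2 L2_cmult[OF y1]] L2_inner_cmult_left n by simp
  have eq: "(\<lambda>x. r x - m * y3 x - n * y1 x) = (\<lambda>x. r x - (n - m * k) * y1 x - m * y2 x)"
    by (simp add: y3_def fun_eq_iff algebra_simps)
  show thesis by (rule that[of "n - m * k" m]) (use n 2 in \<open>simp_all add: eq\<close>)
qed

context sl_solutions begin

section \<open>The adjoint is a restriction of the maximal operator\<close>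

lemma lagrange_source:
  assumes "adm f g (\<lambda>x. of_real (q x) * f x - v x)" "adm \<phi> \<psi> (\<lambda>x. of_real (q x) * \<phi> x - w x)"
  shows "prim L (\<lambda>x. f x * \<psi> x - \<phi> x * g x) (\<lambda>x. \<phi> x * v x - f x * w x)"
  by (rule prim_cong[OF lagrange[OF assms]]) (simp_all add: algebra_simps)

lemma adm_cnj_source:
  assumes "adm f g (\<lambda>x. of_real (q x) * f x - v x)"
  shows "adm (\<lambda>x. cnj (f x)) (\<lambda>x. cnj (g x)) (\<lambda>x. of_real (q x) * cnj (f x) - cnj (v x))"
  using adm_cnj[OF assms] by simp

lemma in_maximal:
  assumes "adm f g (\<lambda>x. of_real (q x) * f x - v x)" "f \<in> L2 I" "v \<in> L2 I"
  shows "(f, v) \<in> maximal_operator I P q"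
  unfolding maximal_operator_iff using assms
  by (intro conjI exI[of _ f] exI[of _ g] exI[of _ "\<lambda>x. of_real (q x) * f x - v x"]) simp_all

lemma cnj_measurable:
  assumes f: "f \<in> borel_measurable M" shows "(\<lambda>x. cnj (f x)) \<in> borel_measurable M"
proof -
  have "cnj \<in> borel_measurable borel" by (intro borel_measurable_continuous_onI continuous_intros)
  from measurable_compose[OF f this] show ?thesis .
qed

lemma trunc_L2:
  assumes "f \<in> borel_measurable L" "y \<in> I" "x \<in> I" "set_integrable L {y..<x} (\<lambda>t. (cmod (f t))\<^sup>2)"
  shows "(\<lambda>t. indicator {y..<x} t *\<^sub>R f t) \<in> borel_measurable L" "(\<lambda>t. indicator {y..<x} t *\<^sub>R f t) \<in> L2 I"
proof -
  show m: "(\<lambda>t. indicator {y..<x} t *\<^sub>R f t) \<in> borel_measurable L"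
    by (intro borel_measurable_scaleR borel_measurable_indicator locfin_Ico[OF locfin_L] assms)
  have "(\<lambda>t. (cmod (indicator {y..<x} t *\<^sub>R f t))\<^sup>2) = (\<lambda>t. indicator {y..<x} t *\<^sub>R (cmod (f t))\<^sup>2)"
    by (auto simp: indicator_def fun_eq_iff)
  then show "(\<lambda>t. indicator {y..<x} t *\<^sub>R f t) \<in> L2 I"
    using assms(4) by (simp add: L2_L[OF m] set_integrable_def)
qed

lemma adm_square_integrable:
  assumes "adm f g h" "y \<in> I" "x \<in> I"
  shows "set_integrable L {y..<x} (\<lambda>t. (cmod (f t))\<^sup>2)"
proof -
  obtain D where "\<forall>t\<in>{y..<x}. cmod (f t) \<le> D"
    using prim_locally_bounded[OF T adm_f[OF assms(1)] assms(2,3)] by blast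
  then show ?thesis by (intro bounded_L2_Ico[OF adm_measurable(1)[OF assms(1)] assms(2,3)]) blast
qed

text \<open>On \<open>{\<alpha>..<\<beta>}\<close> let \<open>w\<close> be the part of
  \<open>u - f0\<close> orthogonal to \<open>y1\<close> and \<open>y2\<close>. Orthogonality makes
  the solution \<open>vc \<alpha> w\<close> vanish beyond \<open>\<beta>\<close>, so it may be used
  as a test function. Testing \<open>u\<close> against it and applying the Lagrange identity to
  \<open>f0\<close> shows that \<open>w\<close> is orthogonal to \<open>u - f0\<close>, hence to
  itself.\<close>

lemma adjoint_local:
  assumes uv: "(u, v) \<in> adjoint_graph I (maximal_operator I P q)"
    and um: "u \<in> borel_measurable L" and vm: "v \<in> borel_measurable L"
    and f0: "adm f0 g0 (\<lambda>x. of_real (q x) * f0 x - v x)"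
    and \<alpha>\<beta>: "\<alpha> \<in> I" "\<beta> \<in> I" "\<alpha> < \<beta>"
  obtains k1 k2 where "AE x in L. x \<in> {\<alpha>..<\<beta>} \<longrightarrow> u x = f0 x + k1 * y1 x + k2 * y2 x"
proof -
  let ?J = "{\<alpha>..<\<beta>}"
  let ?tr = "\<lambda>f t. indicator ?J t *\<^sub>R (f t :: complex)"
  have uL: "u \<in> L2 I" and vL: "v \<in> L2 I" using uv by (simp_all add: adjoint_iff)
  have JL: "?J \<in> sets L" by (rule locfin_Ico[OF locfin_L \<alpha>\<beta>(1,2)])
  note trY1 = trunc_L2[OF adm_measurable(1)[OF adm1] \<alpha>\<beta>(1,2) adm_square_integrable[OF adm1 \<alpha>\<beta>(1,2)]]
  note trY2 = trunc_L2[OF adm_measurable(1)[OF adm2] \<alpha>\<beta>(1,2) adm_square_integrable[OF adm2 \<alpha>\<beta>(1,2)]]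
  note trf0 = trunc_L2[OF adm_measurable(1)[OF f0] \<alpha>\<beta>(1,2) adm_square_integrable[OF f0 \<alpha>\<beta>(1,2)]]
  have "integrable L (\<lambda>t. (cmod (u t))\<^sup>2)" using uL L2_L[OF um] by simp
  note tru = trunc_L2[OF um \<alpha>\<beta>(1,2) set_integrable_sub[OF this JL]]
  define r0 where "r0 t = ?tr u t - ?tr f0 t" for t
  have r0: "r0 \<in> L2 I" "r0 \<in> borel_measurable L"
    unfolding r0_def[abs_def] using L2_diff[OF tru(2) trf0(2)] borel_measurable_diff[OF tru(1) trf0(1)] .
  obtain k1 k2 where k: "L2_inner I (?tr y1) (\<lambda>x. r0 x - k1 * ?tr y1 x - k2 * ?tr y2 x) = 0"
    "L2_inner I (?tr y2) (\<lambda>x. r0 x - k1 * ?tr y1 x - k2 * ?tr y2 x) = 0"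
    by (rule L2_projection2[OF trY1(2) trY2(2) r0(1)])
  define w where "w x = r0 x - k1 * ?tr y1 x - k2 * ?tr y2 x" for x
  have wL: "w \<in> L2 I" unfolding w_def[abs_def] by (intro L2_diff L2_cmult r0 trY1 trY2)
  have wm: "w \<in> borel_measurable L" unfolding w_def[abs_def]
    by (intro borel_measurable_diff borel_measurable_times borel_measurable_const r0 trY1 trY2)
  have w0: "w t = 0" if "t \<notin> ?J" for t using that by (simp add: w_def r0_def)
  have k: "L2_inner I (?tr y1) w = 0" "L2_inner I (?tr y2) w = 0" using k by (simp_all add: w_def[abs_def])
  have lw: "locint L w" by (rule L2_locint[OF wm wL])
  have orth: "(LINT t:?J|L. y1 t * w t) = 0" "(LINT t:?J|L. y2 t * w t) = 0"
  proof -
    have "L2_inner I (?tr y1) w = (LINT t:?J|L. y1 t * w t)"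
      unfolding L2_inner_L[OF trY1(1) wm] set_lebesgue_integral_def
      by (intro Bochner_Integration.integral_cong) (simp_all add: real_y)
    then show "(LINT t:?J|L. y1 t * w t) = 0" using k by simp
    have "L2_inner I (?tr y2) w = (LINT t:?J|L. y2 t * w t)"
      unfolding L2_inner_L[OF trY2(1) wm] set_lebesgue_integral_def
      by (intro Bochner_Integration.integral_cong) (simp_all add: real_y)
    then show "(LINT t:?J|L. y2 t * w t) = 0" using k by simp
  qed
  define \<phi> \<psi> where "\<phi> = vc \<alpha> w" and "\<psi> = vd \<alpha> w"
  have \<phi>: "adm \<phi> \<psi> (\<lambda>x. of_real (q x) * \<phi> x - w x)"
    unfolding \<phi>_def \<psi>_def by (rule vc_adm[OF lw \<alpha>\<beta>(1)])
  have l0: "osint L \<alpha> (\<lambda>t. y t * w t) x = 0" if "x \<le> \<alpha>" for x y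
    by (rule osint_left_zero[OF w0 that]) simp
  \<comment> \<open>Beyond \<open>\<beta>\<close> the two coefficients of \<open>vc\<close> are the
    pairings of \<open>w\<close> with \<open>y1\<close> and \<open>y2\<close>, which vanish.\<close>
  have r0': "osint L \<alpha> (\<lambda>t. y1 t * w t) x = 0" "osint L \<alpha> (\<lambda>t. y2 t * w t) x = 0" if "\<beta> \<le> x" for x
    using osint_supported[OF w0 less_imp_le[OF \<alpha>\<beta>(3)] that] orth by simp_all
  have \<phi>0: "\<phi> x = 0" "\<psi> x = 0" if "x \<le> \<alpha> \<or> \<beta> \<le> x" for x
    using that l0 r0' unfolding \<phi>_def \<psi>_def vc_def vd_def by auto
  obtain D where D: "\<forall>t\<in>?J. cmod (\<phi> t) \<le> D"
    using prim_locally_bounded[OF T adm_f[OF \<phi>] \<alpha>\<beta>(1,2)] by blast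
  have \<phi>L: "\<phi> \<in> L2 I"
    by (rule L2_supported[OF adm_measurable(1)[OF \<phi>] \<alpha>\<beta>(1,2), of D]) (use D \<phi>0 in auto)
  have "(\<phi>, w) \<in> maximal_operator I P q" by (rule in_maximal[OF \<phi> \<phi>L wL])
  then have inner: "L2_inner I u w = L2_inner I v \<phi>" using uv by (simp add: adjoint_iff)
  have e1: "L2_inner I u w = (LINT t:?J|L. cnj (u t) * w t)"
    unfolding L2_inner_L[OF um wm] by (rule integral_supported) (simp add: w0)
  have e2: "L2_inner I v \<phi> = (LINT t:?J|L. cnj (v t) * \<phi> t)"
    unfolding L2_inner_L[OF vm adm_measurable(1)[OF \<phi>]]
  proof (rule integral_supported)
    fix t assume "t \<notin> ?J"
    then have "t \<le> \<alpha> \<or> \<beta> \<le> t" by auto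
    then show "cnj (v t) * \<phi> t = 0" by (simp add: \<phi>0)
  qed
  note lag = lagrange_source[OF adm_cnj_source[OF f0] \<phi>]
  have z: "(LINT t:?J|L. \<phi> t * cnj (v t) - cnj (f0 t) * w t) = 0"
    using primD[OF lag \<alpha>\<beta>(1,2) less_imp_le[OF \<alpha>\<beta>(3)]] \<phi>0[of \<alpha>] \<phi>0[of \<beta>] by simp
  have i1: "locint L (\<lambda>t. \<phi> t * cnj (v t))"
    by (rule locint_prim_mult[OF T locfin_L adm_f[OF \<phi>]]) (rule L2_locint[OF cnj_measurable[OF vm] L2_cnj[OF vL]])
  have i2: "locint L (\<lambda>t. cnj (f0 t) * w t)"
    by (rule locint_prim_mult[OF T locfin_L adm_f[OF adm_cnj_source[OF f0]] lw])
  have e3: "(LINT t:?J|L. \<phi> t * cnj (v t)) = (LINT t:?J|L. cnj (f0 t) * w t)"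
    using z set_integral_diff(2)[OF locintD[OF i1 \<alpha>\<beta>(1,2)] locintD[OF i2 \<alpha>\<beta>(1,2)]] by simp
  have i3: "set_integrable L ?J (\<lambda>t. cnj (u t) * w t)"
  proof (rule set_integrable_sub[OF _ JL])
    have m: "(\<lambda>t. cnj (u t) * w t) \<in> borel_measurable L"
      by (intro borel_measurable_times cnj_measurable um wm)
    show "integrable L (\<lambda>t. cnj (u t) * w t)"
      using L2_inner_integrable[OF uL wL] lebesgue_on_L(2)[OF borel_I m] by simp
  qed
  have "L2_inner I r0 w = (LINT t:?J|L. cnj (u t) * w t - cnj (f0 t) * w t)"
    unfolding L2_inner_L[OF r0(2) wm] set_lebesgue_integral_def
    by (intro Bochner_Integration.integral_cong) (auto simp: r0_def indicator_def algebra_simps w0)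
  also have "\<dots> = (LINT t:?J|L. cnj (u t) * w t) - (LINT t:?J|L. cnj (f0 t) * w t)"
    by (rule set_integral_diff(2)[OF i3 locintD[OF i2 \<alpha>\<beta>(1,2)]])
  also have "\<dots> = 0"
    using inner e1 e2 e3 by (simp add: mult.commute)
  finally have r0w: "L2_inner I r0 w = 0" .
  \<comment> \<open>\<open>w\<close> differs from \<open>r0\<close> by multiples of the truncated
    solutions, to which it is orthogonal.\<close>
  have "L2_inner I w w = 0"
  proof -
    have "L2_inner I (\<lambda>x. r0 x - k1 * ?tr y1 x - k2 * ?tr y2 x) w = 0"
      unfolding L2_inner_diff_left[OF wL L2_diff[OF r0(1) L2_cmult[OF trY1(2)]] L2_cmult[OF trY2(2)]]
        L2_inner_diff_left[OF wL r0(1) L2_cmult[OF trY1(2)]] L2_inner_cmult_left k r0w by simp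
    then show ?thesis by (simp add: w_def[abs_def])
  qed
  from L2_inner_self_zero[OF wL this] have "AE x in L. w x = 0" unfolding AE_lebesgue_on_L[OF borel_I] .
  then have "AE x in L. x \<in> ?J \<longrightarrow> u x = f0 x + k1 * y1 x + k2 * y2 x"
  proof eventually_elim
    case (elim x)
    show ?case
    proof
      assume "x \<in> ?J"
      with elim have "u x - f0 x - k1 * y1 x - k2 * y2 x = 0" by (simp add: w_def r0_def)
      then show "u x = f0 x + k1 * y1 x + k2 * y2 x" by (simp add: algebra_simps)
    qed
  qed
  then show thesis by (rule that)
qed

text \<open>Locally \<open>u\<close> is a particular solution plus a combination of
  \<open>y1, y2\<close>. Independence on one fixed interval makes the coefficients agree for all
  intervals of an exhaustion, so the representation is global.\<close>

lemma adjoint_subset: "adjoint_graph I (maximal_operator I P q) \<subseteq> maximal_operator I P q"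
proof (rule subrelI)
  fix u v assume uv: "(u, v) \<in> adjoint_graph I (maximal_operator I P q)"
  then have L2: "u \<in> L2 I" "v \<in> L2 I" by (simp_all add: adjoint_iff)
  obtain u' where u': "u' \<in> borel_measurable L" "u' \<in> L2 I" "AE x in lebesgue_on I. u x = u' x"
    by (rule L2_borel_rep[OF L2(1)])
  obtain v' where v': "v' \<in> borel_measurable L" "v' \<in> L2 I" "AE x in lebesgue_on I. v x = v' x"
    by (rule L2_borel_rep[OF L2(2)])
  have uv': "(u', v') \<in> adjoint_graph I (maximal_operator I P q)"
    unfolding adjoint_iff
  proof (intro conjI u' v' allI impI)
    fix f g assume fg: "(f, g) \<in> maximal_operator I P q"
    then have fgL: "f \<in> L2 I" "g \<in> L2 I" using maximal_operator_L2 by blast+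
    have "L2_inner I u' g = L2_inner I u g"
      by (rule L2_inner_cong) (use u' L2 fgL in auto)
    moreover have "L2_inner I v' f = L2_inner I v f"
      by (rule L2_inner_cong) (use v' L2 fgL in auto)
    ultimately show "L2_inner I u' g = L2_inner I v' f" using uv fg by (simp add: adjoint_iff)
  qed
  note f0 = vc_adm[OF L2_locint[OF v'(1,2)] c]
  obtain \<alpha>0 where \<alpha>0: "\<alpha>0 \<in> I" "\<alpha>0 < c" by (rule smaller[OF c])
  obtain l r :: "nat \<Rightarrow> real" where lr: "I = (\<Union>n. {l n..<r n})" "\<And>n. l n \<in> I" "\<And>n. r n \<in> I"
    by (rule exhaust) (rule that; assumption)
  \<comment> \<open>The exhausting intervals are enlarged to contain \<open>{\<alpha>0..<c}\<close>,
    on which \<open>independent\<close> compares their coefficients.\<close>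
  define \<alpha> \<beta> where "\<alpha> n = min (l n) \<alpha>0" and "\<beta> n = max (r n) c" for n
  have \<alpha>\<beta>: "\<alpha> n \<in> I" "\<beta> n \<in> I" "\<alpha> n < \<beta> n" for n
    using lr(2,3)[of n] \<alpha>0 c by (auto simp: \<alpha>_def \<beta>_def min_def max_def)
  have ex: "\<exists>k. AE x in L. x \<in> {\<alpha> n..<\<beta> n} \<longrightarrow> u' x = vc c v' x + fst k * y1 x + snd k * y2 x" for n
  proof -
    obtain k1 k2 where "AE x in L. x \<in> {\<alpha> n..<\<beta> n} \<longrightarrow> u' x = vc c v' x + k1 * y1 x + k2 * y2 x"
      by (rule adjoint_local[OF uv' u'(1) v'(1) f0 \<alpha>\<beta>])
    then show ?thesis by (intro exI[of _ "(k1, k2)"]) simp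
  qed
  have "\<exists>k. \<forall>n. AE x in L. x \<in> {\<alpha> n..<\<beta> n} \<longrightarrow> u' x = vc c v' x + fst (k n) * y1 x + snd (k n) * y2 x"
    by (rule choice, rule allI, rule ex)
  then obtain k where "\<forall>n. AE x in L. x \<in> {\<alpha> n..<\<beta> n} \<longrightarrow> u' x = vc c v' x + fst (k n) * y1 x + snd (k n) * y2 x"
    by (rule exE)
  note k = spec[OF this]
  have keq: "k n = k 0" for n
  proof -
    have "AE x in L. x \<in> {\<alpha>0..<c} \<longrightarrow> (fst (k n) - fst (k 0)) * y1 x + (snd (k n) - snd (k 0)) * y2 x = 0"
      using k[of n] k[of 0]
    proof eventually_elim
      case (elim x)
      show ?case
      proof
        assume x: "x \<in> {\<alpha>0..<c}"
        then have "x \<in> {\<alpha> n..<\<beta> n}" "x \<in> {\<alpha> 0..<\<beta> 0}" by (auto simp: \<alpha>_def \<beta>_def)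
        with elim have un: "u' x = vc c v' x + fst (k n) * y1 x + snd (k n) * y2 x"
          and u0: "u' x = vc c v' x + fst (k 0) * y1 x + snd (k 0) * y2 x" by blast+
        have "(fst (k n) - fst (k 0)) * y1 x + (snd (k n) - snd (k 0)) * y2 x = u' x - u' x"
          by (subst un, subst u0) (simp add: algebra_simps)
        then show "(fst (k n) - fst (k 0)) * y1 x + (snd (k n) - snd (k 0)) * y2 x = 0" by simp
      qed
    qed
    from independent[OF \<alpha>0 this] show ?thesis by (simp add: prod_eq_iff)
  qed
  have k0: "AE x in L. x \<in> {\<alpha> n..<\<beta> n} \<longrightarrow> u' x = vc c v' x + fst (k 0) * y1 x + snd (k 0) * y2 x" for n
    using k[of n] unfolding keq[of n] .
  have "AE x in L. \<forall>n. x \<in> {\<alpha> n..<\<beta> n} \<longrightarrow> u' x = vc c v' x + fst (k 0) * y1 x + snd (k 0) * y2 x"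
    by (rule AE_all_countable[THEN iffD2], rule allI) (rule k0)
  then have "AE x in L. u' x = vc c v' x + fst (k 0) * y1 x + snd (k 0) * y2 x"
  proof (rule AE_mp, intro AE_I2 impI)
    fix x assume x: "x \<in> space L" and
      A: "\<forall>n. x \<in> {\<alpha> n..<\<beta> n} \<longrightarrow> u' x = vc c v' x + fst (k 0) * y1 x + snd (k 0) * y2 x"
    have "x \<in> (\<Union>n. {l n..<r n})" using x unfolding locfin_space[OF locfin_L] by (subst lr(1)[symmetric])
    then obtain n where "x \<in> {l n..<r n}" by blast
    then have "x \<in> {\<alpha> n..<\<beta> n}" by (auto simp: \<alpha>_def \<beta>_def)
    with A show "u' x = vc c v' x + fst (k 0) * y1 x + snd (k 0) * y2 x" by blast
  qed
  then have ae: "AE x in lebesgue_on I. u' x = vc c v' x + fst (k 0) * y1 x + snd (k 0) * y2 x"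
    unfolding AE_lebesgue_on_L[OF borel_I] .
  let ?f = "\<lambda>x. vc c v' x + fst (k 0) * y1 x + snd (k 0) * y2 x"
  let ?g = "\<lambda>x. vd c v' x + fst (k 0) * z1 x + snd (k 0) * z2 x"
  have "adm ?f ?g (\<lambda>x. (of_real (q x) * vc c v' x - v' x) + fst (k 0) * (of_real (q x) * y1 x) + snd (k 0) * (of_real (q x) * y2 x))"
    by (intro adm_add adm_cmult f0 adm1 adm2)
  moreover have "AE x in lebesgue_on I. u x = ?f x" using u'(3) ae by eventually_elim simp
  moreover have "AE x in lebesgue_on I. v x = - ((of_real (q x) * vc c v' x - v' x) + fst (k 0) * (of_real (q x) * y1 x) + snd (k 0) * (of_real (q x) * y2 x)) + of_real (q x) * ?f x"
    using v'(3) by eventually_elim (simp add: algebra_simps)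
  ultimately show "(u, v) \<in> maximal_operator I P q"
    unfolding maximal_operator_iff using L2 by blast
qed

section \<open>Selfadjointness as symmetry, and its failure when 1 and P are square integrable at an
  endpoint\<close>

lemma selfadjoint_iff_symmetric:
  "maximal_operator I P q = adjoint_graph I (maximal_operator I P q) \<longleftrightarrow>
    (\<forall>f v f' v'. (f, v) \<in> maximal_operator I P q \<longrightarrow> (f', v') \<in> maximal_operator I P q \<longrightarrow>
      L2_inner I f v' = L2_inner I v f')"
proof
  assume "maximal_operator I P q = adjoint_graph I (maximal_operator I P q)"
  then show "\<forall>f v f' v'. (f, v) \<in> maximal_operator I P q \<longrightarrow> (f', v') \<in> maximal_operator I P q \<longrightarrow>
      L2_inner I f v' = L2_inner I v f'"
    by (metis adjoint_iff)
next
  assume A: "\<forall>f v f' v'. (f, v) \<in> maximal_operator I P q \<longrightarrow> (f', v') \<in> maximal_operator I P q \<longrightarrow>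
      L2_inner I f v' = L2_inner I v f'"
  have "maximal_operator I P q \<subseteq> adjoint_graph I (maximal_operator I P q)"
  proof (rule subrelI)
    fix u v assume "(u, v) \<in> maximal_operator I P q"
    then show "(u, v) \<in> adjoint_graph I (maximal_operator I P q)"
      unfolding adjoint_iff using A maximal_operator_L2 by blast
  qed
  with adjoint_subset show "maximal_operator I P q = adjoint_graph I (maximal_operator I P q)" by blast
qed

text \<open>With base point \<open>e = \<alpha>\<close> the solutions vanish to the left of the
  sources and are combinations of \<open>y1, y2\<close> to the right; with \<open>e = c\<close> the
  sides are exchanged. Two indicator sources give solutions whose Wronskian on the nonzero side is,
  up to sign, the determinant of \<open>rank_two\<close>, while symmetry would force it to
  vanish.\<close>

lemma test_functions:
  assumes e: "e \<in> {\<alpha>, c}" and \<alpha>: "\<alpha> \<in> I" "\<alpha> < c"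
    and L2: "\<And>w. w \<in> borel_measurable L \<Longrightarrow> (\<And>t. t \<notin> {\<alpha>..<c} \<Longrightarrow> w t = 0) \<Longrightarrow> locint L w \<Longrightarrow> vc e w \<in> L2 I"
    and sa: "maximal_operator I P q = adjoint_graph I (maximal_operator I P q)"
  shows False
proof -
  obtain \<gamma> where \<gamma>: "\<alpha> < \<gamma>" "\<gamma> \<le> c"
    "(LINT t:{\<alpha>..<c}|L. y1 t) * (LINT t:{\<alpha>..<\<gamma>}|L. y2 t) \<noteq> (LINT t:{\<alpha>..<\<gamma>}|L. y1 t) * (LINT t:{\<alpha>..<c}|L. y2 t)"
    by (rule rank_two[OF \<alpha>])
  have \<gamma>I: "\<gamma> \<in> I" using betweenI[OF \<alpha>(1) c] \<gamma> by simp
  have eI: "e \<in> I" using e \<alpha>(1) c by auto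
  define w :: "real \<Rightarrow> real \<Rightarrow> complex" where "w x t = indicator {\<alpha>..<x} t" for x t
  have wm: "w x \<in> borel_measurable L" if "x \<in> I" for x
    unfolding w_def[abs_def] by (intro borel_measurable_indicator locfin_Ico[OF locfin_L \<alpha>(1) that])
  have w0: "w x t = 0" if "t \<notin> {\<alpha>..<c}" "x \<le> c" for x t using that by (auto simp: w_def)
  have wL: "w x \<in> L2 I" if "x \<in> I" for x
    by (rule L2_supported[OF wm[OF that] \<alpha>(1) that, of 1]) (auto simp: w_def)
  have lw: "locint L (w x)" if "x \<in> I" for x by (rule L2_locint[OF wm[OF that] wL[OF that]])
  have val: "(LINT t:{\<alpha>..<c}|L. y t * w x t) = (LINT t:{\<alpha>..<x}|L. y t)" if "x \<le> c" for x y
    unfolding set_lebesgue_integral_def using that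
    by (intro Bochner_Integration.integral_cong) (auto simp: w_def indicator_def)
  note adm = vc_adm[OF lw eI]
  have mx: "(vc e (w x), w x) \<in> maximal_operator I P q" if "x \<in> I" "x \<le> c" for x
    by (rule in_maximal[OF adm[OF that(1)] L2[OF wm[OF that(1)] w0[OF _ that(2)] lw[OF that(1)]] wL[OF that(1)]])
  let ?\<phi> = "vc e (w c)" and ?\<phi>' = "vc e (w \<gamma>)" and ?\<psi> = "vd e (w c)" and ?\<psi>' = "vd e (w \<gamma>)"
  have "(?\<phi>, w c) \<in> adjoint_graph I (maximal_operator I P q)" using mx[OF c order_refl] sa by simp
  then have inner: "L2_inner I ?\<phi> (w \<gamma>) = L2_inner I (w c) ?\<phi>'"
    using mx[OF \<gamma>I \<gamma>(2)] by (simp add: adjoint_iff)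
  have e1: "L2_inner I ?\<phi> (w \<gamma>) = (LINT t:{\<alpha>..<c}|L. cnj (?\<phi> t) * w \<gamma> t)"
    unfolding L2_inner_L[OF adm_measurable(1)[OF adm[OF c]] wm[OF \<gamma>I]]
    by (rule integral_supported) (simp add: w0 \<gamma>)
  have e2: "L2_inner I (w c) ?\<phi>' = (LINT t:{\<alpha>..<c}|L. ?\<phi>' t * cnj (w c t))"
    unfolding L2_inner_L[OF wm[OF c] adm_measurable(1)[OF adm[OF \<gamma>I]]] mult.commute[of "cnj _"]
    by (rule integral_supported) (simp add: w0)
  note ac = adm_cnj_source[OF adm[OF c]]
  have i1: "locint L (\<lambda>t. ?\<phi>' t * cnj (w c t))"
    by (rule locint_prim_mult[OF T locfin_L adm_f[OF adm[OF \<gamma>I]]])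
      (rule L2_locint[OF cnj_measurable[OF wm[OF c]] L2_cnj[OF wL[OF c]]])
  have i2: "locint L (\<lambda>t. cnj (?\<phi> t) * w \<gamma> t)"
    by (rule locint_prim_mult[OF T locfin_L adm_f[OF ac] lw[OF \<gamma>I]])
  have "cnj (?\<phi> c) * ?\<psi>' c - ?\<phi>' c * cnj (?\<psi> c) = cnj (?\<phi> \<alpha>) * ?\<psi>' \<alpha> - ?\<phi>' \<alpha> * cnj (?\<psi> \<alpha>) +
      (LINT t:{\<alpha>..<c}|L. ?\<phi>' t * cnj (w c t) - cnj (?\<phi> t) * w \<gamma> t)"
    by (rule primD[OF lagrange_source[OF ac adm[OF \<gamma>I]] \<alpha>(1) c less_imp_le[OF \<alpha>(2)]])
  then have W: "cnj (?\<phi> c) * ?\<psi>' c - ?\<phi>' c * cnj (?\<psi> c) = cnj (?\<phi> \<alpha>) * ?\<psi>' \<alpha> - ?\<phi>' \<alpha> * cnj (?\<psi> \<alpha>)"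
    using set_integral_diff(2)[OF locintD[OF i1 \<alpha>(1) c] locintD[OF i2 \<alpha>(1) c]] e1 e2 inner by simp
  let ?C1 = "LINT t:{\<alpha>..<c}|L. y1 t" and ?C2 = "LINT t:{\<alpha>..<c}|L. y2 t"
  let ?C1' = "LINT t:{\<alpha>..<\<gamma>}|L. y1 t" and ?C2' = "LINT t:{\<alpha>..<\<gamma>}|L. y2 t"
  have creal: "cnj (LINT t:B|L. y t) = (LINT t:B|L. y t)" if "\<And>t. cnj (y t) = y t" for B y
    unfolding set_lebesgue_integral_def Bochner_Integration.integral_cnj[symmetric]
    by (intro Bochner_Integration.integral_cong) (simp_all add: that)
  note cr = creal[of y1, OF real_y(1)] creal[of y2, OF real_y(2)]
  show False
  proof (cases "e = \<alpha>")
    case True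
    have L0: "osint L \<alpha> (\<lambda>t. y t * w x t) \<alpha> = 0" for x y by simp
    have R: "osint L \<alpha> (\<lambda>t. y t * w x t) c = (LINT t:{\<alpha>..<x}|L. y t)" if "x \<le> c" for x y
      using osint_supported[OF w0[OF _ that] less_imp_le[OF \<alpha>(2)] order_refl] val[OF that] by simp
    have "cnj ?C1 * ?C2' = ?C1' * cnj ?C2"
      using W unfolding True vc_def vd_def using R[OF order_refl] R[OF \<gamma>(2)]
      by (simp add: init algebra_simps)
    then show False using \<gamma>(3) by (simp add: cr)
  next
    case False
    then have ec: "e = c" using e by simp
    have R: "osint L c (\<lambda>t. y t * w x t) \<alpha> = - (LINT t:{\<alpha>..<x}|L. y t)" if "x \<le> c" for x y
      using osint_supported_left[OF w0[OF _ that] less_imp_le[OF \<alpha>(2)] order_refl] val[OF that] by simp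
    have z\<alpha>: "z1 \<alpha> = 0" "z2 \<alpha> = 1" "y1 \<alpha> = 1"
      using z_left[OF adm1 \<alpha>(1)] z_left[OF adm2 \<alpha>(1)] y_left_vals(1)[OF \<alpha>(1)] \<alpha>(2) by (simp_all add: init)
    have "cnj ?C1 * ?C2' = ?C1' * cnj ?C2"
      using W unfolding ec vc_def vd_def using R[OF order_refl] R[OF \<gamma>(2)]
      by (simp add: z\<alpha> real_y cr algebra_simps)
    then show False using \<gamma>(3) by (simp add: cr)
  qed
qed

text \<open>A solution that starts from zero at \<open>\<alpha>\<close> vanishes on the left, is
  bounded up to \<open>d\<close> and is a combination of 1 and P beyond \<open>d\<close>. It is
  therefore square integrable, as \<open>test_functions\<close> requires.\<close>

lemma not_selfadjoint_right:
  assumes 1: "set_integrable L {x \<in> I. d < x} (\<lambda>x. 1 :: real)" and P: "set_integrable L {x \<in> I. d < x} (\<lambda>x. (Pl x)\<^sup>2)"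
  shows "maximal_operator I P q \<noteq> adjoint_graph I (maximal_operator I P q)"
proof
  assume sa: "maximal_operator I P q = adjoint_graph I (maximal_operator I P q)"
  let ?R = "{x \<in> I. d < x}"
  have Rb: "?R \<in> sets borel"
  proof -
    have "?R = I \<inter> {d<..}" by auto
    then show ?thesis by simp
  qed
  have RL: "?R \<in> sets L" using Rb by (simp add: sets_L sets_I_iff)
  obtain \<alpha> where \<alpha>: "\<alpha> \<in> I" "\<alpha> < c" by (rule smaller[OF c])
  obtain e where e: "e \<in> I" "d < e" by (rule larger[OF d])
  have Plm: "(\<lambda>x. complex_of_real (Pl x)) \<in> borel_measurable L" by (rule prim_measurable[OF T locfin_L prim_Pl])
  have R1: "(\<lambda>x. complex_of_real (indicator ?R x)) \<in> L2 I"
  proof (subst L2_L)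
    show "(\<lambda>x. complex_of_real (indicator ?R x)) \<in> borel_measurable L"
      by (rule measurable_compose[OF borel_measurable_indicator[OF RL]]) simp
    show "integrable L (\<lambda>x. (cmod (complex_of_real (indicator ?R x)))\<^sup>2)"
      using 1 unfolding set_integrable_def
      by (rule Bochner_Integration.integrable_cong[THEN iffD1, rotated 2]) (auto simp: indicator_def)
  qed
  have R2: "(\<lambda>x. indicator ?R x *\<^sub>R complex_of_real (Pl x)) \<in> L2 I"
  proof (subst L2_L)
    show "(\<lambda>x. indicator ?R x *\<^sub>R complex_of_real (Pl x)) \<in> borel_measurable L"
      by (intro borel_measurable_scaleR borel_measurable_indicator RL Plm)
    show "integrable L (\<lambda>x. (cmod (indicator ?R x *\<^sub>R complex_of_real (Pl x)))\<^sup>2)"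
      using P unfolding set_integrable_def
      by (rule Bochner_Integration.integrable_cong[THEN iffD1, rotated 2]) (auto simp: indicator_def)
  qed
  show False
  proof (rule test_functions[OF _ \<alpha> _ sa, of \<alpha>])
    fix w assume wm: "w \<in> borel_measurable L" and w0: "\<And>t. t \<notin> {\<alpha>..<c} \<Longrightarrow> w t = 0" and lw: "locint L w"
    note adm = vc_adm[OF lw \<alpha>(1)]
    define C1 C2 where "C1 = (LINT t:{\<alpha>..<c}|L. y1 t * w t)" and "C2 = (LINT t:{\<alpha>..<c}|L. y2 t * w t)"
    \<comment> \<open>To the right of \<open>d\<close> the solution is \<open>C2 y1 - C1 y2\<close>;
      inserting the affine expressions of \<open>y1\<close> and \<open>y2\<close> in
      \<open>Pl\<close> gives \<open>K1 + K2 Pl\<close>.\<close>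
    define K1 K2 where "K1 = C2 * (y1 d - z1 d * of_real (Pl d)) - C1 * (y2 d - z2 d * of_real (Pl d))"
      and "K2 = C2 * z1 d - C1 * z2 d"
    define \<phi>1 where "\<phi>1 x = (if x \<le> d then vc \<alpha> w x else 0)" for x
    have \<phi>1: "\<phi>1 \<in> L2 I"
    proof -
      have "\<phi>1 = (\<lambda>x. indicator {x. x \<le> d} x *\<^sub>R vc \<alpha> w x)" by (auto simp: \<phi>1_def fun_eq_iff)
      moreover have "indicat_real {x. x \<le> d} \<in> borel_measurable L"
        by (rule measurable_compose[OF id_measurable[OF locfin_L]]) (rule borel_measurable_indicator, simp)
      ultimately have m: "\<phi>1 \<in> borel_measurable L"
        using adm_measurable(1)[OF adm] by (simp add: borel_measurable_scaleR)
      obtain D where D: "\<forall>t\<in>{\<alpha>..<e}. cmod (vc \<alpha> w t) \<le> D"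
        using prim_locally_bounded[OF T adm_f[OF adm] \<alpha>(1) e(1)] by blast
      show ?thesis
      proof (rule L2_supported[OF m \<alpha>(1) e(1), of "max 0 D"])
        show "cmod (\<phi>1 t) \<le> max 0 D" if "t \<in> {\<alpha>..<e}" for t
          using D that by (auto simp: \<phi>1_def le_max_iff_disj)
        show "\<phi>1 t = 0" if "t \<notin> {\<alpha>..<e}" for t
        proof (cases "t < \<alpha>")
          case True
          then have "vc \<alpha> w t = 0"
            unfolding vc_def using osint_left_zero[of \<alpha> w t] w0 by simp
          then show ?thesis by (simp add: \<phi>1_def)
        next
          case False
          then show ?thesis using that e(2) by (simp add: \<phi>1_def)
        qed
      qed
    qed
    have eq: "vc \<alpha> w x = \<phi>1 x + K1 * of_real (indicator ?R x) + K2 * (indicator ?R x *\<^sub>R of_real (Pl x))" if x: "x \<in> I" for x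
    proof (cases "x \<le> d")
      case True
      then show ?thesis by (simp add: \<phi>1_def)
    next
      case False
      then have "vc \<alpha> w x = C2 * y1 x - C1 * y2 x"
        unfolding vc_def C1_def C2_def using osint_supported[OF w0 less_imp_le[OF \<alpha>(2)], where x=x] c_less_d by simp
      also have "\<dots> = K1 + K2 * of_real (Pl x)"
      proof -
        have dx: "d \<le> x" using False by simp
        show ?thesis unfolding y_right[OF adm1 x dx] y_right[OF adm2 x dx]
          by (simp add: K1_def K2_def algebra_simps)
      qed
      finally show ?thesis using False x by (simp add: \<phi>1_def)
    qed
    have "(\<lambda>x. \<phi>1 x + K1 * of_real (indicator ?R x) + K2 * (indicator ?R x *\<^sub>R of_real (Pl x))) \<in> L2 I"
      by (intro L2_add L2_cmult \<phi>1 R1 R2)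
    then show "vc \<alpha> w \<in> L2 I"
    proof (rule L2_cong_AE)
      show "vc \<alpha> w \<in> borel_measurable (lebesgue_on I)" by (rule lebesgue_on_L(1)[OF borel_I adm_measurable(1)[OF adm]])
      show "AE x in lebesgue_on I. \<phi>1 x + K1 * of_real (indicator ?R x) + K2 * (indicator ?R x *\<^sub>R of_real (Pl x)) = vc \<alpha> w x"
        by (rule AE_I2) (simp add: eq)
    qed
  qed simp
qed

lemma not_selfadjoint_left:
  assumes 1: "set_integrable L {x \<in> I. x < c} (\<lambda>x. 1 :: real)" and P: "set_integrable L {x \<in> I. x < c} (\<lambda>x. (Pl x)\<^sup>2)"
  shows "maximal_operator I P q \<noteq> adjoint_graph I (maximal_operator I P q)"
proof
  assume sa: "maximal_operator I P q = adjoint_graph I (maximal_operator I P q)"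
  obtain \<alpha> where \<alpha>: "\<alpha> \<in> I" "\<alpha> < c" by (rule smaller[OF c])
  \<comment> \<open>The cut is at \<open>\<alpha>\<close> instead of \<open>c\<close>: the sources
    live on \<open>{\<alpha>..<c}\<close>, and to the left of them the solution is a combination of
    \<open>y1, y2\<close> with constant coefficients.\<close>
  let ?R = "{x \<in> I. x < \<alpha>}"
  have Rb: "?R \<in> sets borel"
  proof -
    have "?R = I \<inter> {..<\<alpha>}" by auto
    then show ?thesis by simp
  qed
  have RL: "?R \<in> sets L" using Rb by (simp add: sets_L sets_I_iff)
  have sub: "?R \<subseteq> {x \<in> I. x < c}" using \<alpha> by auto
  have Plm: "(\<lambda>x. complex_of_real (Pl x)) \<in> borel_measurable L" by (rule prim_measurable[OF T locfin_L prim_Pl])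
  have R1: "(\<lambda>x. complex_of_real (indicator ?R x)) \<in> L2 I"
  proof (subst L2_L)
    show "(\<lambda>x. complex_of_real (indicator ?R x)) \<in> borel_measurable L"
      by (rule measurable_compose[OF borel_measurable_indicator[OF RL]]) simp
    show "integrable L (\<lambda>x. (cmod (complex_of_real (indicator ?R x)))\<^sup>2)"
      using set_integrable_subset[OF 1 RL sub] unfolding set_integrable_def
      by (rule Bochner_Integration.integrable_cong[THEN iffD1, rotated 2]) (auto simp: indicator_def)
  qed
  have R2: "(\<lambda>x. indicator ?R x *\<^sub>R complex_of_real (Pl x)) \<in> L2 I"
  proof (subst L2_L)
    show "(\<lambda>x. indicator ?R x *\<^sub>R complex_of_real (Pl x)) \<in> borel_measurable L"
      by (intro borel_measurable_scaleR borel_measurable_indicator RL Plm)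
    show "integrable L (\<lambda>x. (cmod (indicator ?R x *\<^sub>R complex_of_real (Pl x)))\<^sup>2)"
      using set_integrable_subset[OF P RL sub] unfolding set_integrable_def
      by (rule Bochner_Integration.integrable_cong[THEN iffD1, rotated 2]) (auto simp: indicator_def)
  qed
  show False
  proof (rule test_functions[OF _ \<alpha> _ sa, of c])
    fix w assume wm: "w \<in> borel_measurable L" and w0: "\<And>t. t \<notin> {\<alpha>..<c} \<Longrightarrow> w t = 0" and lw: "locint L w"
    note adm = vc_adm[OF lw c]
    define C1 C2 where "C1 = (LINT t:{\<alpha>..<c}|L. y1 t * w t)" and "C2 = (LINT t:{\<alpha>..<c}|L. y2 t * w t)"
    define \<phi>1 where "\<phi>1 x = (if \<alpha> \<le> x then vc c w x else 0)" for x
    have \<phi>1: "\<phi>1 \<in> L2 I"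
    proof -
      have "\<phi>1 = (\<lambda>x. indicator {x. \<alpha> \<le> x} x *\<^sub>R vc c w x)" by (auto simp: \<phi>1_def fun_eq_iff)
      moreover have "indicat_real {x. \<alpha> \<le> x} \<in> borel_measurable L"
        by (rule measurable_compose[OF id_measurable[OF locfin_L]]) (rule borel_measurable_indicator, simp)
      ultimately have m: "\<phi>1 \<in> borel_measurable L"
        using adm_measurable(1)[OF adm] by (simp add: borel_measurable_scaleR)
      obtain D where D: "\<forall>t\<in>{\<alpha>..<c}. cmod (vc c w t) \<le> D"
        using prim_locally_bounded[OF T adm_f[OF adm] \<alpha>(1) c] by blast
      show ?thesis
      proof (rule L2_supported[OF m \<alpha>(1) c, of D])
        show "cmod (\<phi>1 t) \<le> D" if "t \<in> {\<alpha>..<c}" for t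
          using D that by (auto simp: \<phi>1_def)
        show "\<phi>1 t = 0" if "t \<notin> {\<alpha>..<c}" for t
        proof (cases "c \<le> t")
          case True
          then have "vc c w t = 0"
            unfolding vc_def using osint_right_zero[of c w t] w0 by simp
          then show ?thesis by (simp add: \<phi>1_def)
        next
          case False
          then show ?thesis using that by (simp add: \<phi>1_def)
        qed
      qed
    qed
    have eq: "vc c w x = \<phi>1 x + (- C2 - C1 * of_real (Pl c)) * of_real (indicator ?R x) + C1 * (indicator ?R x *\<^sub>R of_real (Pl x))" if x: "x \<in> I" for x
    proof (cases "\<alpha> \<le> x")
      case True
      then show ?thesis by (simp add: \<phi>1_def)
    next
      case False
      then have "vc c w x = - C2 * y1 x + C1 * y2 x"
        unfolding vc_def C1_def C2_def using osint_supported_left[OF w0 less_imp_le[OF \<alpha>(2)], where x=x] by simp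
      also have "\<dots> = (- C2 - C1 * of_real (Pl c)) + C1 * of_real (Pl x)"
      proof -
        have xc: "x \<le> c" using False \<alpha>(2) by simp
        show ?thesis unfolding y_left_vals(1)[OF x xc] y_left_vals(2)[OF x xc]
          by (simp add: algebra_simps)
      qed
      finally show ?thesis using False x by (simp add: \<phi>1_def)
    qed
    have "(\<lambda>x. \<phi>1 x + (- C2 - C1 * of_real (Pl c)) * of_real (indicator ?R x) + C1 * (indicator ?R x *\<^sub>R of_real (Pl x))) \<in> L2 I"
      by (intro L2_add L2_cmult \<phi>1 R1 R2)
    then show "vc c w \<in> L2 I"
    proof (rule L2_cong_AE)
      show "vc c w \<in> borel_measurable (lebesgue_on I)" by (rule lebesgue_on_L(1)[OF borel_I adm_measurable(1)[OF adm]])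
      show "AE x in lebesgue_on I. \<phi>1 x + (- C2 - C1 * of_real (Pl c)) * of_real (indicator ?R x) + C1 * (indicator ?R x *\<^sub>R of_real (Pl x)) = vc c w x"
        by (rule AE_I2) (simp add: eq)
    qed
  qed simp
qed

end

section \<open>Wronskians at the endpoints\<close>

lemma integral_Cauchy_Schwarz:
  fixes \<phi> \<eta> :: "'a \<Rightarrow> real"
  assumes m: "\<phi> \<in> borel_measurable M" "\<eta> \<in> borel_measurable M"
    and i: "integrable M (\<lambda>x. (\<phi> x)\<^sup>2)" "integrable M (\<lambda>x. (\<eta> x)\<^sup>2)"
  shows "integrable M (\<lambda>x. \<phi> x * \<eta> x)"
    "(LINT x|M. \<phi> x * \<eta> x)\<^sup>2 \<le> (LINT x|M. (\<phi> x)\<^sup>2) * (LINT x|M. (\<eta> x)\<^sup>2)"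
proof -
  show p: "integrable M (\<lambda>x. \<phi> x * \<eta> x)"
  proof (rule Bochner_Integration.integrable_bound)
    show "integrable M (\<lambda>x. (\<phi> x)\<^sup>2 + (\<eta> x)\<^sup>2)" using i by (rule Bochner_Integration.integrable_add)
    show "(\<lambda>x. \<phi> x * \<eta> x) \<in> borel_measurable M" using m by (rule borel_measurable_times)
    show "AE x in M. norm (\<phi> x * \<eta> x) \<le> norm ((\<phi> x)\<^sup>2 + (\<eta> x)\<^sup>2)"
    proof (rule AE_I2)
      fix x
      have "2 * \<bar>\<phi> x\<bar> * \<bar>\<eta> x\<bar> \<le> (\<phi> x)\<^sup>2 + (\<eta> x)\<^sup>2" using sum_squares_bound[of "\<bar>\<phi> x\<bar>" "\<bar>\<eta> x\<bar>"] by simp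
      moreover have "0 \<le> \<bar>\<phi> x\<bar> * \<bar>\<eta> x\<bar>" by simp
      ultimately have "\<bar>\<phi> x\<bar> * \<bar>\<eta> x\<bar> \<le> (\<phi> x)\<^sup>2 + (\<eta> x)\<^sup>2" by linarith
      then show "norm (\<phi> x * \<eta> x) \<le> norm ((\<phi> x)\<^sup>2 + (\<eta> x)\<^sup>2)" by (simp add: abs_mult)
    qed
  qed
  let ?A = "LINT x|M. (\<phi> x)\<^sup>2" and ?B = "LINT x|M. (\<eta> x)\<^sup>2" and ?C = "LINT x|M. \<phi> x * \<eta> x"
  have quad: "0 \<le> t\<^sup>2 * ?A + 2 * t * ?C + ?B" for t
  proof -
    have "0 \<le> (LINT x|M. (t * \<phi> x + \<eta> x)\<^sup>2)" by simp
    also have "(\<lambda>x. (t * \<phi> x + \<eta> x)\<^sup>2) = (\<lambda>x. t\<^sup>2 * (\<phi> x)\<^sup>2 + (2 * t) * (\<phi> x * \<eta> x) + (\<eta> x)\<^sup>2)"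
      by (simp add: fun_eq_iff power2_eq_square algebra_simps)
    also have "(LINT x|M. t\<^sup>2 * (\<phi> x)\<^sup>2 + (2 * t) * (\<phi> x * \<eta> x) + (\<eta> x)\<^sup>2) = t\<^sup>2 * ?A + (2 * t) * ?C + ?B"
      using i p by simp
    finally show ?thesis .
  qed
  have A0: "0 \<le> ?A" by simp
  show "?C\<^sup>2 \<le> ?A * ?B"
  proof (cases "?A = 0")
    case True
    have "?C = 0"
    proof (rule ccontr)
      assume C: "?C \<noteq> 0"
      \<comment> \<open>With \<open>?A = 0\<close> the quadratic is linear in \<open>t\<close>, and
        this choice of \<open>t\<close> gives it the value -1.\<close>
      have "0 \<le> 2 * (- (?B + 1) / (2 * ?C)) * ?C + ?B" using quad[of "- (?B + 1) / (2 * ?C)"] True by simp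
      moreover have "2 * (- (?B + 1) / (2 * ?C)) * ?C = - (?B + 1)" using C by (simp add: field_simps)
      ultimately show False by linarith
    qed
    then show ?thesis using True by simp
  next
    case False
    then have A: "0 < ?A" using A0 by linarith
    have "0 \<le> (- ?C / ?A)\<^sup>2 * ?A + 2 * (- ?C / ?A) * ?C + ?B" by (rule quad)
    also have "\<dots> = ?B - ?C\<^sup>2 / ?A" using A by (simp add: power2_eq_square field_simps)
    finally show ?thesis using A by (simp add: field_simps)
  qed
qed

section \<open>Divergence of the integral of 1/r, and exhaustion up to an endpoint\<close>

context open_interval begin

lemma set_Cauchy_Schwarz:
  fixes \<phi> \<eta> :: "real \<Rightarrow> complex"
  assumes B: "B \<in> sets L" and m: "\<phi> \<in> borel_measurable L" "\<eta> \<in> borel_measurable L"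
    and i: "set_integrable L B (\<lambda>t. (cmod (\<phi> t))\<^sup>2)" "set_integrable L B (\<lambda>t. (cmod (\<eta> t))\<^sup>2)"
  shows "(LINT t:B|L. cmod (\<phi> t * \<eta> t)) \<le> sqrt ((LINT t:B|L. (cmod (\<phi> t))\<^sup>2) * (LINT t:B|L. (cmod (\<eta> t))\<^sup>2))"
proof -
  let ?f = "\<lambda>t. indicator B t * cmod (\<phi> t)" and ?g = "\<lambda>t. indicator B t * cmod (\<eta> t)"
  have sq: "(indicator B t * cmod z)\<^sup>2 = indicator B t * (cmod z)\<^sup>2" for t z by (auto simp: indicator_def)
  have fm: "?f \<in> borel_measurable L" "?g \<in> borel_measurable L"
    by (rule borel_measurable_times[OF borel_measurable_indicator[OF B] measurable_compose[OF m(1) borel_measurable_norm]]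
        borel_measurable_times[OF borel_measurable_indicator[OF B] measurable_compose[OF m(2) borel_measurable_norm]])+
  have fi: "integrable L (\<lambda>t. (?f t)\<^sup>2)" "integrable L (\<lambda>t. (?g t)\<^sup>2)"
    using i by (simp_all add: sq set_integrable_def)
  have "(LINT t|L. ?f t * ?g t)\<^sup>2 \<le> (LINT t|L. (?f t)\<^sup>2) * (LINT t|L. (?g t)\<^sup>2)"
    by (rule integral_Cauchy_Schwarz(2)[OF fm fi])
  moreover have "(LINT t|L. ?f t * ?g t) = (LINT t:B|L. cmod (\<phi> t * \<eta> t))"
    unfolding set_lebesgue_integral_def
    by (intro Bochner_Integration.integral_cong) (auto simp: indicator_def norm_mult)
  ultimately have "(LINT t:B|L. cmod (\<phi> t * \<eta> t))\<^sup>2 \<le> (LINT t:B|L. (cmod (\<phi> t))\<^sup>2) * (LINT t:B|L. (cmod (\<eta> t))\<^sup>2)"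
    by (simp add: sq set_lebesgue_integral_def)
  then show ?thesis by (rule real_le_rsqrt)
qed

lemma set_integral_le_integral:
  fixes f :: "real \<Rightarrow> real"
  assumes "integrable L f" "B \<in> sets L" "\<And>x. 0 \<le> f x"
  shows "(LINT t:B|L. f t) \<le> (LINT t|L. f t)"
  unfolding set_lebesgue_integral_def
proof (rule integral_mono)
  show "integrable L (\<lambda>t. indicator B t *\<^sub>R f t)"
    using set_integrable_sub[OF assms(1,2)] by (simp add: set_integrable_def)
  show "indicator B t *\<^sub>R f t \<le> f t" for t using assms(3)[of t] by (simp add: indicator_def)
qed (fact assms)

lemma FTC_Ico:
  fixes r \<theta> :: "real \<Rightarrow> real"
  assumes yx: "y \<in> I" "x \<in> I" "y \<le> x"
    and r: "\<And>t. t \<in> {y..x} \<Longrightarrow> 0 < r t" "\<And>t. t \<in> {y..x} \<Longrightarrow> isCont r t"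
    and \<theta>: "\<And>t. t \<in> {y..x} \<Longrightarrow> (\<theta> has_real_derivative 1 / r t) (at t)"
  shows "set_integrable L {y..<x} (\<lambda>t. 1 / r t)" "(LINT t:{y..<x}|L. 1 / r t) = \<theta> x - \<theta> y"
proof -
  have Lb: "I \<inter> space lborel \<in> sets lborel" by simp
  have c: "isCont (\<lambda>t. 1 / r t) t" if "y \<le> t" "t \<le> x" for t
    using r[of t] that by (intro continuous_intros) auto
  let ?F = "\<lambda>t. 1 / r t * indicator {y..x} t"
  let ?G = "\<lambda>t. indicator I t *\<^sub>R (indicator {y..<x} t *\<^sub>R (1 / r t))"
  have sub: "t \<in> {y..<x} \<Longrightarrow> t \<in> I" for t using subI(2)[OF yx(1,2)] by blast
  have Fi: "integrable lborel ?F" by (rule borel_integrable_atLeastAtMost[OF c])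
  have v: "integral\<^sup>L lborel ?F = \<theta> x - \<theta> y"
    by (rule integral_FTC_Icc_real[OF yx(3) \<theta> c]) auto
  have ae: "AE t in lborel. ?F t = ?G t"
    using AE_lborel_singleton[of x]
    by eventually_elim (use sub in \<open>auto simp: indicator_def\<close>)
  have G: "?G = (\<lambda>t. indicator {y..<x} t * ?F t)"
    using sub by (auto simp: indicator_def fun_eq_iff)
  have Gm: "?G \<in> borel_measurable lborel"
    unfolding G using borel_measurable_integrable[OF Fi]
    by (rule borel_measurable_times[rotated]) (rule borel_measurable_indicator, simp)
  have Gi: "integrable lborel ?G" by (rule integrable_cong_AE_imp[OF Fi Gm ae])
  have "integral\<^sup>L lborel ?G = \<theta> x - \<theta> y"
    using Bochner_Integration.integral_cong_AE[OF borel_measurable_integrable[OF Fi] Gm ae] v by simp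
  with Gi show "set_integrable L {y..<x} (\<lambda>t. 1 / r t)" "(LINT t:{y..<x}|L. 1 / r t) = \<theta> x - \<theta> y"
    unfolding set_integrable_def set_lebesgue_integral_def
    by (simp_all only: integrable_restrict_space[OF Lb] integral_restrict_space[OF Lb])
qed

text \<open>A Wronskian \<open>f g' - f' g\<close> that stays away from zero forces \<open>|f|\<^sup>2 + |f'|\<^sup>2 \<ge> const / r\<close> when the
  quasi-derivatives \<open>g, g'\<close> are \<open>O(sqrt r)\<close>; this is not integrable when \<open>1 / r\<close> is not.\<close>

lemma growth_contradiction:
  fixes f f' g g' :: "real \<Rightarrow> complex" and r \<theta> :: "real \<Rightarrow> real" and y x :: "nat \<Rightarrow> real"
  assumes fm: "f \<in> borel_measurable L" "f' \<in> borel_measurable L" and fL: "f \<in> L2 I" "f' \<in> L2 I" and \<epsilon>: "0 < \<epsilon>"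
    and yx: "\<And>n. y n \<in> I" "\<And>n. x n \<in> I" "\<And>n. y n \<le> x n"
    and W: "\<And>n t. t \<in> {y n..<x n} \<Longrightarrow> \<epsilon> \<le> cmod (f t * g' t - f' t * g t)"
    and g: "\<And>n t. t \<in> {y n..<x n} \<Longrightarrow> cmod (g t) \<le> C * sqrt (r t)" "\<And>n t. t \<in> {y n..<x n} \<Longrightarrow> cmod (g' t) \<le> C * sqrt (r t)"
    and r: "\<And>n t. t \<in> {y n..x n} \<Longrightarrow> 0 < r t" "\<And>n t. t \<in> {y n..x n} \<Longrightarrow> isCont r t"
    and \<theta>: "\<And>n t. t \<in> {y n..x n} \<Longrightarrow> (\<theta> has_real_derivative 1 / r t) (at t)"
    and unb: "\<And>K. \<exists>n. K < \<theta> (x n) - \<theta> (y n)"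
  shows False
proof -
  \<comment> \<open>The bounds on \<open>g, g'\<close> give
    \<open>\<epsilon> \<le> C * sqrt (r t)\<close> times the sum of the moduli of \<open>f\<close>
    and \<open>f'\<close>. Squaring this and using (x + y)^2 \<le> 2 (x^2 + y^2) yields
    \<open>1 / r t \<le> ?\<rho> t\<close>.\<close>
  let ?\<rho> = "\<lambda>t. (2 * C\<^sup>2 / \<epsilon>\<^sup>2) * ((cmod (f t))\<^sup>2 + (cmod (f' t))\<^sup>2)"
  have \<rho>: "integrable L ?\<rho>"
    using fL L2_L[OF fm(1)] L2_L[OF fm(2)] by (intro integrable_mult_right Bochner_Integration.integrable_add) auto
  obtain n where n: "(LINT t|L. ?\<rho> t) < \<theta> (x n) - \<theta> (y n)" using unb by blast
  have J: "{y n..<x n} \<in> sets L" by (rule locfin_Ico[OF locfin_L yx(1,2)])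
  note ftc = FTC_Ico[OF yx(1)[of n] yx(2)[of n] yx(3)[of n] r(1) r(2) \<theta>]
  have "\<theta> (x n) - \<theta> (y n) = (LINT t:{y n..<x n}|L. 1 / r t)" using ftc(2) by simp
  also have "\<dots> \<le> (LINT t:{y n..<x n}|L. ?\<rho> t)"
  proof (rule set_integral_mono[OF ftc(1) set_integrable_sub[OF \<rho> J]])
    fix t assume t: "t \<in> {y n..<x n}"
    have rt: "0 < r t" using r(1)[of t n] t by simp
    have "\<epsilon> \<le> cmod (f t * g' t) + cmod (f' t * g t)"
      using W[OF t] norm_triangle_ineq4[of "f t * g' t" "f' t * g t"] by linarith
    also have "\<dots> = cmod (f t) * cmod (g' t) + cmod (f' t) * cmod (g t)" by (simp add: norm_mult)
    also have "\<dots> \<le> cmod (f t) * (C * sqrt (r t)) + cmod (f' t) * (C * sqrt (r t))"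
      by (intro add_mono mult_left_mono g[OF t] norm_ge_zero)
    finally have "\<epsilon>\<^sup>2 \<le> (cmod (f t) * (C * sqrt (r t)) + cmod (f' t) * (C * sqrt (r t)))\<^sup>2"
      using \<epsilon> by (intro power_mono) auto
    also have "\<dots> = C\<^sup>2 * r t * (cmod (f t) + cmod (f' t))\<^sup>2"
    proof -
      have "cmod (f t) * (C * sqrt (r t)) + cmod (f' t) * (C * sqrt (r t)) = C * sqrt (r t) * (cmod (f t) + cmod (f' t))"
        by (simp add: algebra_simps)
      then show ?thesis using rt by (simp add: power_mult_distrib)
    qed
    also have "\<dots> \<le> C\<^sup>2 * r t * (2 * ((cmod (f t))\<^sup>2 + (cmod (f' t))\<^sup>2))"
    proof (rule mult_left_mono)
      show "(cmod (f t) + cmod (f' t))\<^sup>2 \<le> 2 * ((cmod (f t))\<^sup>2 + (cmod (f' t))\<^sup>2)"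
        using zero_le_power2[of "cmod (f t) - cmod (f' t)"] by (simp add: power2_eq_square algebra_simps)
    qed (use rt in simp)
    finally show "1 / r t \<le> ?\<rho> t" using rt \<epsilon> by (simp add: field_simps)
  qed
  also have "\<dots> \<le> (LINT t|L. ?\<rho> t)"
    by (rule set_integral_le_integral[OF \<rho> J]) (intro mult_nonneg_nonneg divide_nonneg_nonneg, auto)
  finally show False using n by simp
qed

text \<open>Monotone convergence turns a bound that is uniform in the right end point into
  integrability up to the endpoint of \<open>I\<close>.\<close>

lemma integrable_exhaust_right:
  fixes \<phi> :: "real \<Rightarrow> real"
  assumes m: "\<phi> \<in> borel_measurable L" and nn: "\<And>t. 0 \<le> \<phi> t" and x1: "x1 \<in> I"
    and i: "\<And>x. x \<in> I \<Longrightarrow> x1 \<le> x \<Longrightarrow> set_integrable L {x1..<x} \<phi>"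
    and b: "\<And>x. x \<in> I \<Longrightarrow> x1 \<le> x \<Longrightarrow> (LINT t:{x1..<x}|L. \<phi> t) \<le> K"
  shows "set_integrable L {t \<in> I. x1 \<le> t} \<phi>"
proof -
  obtain l r :: "nat \<Rightarrow> real" where lr: "I = (\<Union>n. {l n..<r n})" "incseq r" "\<And>n. r n \<in> I"
    by (rule exhaust) (rule that; assumption)
  define e where "e n = max x1 (r n)" for n
  have e: "e n \<in> I" "x1 \<le> e n" for n using x1 lr(3)[of n] by (auto simp: e_def max_def)
  have mono: "e m \<le> e n" if "m \<le> n" for m n using incseqD[OF lr(2) that] by (auto simp: e_def)
  let ?f = "\<lambda>n t. indicator {x1..<e n} t *\<^sub>R \<phi> t"
  have fi: "integrable L (?f n)" for n using i[OF e] by (simp add: set_integrable_def)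
  have le: "?f m t \<le> ?f n t" if "m \<le> n" for m n t
    using mono[OF that] nn[of t] by (auto simp: indicator_def)
  have "incseq (\<lambda>n. LINT t|L. ?f n t)"
    by (intro incseq_SucI integral_mono fi le) simp
  moreover have "\<forall>n. (LINT t|L. ?f n t) \<le> K" using b[OF e] by (simp add: set_lebesgue_integral_def)
  ultimately obtain Lm where Lm: "(\<lambda>n. LINT t|L. ?f n t) \<longlonglongrightarrow> Lm" by (rule incseq_convergent)
  have Ri: "{t \<in> I. x1 \<le> t} \<in> sets L"
  proof -
    have "{t \<in> I. x1 \<le> t} = I \<inter> {x1..}" by auto
    then show ?thesis by (simp add: sets_L sets_I_iff)
  qed
  show ?thesis unfolding set_integrable_def
  proof (rule integrable_monotone_convergence[of L ?f])
    show "AE t in L. mono (\<lambda>n. ?f n t)" using le by (intro AE_I2 monoI)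
    show "AE t in L. (\<lambda>n. ?f n t) \<longlonglongrightarrow> indicator {t \<in> I. x1 \<le> t} t *\<^sub>R \<phi> t"
    proof (rule AE_I2)
      fix t assume "t \<in> space L"
      then have t: "t \<in> I" by (simp add: locfin_space[OF locfin_L])
      then have "t \<in> (\<Union>n. {l n..<r n})" by (subst lr(1)[symmetric])
      then obtain n where n: "t < r n" by auto
      have "?f m t = indicator {t \<in> I. x1 \<le> t} t *\<^sub>R \<phi> t" if "m \<ge> n" for m
        using n incseqD[OF lr(2) that] t by (auto simp: indicator_def e_def)
      then show "(\<lambda>n. ?f n t) \<longlonglongrightarrow> indicator {t \<in> I. x1 \<le> t} t *\<^sub>R \<phi> t"
        by (intro tendsto_eventually eventually_sequentiallyI[of n])
    qed
    show "(\<lambda>t. indicator {t \<in> I. x1 \<le> t} t *\<^sub>R \<phi> t) \<in> borel_measurable L"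
      by (intro borel_measurable_scaleR borel_measurable_indicator Ri m)
  qed (fact fi Lm)+
qed

lemma integrable_exhaust_left:
  fixes \<phi> :: "real \<Rightarrow> real"
  assumes m: "\<phi> \<in> borel_measurable L" and nn: "\<And>t. 0 \<le> \<phi> t" and x1: "x1 \<in> I"
    and i: "\<And>x. x \<in> I \<Longrightarrow> x \<le> x1 \<Longrightarrow> set_integrable L {x..<x1} \<phi>"
    and b: "\<And>x. x \<in> I \<Longrightarrow> x \<le> x1 \<Longrightarrow> (LINT t:{x..<x1}|L. \<phi> t) \<le> K"
  shows "set_integrable L {t \<in> I. t < x1} \<phi>"
proof -
  obtain l r :: "nat \<Rightarrow> real" where lr: "I = (\<Union>n. {l n..<r n})" "decseq l" "\<And>n. l n \<in> I"
    by (rule exhaust) (rule that; assumption)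
  define e where "e n = min x1 (l n)" for n
  have e: "e n \<in> I" "e n \<le> x1" for n using x1 lr(3)[of n] by (auto simp: e_def min_def)
  have mono: "e n \<le> e m" if "m \<le> n" for m n using decseqD[OF lr(2) that] by (auto simp: e_def)
  let ?f = "\<lambda>n t. indicator {e n..<x1} t *\<^sub>R \<phi> t"
  have fi: "integrable L (?f n)" for n using i[OF e] by (simp add: set_integrable_def)
  have le: "?f m t \<le> ?f n t" if "m \<le> n" for m n t
    using mono[OF that] nn[of t] by (auto simp: indicator_def)
  have "incseq (\<lambda>n. LINT t|L. ?f n t)"
    by (intro incseq_SucI integral_mono fi le) simp
  moreover have "\<forall>n. (LINT t|L. ?f n t) \<le> K" using b[OF e] by (simp add: set_lebesgue_integral_def)
  ultimately obtain Lm where Lm: "(\<lambda>n. LINT t|L. ?f n t) \<longlonglongrightarrow> Lm" by (rule incseq_convergent)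
  have Ri: "{t \<in> I. t < x1} \<in> sets L"
  proof -
    have "{t \<in> I. t < x1} = I \<inter> {..<x1}" by auto
    then show ?thesis by (simp add: sets_L sets_I_iff)
  qed
  show ?thesis unfolding set_integrable_def
  proof (rule integrable_monotone_convergence[of L ?f])
    show "AE t in L. mono (\<lambda>n. ?f n t)" using le by (intro AE_I2 monoI)
    show "AE t in L. (\<lambda>n. ?f n t) \<longlonglongrightarrow> indicator {t \<in> I. t < x1} t *\<^sub>R \<phi> t"
    proof (rule AE_I2)
      fix t assume "t \<in> space L"
      then have t: "t \<in> I" by (simp add: locfin_space[OF locfin_L])
      then have "t \<in> (\<Union>n. {l n..<r n})" by (subst lr(1)[symmetric])
      then obtain n where n: "l n \<le> t" by auto
      have "?f m t = indicator {t \<in> I. t < x1} t *\<^sub>R \<phi> t" if "m \<ge> n" for m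
        using n decseqD[OF lr(2) that] t by (auto simp: indicator_def e_def)
      then show "(\<lambda>n. ?f n t) \<longlonglongrightarrow> indicator {t \<in> I. t < x1} t *\<^sub>R \<phi> t"
        by (intro tendsto_eventually eventually_sequentiallyI[of n])
    qed
    show "(\<lambda>t. indicator {t \<in> I. t < x1} t *\<^sub>R \<phi> t) \<in> borel_measurable L"
      by (intro borel_measurable_scaleR borel_measurable_indicator Ri m)
  qed (fact fi Lm)+
qed

text \<open>The point \<open>x1\<close> can be pushed beyond any given \<open>x0\<close>; this is
  used to place it to the right of the support of the potential as well.\<close>

lemma tail_right:
  fixes D :: "real \<Rightarrow> complex"
  assumes D: "integrable L D" and \<epsilon>: "0 < \<epsilon>" and x0: "x0 \<in> I"
  obtains x1 where "x1 \<in> I" "x0 \<le> x1" "(LINT t|L. indicator {t. x1 \<le> t} t * norm (D t)) < \<epsilon>"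
proof -
  obtain l r :: "nat \<Rightarrow> real" where lr: "I = (\<Union>n. {l n..<r n})" "incseq r" "\<And>n. r n \<in> I"
    by (rule exhaust) (rule that; assumption)
  define e where "e n = max x0 (r n)" for n
  have e: "e n \<in> I" "x0 \<le> e n" for n using x0 lr(3)[of n] by (auto simp: e_def max_def)
  have im: "indicat_real {t. x \<le> t} \<in> borel_measurable L" for x
    by (rule measurable_compose[OF id_measurable[OF locfin_L]]) (rule borel_measurable_indicator, simp)
  have "(\<lambda>n. LINT t|L. indicator {t. e n \<le> t} t * norm (D t)) \<longlonglongrightarrow> (LINT t|L. (0::real))"
  proof (rule integral_dominated_convergence)
    show "integrable L (\<lambda>t. norm (D t))" using D by (rule integrable_norm)
    show "(\<lambda>t. indicator {t. e n \<le> t} t * norm (D t)) \<in> borel_measurable L" for n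
      by (rule borel_measurable_times[OF im measurable_compose[OF borel_measurable_integrable[OF D] borel_measurable_norm]])
    show "AE t in L. norm (indicator {t. e n \<le> t} t * norm (D t)) \<le> norm (D t)" for n
      by (intro AE_I2) (auto simp: indicator_def)
    show "AE t in L. (\<lambda>n. indicator {t. e n \<le> t} t * norm (D t)) \<longlonglongrightarrow> 0"
    proof (rule AE_I2)
      fix t assume "t \<in> space L"
      then have t: "t \<in> I" by (simp add: locfin_space[OF locfin_L])
      then have "t \<in> (\<Union>n. {l n..<r n})" by (subst lr(1)[symmetric])
      then obtain n where n: "t < r n" by auto
      have "indicator {t. e m \<le> t} t * norm (D t) = 0" if "m \<ge> n" for m
        using n incseqD[OF lr(2) that] t by (auto simp: indicator_def e_def)
      then show "(\<lambda>n. indicator {t. e n \<le> t} t * norm (D t)) \<longlonglongrightarrow> 0"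
        by (intro tendsto_eventually eventually_sequentiallyI[of n])
    qed
  qed simp
  then have "eventually (\<lambda>n. (LINT t|L. indicator {t. e n \<le> t} t * norm (D t)) < \<epsilon>) sequentially"
    using \<epsilon> by (intro order_tendstoD(2)) simp
  then obtain n where "(LINT t|L. indicator {t. e n \<le> t} t * norm (D t)) < \<epsilon>"
    by (auto simp: eventually_sequentially)
  with e show thesis by (intro that[of "e n"])
qed

lemma tail_left:
  fixes D :: "real \<Rightarrow> complex"
  assumes D: "integrable L D" and \<epsilon>: "0 < \<epsilon>" and x0: "x0 \<in> I"
  obtains x1 where "x1 \<in> I" "x1 \<le> x0" "(LINT t|L. indicator {t. t < x1} t * norm (D t)) < \<epsilon>"
proof -
  obtain l r :: "nat \<Rightarrow> real" where lr: "I = (\<Union>n. {l n..<r n})" "decseq l" "\<And>n. l n \<in> I"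
    by (rule exhaust) (rule that; assumption)
  define e where "e n = min x0 (l n)" for n
  have e: "e n \<in> I" "e n \<le> x0" for n using x0 lr(3)[of n] by (auto simp: e_def min_def)
  have im: "indicat_real {t. t < x} \<in> borel_measurable L" for x
    by (rule measurable_compose[OF id_measurable[OF locfin_L]]) (rule borel_measurable_indicator, simp)
  have "(\<lambda>n. LINT t|L. indicator {t. t < e n} t * norm (D t)) \<longlonglongrightarrow> (LINT t|L. (0::real))"
  proof (rule integral_dominated_convergence)
    show "integrable L (\<lambda>t. norm (D t))" using D by (rule integrable_norm)
    show "(\<lambda>t. indicator {t. t < e n} t * norm (D t)) \<in> borel_measurable L" for n
      by (rule borel_measurable_times[OF im measurable_compose[OF borel_measurable_integrable[OF D] borel_measurable_norm]])
    show "AE t in L. norm (indicator {t. t < e n} t * norm (D t)) \<le> norm (D t)" for n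
      by (intro AE_I2) (auto simp: indicator_def)
    show "AE t in L. (\<lambda>n. indicator {t. t < e n} t * norm (D t)) \<longlonglongrightarrow> 0"
    proof (rule AE_I2)
      fix t assume "t \<in> space L"
      then have t: "t \<in> I" by (simp add: locfin_space[OF locfin_L])
      then have "t \<in> (\<Union>n. {l n..<r n})" by (subst lr(1)[symmetric])
      then obtain n where n: "l n \<le> t" by auto
      have "indicator {t. t < e m} t * norm (D t) = 0" if "m \<ge> n" for m
        using n decseqD[OF lr(2) that] t by (auto simp: indicator_def e_def)
      then show "(\<lambda>n. indicator {t. t < e n} t * norm (D t)) \<longlonglongrightarrow> 0"
        by (intro tendsto_eventually eventually_sequentiallyI[of n])
    qed
  qed simp
  then have "eventually (\<lambda>n. (LINT t|L. indicator {t. t < e n} t * norm (D t)) < \<epsilon>) sequentially"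
    using \<epsilon> by (intro order_tendstoD(2)) simp
  then obtain n where "(LINT t|L. indicator {t. t < e n} t * norm (D t)) < \<epsilon>"
    by (auto simp: eventually_sequentially)
  with e show thesis by (intro that[of "e n"])
qed

end

context sl_solutions begin

text \<open>An element (f, v) of the maximal operator with chosen representatives: the derivative of
  \<open>g\<close> is literally \<open>q f - v\<close> and \<open>v\<close> is Borel measurable, so
  no exceptional sets have to be carried along.\<close>

definition source :: "(real \<Rightarrow> complex) \<Rightarrow> (real \<Rightarrow> complex) \<Rightarrow> (real \<Rightarrow> complex) \<Rightarrow> bool" where
  "source f g v \<longleftrightarrow> adm f g (\<lambda>x. of_real (q x) * f x - v x) \<and> v \<in> borel_measurable L \<and> f \<in> L2 I \<and> v \<in> L2 I"

lemma q_zero: "t \<in> {y..<x} \<Longrightarrow> d \<le> y \<or> x \<le> c \<Longrightarrow> q t = 0"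
  using q_left[of t] q_right[of t] by auto

text \<open>The alternative \<open>dc\<close> keeps the interval off the support of
  \<open>q\<close>, so that the increment of \<open>g\<close> is an integral of \<open>- v\<close>;
  Cauchy-Schwarz against the constant 1 produces \<open>sqrt (x - y)\<close>.\<close>

lemma holder:
  assumes f: "source f g v" and yx: "y \<in> I" "x \<in> I" "y \<le> x" and dc: "d \<le> y \<or> x \<le> c"
  shows "cmod (g x - g y) \<le> sqrt (LINT t|L. (cmod (v t))\<^sup>2) * sqrt (x - y)"
proof -
  have adm: "adm f g (\<lambda>x. of_real (q x) * f x - v x)" and vm: "v \<in> borel_measurable L" and vL: "v \<in> L2 I"
    using f by (simp_all add: source_def)
  have J: "{y..<x} \<in> sets L" by (rule locfin_Ico[OF locfin_L yx(1,2)])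
  have v2: "integrable L (\<lambda>t. (cmod (v t))\<^sup>2)" using vL L2_L[OF vm] by simp
  have o2: "set_integrable L {y..<x} (\<lambda>t. (cmod (1::complex))\<^sup>2)"
    by (rule bounded_L2_Ico[OF _ yx(1,2), of _ 1]) simp_all
  have "g x = g y + (LINT t:{y..<x}|L. of_real (q t) * f t - v t)" by (rule primD[OF adm_g[OF adm] yx])
  also have "(LINT t:{y..<x}|L. of_real (q t) * f t - v t) = (LINT t:{y..<x}|L. - (1 * v t))"
    by (rule set_lebesgue_integral_cong[OF J]) (use q_zero dc in auto)
  finally have "cmod (g x - g y) = cmod (LINT t:{y..<x}|L. - (1 * v t))" by simp
  also have "\<dots> \<le> (LINT t|L. norm (indicator {y..<x} t *\<^sub>R - (1 * v t)))"
    unfolding set_lebesgue_integral_def by (rule integral_norm_bound)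
  also have "\<dots> = (LINT t:{y..<x}|L. cmod (1 * v t))"
    unfolding set_lebesgue_integral_def by (intro Bochner_Integration.integral_cong) (auto simp: indicator_def)
  also have "\<dots> \<le> sqrt ((LINT t:{y..<x}|L. (cmod 1)\<^sup>2) * (LINT t:{y..<x}|L. (cmod (v t))\<^sup>2))"
    by (rule set_Cauchy_Schwarz[OF J _ vm o2 set_integrable_sub[OF v2 J]]) simp
  also have "(LINT t:{y..<x}|L. (cmod (1::complex))\<^sup>2) = x - y"
  proof -
    have "complex_of_real (LINT t:{y..<x}|L. (cmod (1::complex))\<^sup>2) = (LINT t:{y..<x}|L. complex_of_real ((cmod (1::complex))\<^sup>2))"
      by (rule set_integral_complex_of_real[symmetric])
    also have "\<dots> = complex_of_real (x - y)" using integral_one[OF yx] by simp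
    finally show ?thesis by (simp only: of_real_eq_iff)
  qed
  also have "sqrt ((x - y) * (LINT t:{y..<x}|L. (cmod (v t))\<^sup>2)) \<le> sqrt ((x - y) * (LINT t|L. (cmod (v t))\<^sup>2))"
    using yx(3) by (intro real_sqrt_le_mono mult_left_mono set_integral_le_integral[OF v2 J]) simp_all
  finally show ?thesis by (simp add: real_sqrt_mult mult.commute)
qed

lemma Pl_measurable: "(\<lambda>x. complex_of_real (Pl x)) \<in> borel_measurable L"
  by (rule prim_measurable[OF T locfin_L prim_Pl])

lemma Pl_square_integrable: assumes "y \<in> I" "x \<in> I" shows "set_integrable L {y..<x} (\<lambda>t. (Pl t)\<^sup>2)"
proof -
  obtain D where D: "\<forall>t\<in>{y..<x}. cmod (of_real (Pl t)) \<le> D"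
    using prim_locally_bounded[OF T prim_Pl assms] by blast
  have "set_integrable L {y..<x} (\<lambda>t. (cmod (of_real (Pl t)))\<^sup>2)"
    by (rule bounded_L2_Ico[OF Pl_measurable assms, of D]) (use D in blast)
  then show ?thesis by simp
qed

text \<open>With \<open>p = g P - f\<close>, which has derivative \<open>- P v\<close> away from the support of \<open>q\<close>, the identity \<open>g P = f + p\<close>
  bounds \<open>P\<close> in \<open>L\<^sup>2\<close> on an interval by itself, with a factor that is small on short intervals.\<close>

lemma gronwall:
  assumes f: "source f g v" and yx: "y \<in> I" "x \<in> I" "y \<le> x" and dc: "d \<le> y \<or> x \<le> c" and e: "e \<in> {y..x}"
    and \<epsilon>: "0 < \<epsilon>" "\<And>t. t \<in> {y..<x} \<Longrightarrow> \<epsilon> \<le> cmod (g t)"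
  shows "\<epsilon>\<^sup>2 * (LINT t:{y..<x}|L. (Pl t)\<^sup>2) \<le> 3 * ((cmod (g e * of_real (Pl e) - f e))\<^sup>2 * (x - y) +
     (LINT t|L. (cmod (v t))\<^sup>2) * (x - y) * (LINT t:{y..<x}|L. (Pl t)\<^sup>2) + (LINT t|L. (cmod (f t))\<^sup>2))"
proof -
  have adm: "adm f g (\<lambda>x. of_real (q x) * f x - v x)" and vm: "v \<in> borel_measurable L"
    and vL: "v \<in> L2 I" and fL: "f \<in> L2 I"
    using f by (simp_all add: source_def)
  have J: "{y..<x} \<in> sets L" by (rule locfin_Ico[OF locfin_L yx(1,2)])
  have v2: "integrable L (\<lambda>t. (cmod (v t))\<^sup>2)" using vL L2_L[OF vm] by simp
  have f2: "integrable L (\<lambda>t. (cmod (f t))\<^sup>2)" using fL L2_L[OF adm_measurable(1)[OF adm]] by simp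
  define \<Phi> where "\<Phi> = (LINT t:{y..<x}|L. (Pl t)\<^sup>2)"
  define E where "E = (LINT t|L. (cmod (v t))\<^sup>2)"
  \<comment> \<open>P has quasi-derivative 1, so \<open>p\<close> is a Wronskian of P and
    \<open>f\<close>: the densities \<open>s g\<close> cancel and no jumps remain. The explicit
    factor 1 is the primitive that the product rule pairs with \<open>f\<close>.\<close>
  define p where "p t = g t * of_real (Pl t) - 1 * f t" for t
  let ?k = "\<lambda>t. of_real (Pl t) * (of_real (q t) * f t - v t) - f t * 0"
  have p: "prim L p ?k"
    unfolding p_def[abs_def]
    by (rule prim_wronskian_L[OF T prim_Pl adm_g[OF adm] adm_f[OF adm] prim_const[of L 1]]) simp
  have Pi: "set_integrable L {y..<x} (\<lambda>t. (cmod (of_real (Pl t)))\<^sup>2)" using Pl_square_integrable[OF yx(1,2)] by simp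
  have K: "(LINT t:{y..<x}|L. norm (?k t)) \<le> sqrt (\<Phi> * E)"
  proof -
    have "(LINT t:{y..<x}|L. norm (?k t)) = (LINT t:{y..<x}|L. cmod (of_real (Pl t) * v t))"
      by (rule set_lebesgue_integral_cong[OF J]) (use q_zero dc in \<open>auto simp: norm_mult\<close>)
    also have "\<dots> \<le> sqrt ((LINT t:{y..<x}|L. (cmod (of_real (Pl t)))\<^sup>2) * (LINT t:{y..<x}|L. (cmod (v t))\<^sup>2))"
      by (rule set_Cauchy_Schwarz[OF J Pl_measurable vm Pi set_integrable_sub[OF v2 J]])
    also have "\<dots> \<le> sqrt (\<Phi> * E)"
    proof -
      have "0 \<le> \<Phi>" unfolding \<Phi>_def set_lebesgue_integral_def by simp
      then show ?thesis using set_integral_le_integral[OF v2 J] by (simp add: \<Phi>_def E_def mult_left_mono)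
    qed
    finally show ?thesis .
  qed
  have pdiff: "norm (p t - p e) \<le> sqrt (\<Phi> * E)" if t: "t \<in> {y..x}" for t
  proof -
    have I: "t \<in> I" "e \<in> I" using betweenI[OF yx(1,2)] t e by auto
    have "norm (p t - p e) \<le> (LINT t:{y..<x}|L. norm (?k t))"
    proof (cases "t \<le> e")
      case True
      then have "norm (p t - p e) = norm (LINT r:{t..<e}|L. ?k r)"
        using primD[OF p I(1,2) True] by simp
      also have "\<dots> \<le> (LINT t:{y..<x}|L. norm (?k t))"
        using t e True by (intro norm_set_integral_le[OF locfin_L prim_locint[OF p] yx(1,2)]) auto
      finally show ?thesis .
    next
      case False
      then have et: "e \<le> t" by simp
      have "norm (p t - p e) = norm (LINT r:{e..<t}|L. ?k r)"
        using primD[OF p I(2,1) et] by simp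
      also have "\<dots> \<le> (LINT t:{y..<x}|L. norm (?k t))"
        using t e et by (intro norm_set_integral_le[OF locfin_L prim_locint[OF p] yx(1,2)]) auto
      finally show ?thesis .
    qed
    with K show ?thesis by simp
  qed
  have \<Phi>E: "0 \<le> \<Phi> * E" unfolding \<Phi>_def E_def set_lebesgue_integral_def by simp
  \<comment> \<open>This combines \<open>g P = p + f\<close> with the deviation of \<open>p\<close>
    from \<open>p e\<close>; the factor 3 is that of (x + y + z)^2 \<le> 3 (x^2 + y^2 +
    z^2).\<close>
  have pt: "\<epsilon>\<^sup>2 * (Pl t)\<^sup>2 \<le> 3 * ((cmod (p e))\<^sup>2 + \<Phi> * E) * 1 + 3 * (cmod (f t))\<^sup>2" if t: "t \<in> {y..<x}" for t
  proof -
    have "\<epsilon> * \<bar>Pl t\<bar> \<le> cmod (g t) * \<bar>Pl t\<bar>" by (intro mult_right_mono \<epsilon>(2) t) simp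
    also have "\<dots> = cmod (p t + f t)" by (simp add: p_def norm_mult)
    also have "\<dots> = cmod (p e + (p t - p e) + f t)" by simp
    also have "\<dots> \<le> cmod (p e) + sqrt (\<Phi> * E) + cmod (f t)"
      using pdiff[of t] t norm_triangle_ineq[of "p e + (p t - p e)" "f t"] norm_triangle_ineq[of "p e" "p t - p e"] by simp
    finally have "(\<epsilon> * \<bar>Pl t\<bar>)\<^sup>2 \<le> (cmod (p e) + sqrt (\<Phi> * E) + cmod (f t))\<^sup>2"
      using \<epsilon> by (intro power_mono) auto
    also have "\<dots> \<le> 3 * ((cmod (p e))\<^sup>2 + (sqrt (\<Phi> * E))\<^sup>2 + (cmod (f t))\<^sup>2)"
    proof -
      have "(a + b + c)\<^sup>2 \<le> 3 * (a\<^sup>2 + b\<^sup>2 + c\<^sup>2)" for a b c :: real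
      proof -
        have "3 * (a\<^sup>2 + b\<^sup>2 + c\<^sup>2) - (a + b + c)\<^sup>2 = (a - b)\<^sup>2 + (a - c)\<^sup>2 + (b - c)\<^sup>2"
          by (simp add: power2_eq_square algebra_simps)
        then show ?thesis using zero_le_power2[of "a - b"] zero_le_power2[of "a - c"] zero_le_power2[of "b - c"] by linarith
      qed
      then show ?thesis .
    qed
    finally show ?thesis using \<Phi>E by (simp add: power_mult_distrib algebra_simps)
  qed
  have o2: "set_integrable L {y..<x} (\<lambda>t. 1 :: real)"
    using bounded_L2_Ico[OF borel_measurable_const[of 1] yx(1,2), of 1] by simp
  have o: "(LINT t:{y..<x}|L. 1) = x - y"
  proof -
    have "complex_of_real (LINT t:{y..<x}|L. 1) = (LINT t:{y..<x}|L. complex_of_real 1)"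
      by (rule set_integral_complex_of_real[symmetric])
    also have "\<dots> = complex_of_real (x - y)" using integral_one[OF yx] by simp
    finally show ?thesis by (simp only: of_real_eq_iff)
  qed
  note fi = set_integrable_sub[OF f2 J]
  have "\<epsilon>\<^sup>2 * \<Phi> = (LINT t:{y..<x}|L. \<epsilon>\<^sup>2 * (Pl t)\<^sup>2)" unfolding \<Phi>_def by simp
  also have "\<dots> \<le> (LINT t:{y..<x}|L. 3 * ((cmod (p e))\<^sup>2 + \<Phi> * E) * 1 + 3 * (cmod (f t))\<^sup>2)"
    by (intro set_integral_mono pt set_integral_add(1) set_integrable_mult_right o2 fi Pl_square_integrable yx)
  also have "\<dots> = (LINT t:{y..<x}|L. 3 * ((cmod (p e))\<^sup>2 + \<Phi> * E) * 1) + (LINT t:{y..<x}|L. 3 * (cmod (f t))\<^sup>2)"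
    by (intro set_integral_add(2) set_integrable_mult_right o2 fi)
  also have "\<dots> = 3 * ((cmod (p e))\<^sup>2 + \<Phi> * E) * (x - y) + 3 * (LINT t:{y..<x}|L. (cmod (f t))\<^sup>2)"
    by (simp only: set_integral_mult_right o)
  also have "\<dots> \<le> 3 * ((cmod (p e))\<^sup>2 + \<Phi> * E) * (x - y) + 3 * (LINT t|L. (cmod (f t))\<^sup>2)"
    using set_integral_le_integral[OF f2 J] by simp
  finally show ?thesis unfolding \<Phi>_def[symmetric] E_def[symmetric] by (simp add: p_def algebra_simps)
qed

end

lemma ln_unbounded: "\<exists>n. K < ln (real n + 1)"
proof -
  obtain n where n: "exp K < real n" using reals_Archimedean2 by blast
  have "K = ln (exp K)" by simp
  also have "\<dots> < ln (real n + 1)" using n by (subst ln_less_cancel_iff) auto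
  finally show ?thesis by blast
qed

lemma divide_Suc_bounds:
  fixes w :: real
  assumes "0 < w"
  shows "w / (real n + 1) \<le> w" "0 < w / (real n + 1)"
proof -
  show "0 < w / (real n + 1)" using assms by simp
  have "w * 1 \<le> w * (real n + 1)" using assms by (intro mult_left_mono) auto
  then show "w / (real n + 1) \<le> w" by (simp add: divide_le_eq)
qed

section \<open>Decay and growth of quasi-derivatives at the endpoints\<close>

context sl_solutions begin

lemma mem_I_le: assumes "z \<in> I" "x \<le> z" "a < ereal x" shows "x \<in> I"
proof -
  have "ereal x \<le> ereal z" using assms(2) by simp
  also have "ereal z < b" using assms(1) by (simp add: mem_I)
  finally show ?thesis using assms(3) by (simp add: mem_I)
qed

lemma mem_I_ge: assumes "z \<in> I" "z \<le> x" "ereal x < b" shows "x \<in> I"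
proof -
  have "a < ereal z" using assms(1) by (simp add: mem_I)
  also have "ereal z \<le> ereal x" using assms(2) by simp
  finally show ?thesis using assms(3) by (simp add: mem_I)
qed

lemma sourceD:
  assumes "source f g v"
  shows "adm f g (\<lambda>x. of_real (q x) * f x - v x)" "v \<in> borel_measurable L" "f \<in> L2 I" "v \<in> L2 I" "f \<in> borel_measurable L"
  using assms adm_measurable(1) by (auto simp: source_def)

lemma Pl2_measurable: "(\<lambda>t. (Pl t)\<^sup>2) \<in> borel_measurable L"
proof -
  have "(\<lambda>t. (cmod (of_real (Pl t)))\<^sup>2) \<in> borel_measurable L"
    by (intro borel_measurable_power measurable_compose[OF Pl_measurable borel_measurable_norm])
  then show ?thesis by simp
qed

text \<open>For \<open>l \<le> \<delta>\<close> the term with \<open>\<Phi>\<close> on the right is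
  at most half of the left side and is absorbed there; this doubles the factor 3 to 6.\<close>

lemma gronwall_const:
  fixes \<epsilon> \<Phi> K0 E F \<delta> l :: real
  assumes "\<epsilon>\<^sup>2 * \<Phi> \<le> 3 * (K0 * l + E * l * \<Phi> + F)" "0 \<le> \<Phi>" "0 \<le> K0" "0 \<le> E" "0 < \<epsilon>" "0 \<le> l" "l \<le> \<delta>"
    and \<delta>: "3 * E * \<delta> \<le> \<epsilon>\<^sup>2 / 2"
  shows "\<Phi> \<le> 6 * (K0 * \<delta> + F) / \<epsilon>\<^sup>2"
proof -
  have "3 * (E * l * \<Phi>) \<le> (3 * E * \<delta>) * \<Phi>"
    using assms mult_right_mono[OF mult_left_mono[OF assms(7,4)] assms(2)] by (simp add: mult_ac)
  also have "\<dots> \<le> \<epsilon>\<^sup>2 / 2 * \<Phi>" by (intro mult_right_mono \<delta> assms)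
  finally have 1: "3 * (E * l * \<Phi>) \<le> \<epsilon>\<^sup>2 / 2 * \<Phi>" .
  have "K0 * l \<le> K0 * \<delta>" using assms by (intro mult_left_mono)
  with 1 assms(1) have "\<epsilon>\<^sup>2 * \<Phi> \<le> 6 * (K0 * \<delta> + F)" by (simp add: algebra_simps)
  then show ?thesis using assms(5) by (simp add: field_simps)
qed

lemma small_delta:
  fixes E \<epsilon> :: real
  assumes "0 \<le> E" "0 < \<epsilon>"
  obtains \<delta> where "0 < \<delta>" "3 * E * \<delta> \<le> \<epsilon>\<^sup>2 / 2" "sqrt E * sqrt \<delta> \<le> \<epsilon>"
proof -
  \<comment> \<open>\<open>E + 1\<close> keeps the denominator positive when \<open>E = 0\<close>.
    The factor 6 is chosen for \<open>3 * E * \<delta> \<le> \<epsilon>\<^sup>2 / 2\<close>, which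
    also covers the bound on the square roots.\<close>
  define \<delta> where "\<delta> = \<epsilon>\<^sup>2 / (6 * (E + 1))"
  have E1: "0 < 6 * (E + 1)" using assms by simp
  have \<delta>: "0 < \<delta>" unfolding \<delta>_def using assms E1 by simp
  have "E * \<delta> \<le> (E + 1) * \<delta>" using \<delta> by simp
  also have "\<dots> = \<epsilon>\<^sup>2 / 6" unfolding \<delta>_def using assms by (simp add: field_simps)
  finally have Ed: "E * \<delta> \<le> \<epsilon>\<^sup>2 / 6" .
  show thesis
  proof (rule that[OF \<delta>])
    show "3 * E * \<delta> \<le> \<epsilon>\<^sup>2 / 2" using Ed by (simp add: mult_ac)
    have "E * \<delta> \<le> \<epsilon>\<^sup>2" using Ed zero_le_power2[of \<epsilon>] by linarith
    then have "sqrt (E * \<delta>) \<le> sqrt (\<epsilon>\<^sup>2)" by (rule real_sqrt_le_mono)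
    then show "sqrt E * sqrt \<delta> \<le> \<epsilon>" using assms by (simp add: real_sqrt_mult)
  qed
qed

text \<open>The Hoelder bound makes \<open>g\<close> Cauchy along \<open>e\<close>; letting one of
  its two arguments tend to \<open>z\<close> gives the same bound against the limit.\<close>

lemma holder_limit:
  fixes g :: "real \<Rightarrow> complex" and e :: "nat \<Rightarrow> real"
  assumes h: "\<And>x y. x \<in> S \<Longrightarrow> y \<in> S \<Longrightarrow> cmod (g x - g y) \<le> N * sqrt \<bar>x - y\<bar>" and N: "0 \<le> N"
    and e: "\<And>n. e n \<in> S" "e \<longlonglongrightarrow> z"
  obtains \<gamma> where "\<And>t. t \<in> S \<Longrightarrow> cmod (g t - \<gamma>) \<le> N * sqrt \<bar>t - z\<bar>"
proof -
  have "Cauchy (\<lambda>n. g (e n))"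
  proof (rule metric_CauchyI)
    fix \<epsilon> :: real assume \<epsilon>: "0 < \<epsilon>"
    then have "0 < (\<epsilon> / (N + 1))\<^sup>2" using N by simp
    then obtain M where M: "\<And>m n. m \<ge> M \<Longrightarrow> n \<ge> M \<Longrightarrow> dist (e m) (e n) < (\<epsilon> / (N + 1))\<^sup>2"
      using metric_CauchyD[OF LIMSEQ_imp_Cauchy[OF e(2)]] by blast
    have "dist (g (e m)) (g (e n)) < \<epsilon>" if "m \<ge> M" "n \<ge> M" for m n
    proof -
      have "sqrt \<bar>e m - e n\<bar> \<le> sqrt ((\<epsilon> / (N + 1))\<^sup>2)"
        using M[OF that] by (intro real_sqrt_le_mono) (simp add: dist_real_def)
      also have "\<dots> = \<epsilon> / (N + 1)" using \<epsilon> N by simp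
      finally have "N * sqrt \<bar>e m - e n\<bar> \<le> N * (\<epsilon> / (N + 1))" using N by (rule mult_left_mono)
      also have "\<dots> < \<epsilon>" using \<epsilon> N by (simp add: field_simps)
      finally show ?thesis using h[OF e(1) e(1), of m n] by (simp add: dist_norm)
    qed
    then show "\<exists>M. \<forall>m\<ge>M. \<forall>n\<ge>M. dist (g (e m)) (g (e n)) < \<epsilon>" by blast
  qed
  then obtain \<gamma> where \<gamma>: "(\<lambda>n. g (e n)) \<longlonglongrightarrow> \<gamma>" using Cauchy_convergent convergent_def by blast
  show thesis
  proof (rule that[of \<gamma>])
    fix t assume t: "t \<in> S"
    show "cmod (g t - \<gamma>) \<le> N * sqrt \<bar>t - z\<bar>"
    proof (rule LIMSEQ_le)
      show "(\<lambda>n. cmod (g t - g (e n))) \<longlonglongrightarrow> cmod (g t - \<gamma>)" by (intro tendsto_intros \<gamma>)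
      show "(\<lambda>n. N * sqrt \<bar>t - e n\<bar>) \<longlonglongrightarrow> N * sqrt \<bar>t - z\<bar>" by (intro tendsto_intros e)
    qed (use h[OF t e(1)] in blast)
  qed
qed

lemma shrink_tendsto: "(\<lambda>n. z + w / (real n + 1)) \<longlonglongrightarrow> z"
proof -
  have "(\<lambda>n. w * inverse (real (Suc n))) \<longlonglongrightarrow> w * 0" by (intro tendsto_mult_left LIMSEQ_inverse_real_of_nat)
  then have "(\<lambda>n. z + w * inverse (real (Suc n))) \<longlonglongrightarrow> z + w * 0" by (intro tendsto_add tendsto_const)
  then show ?thesis by (simp add: field_simps)
qed

text \<open>Let \<open>\<gamma>\<close> be the limit of \<open>g\<close> at the finite endpoint. If
  it were nonzero, |g| would be at least |\<gamma>|/2 near the endpoint, and \<open>gronwall\<close>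
  would bound the integral of P^2 uniformly, against \<open>nP\<close>. With \<gamma> = 0 the
  Hoelder bound is the claim.\<close>

lemma right_vanish:
  assumes f: "source f g v" and b: "b = ereal br"
    and nP: "\<not> set_integrable L {x \<in> I. d < x} (\<lambda>x. (Pl x)\<^sup>2)" and t: "t \<in> I" "d \<le> t"
  shows "cmod (g t) \<le> sqrt (LINT t|L. (cmod (v t))\<^sup>2) * sqrt (br - t)"
proof -
  define E where "E = (LINT t|L. (cmod (v t))\<^sup>2)"
  have E0: "0 \<le> E" by (simp add: E_def)
  have lt: "x < br" if "x \<in> I" for x using that by (simp add: mem_I b)
  have mem: "x \<in> I" if "d \<le> x" "x < br" for x
    using that by (intro mem_I_ge[OF d]) (simp_all add: b)
  have h: "cmod (g x - g y) \<le> sqrt E * sqrt \<bar>x - y\<bar>" if "x \<in> {x \<in> I. d \<le> x}" "y \<in> {x \<in> I. d \<le> x}" for x y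
  proof (cases "y \<le> x")
    case True
    then show ?thesis using holder[OF f, of y x] that by (simp add: E_def)
  next
    case False
    then show ?thesis using holder[OF f, of x y] that by (simp add: E_def norm_minus_commute)
  qed
  have en: "br + (d - br) / (real n + 1) \<in> {x \<in> I. d \<le> x}" for n
  proof -
    have "0 < br - d" using lt[OF d] by simp
    then have "(br - d) / (real n + 1) \<le> br - d" "0 < (br - d) / (real n + 1)" by (rule divide_Suc_bounds)+
    moreover have "(d - br) / (real n + 1) = - ((br - d) / (real n + 1))" by (simp add: field_simps)
    ultimately have "d \<le> br + (d - br) / (real n + 1)" "br + (d - br) / (real n + 1) < br" by linarith+
    then show ?thesis using mem by simp
  qed
  obtain \<gamma> where \<gamma>: "\<And>t. t \<in> {x \<in> I. d \<le> x} \<Longrightarrow> cmod (g t - \<gamma>) \<le> sqrt E * sqrt \<bar>t - br\<bar>"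
    by (rule holder_limit[OF h _ en shrink_tendsto]) (assumption, assumption, simp add: E0, rule that, assumption)
  have \<gamma>': "cmod (g t - \<gamma>) \<le> sqrt E * sqrt (br - t)" if "t \<in> I" "d \<le> t" for t
    using \<gamma>[of t] that lt[OF that(1)] by simp
  have "\<gamma> = 0"
  proof (rule ccontr)
    assume "\<gamma> \<noteq> 0"
    define \<epsilon> where "\<epsilon> = cmod \<gamma> / 2"
    have \<epsilon>: "0 < \<epsilon>" using \<open>\<gamma> \<noteq> 0\<close> by (simp add: \<epsilon>_def)
    obtain \<delta> where \<delta>: "0 < \<delta>" "3 * E * \<delta> \<le> \<epsilon>\<^sup>2 / 2" "sqrt E * sqrt \<delta> \<le> \<epsilon>" by (rule small_delta[OF E0 \<epsilon>])
    \<comment> \<open>Far enough to the right to avoid the support of \<open>q\<close> and to leave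
      a length of at most \<open>\<delta>\<close> up to the endpoint.\<close>
    define x1 where "x1 = max d (br - \<delta>)"
    have x1: "x1 \<in> I" "d \<le> x1" using mem[of x1] lt[OF d] \<delta>(1) by (auto simp: x1_def)
    have ge: "\<epsilon> \<le> cmod (g t)" if "t \<in> I" "x1 \<le> t" for t
    proof -
      have "sqrt E * sqrt (br - t) \<le> sqrt E * sqrt \<delta>"
        using that(2) E0 by (intro mult_left_mono real_sqrt_le_mono) (auto simp: x1_def)
      then have "cmod (g t - \<gamma>) \<le> \<epsilon>" using \<gamma>'[OF that(1)] that(2) x1(2) \<delta>(3) by linarith
      moreover have "cmod \<gamma> \<le> cmod (g t) + cmod (g t - \<gamma>)"
        using norm_triangle_ineq4[of "g t" "g t - \<gamma>"] by simp
      ultimately show ?thesis by (simp add: \<epsilon>_def)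
    qed
    have "set_integrable L {t \<in> I. x1 \<le> t} (\<lambda>t. (Pl t)\<^sup>2)"
    proof (rule integrable_exhaust_right[OF Pl2_measurable _ x1(1)])
      fix x assume x: "x \<in> I" "x1 \<le> x"
      show "set_integrable L {x1..<x} (\<lambda>t. (Pl t)\<^sup>2)" by (rule Pl_square_integrable[OF x1(1) x(1)])
      show "(LINT t:{x1..<x}|L. (Pl t)\<^sup>2) \<le> 6 * ((cmod (g x1 * of_real (Pl x1) - f x1))\<^sup>2 * \<delta> + (LINT t|L. (cmod (f t))\<^sup>2)) / \<epsilon>\<^sup>2"
      proof (rule gronwall_const[OF _ _ _ E0 \<epsilon> _ _ \<delta>(2)])
        show "\<epsilon>\<^sup>2 * (LINT t:{x1..<x}|L. (Pl t)\<^sup>2) \<le> 3 * ((cmod (g x1 * of_real (Pl x1) - f x1))\<^sup>2 * (x - x1) +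
            E * (x - x1) * (LINT t:{x1..<x}|L. (Pl t)\<^sup>2) + (LINT t|L. (cmod (f t))\<^sup>2))"
          unfolding E_def
        proof (rule gronwall[OF f x1(1) x _ _ \<epsilon>])
          show "\<epsilon> \<le> cmod (g t)" if "t \<in> {x1..<x}" for t
            using that subI(2)[OF x1(1) x(1)] by (intro ge) auto
        qed (use x x1 in auto)
        show "0 \<le> (LINT t:{x1..<x}|L. (Pl t)\<^sup>2)" unfolding set_lebesgue_integral_def by simp
        show "x - x1 \<le> \<delta>" using lt[OF x(1)] by (auto simp: x1_def)
      qed (use x in simp_all)
    qed simp
    moreover have "set_integrable L {d..<x1} (\<lambda>t. (Pl t)\<^sup>2)" by (rule Pl_square_integrable[OF d x1(1)])
    moreover have "{t \<in> I. x1 \<le> t} = I \<inter> {x1..}" "{x \<in> I. d < x} = I \<inter> {d<..}" by auto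
    then have s: "{t \<in> I. x1 \<le> t} \<in> sets L" "{x \<in> I. d < x} \<in> sets L" by (simp_all add: sets_L sets_I_iff)
    ultimately have "set_integrable L ({d..<x1} \<union> {t \<in> I. x1 \<le> t}) (\<lambda>t. (Pl t)\<^sup>2)"
      using locfin_Ico[OF locfin_L d x1(1)] by (intro set_integrable_Un)
    then have "set_integrable L {x \<in> I. d < x} (\<lambda>t. (Pl t)\<^sup>2)"
      by (rule set_integrable_subset[OF _ s(2)]) auto
    with nP show False by simp
  qed
  with \<gamma>'[OF t] show ?thesis by (simp add: E_def)
qed

lemma left_vanish:
  assumes f: "source f g v" and a: "a = ereal ar"
    and nP: "\<not> set_integrable L {x \<in> I. x < c} (\<lambda>x. (Pl x)\<^sup>2)" and t: "t \<in> I" "t \<le> c"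
  shows "cmod (g t) \<le> sqrt (LINT t|L. (cmod (v t))\<^sup>2) * sqrt (t - ar)"
proof -
  define E where "E = (LINT t|L. (cmod (v t))\<^sup>2)"
  have E0: "0 \<le> E" by (simp add: E_def)
  have lt: "ar < x" if "x \<in> I" for x using that by (simp add: mem_I a)
  have mem: "x \<in> I" if "x \<le> c" "ar < x" for x
    using that by (intro mem_I_le[OF c]) (simp_all add: a)
  have h: "cmod (g x - g y) \<le> sqrt E * sqrt \<bar>x - y\<bar>" if "x \<in> {x \<in> I. x \<le> c}" "y \<in> {x \<in> I. x \<le> c}" for x y
  proof (cases "y \<le> x")
    case True
    then show ?thesis using holder[OF f, of y x] that by (simp add: E_def)
  next
    case False
    then show ?thesis using holder[OF f, of x y] that by (simp add: E_def norm_minus_commute)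
  qed
  have en: "ar + (c - ar) / (real n + 1) \<in> {x \<in> I. x \<le> c}" for n
  proof -
    have "0 < c - ar" using lt[OF c] by simp
    then have "(c - ar) / (real n + 1) \<le> c - ar" "0 < (c - ar) / (real n + 1)" by (rule divide_Suc_bounds)+
    then have "ar + (c - ar) / (real n + 1) \<le> c" "ar < ar + (c - ar) / (real n + 1)" by linarith+
    then show ?thesis using mem by simp
  qed
  obtain \<gamma> where \<gamma>: "\<And>t. t \<in> {x \<in> I. x \<le> c} \<Longrightarrow> cmod (g t - \<gamma>) \<le> sqrt E * sqrt \<bar>t - ar\<bar>"
    by (rule holder_limit[OF h _ en shrink_tendsto]) (assumption, assumption, simp add: E0, rule that, assumption)
  have \<gamma>': "cmod (g t - \<gamma>) \<le> sqrt E * sqrt (t - ar)" if "t \<in> I" "t \<le> c" for t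
    using \<gamma>[of t] that lt[OF that(1)] by simp
  have "\<gamma> = 0"
  proof (rule ccontr)
    assume "\<gamma> \<noteq> 0"
    define \<epsilon> where "\<epsilon> = cmod \<gamma> / 2"
    have \<epsilon>: "0 < \<epsilon>" using \<open>\<gamma> \<noteq> 0\<close> by (simp add: \<epsilon>_def)
    obtain \<delta> where \<delta>: "0 < \<delta>" "3 * E * \<delta> \<le> \<epsilon>\<^sup>2 / 2" "sqrt E * sqrt \<delta> \<le> \<epsilon>" by (rule small_delta[OF E0 \<epsilon>])
    define x1 where "x1 = min c (ar + \<delta>)"
    have x1: "x1 \<in> I" "x1 \<le> c" using mem[of x1] lt[OF c] \<delta>(1) by (auto simp: x1_def)
    have ge: "\<epsilon> \<le> cmod (g t)" if "t \<in> I" "t \<le> x1" for t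
    proof -
      have "sqrt E * sqrt (t - ar) \<le> sqrt E * sqrt \<delta>"
        using that(2) E0 by (intro mult_left_mono real_sqrt_le_mono) (auto simp: x1_def)
      then have "cmod (g t - \<gamma>) \<le> \<epsilon>" using \<gamma>'[OF that(1)] that(2) x1(2) \<delta>(3) by linarith
      moreover have "cmod \<gamma> \<le> cmod (g t) + cmod (g t - \<gamma>)"
        using norm_triangle_ineq4[of "g t" "g t - \<gamma>"] by simp
      ultimately show ?thesis by (simp add: \<epsilon>_def)
    qed
    have "set_integrable L {t \<in> I. t < x1} (\<lambda>t. (Pl t)\<^sup>2)"
    proof (rule integrable_exhaust_left[OF Pl2_measurable _ x1(1)])
      fix x assume x: "x \<in> I" "x \<le> x1"
      show "set_integrable L {x..<x1} (\<lambda>t. (Pl t)\<^sup>2)" by (rule Pl_square_integrable[OF x(1) x1(1)])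
      show "(LINT t:{x..<x1}|L. (Pl t)\<^sup>2) \<le> 6 * ((cmod (g x1 * of_real (Pl x1) - f x1))\<^sup>2 * \<delta> + (LINT t|L. (cmod (f t))\<^sup>2)) / \<epsilon>\<^sup>2"
      proof (rule gronwall_const[OF _ _ _ E0 \<epsilon> _ _ \<delta>(2)])
        show "\<epsilon>\<^sup>2 * (LINT t:{x..<x1}|L. (Pl t)\<^sup>2) \<le> 3 * ((cmod (g x1 * of_real (Pl x1) - f x1))\<^sup>2 * (x1 - x) +
            E * (x1 - x) * (LINT t:{x..<x1}|L. (Pl t)\<^sup>2) + (LINT t|L. (cmod (f t))\<^sup>2))"
          unfolding E_def
        \<comment> \<open>The base point of \<open>gronwall\<close> is now the fixed right end
          \<open>x1\<close>, so that the bound does not depend on the moving left end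
          \<open>x\<close>.\<close>
        proof (rule gronwall[OF f x(1) x1(1) x(2) _ _ \<epsilon>])
          show "\<epsilon> \<le> cmod (g t)" if "t \<in> {x..<x1}" for t
            using that subI(2)[OF x(1) x1(1)] by (intro ge) auto
        qed (use x x1 in auto)
        show "0 \<le> (LINT t:{x..<x1}|L. (Pl t)\<^sup>2)" unfolding set_lebesgue_integral_def by simp
        show "x1 - x \<le> \<delta>" using lt[OF x(1)] by (auto simp: x1_def)
      qed (use x in simp_all)
    qed simp
    moreover have "set_integrable L {x1..<c} (\<lambda>t. (Pl t)\<^sup>2)" by (rule Pl_square_integrable[OF x1(1) c])
    moreover have "{t \<in> I. t < x1} = I \<inter> {..<x1}" "{x \<in> I. x < c} = I \<inter> {..<c}" by auto
    then have s: "{t \<in> I. t < x1} \<in> sets L" "{x \<in> I. x < c} \<in> sets L" by (simp_all add: sets_L sets_I_iff)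
    ultimately have "set_integrable L ({t \<in> I. t < x1} \<union> {x1..<c}) (\<lambda>t. (Pl t)\<^sup>2)"
      using locfin_Ico[OF locfin_L x1(1) c] by (intro set_integrable_Un)
    then have "set_integrable L {x \<in> I. x < c} (\<lambda>t. (Pl t)\<^sup>2)"
      by (rule set_integrable_subset[OF _ s(2)]) auto
    with nP show False by simp
  qed
  with \<gamma>'[OF t] show ?thesis by (simp add: E_def)
qed

text \<open>Adding one under the root lets the root dominate the constant contribution of
  \<open>g0\<close> as well, in particular at \<open>l = 0\<close>.\<close>

lemma growth_const:
  fixes g0 g1 :: complex and N l :: real
  assumes "cmod (g1 - g0) \<le> N * sqrt l" "0 \<le> l" "0 \<le> N" "cmod g0 + N \<le> C"
  shows "cmod g1 \<le> C * sqrt (l + 1)"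
proof -
  have "cmod g1 \<le> cmod g0 + cmod (g1 - g0)" using norm_triangle_ineq[of g0 "g1 - g0"] by simp
  also have "\<dots> \<le> cmod g0 * sqrt (l + 1) + N * sqrt (l + 1)"
  proof (intro add_mono)
    show "cmod g0 \<le> cmod g0 * sqrt (l + 1)" using assms(2) by (simp add: mult_le_cancel_left1)
    show "cmod (g1 - g0) \<le> N * sqrt (l + 1)"
      using assms by (intro order_trans[OF assms(1)] mult_left_mono) auto
  qed
  also have "\<dots> = (cmod g0 + N) * sqrt (l + 1)" by (simp add: algebra_simps)
  also have "\<dots> \<le> C * sqrt (l + 1)" using assms by (intro mult_right_mono) auto
  finally show ?thesis .
qed

text \<open>The function \<open>r\<close> is \<open>t - x1 + 1\<close> at an infinite endpoint and
  \<open>br - t\<close> at a finite one. In both cases the primitive of \<open>1 / r\<close> is a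
  logarithm, up to sign, that is unbounded towards the endpoint, so
  \<open>growth_contradiction\<close> applies.\<close>

lemma right_contradiction:
  assumes f: "source f g v" and f': "source f' g' v'" and x1: "x1 \<in> I" "d \<le> x1" and \<epsilon>: "0 < \<epsilon>"
    and W: "\<And>t. t \<in> I \<Longrightarrow> x1 \<le> t \<Longrightarrow> \<epsilon> \<le> cmod (f t * g' t - f' t * g t)"
    and b: "b = \<infinity> \<or> \<not> set_integrable L {x \<in> I. d < x} (\<lambda>x. (Pl x)\<^sup>2)"
  shows False
proof -
  define N N' where "N = sqrt (LINT t|L. (cmod (v t))\<^sup>2)" and "N' = sqrt (LINT t|L. (cmod (v' t))\<^sup>2)"
  have N: "0 \<le> N" "0 \<le> N'" by (simp_all add: N_def N'_def)
  show False
  proof (cases "b = \<infinity>")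
    case True
    have mem: "x \<in> I" if "x1 \<le> x" for x using that by (intro mem_I_ge[OF x1(1)]) (simp_all add: True)
    define C where "C = max (cmod (g x1) + N) (cmod (g' x1) + N')"
    show False
    proof (rule growth_contradiction[where f=f and f'=f' and g=g and g'=g' and y="\<lambda>n. x1" and x="\<lambda>n. x1 + real n"
          and r="\<lambda>t. t - x1 + 1" and \<theta>="\<lambda>t. ln (t - x1 + 1)" and C=C and \<epsilon>=\<epsilon>])
      show "cmod (g t) \<le> C * sqrt (t - x1 + 1)" if "t \<in> {x1..<x1 + real n}" for n t
        using holder[OF f x1(1) mem[of t]] that x1(2) N
        by (intro growth_const[of _ "g x1" N]) (auto simp: C_def N_def)
      show "cmod (g' t) \<le> C * sqrt (t - x1 + 1)" if "t \<in> {x1..<x1 + real n}" for n t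
        using holder[OF f' x1(1) mem[of t]] that x1(2) N
        by (intro growth_const[of _ "g' x1" N']) (auto simp: C_def N'_def)
      show "((\<lambda>t. ln (t - x1 + 1)) has_real_derivative 1 / (t - x1 + 1)) (at t)" if "t \<in> {x1..x1 + real n}" for n t
        using that by (auto intro!: derivative_eq_intros)
      show "\<exists>n. K < ln (x1 + real n - x1 + 1) - ln (x1 - x1 + 1)" for K
        using ln_unbounded[of K] by simp
    qed (use sourceD[OF f] sourceD[OF f'] \<epsilon> W mem x1 in auto)
  next
    case False
    then obtain br where br: "b = ereal br" using x1(1) by (cases b) (auto simp: mem_I)
    have nP: "\<not> set_integrable L {x \<in> I. d < x} (\<lambda>x. (Pl x)\<^sup>2)" using b False by simp
    have lt: "x1 < br" using x1(1) by (simp add: mem_I br)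
    have mem: "x \<in> I" if "x1 \<le> x" "x < br" for x
      using that by (intro mem_I_ge[OF x1(1)]) (simp_all add: br)
    \<comment> \<open>These points approach \<open>br\<close> in such a way that the difference of
      logarithms is exactly \<open>ln (real n + 1)\<close>.\<close>
    define e where "e n = br - (br - x1) / (real n + 1)" for n
    have e: "x1 \<le> e n" "e n < br" for n
    proof -
      have "(br - x1) / (real n + 1) \<le> br - x1" "0 < (br - x1) / (real n + 1)" using lt by (auto intro!: divide_Suc_bounds)
      then show "x1 \<le> e n" "e n < br" unfolding e_def by linarith+
    qed
    show False
    proof (rule growth_contradiction[where f=f and f'=f' and g=g and g'=g' and y="\<lambda>n. x1" and x=e
          and r="\<lambda>t. br - t" and \<theta>="\<lambda>t. - ln (br - t)" and C="max N N'" and \<epsilon>=\<epsilon>])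
      have inI: "t \<in> I \<and> d \<le> t" if "t \<in> {x1..<e n}" for n t using that mem[of t] e[of n] x1(2) by auto
      show "cmod (g t) \<le> max N N' * sqrt (br - t)" if "t \<in> {x1..<e n}" for n t
      proof -
        have "cmod (g t) \<le> N * sqrt (br - t)" using right_vanish[OF f br nP] inI[OF that] by (simp add: N_def)
        also have "\<dots> \<le> max N N' * sqrt (br - t)" using that e[of n] by (intro mult_right_mono) auto
        finally show ?thesis .
      qed
      show "cmod (g' t) \<le> max N N' * sqrt (br - t)" if "t \<in> {x1..<e n}" for n t
      proof -
        have "cmod (g' t) \<le> N' * sqrt (br - t)" using right_vanish[OF f' br nP] inI[OF that] by (simp add: N'_def)
        also have "\<dots> \<le> max N N' * sqrt (br - t)" using that e[of n] by (intro mult_right_mono) auto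
        finally show ?thesis .
      qed
      show "((\<lambda>t. - ln (br - t)) has_real_derivative 1 / (br - t)) (at t)" if "t \<in> {x1..e n}" for n t
        using that e(2)[of n] by (auto intro!: derivative_eq_intros)
      show "\<exists>n. K < - ln (br - e n) - - ln (br - x1)" for K
      proof -
        have "- ln (br - e n) - - ln (br - x1) = ln (real n + 1)" for n
          using lt by (simp add: e_def ln_div)
        then show ?thesis using ln_unbounded[of K] by simp
      qed
      show "0 < br - t" if "t \<in> {x1..e n}" for n t using that e(2)[of n] by simp
      show "\<epsilon> \<le> cmod (f t * g' t - f' t * g t)" if "t \<in> {x1..<e n}" for n t
        using that inI[OF that] by (intro W) auto
    qed (use sourceD[OF f] sourceD[OF f'] \<epsilon> mem e x1 in auto)
  qed
qed

lemma left_contradiction: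
  assumes f: "source f g v" and f': "source f' g' v'" and x1: "x1 \<in> I" "x1 \<le> c" and \<epsilon>: "0 < \<epsilon>"
    and W: "\<And>t. t \<in> I \<Longrightarrow> t \<le> x1 \<Longrightarrow> \<epsilon> \<le> cmod (f t * g' t - f' t * g t)"
    and a: "a = -\<infinity> \<or> \<not> set_integrable L {x \<in> I. x < c} (\<lambda>x. (Pl x)\<^sup>2)"
  shows False
proof -
  define N N' where "N = sqrt (LINT t|L. (cmod (v t))\<^sup>2)" and "N' = sqrt (LINT t|L. (cmod (v' t))\<^sup>2)"
  have N: "0 \<le> N" "0 \<le> N'" by (simp_all add: N_def N'_def)
  show False
  proof (cases "a = -\<infinity>")
    case True
    have mem: "x \<in> I" if "x \<le> x1" for x using that by (intro mem_I_le[OF x1(1)]) (simp_all add: True)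
    define C where "C = max (cmod (g x1) + N) (cmod (g' x1) + N')"
    show False
    proof (rule growth_contradiction[where f=f and f'=f' and g=g and g'=g' and y="\<lambda>n. x1 - real n" and x="\<lambda>n. x1"
          and r="\<lambda>t. x1 - t + 1" and \<theta>="\<lambda>t. - ln (x1 - t + 1)" and C=C and \<epsilon>=\<epsilon>])
      show "cmod (g t) \<le> C * sqrt (x1 - t + 1)" if "t \<in> {x1 - real n..<x1}" for n t
        using holder[OF f mem[of t] x1(1)] that x1(2) N
        by (intro growth_const[of _ "g x1" N]) (auto simp: C_def N_def norm_minus_commute)
      show "cmod (g' t) \<le> C * sqrt (x1 - t + 1)" if "t \<in> {x1 - real n..<x1}" for n t
        using holder[OF f' mem[of t] x1(1)] that x1(2) N
        by (intro growth_const[of _ "g' x1" N']) (auto simp: C_def N'_def norm_minus_commute)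
      show "((\<lambda>t. - ln (x1 - t + 1)) has_real_derivative 1 / (x1 - t + 1)) (at t)" if "t \<in> {x1 - real n..x1}" for n t
        using that by (auto intro!: derivative_eq_intros)
      show "\<exists>n. K < - ln (x1 - x1 + 1) - - ln (x1 - (x1 - real n) + 1)" for K
        using ln_unbounded[of K] by simp
    qed (use sourceD[OF f] sourceD[OF f'] \<epsilon> W mem x1 in auto)
  next
    case False
    then obtain ar where ar: "a = ereal ar" using x1(1) by (cases a) (auto simp: mem_I)
    have nP: "\<not> set_integrable L {x \<in> I. x < c} (\<lambda>x. (Pl x)\<^sup>2)" using a False by simp
    have lt: "ar < x1" using x1(1) by (simp add: mem_I ar)
    have mem: "x \<in> I" if "x \<le> x1" "ar < x" for x
      using that by (intro mem_I_le[OF x1(1)]) (simp_all add: ar)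
    define e where "e n = ar + (x1 - ar) / (real n + 1)" for n
    have e: "e n \<le> x1" "ar < e n" for n
    proof -
      have "(x1 - ar) / (real n + 1) \<le> x1 - ar" "0 < (x1 - ar) / (real n + 1)" using lt by (auto intro!: divide_Suc_bounds)
      then show "e n \<le> x1" "ar < e n" unfolding e_def by linarith+
    qed
    show False
    proof (rule growth_contradiction[where f=f and f'=f' and g=g and g'=g' and y=e and x="\<lambda>n. x1"
          and r="\<lambda>t. t - ar" and \<theta>="\<lambda>t. ln (t - ar)" and C="max N N'" and \<epsilon>=\<epsilon>])
      have inI: "t \<in> I \<and> t \<le> c" if "t \<in> {e n..<x1}" for n t using that mem[of t] e[of n] x1(2) by auto
      show "cmod (g t) \<le> max N N' * sqrt (t - ar)" if "t \<in> {e n..<x1}" for n t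
      proof -
        have "cmod (g t) \<le> N * sqrt (t - ar)" using left_vanish[OF f ar nP] inI[OF that] by (simp add: N_def)
        also have "\<dots> \<le> max N N' * sqrt (t - ar)" using that e[of n] by (intro mult_right_mono) auto
        finally show ?thesis .
      qed
      show "cmod (g' t) \<le> max N N' * sqrt (t - ar)" if "t \<in> {e n..<x1}" for n t
      proof -
        have "cmod (g' t) \<le> N' * sqrt (t - ar)" using left_vanish[OF f' ar nP] inI[OF that] by (simp add: N'_def)
        also have "\<dots> \<le> max N N' * sqrt (t - ar)" using that e[of n] by (intro mult_right_mono) auto
        finally show ?thesis .
      qed
      show "((\<lambda>t. ln (t - ar)) has_real_derivative 1 / (t - ar)) (at t)" if "t \<in> {e n..x1}" for n t
        using that e(2)[of n] by (auto intro!: derivative_eq_intros)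
      show "\<exists>n. K < ln (x1 - ar) - ln (e n - ar)" for K
      proof -
        have "ln (x1 - ar) - ln (e n - ar) = ln (real n + 1)" for n
          using lt by (simp add: e_def ln_div)
        then show ?thesis using ln_unbounded[of K] by simp
      qed
      show "0 < t - ar" if "t \<in> {e n..x1}" for n t using that e(2)[of n] by simp
      show "\<epsilon> \<le> cmod (f t * g' t - f' t * g t)" if "t \<in> {e n..<x1}" for n t
        using that inI[OF that] by (intro W) auto
    qed (use sourceD[OF f] sourceD[OF f'] \<epsilon> mem e x1 in auto)
  qed
qed

section \<open>Vanishing boundary terms and symmetry\<close>

lemma source_integrable:
  assumes f: "source f g v" and f': "source f' g' v'"
  shows "integrable L (\<lambda>t. f' t * v t - f t * v' t)"
proof -
  have "integrable L (\<lambda>t. f' t * v t)"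
    using L2_product_integrable[OF sourceD(3)[OF f'] sourceD(4)[OF f]]
      lebesgue_on_L(2)[OF borel_I borel_measurable_times[OF sourceD(5)[OF f'] sourceD(2)[OF f]]] by simp
  moreover have "integrable L (\<lambda>t. f t * v' t)"
    using L2_product_integrable[OF sourceD(3)[OF f] sourceD(4)[OF f']]
      lebesgue_on_L(2)[OF borel_I borel_measurable_times[OF sourceD(5)[OF f] sourceD(2)[OF f']]] by simp
  ultimately show ?thesis by (rule Bochner_Integration.integrable_diff)
qed

lemma ray_sets: "{t \<in> I. x \<le> t} \<in> sets L" "{t \<in> I. t < x} \<in> sets L"
proof -
  have "{t \<in> I. x \<le> t} = I \<inter> {x..}" "{t \<in> I. t < x} = I \<inter> {..<x}" by auto
  then show "{t \<in> I. x \<le> t} \<in> sets L" "{t \<in> I. t < x} \<in> sets L" by (simp_all add: sets_L sets_I_iff)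
qed

lemma set_integral_tail_le:
  fixes D :: "real \<Rightarrow> complex"
  assumes D: "integrable L D" and B: "B \<in> sets L" and S: "B \<subseteq> S" "indicat_real S \<in> borel_measurable L"
  shows "norm (LINT t:B|L. D t) \<le> (LINT t|L. indicator S t * norm (D t))"
proof -
  have "norm (LINT t:B|L. D t) \<le> (LINT t|L. norm (indicator B t *\<^sub>R D t))"
    unfolding set_lebesgue_integral_def by (rule integral_norm_bound)
  also have "\<dots> \<le> (LINT t|L. indicator S t * norm (D t))"
  proof (rule integral_mono)
    show "integrable L (\<lambda>t. norm (indicator B t *\<^sub>R D t))"
      using set_integrable_sub[OF D B] unfolding set_integrable_def by (rule integrable_norm)
    show "integrable L (\<lambda>t. indicator S t * norm (D t))"
    proof (rule Bochner_Integration.integrable_bound[OF integrable_norm[OF D]])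
      show "(\<lambda>t. indicator S t * norm (D t)) \<in> borel_measurable L"
        by (rule borel_measurable_times[OF S(2) measurable_compose[OF borel_measurable_integrable[OF D] borel_measurable_norm]])
    qed (auto simp: indicator_def)
    show "norm (indicator B t *\<^sub>R D t) \<le> indicator S t * norm (D t)" for t
      using S(1) by (auto simp: indicator_def)
  qed
  finally show ?thesis .
qed

text \<open>By the Lagrange identity the expression does not change as \<open>x0\<close> moves to
  the right. The integral over the tail becomes small, so a nonzero value would keep the Wronskian
  away from zero near \<open>b\<close>, which \<open>right_contradiction\<close> excludes.\<close>

lemma right_boundary:
  assumes f: "source f g v" and f': "source f' g' v'" and x0: "x0 \<in> I"
    and b: "b = \<infinity> \<or> \<not> set_integrable L {x \<in> I. d < x} (\<lambda>x. (Pl x)\<^sup>2)"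
  shows "(f x0 * g' x0 - f' x0 * g x0) + (LINT t:{t \<in> I. x0 \<le> t}|L. f' t * v t - f t * v' t) = 0" (is "?W x0 + ?R x0 = 0")
proof (rule ccontr)
  assume ne: "?W x0 + ?R x0 \<noteq> 0"
  define \<epsilon> where "\<epsilon> = cmod (?W x0 + ?R x0) / 2"
  have \<epsilon>: "0 < \<epsilon>" using ne by (simp add: \<epsilon>_def)
  note D = source_integrable[OF f f']
  have "max x0 d \<in> I" using x0 d by (simp add: max_def)
  then obtain x1 where x1: "x1 \<in> I" "max x0 d \<le> x1"
    "(LINT t|L. indicator {t. x1 \<le> t} t * norm (f' t * v t - f t * v' t)) < \<epsilon>"
    by (rule tail_right[OF D \<epsilon>])
  note lag = lagrange_source[OF sourceD(1)[OF f] sourceD(1)[OF f']]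
  have im: "indicat_real {t. x1 \<le> t} \<in> borel_measurable L"
    by (rule measurable_compose[OF id_measurable[OF locfin_L]]) (rule borel_measurable_indicator, simp)
  show False
  proof (rule right_contradiction[OF f f' x1(1) _ \<epsilon> _ b])
    show "d \<le> x1" using x1 by simp
    fix x assume x: "x \<in> I" "x1 \<le> x"
    then have x0x: "x0 \<le> x" using x1 by simp
    have W: "?W x = ?W x0 + (LINT t:{x0..<x}|L. f' t * v t - f t * v' t)"
      by (rule primD[OF lag x0 x(1) x0x])
    have "{t \<in> I. x0 \<le> t} = {x0..<x} \<union> {t \<in> I. x \<le> t}" using subI(2)[OF x0 x(1)] x0x by auto
    then have "?R x0 = (LINT t:{x0..<x}|L. f' t * v t - f t * v' t) + ?R x"
      by (simp only:) (rule set_integral_Un[OF _ set_integrable_sub[OF D locfin_Ico[OF locfin_L x0 x(1)]]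
        set_integrable_sub[OF D ray_sets(1)[of x]]], auto)
    then have eq: "?W x0 + ?R x0 = ?W x + ?R x" using W by simp
    have "norm (?R x) \<le> (LINT t|L. indicator {t. x1 \<le> t} t * norm (f' t * v t - f t * v' t))"
      using x by (intro set_integral_tail_le[OF D ray_sets(1)] im) auto
    then have "norm (?R x) < \<epsilon>" using x1(3) by simp
    moreover have "2 * \<epsilon> \<le> norm (?W x) + norm (?R x)"
      using norm_triangle_ineq[of "?W x" "?R x"] unfolding \<epsilon>_def eq by simp
    ultimately show "\<epsilon> \<le> cmod (?W x)" by linarith
  qed
qed

lemma left_boundary:
  assumes f: "source f g v" and f': "source f' g' v'" and x0: "x0 \<in> I"
    and a: "a = -\<infinity> \<or> \<not> set_integrable L {x \<in> I. x < c} (\<lambda>x. (Pl x)\<^sup>2)"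
  shows "(f x0 * g' x0 - f' x0 * g x0) - (LINT t:{t \<in> I. t < x0}|L. f' t * v t - f t * v' t) = 0" (is "?W x0 - ?R x0 = 0")
proof (rule ccontr)
  assume ne: "?W x0 - ?R x0 \<noteq> 0"
  define \<epsilon> where "\<epsilon> = cmod (?W x0 - ?R x0) / 2"
  have \<epsilon>: "0 < \<epsilon>" using ne by (simp add: \<epsilon>_def)
  note D = source_integrable[OF f f']
  have "min x0 c \<in> I" using x0 c by (simp add: min_def)
  then obtain x1 where x1: "x1 \<in> I" "x1 \<le> min x0 c"
    "(LINT t|L. indicator {t. t < x1} t * norm (f' t * v t - f t * v' t)) < \<epsilon>"
    by (rule tail_left[OF D \<epsilon>])
  note lag = lagrange_source[OF sourceD(1)[OF f] sourceD(1)[OF f']]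
  have im: "indicat_real {t. t < x1} \<in> borel_measurable L"
    by (rule measurable_compose[OF id_measurable[OF locfin_L]]) (rule borel_measurable_indicator, simp)
  show False
  proof (rule left_contradiction[OF f f' x1(1) _ \<epsilon> _ a])
    show "x1 \<le> c" using x1 by simp
    fix x assume x: "x \<in> I" "x \<le> x1"
    then have x0x: "x \<le> x0" using x1 by simp
    have W: "?W x0 = ?W x + (LINT t:{x..<x0}|L. f' t * v t - f t * v' t)"
      by (rule primD[OF lag x(1) x0 x0x])
    have "t \<in> {t \<in> I. t < x0} \<longleftrightarrow> t \<in> {t \<in> I. t < x} \<union> {x..<x0}" for t
      using betweenI[OF x(1) x0, of t] x0x by (cases "t < x") auto
    then have "{t \<in> I. t < x0} = {t \<in> I. t < x} \<union> {x..<x0}" by (rule set_eqI)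
    then have "?R x0 = ?R x + (LINT t:{x..<x0}|L. f' t * v t - f t * v' t)"
      by (rule ssubst) (rule set_integral_Un[OF _ set_integrable_sub[OF D ray_sets(2)[of x]]
        set_integrable_sub[OF D locfin_Ico[OF locfin_L x(1) x0]]], auto)
    then have eq: "?W x0 - ?R x0 = ?W x - ?R x" using W by simp
    have "norm (?R x) \<le> (LINT t|L. indicator {t. t < x1} t * norm (f' t * v t - f t * v' t))"
      using x by (intro set_integral_tail_le[OF D ray_sets(2)] im) auto
    then have "norm (?R x) < \<epsilon>" using x1(3) by simp
    moreover have "2 * \<epsilon> \<le> norm (?W x) + norm (?R x)"
      using norm_triangle_ineq4[of "?W x" "?R x"] unfolding \<epsilon>_def eq by simp
    ultimately show "\<epsilon> \<le> cmod (?W x)" by linarith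
  qed
qed

text \<open>The second component is replaced by the Borel function computed from \<open>f\<close>
  and the derivative of \<open>g\<close>, so that the equation becomes exact.\<close>

lemma maximal_source:
  assumes "(u, w) \<in> maximal_operator I P q"
  obtains f g v where "source f g v" "AE x in lebesgue_on I. u x = f x" "AE x in lebesgue_on I. w x = v x"
proof -
  obtain f g h where uw: "u \<in> L2 I" "w \<in> L2 I" and fgh: "adm f g h" "AE x in lebesgue_on I. u x = f x"
    "AE x in lebesgue_on I. w x = - h x + of_real (q x) * f x"
    using assms unfolding maximal_operator_iff by blast
  define v where "v x = of_real (q x) * f x - h x" for x
  have vm: "v \<in> borel_measurable L"
    unfolding v_def[abs_def] using locint_measurable[OF locfin_L locint_q[OF adm_f[OF fgh(1)]]] adm_measurable(3)[OF fgh(1)]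
    by (rule borel_measurable_diff)
  have wv: "AE x in lebesgue_on I. w x = v x" using fgh(3) by eventually_elim (simp add: v_def)
  have "source f g v" unfolding source_def
  proof (intro conjI vm)
    show "adm f g (\<lambda>x. of_real (q x) * f x - v x)" using fgh(1) by (simp add: v_def)
    show "f \<in> L2 I" by (rule L2_cong_AE[OF uw(1) lebesgue_on_L(1)[OF borel_I adm_measurable(1)[OF fgh(1)]] fgh(2)])
    show "v \<in> L2 I" by (rule L2_cong_AE[OF uw(2) lebesgue_on_L(1)[OF borel_I vm] wv])
  qed
  then show thesis using fgh(2) wv by (rule that)
qed

lemma source_cnj:
  assumes f: "source f g v" shows "source (\<lambda>x. cnj (f x)) (\<lambda>x. cnj (g x)) (\<lambda>x. cnj (v x))"
  unfolding source_def
  by (intro conjI adm_cnj_source[OF sourceD(1)[OF f]] cnj_measurable[OF sourceD(2)[OF f]] L2_cnj sourceD(3,4)[OF f])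

text \<open>The Lagrange identity for the conjugate of \<open>f\<close> and for \<open>f'\<close> is
  split at \<open>c\<close>. The two boundary lemmas evaluate the halves as the Wronskian at
  \<open>c\<close> with opposite signs.\<close>

lemma symmetric_if:
  assumes a: "a = -\<infinity> \<or> \<not> set_integrable L {x \<in> I. x < c} (\<lambda>x. (Pl x)\<^sup>2)"
    and b: "b = \<infinity> \<or> \<not> set_integrable L {x \<in> I. d < x} (\<lambda>x. (Pl x)\<^sup>2)"
    and m: "(u, w) \<in> maximal_operator I P q" "(u', w') \<in> maximal_operator I P q"
  shows "L2_inner I u w' = L2_inner I w u'"
proof -
  obtain f g v where f: "source f g v" "AE x in lebesgue_on I. u x = f x" "AE x in lebesgue_on I. w x = v x"
    by (rule maximal_source[OF m(1)])
  obtain f' g' v' where f': "source f' g' v'" "AE x in lebesgue_on I. u' x = f' x" "AE x in lebesgue_on I. w' x = v' x"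
    by (rule maximal_source[OF m(2)])
  note uL = maximal_operator_L2[OF m(1)] and uL' = maximal_operator_L2[OF m(2)]
  have e1: "L2_inner I u w' = (LINT x|L. cnj (f x) * v' x)"
    unfolding L2_inner_L[OF sourceD(5)[OF f(1)] sourceD(2)[OF f'(1)], symmetric]
    by (rule L2_inner_cong) (use uL uL' sourceD[OF f(1)] sourceD[OF f'(1)] f f' in auto)
  have e2: "L2_inner I w u' = (LINT x|L. cnj (v x) * f' x)"
    unfolding L2_inner_L[OF sourceD(2)[OF f(1)] sourceD(5)[OF f'(1)], symmetric]
    by (rule L2_inner_cong) (use uL uL' sourceD[OF f(1)] sourceD[OF f'(1)] f f' in auto)
  note F = source_cnj[OF f(1)]
  let ?D = "\<lambda>t. f' t * cnj (v t) - cnj (f t) * v' t"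
  note D = source_integrable[OF F f'(1)]
  have i1: "integrable L (\<lambda>x. f' x * cnj (v x))"
    using L2_product_integrable[OF sourceD(3)[OF f'(1)] sourceD(4)[OF F]]
      lebesgue_on_L(2)[OF borel_I borel_measurable_times[OF sourceD(5)[OF f'(1)] sourceD(2)[OF F]]] by simp
  have i2: "integrable L (\<lambda>x. cnj (f x) * v' x)"
    using L2_product_integrable[OF sourceD(3)[OF F] sourceD(4)[OF f'(1)]]
      lebesgue_on_L(2)[OF borel_I borel_measurable_times[OF sourceD(5)[OF F] sourceD(2)[OF f'(1)]]] by simp
  have "(LINT t|L. ?D t) = (LINT t:{t \<in> I. t < c} \<union> {t \<in> I. c \<le> t}|L. ?D t)"
    by (rule integral_supported) auto
  also have "\<dots> = (LINT t:{t \<in> I. t < c}|L. ?D t) + (LINT t:{t \<in> I. c \<le> t}|L. ?D t)"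
    by (rule set_integral_Un) (use set_integrable_sub[OF D ray_sets(1)] set_integrable_sub[OF D ray_sets(2)] in auto)
  also have "\<dots> = 0"
    using right_boundary[OF F f'(1) c b] left_boundary[OF F f'(1) c a] by (simp add: algebra_simps)
  finally have "(LINT t|L. f' t * cnj (v t)) = (LINT t|L. cnj (f t) * v' t)"
    unfolding Bochner_Integration.integral_diff[OF i1 i2] by simp
  then show ?thesis unfolding e1 e2 by (simp add: mult.commute)
qed

lemma finite_ray_integrable:
  assumes S: "S \<in> sets L" "S \<subseteq> {x..y}"
  shows "set_integrable L S (\<lambda>x. 1 :: real)"
proof -
  have "S \<subseteq> I" using S(1) by (simp add: sets_L sets_I_iff)
  then have "emeasure L S = emeasure lborel S" by (rule emeasure_L)
  also have "\<dots> \<le> emeasure lborel {x..y}" using S(2) by (intro emeasure_mono) simp_all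
  also have "\<dots> < \<infinity>" by (simp add: emeasure_lborel_Icc_eq)
  finally have "integrable L (indicat_real S)" by (intro integrable_real_indicator S(1))
  then show ?thesis by (simp add: set_integrable_def)
qed

theorem selfadjoint_iff:
  "maximal_operator I P q = adjoint_graph I (maximal_operator I P q) \<longleftrightarrow>
    \<not> (set_integrable L {x \<in> I. x < c} (\<lambda>x. 1 :: real) \<and> set_integrable L {x \<in> I. x < c} (\<lambda>x. (Pl x)\<^sup>2)) \<and>
    \<not> (set_integrable L {x \<in> I. d < x} (\<lambda>x. 1 :: real) \<and> set_integrable L {x \<in> I. d < x} (\<lambda>x. (Pl x)\<^sup>2))"
    (is "_ \<longleftrightarrow> \<not> (?L1 \<and> ?LP) \<and> \<not> (?R1 \<and> ?RP)")
proof
  assume "maximal_operator I P q = adjoint_graph I (maximal_operator I P q)"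
  then show "\<not> (?L1 \<and> ?LP) \<and> \<not> (?R1 \<and> ?RP)"
    using not_selfadjoint_left not_selfadjoint_right by blast
next
  assume A: "\<not> (?L1 \<and> ?LP) \<and> \<not> (?R1 \<and> ?RP)"
  \<comment> \<open>On a bounded ray the constant 1 is integrable, so at a finite endpoint the
    failing condition must be the one on P.\<close>
  have "a = -\<infinity> \<or> \<not> ?LP"
  proof (rule disjCI)
    assume "\<not> \<not> ?LP"
    then have nL: "\<not> ?L1" using A by blast
    show "a = -\<infinity>"
    proof (rule ccontr)
      assume "a \<noteq> -\<infinity>"
      then obtain ar where ar: "a = ereal ar" using c by (cases a) (auto simp: mem_I)
      have "{x \<in> I. x < c} \<subseteq> {ar..c}" by (auto simp: mem_I ar)
      with nL show False using finite_ray_integrable[OF ray_sets(2)] by blast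
    qed
  qed
  moreover have "b = \<infinity> \<or> \<not> ?RP"
  proof (rule disjCI)
    assume "\<not> \<not> ?RP"
    then have nR: "\<not> ?R1" using A by blast
    show "b = \<infinity>"
    proof (rule ccontr)
      assume "b \<noteq> \<infinity>"
      then obtain br where br: "b = ereal br" using c by (cases b) (auto simp: mem_I)
      have "{x \<in> I. d < x} = I \<inter> {d<..}" by auto
      then have s: "{x \<in> I. d < x} \<in> sets L" by (simp add: sets_L sets_I_iff)
      have "{x \<in> I. d < x} \<subseteq> {d..br}" by (auto simp: mem_I br)
      with nR show False using finite_ray_integrable[OF s] by blast
    qed
  qed
  ultimately show "maximal_operator I P q = adjoint_graph I (maximal_operator I P q)"
    unfolding selfadjoint_iff_symmetric using symmetric_if by blast
qed

end

section \<open>From the hypotheses of the theorem to the reduced setting\<close>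

context open_interval begin

lemma L2_subset:
  assumes S: "S \<in> sets borel" "S \<subseteq> I" and f: "f \<in> borel_measurable L"
  shows "f \<in> L2 S \<longleftrightarrow> set_integrable L S (\<lambda>x. (cmod (f x))\<^sup>2)"
proof -
  have SL: "S \<in> sets L" using S by (simp add: sets_L sets_I_iff)
  have "S \<inter> space L = S" using S(2) by (auto simp: locfin_space[OF locfin_L])
  with SL have SS: "S \<inter> space L \<in> sets L" by (simp only:)
  have eq: "restrict_space L S = restrict_space lborel S"
    using S by (subst restrict_restrict_space) (auto simp: Int_absorb1)
  have fm: "f \<in> borel_measurable (restrict_space lborel S)"
    using measurable_restrict_space1[OF f, of S] by (simp add: eq)
  then have "(\<lambda>x. (cmod (f x))\<^sup>2) \<in> borel_measurable (restrict_space lborel S)" by simp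
  from lebesgue_on_L(2)[OF S(1) this] lebesgue_on_L(1)[OF S(1) fm]
  have "f \<in> L2 S \<longleftrightarrow> integrable (restrict_space lborel S) (\<lambda>x. (cmod (f x))\<^sup>2)"
    unfolding L2_iff by blast
  also have "\<dots> \<longleftrightarrow> set_integrable L S (\<lambda>x. (cmod (f x))\<^sup>2)"
    unfolding eq[symmetric] set_integrable_def by (rule integrable_restrict_space[OF SS])
  finally show ?thesis .
qed

lemma set_integrable_cong_AE_iff:
  fixes f g :: "real \<Rightarrow> real"
  assumes "S \<in> sets L" "f \<in> borel_measurable L" "g \<in> borel_measurable L" "AE x in L. f x = g x"
  shows "set_integrable L S f \<longleftrightarrow> set_integrable L S g"
  unfolding set_integrable_def
proof (rule integrable_cong_AE)
  show "AE x in L. indicator S x *\<^sub>R f x = indicator S x *\<^sub>R g x" using assms(4) by eventually_elim simp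
qed (intro borel_measurable_scaleR borel_measurable_indicator assms)+

lemma rays:
  assumes "e \<in> I"
  shows "einterval a (ereal e) = {x \<in> I. x < e}" "einterval (ereal e) b = {x \<in> I. e < x}"
    "{x \<in> I. x < e} \<in> sets borel" "{x \<in> I. e < x} \<in> sets borel"
proof -
  have "ereal x < b" if "x < e" for x
    using assms that by (auto simp: mem_I intro: less_trans[of "ereal x" "ereal e" b])
  then show "einterval a (ereal e) = {x \<in> I. x < e}" by (auto simp: einterval_def mem_I)
  have "a < ereal x" if "e < x" for x
    using assms that by (auto simp: mem_I intro: less_trans[of a "ereal e" "ereal x"])
  then show "einterval (ereal e) b = {x \<in> I. e < x}" by (auto simp: einterval_def mem_I)
  have "{x \<in> I. x < e} = I \<inter> {..<e}" "{x \<in> I. e < x} = I \<inter> {e<..}" by auto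
  then show "{x \<in> I. x < e} \<in> sets borel" "{x \<in> I. e < x} \<in> sets borel" by simp_all
qed

text \<open>Two such rays differ within a compact part of \<open>I\<close>, where \<open>f\<close>
  is integrable. This identifies the conditions for an arbitrary cut point with those at the edges
  \<open>c\<close> and \<open>d\<close> of the support of the potential.\<close>

lemma ray_integrable_indep:
  fixes f :: "real \<Rightarrow> real"
  assumes loc: "\<And>y x. y \<in> I \<Longrightarrow> x \<in> I \<Longrightarrow> set_integrable L {y..<x} f" and e: "e \<in> I" "e' \<in> I"
  shows "set_integrable L {x \<in> I. x < e} f \<longleftrightarrow> set_integrable L {x \<in> I. x < e'} f"
    "set_integrable L {x \<in> I. e < x} f \<longleftrightarrow> set_integrable L {x \<in> I. e' < x} f"
proof -
  have m: "{x \<in> I. x < y} \<in> sets L" "{x \<in> I. y < x} \<in> sets L" if "y \<in> I" for y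
    using rays(3,4)[OF that] by (auto simp: sets_L sets_I_iff)
  have 1: "set_integrable L {x \<in> I. x < y'} f" if "set_integrable L {x \<in> I. x < y} f" "y \<in> I" "y' \<in> I" for y y'
    by (rule set_integrable_subset[OF set_integrable_Un[OF that(1) loc[OF that(2,3)] m(1)[OF that(2)] locfin_Ico[OF locfin_L that(2,3)]] m(1)[OF that(3)]])
      auto
  have 2: "set_integrable L {x \<in> I. y' < x} f" if A: "set_integrable L {x \<in> I. y < x} f" "y \<in> I" "y' \<in> I" for y y'
  proof -
    \<comment> \<open>The open ray omits its end point, so the interval joined to it reaches to some
      \<open>z\<close> beyond \<open>y\<close> in order to contain \<open>y\<close> itself.\<close>
    obtain z where z: "z \<in> I" "y < z" by (rule larger[OF A(2)])
    show ?thesis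
      by (rule set_integrable_subset[OF set_integrable_Un[OF A(1) loc[OF A(3) z(1)] m(2)[OF A(2)] locfin_Ico[OF locfin_L A(3) z(1)]] m(2)[OF A(3)]])
        (use z(2) in auto)
  qed
  show "set_integrable L {x \<in> I. x < e} f \<longleftrightarrow> set_integrable L {x \<in> I. x < e'} f" using 1 e by blast
  show "set_integrable L {x \<in> I. e < x} f \<longleftrightarrow> set_integrable L {x \<in> I. e' < x} f" using 2 e by blast
qed

text \<open>Increments of \<nu> exceed those of P by at most the increments of the identity, whose
  sum telescopes to at most \<open>d - c\<close>.\<close>

lemma bv_loc_minus_id:
  fixes P :: "real \<Rightarrow> real"
  assumes P: "bv_loc I P" and \<nu>: "\<And>x. x \<in> I \<Longrightarrow> P x = x + \<nu> x"
  shows "bv_loc I \<nu>"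
  unfolding bv_loc_def
proof (intro allI impI)
  fix K assume K: "compact K \<and> K \<subseteq> I"
  obtain c d where cd: "c \<in> I" "d \<in> I" "c < d" "K \<subseteq> {c..<d}"
    by (rule compact_sub[OF conjunct1[OF K] conjunct2[OF K]])
  have "bv_on K P" using P K by (simp add: bv_loc_def)
  then obtain B where B: "\<And>(n::nat) t. mono_on {..n} t \<and> t ` {..n} \<subseteq> K \<Longrightarrow>
      (\<Sum>i<n. norm (P (t (Suc i)) - P (t i))) \<le> B" unfolding bv_on_def by blast
  show "bv_on K \<nu>" unfolding bv_on_def
  proof (intro exI[of _ "B + (d - c)"] allI impI)
    fix n and t :: "nat \<Rightarrow> real" assume t: "mono_on {..n} t \<and> t ` {..n} \<subseteq> K"
    have tK: "t i \<in> K" if "i \<le> n" for i using t that by blast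
    have "(\<Sum>i<n. norm (\<nu> (t (Suc i)) - \<nu> (t i))) \<le> (\<Sum>i<n. norm (P (t (Suc i)) - P (t i)) + (t (Suc i) - t i))"
    proof (rule sum_mono)
      fix i assume i: "i \<in> {..<n}"
      have I: "t i \<in> I" "t (Suc i) \<in> I" using tK[of i] tK[of "Suc i"] i K by auto
      have "t i \<le> t (Suc i)" using mono_onD[OF conjunct1[OF t], of i "Suc i"] i by simp
      then show "norm (\<nu> (t (Suc i)) - \<nu> (t i)) \<le> norm (P (t (Suc i)) - P (t i)) + (t (Suc i) - t i)"
        unfolding \<nu>[OF I(1)] \<nu>[OF I(2)] real_norm_def by linarith
    qed
    also have "\<dots> = (\<Sum>i<n. norm (P (t (Suc i)) - P (t i))) + (t n - t 0)"
      by (simp only: sum.distrib sum_lessThan_telescope)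
    also have "\<dots> \<le> B + (d - c)"
    proof (rule add_mono[OF B[OF t]])
      have "t n \<in> {c..<d}" "t 0 \<in> {c..<d}" using tK[of n] tK[of 0] cd(4) by blast+
      then show "t n - t 0 \<le> d - c" by simp
    qed
    finally show "(\<Sum>i<n. norm (\<nu> (t (Suc i)) - \<nu> (t i))) \<le> B + (d - c)" .
  qed
qed

text \<open>Singularity means that \<open>N\<close> is carried by a Lebesgue null set
  \<open>S\<close>, so adding Lebesgue measure to the positive part preserves mutual singularity:
  \<open>A \<inter> S\<close> separates the new pair.\<close>

lemma jordan_add_lebesgue:
  assumes P: "\<And>x. x \<in> I \<Longrightarrow> P x = x + \<nu> x" and bv: "bv_loc I \<nu>" and J: "jordan_decomp I \<nu> M N"
    and sing: "lebesgue_singular I \<nu>"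
  shows "jordan_decomp I P (sum_measure L M) N"
proof -
  note lf = jordan_locfin[OF J]
  have st: "sets M = sets L" "sets N = sets M" using lf by (simp_all add: locfin_def sets_L)
  obtain S where S: "S \<in> sets (restrict_space borel I)" "emeasure lborel S = 0" "emeasure (tv_measure I \<nu>) (I - S) = 0"
    using sing unfolding lebesgue_singular_def by blast
  obtain A where A: "A \<in> sets (restrict_space borel I)" "emeasure M A = 0" "emeasure N (I - A) = 0"
    by (rule jordan_sep[OF J])
  have NS: "emeasure N (I - S) = 0"
    using S(3) unfolding tv_measure_eq[OF J] emeasure_sum_measure[OF st(2)] by simp
  have em: "emeasure (sum_measure L M) B = emeasure L B + emeasure M B" for B
    by (rule emeasure_sum_measure[OF st(1)])
  have lim: "Lim (at_left x) P = x + Lim (at_left x) \<nu>" if x: "x \<in> I" for x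
  proof -
    obtain U W where UW: "mono_on I U" "mono_on I W" "\<And>x. \<nu> x = U x - W x"
      by (rule bv_loc_split[OF bv]) (rule that; assumption)
    note t\<nu> = split_tendsto[OF UW x]
    have "((\<lambda>x. x + \<nu> x) \<longlongrightarrow> x + (left_lim U x - left_lim W x)) (at_left x)"
      by (intro tendsto_add tendsto_ident_at t\<nu>)
    moreover obtain y where y: "y \<in> I" "y < x" by (rule smaller[OF x])
    have "eventually (\<lambda>z. z + \<nu> z = P z) (at_left x)"
      unfolding eventually_at_left_field
    proof (intro exI[of _ y] conjI allI impI y)
      fix z assume "z > y" "z < x"
      then have "z \<in> I" using betweenI[OF y(1) x, of z] by simp
      then show "z + \<nu> z = P z" using P by simp
    qed
    ultimately have "(P \<longlongrightarrow> x + (left_lim U x - left_lim W x)) (at_left x)"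
      by (rule Lim_transform_eventually)
    then show ?thesis
      using tendsto_Lim[OF trivial_limit_at_left_real t\<nu>] tendsto_Lim[OF trivial_limit_at_left_real, of P] by simp
  qed
  show ?thesis unfolding jordan_decomp_def
  proof (intro conjI)
    show "sets (sum_measure L M) = sets (restrict_space borel I)" "sets N = sets (restrict_space borel I)"
      using lf by (simp_all add: sets_L locfin_def)
    show "\<forall>K. compact K \<and> K \<subseteq> I \<longrightarrow> emeasure (sum_measure L M) K < \<infinity> \<and> emeasure N K < \<infinity>"
      using locfin_sum[OF locfin_L lf(1)] lf(2) by (simp add: locfin_def)
    have AS: "A \<inter> S \<in> sets L" using A S by (auto simp: sets_L sets_I_iff)
    show "\<exists>A\<in>sets (restrict_space borel I). emeasure (sum_measure L M) A = 0 \<and> emeasure N (I - A) = 0"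
    proof (intro bexI[of _ "A \<inter> S"] conjI)
      have "A \<inter> S \<subseteq> I" using A by (simp add: sets_I_iff) blast
      have "emeasure L (A \<inter> S) \<le> emeasure L S" using S by (intro emeasure_mono) (auto simp: sets_L)
      also have "\<dots> = 0" using S by (subst emeasure_L) (auto simp: sets_I_iff)
      finally have "emeasure L (A \<inter> S) = 0" by simp
      moreover have "emeasure M (A \<inter> S) \<le> emeasure M A" using A by (intro emeasure_mono) (auto simp: st sets_L)
      ultimately show "emeasure (sum_measure L M) (A \<inter> S) = 0" using A by (simp add: em)
      have I: "I - A \<in> sets N" "I - S \<in> sets N" using A S by (auto simp: st sets_L sets_I_iff)
      have "I - A \<inter> S = (I - A) \<union> (I - S)" by auto
      then have "emeasure N (I - A \<inter> S) \<le> emeasure N (I - A) + emeasure N (I - S)"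
        using emeasure_subadditive[OF I] by simp
      then show "emeasure N (I - A \<inter> S) = 0" using A NS by simp
      show "A \<inter> S \<in> sets (restrict_space borel I)" using AS by (simp add: sets_L)
    qed
    show "\<forall>y\<in>I. \<forall>x\<in>I. y < x \<longrightarrow>
        measure (sum_measure L M) {y..<x} - measure N {y..<x} = Lim (at_left x) P - Lim (at_left y) P"
    proof (intro ballI impI)
      fix y x assume yx: "y \<in> I" "x \<in> I" "y < x"
      have "emeasure L {y..<x} = ennreal (x - y)"
        using yx emeasure_L[OF subI(2)[OF yx(1,2)]] by simp
      moreover have "emeasure M {y..<x} = ennreal (measure M {y..<x})"
        using locfin_Ico_finite[OF lf(1) yx(1,2)] by (intro emeasure_eq_ennreal_measure) auto
      ultimately have "emeasure (sum_measure L M) {y..<x} = ennreal ((x - y) + measure M {y..<x})"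
        unfolding em using yx by (simp add: ennreal_plus)
      then have "measure (sum_measure L M) {y..<x} = (x - y) + measure M {y..<x}"
        using yx by (intro measure_eq_emeasure_eq_ennreal) (simp_all add: add_nonneg_nonneg)
      then show "measure (sum_measure L M) {y..<x} - measure N {y..<x} = Lim (at_left x) P - Lim (at_left y) P"
        using jordan_diff[OF J yx] lim[OF yx(1)] lim[OF yx(2)] by simp
    qed
  qed
qed

text \<open>If \<open>dP\<close> vanishes on an interval, its mutually singular parts agree there and so vanish.\<close>

lemma left_limit_nonconstant:
  assumes J: "jordan_decomp I P M N" and ge: "\<And>B. B \<in> sets L \<Longrightarrow> emeasure L B \<le> emeasure M B"
    and \<alpha>\<beta>: "\<alpha> \<in> I" "\<beta> \<in> I" "\<alpha> < \<beta>"
  shows "\<exists>x\<in>{\<alpha><..<\<beta>}. Lim (at_left x) P \<noteq> k"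
proof (rule ccontr)
  assume "\<not> ?thesis"
  then have const: "Lim (at_left x) P = k" if "x \<in> {\<alpha><..<\<beta>}" for x using that by blast
  let ?J = "{\<alpha><..<\<beta>}"
  \<comment> \<open>The subinterval is itself an instance of the locale, so that
    \<open>locfin_eqI\<close> identifies the two restricted measures on it.\<close>
  interpret J: open_interval "ereal \<alpha>" "ereal \<beta>" ?J
    by unfold_locales (use \<alpha>\<beta>(3) in \<open>simp_all add: einterval_eq\<close>)
  note lf = jordan_locfin[OF J]
  have JI: "?J \<subseteq> I" by (rule subI(3)[OF \<alpha>\<beta>(1,2)])
  have Js: "?J \<in> sets X" if "locfin X" for X using JI by (simp add: locfin_sets[OF that])
  have em: "emeasure (restrict_space X ?J) B = emeasure X B" if "locfin X" "B \<subseteq> ?J" for X B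
  proof (rule emeasure_restrict_space[OF _ that(2)])
    show "?J \<inter> space X \<in> sets X" using Js[OF that(1)] by (simp add: sets.Int_space_eq2)
  qed
  have Jlf: "J.locfin (restrict_space X ?J)" if X: "locfin X" for X
  proof (rule J.locfinI)
    have "sets (restrict_space X ?J) = sets (restrict_space (restrict_space borel I) ?J)"
      using X by (intro sets_restrict_space_cong) (simp add: locfin_def)
    also have "\<dots> = sets (restrict_space borel (I \<inter> ?J))" by (rule sets_restrict_restrict_space)
    also have "I \<inter> ?J = ?J" using JI by blast
    finally show "sets (restrict_space X ?J) = sets (restrict_space borel ?J)" .
    fix y x assume yx: "y \<in> ?J" "x \<in> ?J" "y < x"
    have "emeasure (restrict_space X ?J) {y..<x} = emeasure X {y..<x}"
      using yx by (intro em[OF X]) auto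
    also have "\<dots> < \<infinity>" using yx JI by (intro locfin_Ico_finite[OF X]) blast+
    finally show "emeasure (restrict_space X ?J) {y..<x} < \<infinity>" .
  qed
  have eq: "restrict_space M ?J = restrict_space N ?J"
  proof (rule J.locfin_eqI[OF Jlf[OF lf(1)] Jlf[OF lf(2)]])
    fix y x assume yx: "y \<in> ?J" "x \<in> ?J" "y < x"
    have I: "y \<in> I" "x \<in> I" using yx JI by blast+
    have sub: "{y..<x} \<subseteq> ?J" using yx by auto
    have "measure M {y..<x} = measure N {y..<x}"
      using jordan_diff[OF J I yx(3)] const[OF yx(1)] const[OF yx(2)] by simp
    moreover have "emeasure M {y..<x} = ennreal (measure M {y..<x})" "emeasure N {y..<x} = ennreal (measure N {y..<x})"
      using locfin_Ico_finite[OF lf(1) I] locfin_Ico_finite[OF lf(2) I] by (auto intro!: emeasure_eq_ennreal_measure)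
    ultimately show "emeasure (restrict_space M ?J) {y..<x} = emeasure (restrict_space N ?J) {y..<x}"
      unfolding em[OF lf(1) sub] em[OF lf(2) sub] by simp
  qed
  obtain A where A: "A \<in> sets (restrict_space borel I)" "emeasure M A = 0" "emeasure N (I - A) = 0"
    by (rule jordan_sep[OF J])
  have AM: "A \<in> sets M" and AN: "A \<in> sets N" using A lf by (simp_all add: locfin_def)
  have "emeasure M (?J - A) = emeasure N (?J - A)"
    using em[OF lf(1), of "?J - A"] em[OF lf(2), of "?J - A"] eq by auto
  also have "\<dots> \<le> emeasure N (I - A)"
  proof (rule emeasure_mono)
    show "?J - A \<subseteq> I - A" using JI by blast
    show "I - A \<in> sets N" using sets.compl_sets[OF AN] by (simp add: locfin_space[OF lf(2)])
  qed
  finally have "emeasure M (?J - A) = 0" using A by simp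
  moreover have "emeasure M (?J - A) = emeasure M ?J"
    by (rule emeasure_minus_null[OF Js[OF lf(1)] AM A(2)])
  ultimately have "emeasure L ?J \<le> 0" using ge[OF Js[OF locfin_L]] by simp
  moreover have "emeasure L ?J = ennreal (\<beta> - \<alpha>)" using emeasure_L[OF JI] \<alpha>\<beta>(3) by simp
  ultimately show False using \<alpha>\<beta>(3) by simp
qed

text \<open>Monotone functions have at most countably many discontinuities. P and its
  left-continuous version therefore give the same square integrability conditions.\<close>

lemma left_limit_AE:
  fixes F :: "real \<Rightarrow> real"
  assumes "bv_loc I F"
  shows "F \<in> borel_measurable L" "AE x in L. F x = Lim (at_left x) F"
proof -
  obtain U W where UW: "mono_on I U" "mono_on I W" "\<And>x. F x = U x - W x"
    by (rule bv_loc_split[OF assms]) (rule that; assumption)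
  have "U \<in> borel_measurable L" "W \<in> borel_measurable L"
    using borel_measurable_mono_on_fnc[OF UW(1)] borel_measurable_mono_on_fnc[OF UW(2)]
    by (simp_all add: measurable_cong_sets[OF sets_L refl])
  then have "(\<lambda>x. U x - W x) \<in> borel_measurable L" by (rule borel_measurable_diff)
  moreover have "F = (\<lambda>x. U x - W x)" using UW(3) by (rule ext)
  ultimately show "F \<in> borel_measurable L" by simp
  let ?C = "{x \<in> I. \<not> isCont U x} \<union> {x \<in> I. \<not> isCont W x}"
  have "countable ?C"
    using mono_on_ctble_discont_open[OF open_I UW(1)] mono_on_ctble_discont_open[OF open_I UW(2)] by simp
  then have "?C \<in> null_sets lborel" by (rule countable_imp_null_set_lborel)
  then have "AE x in lborel. x \<notin> ?C" by (rule AE_not_in)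
  then have "AE x in L. x \<notin> ?C" by (simp add: AE_restrict_space_iff)
  then show "AE x in L. F x = Lim (at_left x) F"
  proof (rule AE_mp, intro AE_I2 impI)
    fix x assume x: "x \<in> space L" "x \<notin> ?C"
    then have xI: "x \<in> I" by (simp add: locfin_space[OF locfin_L])
    then have "isCont U x" "isCont W x" using x by auto
    then have "(F \<longlongrightarrow> U x - W x) (at x)"
      unfolding UW(3)[abs_def] isCont_def \<open>F = (\<lambda>x. U x - W x)\<close> by (intro tendsto_diff)
    then have "(F \<longlongrightarrow> F x) (at_left x)"
      unfolding UW(3)[of x] by (rule tendsto_within_subset) simp
    then show "F x = Lim (at_left x) F" using tendsto_Lim[OF trivial_limit_at_left_real] by metis
  qed
qed

lemma sturm_liouville_exists:
  assumes P: "\<And>x. x \<in> I \<Longrightarrow> P x = x + \<nu> x" and bvP: "bv_loc I P" and sing: "lebesgue_singular I \<nu>"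
  obtains s where "sturm_liouville a b I P (tv_measure I P) s (\<lambda>x. Lim (at_left x) P)"
proof -
  have bv: "bv_loc I \<nu>" by (rule bv_loc_minus_id[OF bvP P])
  obtain M0 N where J0: "jordan_decomp I \<nu> M0 N" by (rule jordan_exists[OF bv])
  define M where "M = sum_measure L M0"
  have J: "jordan_decomp I P M N" unfolding M_def by (rule jordan_add_lebesgue[OF P bv J0 sing])
  note lf = jordan_locfin[OF J]
  have ge: "emeasure L B \<le> emeasure M B" for B
    using jordan_locfin(1)[OF J0] unfolding M_def
    by (subst emeasure_sum_measure) (simp_all add: sets_L locfin_def)
  let ?T = "tv_measure I P"
  have sNM: "sets N = sets M" using lf by (simp add: locfin_def)
  have T: "locfin ?T" unfolding tv_measure_eq[OF J] by (rule locfin_sum[OF lf])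
  obtain s :: "real \<Rightarrow> real" where s: "s \<in> borel_measurable ?T" "\<And>x. s x = 1 \<or> s x = -1"
    and si: "\<And>B g. B \<in> sets ?T \<Longrightarrow> set_integrable ?T B g \<Longrightarrow>
      signed_integral I P B g = (LINT x:B|?T. of_real (s x) * g x)"
    by (rule jordan_sign[OF J]) (rule that; assumption)
  have mint: "(LINT t:{y..<x}|X. 1) = complex_of_real (measure X {y..<x})" if X: "locfin X" and yx: "y \<in> I" "x \<in> I" for X y x
  proof -
    have "(LINT t:{y..<x}|X. 1) = complex_of_real (LINT t|X. indicator {y..<x} t)"
      unfolding set_lebesgue_integral_def by (simp add: scaleR_conv_of_real)
    also have "(LINT t|X. indicator {y..<x} t) = measure X {y..<x}"
      using locfin_Ico[OF X yx] by (simp add: sets.Int_space_eq2)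
    finally show ?thesis .
  qed
  have pPl: "prim ?T (\<lambda>x. of_real (Lim (at_left x) P)) (\<lambda>x. of_real (s x))"
  proof (rule primI)
    show "locint ?T (\<lambda>x. of_real (s x))"
      using sign_mult_locint[OF T s, of "\<lambda>x. 1"] locint_one[OF T] by simp
    fix y x assume yx: "y \<in> I" "x \<in> I" "y \<le> x"
    show "complex_of_real (Lim (at_left x) P) = of_real (Lim (at_left y) P) + (LINT t:{y..<x}|?T. of_real (s t))"
    proof (cases "y = x")
      case True
      then show ?thesis by (simp add: set_lebesgue_integral_def)
    next
      case False
      then have yx': "y < x" using yx by simp
      have "(LINT t:{y..<x}|?T. of_real (s t)) = (LINT t:{y..<x}|?T. of_real (s t) * 1)" by simp
      also have "\<dots> = signed_integral I P {y..<x} (\<lambda>_. 1)"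
        by (rule si[symmetric]) (rule locfin_Ico[OF T yx(1,2)], rule locintD[OF locint_one[OF T] yx(1,2)])
      also have "\<dots> = complex_of_real (measure M {y..<x} - measure N {y..<x})"
        unfolding signed_integral_def jordan_pos_neg[OF J] mint[OF lf(1) yx(1,2)] mint[OF lf(2) yx(1,2)] by simp
      also have "measure M {y..<x} - measure N {y..<x} = Lim (at_left x) P - Lim (at_left y) P"
        by (rule jordan_diff[OF J yx(1,2) yx'])
      finally show ?thesis by simp
    qed
  qed
  show thesis
  proof (rule that[of s], unfold_locales)
    show "has_quasi_deriv I P f g \<longleftrightarrow> prim ?T f (\<lambda>x. of_real (s x) * g x)" for f g
      by (rule has_quasi_deriv_prim[OF T s si])
    show "\<exists>x\<in>{\<alpha><..<\<beta>}. Lim (at_left x) P \<noteq> k" if "\<alpha> \<in> I" "\<beta> \<in> I" "\<alpha> < \<beta>" for \<alpha> \<beta> k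
      by (rule left_limit_nonconstant[OF J ge that])
    show "AE x in L. P x = Lim (at_left x) P" by (rule left_limit_AE(2)[OF bvP])
  qed (fact T s pPl refl)+
qed

text \<open>The potential is changed on a null set so as to come from a Borel function and to vanish
  identically outside \<open>{c..<d}\<close>; the maximal operator depends on it only almost
  everywhere.\<close>

lemma L1_compact_rep:
  assumes "q2 \<in> L1_compact I"
  obtains c d q where "c \<in> I" "d \<in> I" "c < d" "locint L (\<lambda>x. of_real (q x))"
    "\<And>x. x < c \<Longrightarrow> q x = 0" "\<And>x. d \<le> x \<Longrightarrow> q x = 0" "AE x in lebesgue_on I. q2 x = q x"
proof -
  have i2: "integrable (lebesgue_on I) q2" using assms by (simp add: L1_compact_def)
  obtain K where K: "compact K" "K \<subseteq> I" "AE x in lebesgue_on I. x \<notin> K \<longrightarrow> q2 x = 0"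
    using assms unfolding L1_compact_def by blast
  obtain c d where cd: "c \<in> I" "d \<in> I" "c < d" "K \<subseteq> {c..<d}" by (rule compact_sub[OF K(1,2)])
  obtain q' where q': "q' \<in> borel_measurable L" "AE x in lebesgue_on I. q2 x = q' x"
    by (rule lebesgue_on_borel_rep_real[OF borel_I borel_measurable_integrable[OF i2]])
  have "integrable (lebesgue_on I) q'"
    by (rule integrable_cong_AE_imp[OF i2 lebesgue_on_L(1)[OF borel_I q'(1)] q'(2)])
  then have iq': "integrable L q'" using lebesgue_on_L(2)[OF borel_I q'(1)] by simp
  define q where "q x = indicator {c..<d} x * q' x" for x
  have "integrable L q"
    using integrable_mult_indicator[OF locfin_Ico[OF locfin_L cd(1,2)] iq'] by (simp add: q_def[abs_def])
  then have iq: "integrable L (\<lambda>x. complex_of_real (q x))" by (rule integrable_of_real)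
  show thesis
  proof (rule that[OF cd(1-3)])
    show "locint L (\<lambda>x. complex_of_real (q x))"
      unfolding locint_def by (intro ballI set_integrable_sub[OF iq] locfin_Ico[OF locfin_L])
    show "AE x in lebesgue_on I. q2 x = q x"
      using K(3) q'(2)
    proof eventually_elim
      case (elim x)
      then show ?case using cd(4) by (cases "x \<in> {c..<d}") (auto simp: q_def)
    qed
  qed (use cd(3) in \<open>auto simp: q_def\<close>)
qed

end

theorem theorem3p3:
  fixes a b :: ereal and P \<nu> q :: "real \<Rightarrow> real"
  defines "I \<equiv> einterval a b"
  assumes "a < b"
    and "\<And>x. x \<in> I \<Longrightarrow> P x = x + \<nu> x"
    and "bv_loc I P"
    and "lebesgue_singular I \<nu>"
    and "q \<in> L1_loc I"
    and "\<exists>q1 \<in> L_infinity I. \<exists>q2 \<in> L1_compact I. AE x in lebesgue_on I. q x = q1 x + q2 x"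
  shows "maximal_operator I P q = adjoint_graph I (maximal_operator I P q) \<longleftrightarrow>
    (\<exists>c\<in>I. (\<lambda>x. 1) \<notin> L2 (einterval a (ereal c)) \<or>
            (\<lambda>x. complex_of_real (P x)) \<notin> L2 (einterval a (ereal c))) \<and>
    (\<exists>c\<in>I. (\<lambda>x. 1) \<notin> L2 (einterval (ereal c) b) \<or>
            (\<lambda>x. complex_of_real (P x)) \<notin> L2 (einterval (ereal c) b))"
proof -
  interpret open_interval a b I
    by unfold_locales (use assms in simp_all)
  obtain s where "sturm_liouville a b I P (tv_measure I P) s (\<lambda>x. Lim (at_left x) P)"
    by (rule sturm_liouville_exists[OF assms(3-5)])
  then interpret sturm_liouville a b I P "tv_measure I P" s "\<lambda>x. Lim (at_left x) P" .
  obtain q1 q2 where q1: "q1 \<in> borel_measurable (lebesgue_on I)" "\<exists>C. AE x in lebesgue_on I. \<bar>q1 x\<bar> \<le> C"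
    and q2: "q2 \<in> L1_compact I" and q: "AE x in lebesgue_on I. q x = q1 x + q2 x"
    using assms(7) unfolding L_infinity_def by blast
  obtain C where C: "AE x in lebesgue_on I. \<bar>q1 x\<bar> \<le> C" using q1(2) by blast
  obtain c d q3 where q3: "c \<in> I" "d \<in> I" "c < d" "locint L (\<lambda>x. of_real (q3 x))"
    "\<And>x. x < c \<Longrightarrow> q3 x = 0" "\<And>x. d \<le> x \<Longrightarrow> q3 x = 0" "AE x in lebesgue_on I. q2 x = q3 x"
    by (rule L1_compact_rep[OF q2]) (rule that; assumption)
  have q13: "AE x in lebesgue_on I. q x = q1 x + q3 x" using q q3(7) by eventually_elim simp
  interpret sl_compact a b I P "tv_measure I P" s "\<lambda>x. Lim (at_left x) P" q3 c d
    by unfold_locales (fact q3)+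
  obtain y1 z1 where y1: "adm y1 z1 (\<lambda>x. of_real (q3 x) * y1 x)" "y1 c = of_real 1" "z1 c = of_real 0" "\<And>x. cnj (y1 x) = y1 x"
    by (rule real_solution_exists[of 1 0]) (rule that; assumption)
  obtain y2 z2 where y2: "adm y2 z2 (\<lambda>x. of_real (q3 x) * y2 x)" "y2 c = of_real 0" "z2 c = of_real 1" "\<And>x. cnj (y2 x) = y2 x"
    by (rule real_solution_exists[of 0 1]) (rule that; assumption)
  interpret sl_solutions a b I P "tv_measure I P" s "\<lambda>x. Lim (at_left x) P" q3 c d y1 z1 y2 z2
    by unfold_locales (use y1 y2 in simp_all)
  have one_m: "(\<lambda>x. 1 :: complex) \<in> borel_measurable L" by simp
  have P_m: "P \<in> borel_measurable L" by (rule left_limit_AE(1)[OF assms(4)])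
  have Pc_m: "(\<lambda>x. complex_of_real (P x)) \<in> borel_measurable L" using P_m by (rule measurable_compose) simp
  have P2_m: "(\<lambda>x. (P x)\<^sup>2) \<in> borel_measurable L" using P_m by (rule borel_measurable_power)
  have P2_AE: "AE x in L. (P x)\<^sup>2 = (Lim (at_left x) P)\<^sup>2" using P_AE by eventually_elim simp
  have one: "(\<lambda>x. 1) \<in> L2 S \<longleftrightarrow> set_integrable L S (\<lambda>x. 1 :: real)" if S: "S \<in> sets borel" "S \<subseteq> I" for S
    using L2_subset[OF S one_m] by simp
  have P2: "(\<lambda>x. complex_of_real (P x)) \<in> L2 S \<longleftrightarrow> set_integrable L S (\<lambda>x. (Lim (at_left x) P)\<^sup>2)"
    if S: "S \<in> sets borel" "S \<subseteq> I" for S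
  proof -
    have "S \<in> sets L" using S by (simp add: sets_L sets_I_iff)
    from set_integrable_cong_AE_iff[OF this P2_m Pl2_measurable P2_AE] L2_subset[OF S Pc_m]
    show ?thesis by simp
  qed
  have one_loc: "set_integrable L {y..<x} (\<lambda>x. 1 :: real)" if "y \<in> I" "x \<in> I" for y x
    using bounded_L2_Ico[OF one_m that, of 1] by simp
  let ?Pl = "\<lambda>x. (Lim (at_left x) P)\<^sup>2"
  have left: "((\<lambda>x. 1) \<notin> L2 (einterval a (ereal e)) \<or> (\<lambda>x. complex_of_real (P x)) \<notin> L2 (einterval a (ereal e))) \<longleftrightarrow>
      \<not> (set_integrable L {x \<in> I. x < c} (\<lambda>x. 1 :: real) \<and> set_integrable L {x \<in> I. x < c} ?Pl)" if e: "e \<in> I" for e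
  proof -
    have sub: "{x \<in> I. x < e} \<subseteq> I" by blast
    have "set_integrable L {x \<in> I. x < e} (\<lambda>x. 1 :: real) \<longleftrightarrow> set_integrable L {x \<in> I. x < c} (\<lambda>x. 1 :: real)"
      by (rule ray_integrable_indep(1)[OF one_loc e q3(1)])
    moreover have "set_integrable L {x \<in> I. x < e} ?Pl \<longleftrightarrow> set_integrable L {x \<in> I. x < c} ?Pl"
      by (rule ray_integrable_indep(1)[OF Pl_square_integrable e q3(1)])
    ultimately show ?thesis
      unfolding rays(1)[OF e] one[OF rays(3)[OF e] sub] P2[OF rays(3)[OF e] sub] by blast
  qed
  have right: "((\<lambda>x. 1) \<notin> L2 (einterval (ereal e) b) \<or> (\<lambda>x. complex_of_real (P x)) \<notin> L2 (einterval (ereal e) b)) \<longleftrightarrow>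
      \<not> (set_integrable L {x \<in> I. d < x} (\<lambda>x. 1 :: real) \<and> set_integrable L {x \<in> I. d < x} ?Pl)" if e: "e \<in> I" for e
  proof -
    have sub: "{x \<in> I. e < x} \<subseteq> I" by blast
    have "set_integrable L {x \<in> I. e < x} (\<lambda>x. 1 :: real) \<longleftrightarrow> set_integrable L {x \<in> I. d < x} (\<lambda>x. 1 :: real)"
      by (rule ray_integrable_indep(2)[OF one_loc e q3(2)])
    moreover have "set_integrable L {x \<in> I. e < x} ?Pl \<longleftrightarrow> set_integrable L {x \<in> I. d < x} ?Pl"
      by (rule ray_integrable_indep(2)[OF Pl_square_integrable e q3(2)])
    ultimately show ?thesis
      unfolding rays(2)[OF e] one[OF rays(4)[OF e] sub] P2[OF rays(4)[OF e] sub] by blast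
  qed
  show ?thesis
    unfolding selfadjoint_shear[OF q1(1) C q13] selfadjoint_iff using left right q3(1) by blast
qed

end
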